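(* Let $\lambda:(0,\infty)\to\mathbb{R}$ be a positive and non-increasing function, with the convention $\lambda(0)=0$, and let $\Lambda=\{\lambda_{m,n}\}_{m,n\in\mathbb{N}}$, $\lambda_{m,n}=\lambda(\max\{m,n\})$. Suppose $1\le p\le2\le q\le\infty$ and that the multiplier operator $\Lambda$ is bounded from $L^1$ to $L^2$. Let $\{N_k\}_{k=0}^\infty$ and $\{m_k\}_{k=0}^M$ be sequences of natural numbers such that $N_k<N_{k+1}$, $N_0=0$ and $\sum_{k=0}^{M}m_k\le\beta$. Then there exists an absolute constant $C>0$ such that $$d_\beta(\Lambda U_p,L^q)\le C\Big(\sum_{k=1}^{M}\lambda(N_k)\varrho_{m_k}+\sum_{k=M+1}^{\infty}\lambda(N_k)\,\big(\theta_{N_k,N_{k+1}}\big)^{1/p-1/q}\Big),$$ where $$\varrho_{m_k}=\frac{\theta_{N_k,N_{k+1}}^{1/p}}{(m_k)^{1/2}}\begin{cases}q^{1/2},&2\le q<\infty,\\(\ln\theta_{N_k,N_{k+1}})^{1/2},&q=\infty,\end{cases}\qquad\text{and}\qquad\theta_{N_k,N_{k+1}}=\sum_{j=N_k+1}^{N_{k+1}}\dim\mathcal{H}_j,\quad k\ge1.$$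
   Context: $\mathbb{N}=\{0,1,2,\dots\}$; $d\ge2$ is a fixed integer. $\Omega_d$ is the unit sphere of $\mathbb{C}^d$ with surface measure $\sigma_d$ (the Lebesgue surface measure of $S^{2d-1}\subset\mathbb{R}^{2d}$ under $\mathbb{C}^d\cong\mathbb{R}^{2d}$, not normalized). $L^p=L^p(\Omega_d)$ is the usual space of complex-valued functions, with closed unit ball $U_p$. $\mathcal{H}_{m,n}$ is the space of restrictions to $\Omega_d$ of polynomials in $z,\bar z$ that are homogeneous of degree $m$ in $z$ and of degree $n$ in $\bar z$ and lie in the kernel of $4\sum_{j=1}^d\partial^2/\partial z_j\partial\bar z_j$. For $l\in\mathbb{N}$, $\mathcal{H}_l=\bigoplus_{\max\{m,n\}=l}\mathcal{H}_{m,n}$. Let $Z_w^{(m,n)}$ be the reproducing kernel (zonal harmonic) of $\mathcal{H}_{m,n}$ at $w\in\Omega_d$, and $(\varphi*\widetilde Z^{(m,n)})(w)=\int_{\Omega_d}\varphi\,\overline{Z_w^{(m,n)}}\,d\sigma_d$ (the orthogonal projection of $\varphi$ onto $\mathcal{H}_{m,n}$ when $\varphi\in L^2$). The multiplier operator $\Lambda$ associated with $\{\lambda_{m,n}\}$ is bounded from $L^p$ to $L^q$ if every $\varphi\in L^p$ has an image $f=\Lambda\varphi\in L^q$ with formal expansion $f\sim\sum_{m,n\in\mathbb{N}}\lambda_{m,n}\,\varphi*\widetilde Z^{(m,n)}$ and $\sup_{\varphi\in U_p}\|\Lambda\varphi\|_q<\infty$. Widths of $\Lambda U_p$ in $L^q$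 are considered under the standing assumption that $\Lambda$ is bounded from $L^p$ to $L^q$. Kolmogorov width: $d_n(A,X)=\inf_{X_n}\sup_{x\in A}\inf_{y\in X_n}\|x-y\|_X$, where $X_n$ ranges over all subspaces of $X$ of dimension $n$.
   Formalization: The added assumption θ_{N_0,N_1} ≤ m_0 (the first m_0 dimensions cover levels 1,…,N_1) is required: the bound has no term for this block, so otherwise making λ tiny above level 1 defeats any absolute constant C. *)

theory Defs
  imports
    "HOL-Analysis.Analysis"
    "HOL-Probability.Essential_Supremum"
    "HOL-Library.Function_Algebras"
begin

section \<open>The complex vector space of complex-valued functions\<close>

global_interpretation cfun: vector_space "\<lambda>(c::complex) (f::'a \<Rightarrow> complex) x. c * f x"
  by unfold_locales (auto simp: fun_eq_iff algebra_simps)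


section \<open>Surface measure and Lebesgue spaces\<close>

text \<open>
  The unnormalized surface measure in polar coordinates: a Borel subset \<open>A\<close> of the unit sphere of
  a Euclidean space of real dimension \<open>D\<close> has surface measure \<open>D\<close> times the volume of the cone
  of all \<open>t *\<^sub>R x\<close> with \<open>0 < t < 1\<close> and \<open>x \<in> A\<close>. Here \<open>D = DIM(complex^'d)\<close> is \<open>2 * CARD('d)\<close>.
\<close>

definition surface_measure :: "(complex^'d) measure" where
  "surface_measure =
     scale_measure (of_nat DIM(complex^'d))
       (distr (restrict_space lborel (ball 0 1 - {0})) (restrict_space borel (sphere 0 1))
          (\<lambda>x. x /\<^sub>R norm x))"

text \<open>
  Elements of \<open>L\<^sup>p\<close> are represented by functions, not by classes modulo equality almost everywhere;
  \<open>Lp_norm\<close> is therefore a seminorm on \<open>Lp_space\<close>. The exponent is an extended real.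
\<close>

definition Lp_space :: "ennreal \<Rightarrow> 'a measure \<Rightarrow> ('a \<Rightarrow> complex) set" where
  "Lp_space p M = {f \<in> borel_measurable M.
     if p = \<infinity> then esssup M (\<lambda>x. ennreal (norm (f x))) < \<infinity>
     else integrable M (\<lambda>x. norm (f x) powr enn2real p)}"

definition Lp_norm :: "ennreal \<Rightarrow> 'a measure \<Rightarrow> ('a \<Rightarrow> complex) \<Rightarrow> real" where
  "Lp_norm p M f =
     (if p = \<infinity> then enn2real (esssup M (\<lambda>x. ennreal (norm (f x))))
      else (\<integral>x. norm (f x) powr enn2real p \<partial>M) powr (1 / enn2real p))"

definition Lp_ball :: "ennreal \<Rightarrow> 'a measure \<Rightarrow> ('a \<Rightarrow> complex) set" where
  "Lp_ball p M = {f \<in> Lp_space p M. Lp_norm p M f \<le> 1}"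


section \<open>Complex spherical harmonics\<close>

definition wirtinger_z :: "'d::finite \<Rightarrow> (complex^'d \<Rightarrow> complex) \<Rightarrow> complex^'d \<Rightarrow> complex" where
  "wirtinger_z j f z =
     (frechet_derivative f (at z) (axis j 1) - \<i> * frechet_derivative f (at z) (axis j \<i>)) / 2"

definition wirtinger_zbar :: "'d::finite \<Rightarrow> (complex^'d \<Rightarrow> complex) \<Rightarrow> complex^'d \<Rightarrow> complex" where
  "wirtinger_zbar j f z =
     (frechet_derivative f (at z) (axis j 1) + \<i> * frechet_derivative f (at z) (axis j \<i>)) / 2"

definition complex_laplacian :: "(complex^'d::finite \<Rightarrow> complex) \<Rightarrow> complex^'d \<Rightarrow> complex" where
  "complex_laplacian f z = 4 * (\<Sum>j\<in>UNIV. wirtinger_z j (wirtinger_zbar j f) z)"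

definition bihomogeneous_polys :: "nat \<Rightarrow> nat \<Rightarrow> (complex^'d::finite \<Rightarrow> complex) set" where
  "bihomogeneous_polys m n =
     {P. \<exists>c :: ('d \<Rightarrow> nat) \<Rightarrow> ('d \<Rightarrow> nat) \<Rightarrow> complex.
        P = (\<lambda>z. \<Sum>a\<in>{a. sum a UNIV = m}. \<Sum>b\<in>{b. sum b UNIV = n}.
               c a b * (\<Prod>j\<in>UNIV. (z $ j) ^ a j) * (\<Prod>j\<in>UNIV. cnj (z $ j) ^ b j))}"

text \<open>
  Functions on the sphere are extended by zero, so that two restrictions are equal as HOL functions
  if and only if they agree on the sphere.
\<close>

definition harmonics :: "nat \<Rightarrow> nat \<Rightarrow> (complex^'d::finite \<Rightarrow> complex) set" where
  "harmonics m n =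
     {(\<lambda>z. if z \<in> sphere 0 1 then P z else 0) | P.
        P \<in> bihomogeneous_polys m n \<and> (\<forall>z. complex_laplacian P z = 0)}"

definition harmonics_level :: "nat \<Rightarrow> (complex^'d::finite \<Rightarrow> complex) set" where
  "harmonics_level l = cfun.span (\<Union>(m, n)\<in>{(m, n). max m n = l}. harmonics m n)"

definition theta :: "'d::finite itself \<Rightarrow> nat \<Rightarrow> nat \<Rightarrow> nat" where
  "theta _ a b = (\<Sum>j = a + 1..b. cfun.dim (harmonics_level j :: (complex^'d \<Rightarrow> complex) set))"

text \<open>The reproducing kernel of \<open>harmonics m n\<close> at \<open>w\<close>, as a function of its other argument.\<close>

definition zonal :: "nat \<Rightarrow> nat \<Rightarrow> complex^'d::finite \<Rightarrow> complex^'d \<Rightarrow> complex" where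
  "zonal m n w = (THE Z. Z \<in> harmonics m n \<and>
     (\<forall>f\<in>harmonics m n. f w = (\<integral>z. f z * cnj (Z z) \<partial>surface_measure)))"

definition zonal_conv :: "(complex^'d::finite \<Rightarrow> complex) \<Rightarrow> nat \<Rightarrow> nat \<Rightarrow> complex^'d \<Rightarrow> complex" where
  "zonal_conv \<phi> m n w = (\<integral>z. \<phi> z * cnj (zonal m n w z) \<partial>surface_measure)"


section \<open>Multiplier operators\<close>

text \<open>
  \<open>f\<close> has the formal expansion with terms \<open>lam m n\<close> times \<open>zonal_conv \<phi> m n\<close>: the component of \<open>f\<close>
  in each \<open>harmonics m n\<close> is the corresponding term. No convergence is asserted.
\<close>

definition has_multiplier_expansion ::
  "(nat \<Rightarrow> nat \<Rightarrow> real) \<Rightarrow> (complex^'d::finite \<Rightarrow> complex) \<Rightarrow> (complex^'d \<Rightarrow> complex) \<Rightarrow> bool" where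
  "has_multiplier_expansion lam \<phi> f \<longleftrightarrow>
     (\<forall>m n. \<forall>w\<in>sphere 0 1. zonal_conv f m n w = of_real (lam m n) * zonal_conv \<phi> m n w)"

definition multiplier_image ::
  "(nat \<Rightarrow> nat \<Rightarrow> real) \<Rightarrow> (complex^'d::finite \<Rightarrow> complex) set \<Rightarrow> ennreal \<Rightarrow> (complex^'d \<Rightarrow> complex) set" where
  "multiplier_image lam A q =
     {f \<in> Lp_space q surface_measure. \<exists>\<phi>\<in>A. has_multiplier_expansion lam \<phi> f}"

definition multiplier_bounded ::
  "'d::finite itself \<Rightarrow> (nat \<Rightarrow> nat \<Rightarrow> real) \<Rightarrow> ennreal \<Rightarrow> ennreal \<Rightarrow> bool" where
  "multiplier_bounded _ lam p q \<longleftrightarrow>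
     (\<forall>\<phi> \<in> Lp_space p (surface_measure :: (complex^'d) measure).
        \<exists>f \<in> Lp_space q surface_measure. has_multiplier_expansion lam \<phi> f) \<and>
     (SUP f \<in> multiplier_image lam (Lp_ball p (surface_measure :: (complex^'d) measure)) q.
        ennreal (Lp_norm q surface_measure f)) < \<infinity>"


section \<open>Kolmogorov widths\<close>

text \<open>
  \<open>X\<close> is a space of functions with seminorm \<open>N\<close>, standing for its quotient by the functions of
  seminorm zero. The subspaces of dimension \<open>n\<close> of the quotient are given by bases \<open>g 0, \<dots>, g (n - 1)\<close>
  which are linearly independent modulo functions of seminorm zero.
\<close>

definition subspaces_of_dim ::
  "('a \<Rightarrow> complex) set \<Rightarrow> (('a \<Rightarrow> complex) \<Rightarrow> real) \<Rightarrow> nat \<Rightarrow> ('a \<Rightarrow> complex) set set" where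
  "subspaces_of_dim X N n =
     {cfun.span (g ` {..<n}) | g :: nat \<Rightarrow> 'a \<Rightarrow> complex.
        (\<forall>i<n. g i \<in> X) \<and>
        (\<forall>c. N (\<lambda>x. \<Sum>i<n. c i * g i x) = 0 \<longrightarrow> (\<forall>i<n. c i = 0))}"

definition kolmogorov_width ::
  "('a \<Rightarrow> complex) set \<Rightarrow> (('a \<Rightarrow> complex) \<Rightarrow> real) \<Rightarrow> nat \<Rightarrow> ('a \<Rightarrow> complex) set \<Rightarrow> ennreal" where
  "kolmogorov_width X N n A =
     (INF V \<in> subspaces_of_dim X N n. SUP x \<in> A. INF y \<in> V. ennreal (N (\<lambda>t. x t - y t)))"


section \<open>The factors in the upper bound\<close>

text \<open>
  \<open>rho p q t m\<close> with \<open>t\<close> the dimension of a block. The quotient is taken in \<open>ennreal\<close>, so it is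
  infinite for \<open>m = 0\<close> (and \<open>t > 1\<close>).
\<close>

definition rho :: "ennreal \<Rightarrow> ennreal \<Rightarrow> nat \<Rightarrow> nat \<Rightarrow> ennreal" where
  "rho p q t m =
     ennreal (real t powr enn2real (1 / p)) / ennreal (sqrt (real m)) *
     ennreal (if q = \<infinity> then sqrt (ln (real t)) else sqrt (enn2real q))"

text \<open>
  In the theorem, the number of dimensions \<open>m 0\<close> belongs to the initial block of levels
  \<open>1, \<dots>, N 1\<close>, for which the upper bound contains no term. The bound holds with a constant
  independent of the sequences only if \<open>m 0\<close> covers that block, that is, if
  \<open>theta TYPE('d) (N 0) (N 1) \<le> m 0\<close>; this is stated as a hypothesis. (Otherwise \<open>lam\<close> could be
  scaled down arbitrarily on the levels above \<open>1\<close> without decreasing the width.)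
  Level \<open>0\<close> is annihilated, because \<open>lam 0 = 0\<close>.
\<close>

end

theory Submission
  imports Defs
begin

text \<open>
  The class is cut into blocks: \<open>levels a b\<close> collects the bidegrees with \<open>a < max m n \<le> b\<close>, and
  the \<open>k\<close>-th block uses \<open>a = N k\<close>, \<open>b = N (k + 1)\<close>. The space that approximates the class contains
  the initial block completely, contains a suitable subspace of dimension at most \<open>m k\<close> of the
  \<open>k\<close>-th block for \<open>1 \<le> k \<le> M\<close>, and ignores the blocks beyond \<open>M\<close>. The triangle inequality in
  \<open>L\<^sup>q\<close> for a convergent series (\<open>Lq_le_series\<close>) adds up the errors of the blocks
  (\<open>width_of_multiplier_class\<close>).

  Everything about a single block of dimension \<open>\<theta>\<close> follows from one identity: the spaces of harmonics
  are invariant under unitary reflections, which act transitively on the sphere up to phases, hence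
  the squares of an orthonormal basis add up to the constant \<open>\<theta> / \<omega>\<close> on the sphere, where \<open>\<omega>\<close> is the
  area of the sphere (\<open>addition_theorem\<close>). Therefore the orthogonal projection onto the block has norm at most
  a constant times \<open>\<theta> powr (1/p - 1/2)\<close> from \<open>L\<^sup>p\<close> to \<open>L\<^sup>2\<close> (\<open>projection_L2_bound\<close>), and the
  inclusion of the block into \<open>L\<^sup>q\<close> has norm at most a constant times \<open>\<theta> powr (1/2 - 1/q)\<close>
  (\<open>block_Lq_bound\<close>). Since the multiplier is non-increasing, it contributes the factor \<open>lam (N k)\<close>,
  and the product of the three factors is the term for an ignored block.

  For a block that is approximated, the gain is the bound \<open>sqrt (r * \<theta> / m)\<close> for the width
  of its Euclidean unit ball in \<open>L\<close>-norms with even exponent \<open>2 * r\<close> (\<open>width_of_euclidean_ball\<close>).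
  By duality a width is governed by the functionals that annihilate the approximating space.
  The space is spanned by \<open>m\<close> random sign combinations of the basis. A functional in the dual unit
  ball which is small on all of them has small coefficients: the mean of its absolute values on random
  signs bounds the Euclidean length of its coefficients, and by
  symmetrization the deviation of the empirical mean from this mean is controlled, uniformly over the
  dual ball, by the norm of a random sum, which is of order \<open>sqrt (r * m * \<theta> / \<omega>)\<close>. For finite \<open>q\<close> the exponent
  \<open>2 * r\<close> is \<open>q\<close> rounded up to an even integer. For \<open>q = \<infinity>\<close> it is of order \<open>ln \<theta>\<close>, because then the
  \<open>L\<close>-norm with exponent \<open>2 * r\<close> dominates the maximum on the block up to a constant: the \<open>r\<close>-th power
  of a polynomial of degree \<open>b\<close> has degree \<open>r * b\<close>, and the dimension of such polynomials is at most
  the \<open>r\<close>-th power of a constant (\<open>sup_le_even_moment\<close>).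

  The harmonics themselves are developed from integration by parts on the sphere, which gives the
  orthogonality of different bidegrees. The Fischer decomposition and
  the Stone-Weierstrass theorem show that an integrable function is determined by its coefficients
  (\<open>harmonics_complete\<close>); this identifies the sum of the block components of a function
  in the class with the function.
\<close>

type_synonym 'd sfun = "complex^'d \<Rightarrow> complex"

abbreviation surface_measure_notation :: "(complex^'d::finite) measure" ("\<sigma>") where
  "\<sigma> \<equiv> surface_measure"

section \<open>Averages over random signs\<close>

text \<open>
  The mean of \<open>F\<close> over independent uniform signs in the coordinates below \<open>n\<close>. The recursion replaces
  a product measure on \<open>{-1, 1}\<^sup>n\<close>: means over several sign vectors can be exchanged with each
  other and with integrals by induction on the number of signs. The remaining coordinates are \<open>0\<close>, which is why sign vectors
  appear below only through \<open>\<bar>a i\<bar> \<le> 1\<close>.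
\<close>

primrec rad :: "nat \<Rightarrow> ((nat \<Rightarrow> real) \<Rightarrow> real) \<Rightarrow> real" where
  "rad 0 F = F (\<lambda>_. 0)"
| "rad (Suc n) F = (rad n (\<lambda>a. F (a(n := 1))) + rad n (\<lambda>a. F (a(n := -1)))) / 2"

lemma rad_mono:
  assumes "\<And>a. (\<And>i. \<bar>a i\<bar> \<le> 1) \<Longrightarrow> F a \<le> G a"
  shows "rad n F \<le> rad n G"
  using assms
proof (induction n arbitrary: F G)
  case 0
  then show ?case by simp
next
  case (Suc n)
  have "rad n (\<lambda>a. F (a(n := 1))) \<le> rad n (\<lambda>a. G (a(n := 1)))"
    by (intro Suc.IH Suc.prems) auto
  moreover have "rad n (\<lambda>a. F (a(n := -1))) \<le> rad n (\<lambda>a. G (a(n := -1)))"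
    by (intro Suc.IH Suc.prems) auto
  ultimately show ?case by simp
qed

lemma rad_const [simp]: "rad n (\<lambda>_. c) = c"
  by (induction n) auto

lemma rad_add: "rad n (\<lambda>a. F a + G a) = rad n F + rad n G"
  by (induction n arbitrary: F G) (auto simp: field_simps)

lemma rad_cmult: "rad n (\<lambda>a. c * F a) = c * rad n F"
  by (induction n arbitrary: F) (auto simp: field_simps)

lemma rad_diff: "rad n (\<lambda>a. F a - G a) = rad n F - rad n G"
  using rad_add[of n F "\<lambda>a. (-1) * G a"] unfolding rad_cmult by simp

lemma rad_uminus: "rad n (\<lambda>a. F (\<lambda>i. - a i)) = rad n F"
proof (induction n arbitrary: F)
  case (Suc n)
  have *: "(\<lambda>i. - (a(n := c)) i) = (\<lambda>i. - a i)(n := - c)" for a :: "nat \<Rightarrow> real" and c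
    by auto
  show ?case
    by (simp add: * Suc.IH[of "\<lambda>a. F (a(n := -1))"] Suc.IH[of "\<lambda>a. F (a(n := 1))"] algebra_simps
        del: fun_upd_apply)
qed simp

lemma rad_attained: "\<exists>a. (\<forall>i. \<bar>a i\<bar> \<le> 1) \<and> F a \<le> rad n F"
proof (induction n arbitrary: F)
  case 0
  then show ?case by (auto intro: exI[of _ "\<lambda>_. 0"])
next
  case (Suc n)
  have "rad n (\<lambda>a. F (a(n := 1))) \<le> rad (Suc n) F \<or> rad n (\<lambda>a. F (a(n := -1))) \<le> rad (Suc n) F"
    by (simp del: fun_upd_apply) linarith
  then obtain c :: real where c: "c = 1 \<or> c = -1" "rad n (\<lambda>a. F (a(n := c))) \<le> rad (Suc n) F"
    by blast
  obtain a where a: "\<forall>i. \<bar>a i\<bar> \<le> 1" "F (a(n := c)) \<le> rad n (\<lambda>a. F (a(n := c)))"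
    using Suc.IH[of "\<lambda>a. F (a(n := c))"] by auto
  show ?case
    using a c by (intro exI[of _ "a(n := c)"] conjI order_trans[OF a(2) c(2)]) auto
qed

text \<open>
  One induction for all exchanges of a mean over signs with another linear functional: a second mean, or an
  integral, where the predicate \<open>P\<close> is integrability.
\<close>

lemma rad_commute:
  assumes add: "\<And>F G :: 'b \<Rightarrow> real. P F \<Longrightarrow> P G \<Longrightarrow> L (\<lambda>x. F x + G x) = L F + L G"
    and scale: "\<And>F. P F \<Longrightarrow> L (\<lambda>x. F x / 2) = (L F :: real) / 2"
    and P_add: "\<And>F G. P F \<Longrightarrow> P G \<Longrightarrow> P (\<lambda>x. F x + G x)"
    and P_scale: "\<And>F. P F \<Longrightarrow> P (\<lambda>x. F x / 2)"
    and "\<And>a. P (F a)"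
  shows "P (\<lambda>x. rad n (\<lambda>a. F a x)) \<and> L (\<lambda>x. rad n (\<lambda>a. F a x)) = rad n (\<lambda>a. L (F a))"
  using assms(5)
proof (induction n arbitrary: F)
  case (Suc n)
  have "P (\<lambda>x. rad n (\<lambda>a. F (a(n := c)) x)) \<and>
      L (\<lambda>x. rad n (\<lambda>a. F (a(n := c)) x)) = rad n (\<lambda>a. L (F (a(n := c))))" for c
    using Suc.IH[of "\<lambda>a. F (a(n := c))"] Suc.prems by blast
  then show ?case
    using Suc.prems by (simp add: add scale P_add P_scale)
qed simp

lemma rad_rad_swap: "rad n (\<lambda>a. rad k (\<lambda>b. F a b)) = rad k (\<lambda>b. rad n (\<lambda>a. F a b))"
  using rad_commute[of "\<lambda>_. True" "rad n" "\<lambda>b a. F a b" k]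
  by (simp add: rad_add rad_cmult[of n "1/2", simplified])

lemma sum_fun_upd_top:
  fixes x :: "nat \<Rightarrow> real"
  shows "(\<Sum>j<Suc n. (a(n := c)) j * x j) = (\<Sum>j<n. a j * x j) + c * x n"
proof -
  have "(\<Sum>j<n. (a(n := c)) j * x j) = (\<Sum>j<n. a j * x j)"
    by (intro sum.cong) auto
  then show ?thesis by simp
qed

lemma rad_linear: "rad n (\<lambda>a. \<Sum>j<n. a j * x j) = 0"
proof (induction n)
  case (Suc n)
  show ?case
    unfolding rad.simps sum_fun_upd_top rad_add rad_const Suc by simp
qed simp

lemma rad_square: "rad n (\<lambda>a. (\<Sum>j<n. a j * x j)^2) = (\<Sum>j<n. (x j)^2)"
proof (induction n)
  case (Suc n)
  have 1: "rad n (\<lambda>a. (\<Sum>j<Suc n. (a(n := c)) j * x j)^2) =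
     rad n (\<lambda>a. (\<Sum>j<n. a j * x j)^2 + (2 * c * x n) * (\<Sum>j<n. a j * x j) + (c * x n)^2)" for c
    unfolding sum_fun_upd_top
    by (rule arg_cong[where f = "rad n"]) (auto simp: power2_eq_square algebra_simps)
  show ?case
    unfolding rad.simps 1 rad_add rad_cmult rad_linear rad_const Suc by simp
qed simp

lemma rad_cube: "rad n (\<lambda>a. (\<Sum>j<n. a j * x j)^3) = 0"
proof -
  have "rad n (\<lambda>a. (\<Sum>j<n. a j * x j)^3) = rad n (\<lambda>a. (\<Sum>j<n. - a j * x j)^3)"
    by (rule rad_uminus[symmetric, of n "\<lambda>a. (\<Sum>j<n. a j * x j)^3"])
  also have "\<dots> = rad n (\<lambda>a. (-1) * (\<Sum>j<n. a j * x j)^3)"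
    by (simp add: sum_negf)
  finally show ?thesis unfolding rad_cmult by simp
qed

lemma rad_fourth: "rad n (\<lambda>a. (\<Sum>j<n. a j * x j)^4) \<le> 3 * (\<Sum>j<n. (x j)^2)^2"
proof (induction n)
  case (Suc n)
  have 1: "rad n (\<lambda>a. (\<Sum>j<Suc n. (a(n := c)) j * x j)^4) =
     rad n (\<lambda>a. (\<Sum>j<n. a j * x j)^4 + ((4 * c * x n) * (\<Sum>j<n. a j * x j)^3
       + ((6 * (c * x n)^2) * (\<Sum>j<n. a j * x j)^2 + ((4 * (c * x n)^3) * (\<Sum>j<n. a j * x j) + (c * x n)^4))))" for c
    unfolding sum_fun_upd_top
    by (rule arg_cong[where f = "rad n"])
       (auto simp: power4_eq_xxxx power2_eq_square power3_eq_cube algebra_simps)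
  have "rad (Suc n) (\<lambda>a. (\<Sum>j<Suc n. a j * x j)^4) =
     rad n (\<lambda>a. (\<Sum>j<n. a j * x j)^4) + 6 * (x n)^2 * (\<Sum>j<n. (x j)^2) + (x n)^4"
    unfolding rad.simps 1 rad_add rad_cmult rad_linear rad_cube rad_square rad_const
    by (simp add: power_mult_distrib)
  also have "\<dots> \<le> 3 * (\<Sum>j<n. (x j)^2)^2 + 6 * (x n)^2 * (\<Sum>j<n. (x j)^2) + 3 * (x n)^4"
  proof -
    have "0 \<le> x n ^ 4" by simp
    then show ?thesis using Suc by linarith
  qed
  also have "\<dots> = 3 * (\<Sum>j<Suc n. (x j)^2)^2"
    by (simp add: power2_eq_square power4_eq_xxxx algebra_simps)
  finally show ?case .
qed simp

text \<open>
  Khintchine's inequality between the first moment and the Euclidean length. The second and the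
  fourth moments are known, and \<open>\<bar>y\<bar>\<close> is bounded below by a combination of \<open>y\<^sup>2\<close> and \<open>y ^ 4\<close>.
\<close>

lemma rad_abs_lower: "5/9 * sqrt (\<Sum>j<n. (x j)^2) \<le> rad n (\<lambda>a. \<bar>\<Sum>j<n. a j * x j\<bar>)"
proof (cases "(\<Sum>j<n. (x j)^2) = 0")
  case True
  then show ?thesis using rad_mono[of "\<lambda>_. 0" "\<lambda>a. \<bar>\<Sum>j<n. a j * x j\<bar>" n] by simp
next
  case False
  define s where "s = sqrt (\<Sum>j<n. (x j)^2)"
  have s: "s > 0" "s^2 = (\<Sum>j<n. (x j)^2)"
    using False sum_nonneg[of "{..<n}" "\<lambda>j. (x j)^2"] by (auto simp: s_def less_le)
  \<comment> \<open>The coefficient \<open>4/27\<close> makes the polynomial touch \<open>\<bar>y\<bar>\<close> from below at \<open>\<bar>y\<bar> = 3/2 * s\<close>.\<close>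
  have pw: "1/s * y^2 - 4/27 / s^3 * y^4 \<le> \<bar>y\<bar>" for y :: real
  proof -
    define t where "t = \<bar>y\<bar> / s"
    have t: "t \<ge> 0" "\<bar>y\<bar> = t * s" using s by (auto simp: t_def)
    have "0 \<le> (t - 3/2)^2 * (t + 3)"
      using t by simp
    also have "\<dots> = 27/4 * (1 - t + 4/27 * t^3)"
      by (simp add: power2_eq_square power3_eq_cube algebra_simps)
    finally have "0 \<le> t * (1 - t + 4/27 * t^3)" using t by simp
    then have "t^2 - 4/27 * t^4 \<le> t"
      by (simp add: power2_eq_square power4_eq_xxxx power3_eq_cube algebra_simps)
    then have "(t^2 - 4/27 * t^4) * s \<le> t * s" using s by simp
    moreover have "y^2 = (t * s)^2" "y^4 = (t * s)^4"
      unfolding t(2)[symmetric] by simp_all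
    then have "1/s * y^2 = t^2 * s" "4/27 / s^3 * y^4 = 4/27 * t^4 * s"
      using s(1) by (simp_all add: power2_eq_square power4_eq_xxxx power3_eq_cube)
    ultimately show ?thesis
      using t(2) by (simp add: algebra_simps)
  qed
  have "rad n (\<lambda>a. 1/s * (\<Sum>j<n. a j * x j)^2 - 4/27 / s^3 * (\<Sum>j<n. a j * x j)^4)
      \<le> rad n (\<lambda>a. \<bar>\<Sum>j<n. a j * x j\<bar>)"
    by (intro rad_mono pw)
  moreover have "rad n (\<lambda>a. 1/s * (\<Sum>j<n. a j * x j)^2 - 4/27 / s^3 * (\<Sum>j<n. a j * x j)^4)
     = 1/s * s^2 - 4/27 / s^3 * rad n (\<lambda>a. (\<Sum>j<n. a j * x j)^4)"
    unfolding rad_diff rad_cmult rad_square s ..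
  moreover have "4/27 / s^3 * rad n (\<lambda>a. (\<Sum>j<n. a j * x j)^4) \<le> 4/27 / s^3 * (3 * (s^2)^2)"
    using rad_fourth[of n x] s by (intro mult_left_mono) auto
  moreover have "4/27 / s^3 * (3 * (s^2)^2) = 4/9 * s" "1/s * s^2 = s"
    using s(1) by (simp_all add: power2_eq_square power3_eq_cube)
  ultimately show ?thesis unfolding s_def[symmetric] by linarith
qed

lemma cosh_le_exp_half_square: "(exp x + exp (-x)) / 2 \<le> exp (x^2 / 2 :: real)"
proof -
  have 1: "(\<lambda>n. (if even n then x^n / fact n else 0)) sums ((exp x + exp (-x)) / 2)"
  proof -
    have "(\<lambda>n. (x ^ n /\<^sub>R fact n + (-x) ^ n /\<^sub>R fact n) / 2) sums ((exp x + exp (-x)) / 2)"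
      by (intro sums_divide sums_add exp_converges)
    then show ?thesis by (rule sums_cong[THEN iffD1, rotated]) (auto simp: field_simps)
  qed
  have "(\<lambda>n. x^(2*n) / fact (2*n)) sums ((exp x + exp (-x)) / 2)"
    using sums_mono_reindex[of "\<lambda>n. 2*n" "\<lambda>n. (if even n then x^n / fact n else 0)"] 1
    by (force simp: strict_mono_def elim!: evenE)
  moreover have "(\<lambda>n. (x^2/2)^n /\<^sub>R fact n) sums exp (x^2/2)"
    by (rule exp_converges)
  moreover have "x^(2*n) / fact (2*n) \<le> (x^2/2)^n /\<^sub>R fact n" for n
  proof -
    have "2^n * fact n \<le> (fact (2*n) :: real)"
    proof (induction n)
      case (Suc n)
      have "2 ^ Suc n * fact (Suc n) = (2 * real (Suc n)) * (2^n * fact n)" by simp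
      also have "\<dots> \<le> (2 * real (Suc n)) * fact (2*n)" using Suc by (intro mult_left_mono) auto
      also have "\<dots> \<le> (2 * real (Suc n)) * (real (2*n+1) * fact (2*n))"
        by (intro mult_left_mono) (auto simp: mult_le_cancel_right1)
      also have "\<dots> = fact (2 * Suc n)" by (simp add: algebra_simps)
      finally show ?case .
    qed simp
    then have "x^(2*n) / fact (2*n) \<le> x^(2*n) / (2^n * fact n)"
      by (intro divide_left_mono) auto
    also have "\<dots> = (x^2/2)^n /\<^sub>R fact n" unfolding power_mult power_divide by (simp add: divide_inverse mult_ac)
    finally show ?thesis .
  qed
  ultimately show ?thesis by (meson sums_le)
qed

lemma rad_exp: "rad n (\<lambda>a. exp (\<Sum>j<n. a j * x j)) \<le> exp ((\<Sum>j<n. (x j)^2) / 2)"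
proof (induction n)
  case (Suc n)
  have 1: "rad n (\<lambda>a. exp (\<Sum>j<Suc n. (a(n := c)) j * x j)) =
     rad n (\<lambda>a. exp (c * x n) * exp (\<Sum>j<n. a j * x j))" for c
    unfolding sum_fun_upd_top exp_add by (simp add: mult.commute)
  have "rad (Suc n) (\<lambda>a. exp (\<Sum>j<Suc n. a j * x j)) =
      (exp (x n) + exp (- x n)) / 2 * rad n (\<lambda>a. exp (\<Sum>j<n. a j * x j))"
    unfolding rad.simps 1 rad_cmult by (simp add: field_simps)
  also have "\<dots> \<le> exp ((x n)^2 / 2) * exp ((\<Sum>j<n. (x j)^2) / 2)"
    using rad_mono[of "\<lambda>_. 0" "\<lambda>a. exp (\<Sum>j<n. a j * x j)" n]
    by (intro mult_mono cosh_le_exp_half_square Suc) auto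
  also have "\<dots> = exp ((\<Sum>j<Suc n. (x j)^2) / 2)"
    by (simp add: exp_add[symmetric] add_divide_distrib add.commute)
  finally show ?case .
qed simp

text \<open>
  The mean over \<open>m\<close> independent sign vectors of length \<open>n\<close>, the rows of a random sign matrix.
\<close>

primrec rad_rows :: "nat \<Rightarrow> nat \<Rightarrow> ((nat \<Rightarrow> real) list \<Rightarrow> real) \<Rightarrow> real" where
  "rad_rows n 0 F = F []"
| "rad_rows n (Suc m) F = rad n (\<lambda>a. rad_rows n m (\<lambda>l. F (a # l)))"

definition sign_rows :: "nat \<Rightarrow> (nat \<Rightarrow> real) list set" where
  "sign_rows m = {l. length l = m \<and> (\<forall>a\<in>set l. \<forall>i. \<bar>a i\<bar> \<le> 1)}"

lemma rad_rows_mono: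
  assumes "\<And>l. l \<in> sign_rows m \<Longrightarrow> F l \<le> G l"
  shows "rad_rows n m F \<le> rad_rows n m G"
  using assms
proof (induction m arbitrary: F G)
  case (Suc m)
  then show ?case
    unfolding rad_rows.simps by (intro rad_mono Suc.IH Suc.prems) (auto simp: sign_rows_def)
qed (simp add: sign_rows_def)

lemma rad_rows_const [simp]: "rad_rows n m (\<lambda>_. c) = c"
  by (induction m) auto

lemma rad_rows_add: "rad_rows n m (\<lambda>l. F l + G l) = rad_rows n m F + rad_rows n m G"
  by (induction m arbitrary: F G) (auto simp: rad_add)

lemma rad_rows_cmult: "rad_rows n m (\<lambda>l. c * F l) = c * rad_rows n m F"
  by (induction m arbitrary: F) (auto simp: rad_cmult)

lemma rad_rows_attained: "\<exists>l\<in>sign_rows m. F l \<le> rad_rows n m F"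
proof (induction m arbitrary: F)
  case (Suc m)
  obtain a where a: "\<forall>i. \<bar>a i\<bar> \<le> 1" "rad_rows n m (\<lambda>l. F (a # l)) \<le> rad_rows n (Suc m) F"
    using rad_attained[of "\<lambda>a. rad_rows n m (\<lambda>l. F (a # l))" n] by auto
  obtain l where "l \<in> sign_rows m" "F (a # l) \<le> rad_rows n m (\<lambda>l. F (a # l))"
    using Suc.IH[of "\<lambda>l. F (a # l)"] by auto
  with a show ?case
    by (intro bexI[of _ "a # l"]) (auto simp: sign_rows_def)
qed (simp add: sign_rows_def)

lemma rad_rows_swap: "rad k (\<lambda>a. rad_rows n m (\<lambda>l. F a l)) = rad_rows n m (\<lambda>l. rad k (\<lambda>a. F a l))"
  using rad_commute[of "\<lambda>_. True" "rad_rows n m" F k]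
  by (simp add: rad_rows_add rad_rows_cmult[of n m "1/2", simplified])

lemma rad_rows_integral:
  fixes F :: "(nat \<Rightarrow> real) list \<Rightarrow> 'a \<Rightarrow> real"
  assumes "\<And>l. integrable M (F l)"
  shows "integrable M (\<lambda>x. rad_rows n m (\<lambda>l. F l x)) \<and>
     (\<integral>x. rad_rows n m (\<lambda>l. F l x) \<partial>M) = rad_rows n m (\<lambda>l. \<integral>x. F l x \<partial>M)"
  using assms
proof (induction m arbitrary: F)
  case (Suc m)
  have IH: "integrable M (\<lambda>x. rad_rows n m (\<lambda>l. F (a # l) x)) \<and>
     (\<integral>x. rad_rows n m (\<lambda>l. F (a # l) x) \<partial>M) = rad_rows n m (\<lambda>l. \<integral>x. F (a # l) x \<partial>M)" for a
    by (intro Suc.IH Suc.prems)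
  have "integrable M (\<lambda>x. rad n (\<lambda>a. rad_rows n m (\<lambda>l. F (a # l) x))) \<and>
     (\<integral>x. rad n (\<lambda>a. rad_rows n m (\<lambda>l. F (a # l) x)) \<partial>M) =
     rad n (\<lambda>a. \<integral>x. rad_rows n m (\<lambda>l. F (a # l) x) \<partial>M)"
    by (rule rad_commute[where P = "integrable M" and L = "integral\<^sup>L M"]) (use IH in auto)
  then show ?case using IH by simp
qed simp

lemma rad_rows_exp:
  "rad_rows n m (\<lambda>l. exp (\<Sum>a\<leftarrow>l. \<Sum>j<n. a j * x j)) \<le> exp (real m * (\<Sum>j<n. (x j)^2) / 2)"
proof (induction m)
  case (Suc m)
  define R where "R = rad_rows n m (\<lambda>l. exp (\<Sum>a\<leftarrow>l. \<Sum>j<n. a j * x j))"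
  have "rad_rows n (Suc m) (\<lambda>l. exp (\<Sum>a\<leftarrow>l. \<Sum>j<n. a j * x j)) =
    rad n (\<lambda>a. R * exp (\<Sum>j<n. a j * x j))"
    unfolding R_def by (simp add: exp_add rad_rows_cmult mult.commute)
  also have "\<dots> = R * rad n (\<lambda>a. exp (\<Sum>j<n. a j * x j))"
    by (rule rad_cmult)
  also have "\<dots> \<le> exp (real m * (\<Sum>j<n. (x j)^2) / 2) * exp ((\<Sum>j<n. (x j)^2) / 2)"
    using rad_mono[of "\<lambda>_. 0" "\<lambda>a. exp (\<Sum>j<n. a j * x j)" n]
    unfolding R_def by (intro mult_mono Suc rad_exp) auto
  also have "\<dots> = exp (real (Suc m) * (\<Sum>j<n. (x j)^2) / 2)"
    by (simp add: exp_add[symmetric] field_simps)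
  finally show ?case .
qed simp

lemma even_power_le_exp:
  "(x::real) ^ (2 * r) \<le> fact (2 * r) * (exp x + exp (- x))"
proof -
  have "\<bar>x\<bar> ^ (2*r) / fact (2*r) \<le> exp \<bar>x\<bar>"
  proof -
    have "(\<Sum>i\<in>{2*r}. \<bar>x\<bar> ^ i /\<^sub>R fact i) \<le> (\<Sum>i. \<bar>x\<bar> ^ i /\<^sub>R fact i)"
      using exp_converges[of "\<bar>x\<bar>"] by (intro sum_le_suminf) (auto simp: sums_iff)
    then show ?thesis using exp_converges[of "\<bar>x\<bar>"] by (simp add: sums_iff field_simps)
  qed
  also have "exp \<bar>x\<bar> \<le> exp x + exp (-x)"
    by (cases "x \<ge> 0") auto
  finally have "\<bar>x\<bar> ^ (2*r) \<le> fact (2*r) * (exp x + exp (-x))"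
    by (simp add: field_simps)
  then show ?thesis by (simp add: power_even_abs)
qed

text \<open>
  Even moments of a sub-Gaussian variable: \<open>t ^ (2 * r)\<close> is compared with \<open>exp t + exp (- t)\<close>, whose mean is
  bounded by \<open>rad_rows_exp\<close>.
\<close>

lemma rad_rows_even_moment:
  assumes "m > 0" "r > 0" "(\<Sum>j<n. (x j)^2) \<le> \<kappa>" "\<kappa> > 0"
  shows "rad_rows n m (\<lambda>l. (\<Sum>a\<leftarrow>l. \<Sum>j<n. a j * x j) ^ (2 * r)) \<le> 2 * (6 * (real r * real m * \<kappa>)) ^ r"
proof -
  \<comment> \<open>This scale makes the bound for the exponential moment equal to \<open>exp r\<close>, which balances \<open>fact (2 * r)\<close>.\<close>
  define s where "s = sqrt (2 * r / (m * \<kappa>))"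
  have s: "s > 0" "s^2 = 2 * r / (m * \<kappa>)" using assms by (auto simp: s_def)
  define X where "X c l = (\<Sum>a\<leftarrow>l. \<Sum>j<n. a j * (c * x j))" for c :: real and l :: "(nat \<Rightarrow> real) list"
  have X: "X c l = c * X 1 l" for c l
    unfolding X_def by (induction l) (auto simp: sum_distrib_left algebra_simps)
  have ex: "rad_rows n m (\<lambda>l. exp (X c l)) \<le> exp r" if "\<bar>c\<bar> = s" for c
  proof -
    have "c^2 = s^2" using that by (metis power2_abs)
    then have "real m * (\<Sum>j<n. (c * x j)^2) / 2 = m * s^2 * (\<Sum>j<n. (x j)^2) / 2"
      by (simp add: power_mult_distrib sum_distrib_left algebra_simps)
    also have "\<dots> \<le> m * s^2 * \<kappa> / 2"
      using assms(3) by (intro divide_right_mono mult_left_mono) auto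
    also have "\<dots> = r" using assms s by simp
    finally show ?thesis using rad_rows_exp[of n m "\<lambda>j. c * x j"] unfolding X_def
      by (meson exp_le_cancel_iff order_trans)
  qed
  have "rad_rows n m (\<lambda>l. (X s l) ^ (2 * r)) \<le>
      rad_rows n m (\<lambda>l. fact (2 * r) * (exp (X s l) + exp (X (-s) l)))"
    using even_power_le_exp by (intro rad_rows_mono) (simp add: X[of s] X[of "-s"])
  also have "\<dots> \<le> fact (2 * r) * (exp r + exp r)"
    unfolding rad_rows_cmult rad_rows_add using s by (intro mult_left_mono add_mono ex) auto
  also have "\<dots> \<le> (2 * real r) ^ (2 * r) * (2 * exp r)"
    using fact_le_power[of "2 * r", where 'a = real] by (intro mult_mono) (auto simp: power_mult_distrib)
  finally have A: "rad_rows n m (\<lambda>l. (X s l) ^ (2 * r)) \<le> (2 * real r) ^ (2 * r) * (2 * exp r)" .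
  have "rad_rows n m (\<lambda>l. (X 1 l) ^ (2 * r)) = (1/s^2)^r * rad_rows n m (\<lambda>l. (X s l) ^ (2 * r))"
    unfolding rad_rows_cmult[symmetric] X[of s] power_mult_distrib power_mult[of _ 2] using s(1)
    by (simp add: power_one_over)
  also have "\<dots> \<le> (1 / s\<^sup>2) ^ r * ((2 * real r) ^ (2 * r) * (2 * exp r))"
    by (intro mult_left_mono A) auto
  also have "(1 / s\<^sup>2) ^ r * ((2 * real r) ^ (2 * r) * (2 * exp r)) =
      2 * ((m * \<kappa> / (2 * r)) * (2 * real r)^2 * exp 1) ^ r"
  proof -
    have e: "exp (real r) = exp 1 ^ r" using exp_of_nat_mult[of r 1] by simp
    have "1 / s\<^sup>2 = m * \<kappa> / (2 * r)" using assms unfolding s by simp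
    then show ?thesis unfolding e power_mult[of _ 2] power_mult_distrib by (simp only: mult_ac)
  qed
  also have "(m * \<kappa> / (2 * r)) * (2 * real r)^2 = 2 * (real r * real m * \<kappa>)"
    using assms by (simp add: power2_eq_square)
  also have "2 * (2 * (real r * real m * \<kappa>) * exp 1) ^ r \<le> 2 * (2 * (real r * real m * \<kappa>) * 3) ^ r"
    using exp_le assms by (intro mult_left_mono power_mono) auto
  finally show ?thesis by (simp add: X_def algebra_simps)
qed

section \<open>Symmetrization\<close>

text \<open>
  The mean over an independent copy \<open>b\<close> of the signs replaces the expectation inside the supremum. Exchanging \<open>a\<close>
  and \<open>b\<close> and splitting the supremum decouples the two copies, and the absolute values are then
  removed with the sign symmetry of \<open>f\<close>. The summand \<open>G\<close> is arbitrary so that the rows can be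
  treated one after the other.
\<close>

lemma rad_symmetrization:
  fixes f :: "'e \<Rightarrow> (nat \<Rightarrow> real) \<Rightarrow> real"
  assumes T: "T \<noteq> {}" "bdd_above (G ` T)"
    and bound: "\<And>e a. e \<in> T \<Longrightarrow> (\<And>i. \<bar>a i\<bar> \<le> 1) \<Longrightarrow> \<bar>f e a\<bar> \<le> B"
    and odd: "\<And>e a. f e (\<lambda>i. - a i) = - f e a"
  shows "rad n (\<lambda>a. SUP e\<in>T. G e + (rad n (\<lambda>a. \<bar>f e a\<bar>) - \<bar>f e a\<bar>))
    \<le> rad n (\<lambda>a. SUP e\<in>T. G e + 2 * f e a)"
proof -
  define S where "S g = (SUP e\<in>T. G e + g e)" for g :: "'e \<Rightarrow> real"
  define sgn where "sgn a \<longleftrightarrow> (\<forall>i. \<bar>a i\<bar> \<le> (1::real))" for a :: "nat \<Rightarrow> real"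
  have bnd: "\<bar>f e a\<bar> \<le> B" if "e \<in> T" "sgn a" for e a
    using bound that by (auto simp: sgn_def)
  have bdd: "bdd_above ((\<lambda>e. G e + g e) ` T)" if "\<And>e. e \<in> T \<Longrightarrow> g e \<le> K" for g K
  proof -
    obtain A where "\<And>e. e \<in> T \<Longrightarrow> G e \<le> A" using T(2) by (auto simp: bdd_above_def)
    then have "G e + g e \<le> A + K" if "e \<in> T" for e using that \<open>\<And>e. e \<in> T \<Longrightarrow> g e \<le> K\<close> by (simp add: add_mono)
    then show ?thesis by (auto simp: bdd_above_def)
  qed
  have upper: "G e + g e \<le> S g" if "e \<in> T" "\<And>e. e \<in> T \<Longrightarrow> g e \<le> K" for g K e
    unfolding S_def using that by (intro cSUP_upper bdd) auto
  have least: "S g \<le> c" if "\<And>e. e \<in> T \<Longrightarrow> G e + g e \<le> c" for g c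
    unfolding S_def using that T(1) by (intro cSUP_least) auto
  define \<Psi> where "\<Psi> b a = S (\<lambda>e. \<bar>f e b\<bar> - \<bar>f e a\<bar>)" for a b
  have 1: "S (\<lambda>e. rad n (\<lambda>b. \<bar>f e b\<bar>) - \<bar>f e a\<bar>) \<le> rad n (\<lambda>b. \<Psi> b a)" for a
  proof (rule least)
    fix e assume e: "e \<in> T"
    have "G e + (rad n (\<lambda>b. \<bar>f e b\<bar>) - \<bar>f e a\<bar>) = rad n (\<lambda>b. G e + (\<bar>f e b\<bar> - \<bar>f e a\<bar>))"
      by (simp add: rad_add rad_diff)
    also have "\<dots> \<le> rad n (\<lambda>b. \<Psi> b a)"
      unfolding \<Psi>_def
    proof (rule rad_mono)
      fix b :: "nat \<Rightarrow> real" assume "\<And>i. \<bar>b i\<bar> \<le> 1"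
      then have "sgn b" by (simp add: sgn_def)
      then have "\<bar>f e b\<bar> - \<bar>f e a\<bar> \<le> B" if "e \<in> T" for e
        using bnd[OF that] by force
      then show "G e + (\<bar>f e b\<bar> - \<bar>f e a\<bar>) \<le> S (\<lambda>e. \<bar>f e b\<bar> - \<bar>f e a\<bar>)"
        using upper[OF e, of "\<lambda>e. \<bar>f e b\<bar> - \<bar>f e a\<bar>" B] by blast
    qed
    finally show "G e + (rad n (\<lambda>b. \<bar>f e b\<bar>) - \<bar>f e a\<bar>) \<le> rad n (\<lambda>b. \<Psi> b a)" .
  qed
  define C where "C a = S (\<lambda>e. 2 * \<bar>f e a\<bar>) + S (\<lambda>e. - 2 * \<bar>f e a\<bar>)" for a
  \<comment> \<open>The supremum of a sum is at most the sum of suprema; each of the two depends on one copy only.\<close>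
  have 2: "\<Psi> b a + \<Psi> a b \<le> (C a + C b) / 2" if "sgn a" "sgn b" for a b
  proof -
    have *: "\<Psi> b a \<le> (S (\<lambda>e. 2 * \<bar>f e b\<bar>) + S (\<lambda>e. - 2 * \<bar>f e a\<bar>)) / 2" if "sgn a" "sgn b" for a b
      unfolding \<Psi>_def
    proof (rule least)
      fix e assume e: "e \<in> T"
      have "G e + 2 * \<bar>f e b\<bar> \<le> S (\<lambda>e. 2 * \<bar>f e b\<bar>)"
        using bnd[OF _ that(2)] by (intro upper[OF e, of _ "2 * B"]) force
      moreover have "G e + - 2 * \<bar>f e a\<bar> \<le> S (\<lambda>e. - 2 * \<bar>f e a\<bar>)"
        by (intro upper[OF e, of _ 0]) auto
      ultimately show "G e + (\<bar>f e b\<bar> - \<bar>f e a\<bar>) \<le> (S (\<lambda>e. 2 * \<bar>f e b\<bar>) + S (\<lambda>e. - 2 * \<bar>f e a\<bar>)) / 2"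
        by simp
    qed
    show ?thesis using *[OF that] *[OF that(2,1)] by (simp add: C_def)
  qed
  \<comment> \<open>For any two indices, one of the choices of sign dominates both absolute values.\<close>
  have 3: "C a \<le> S (\<lambda>e. 2 * f e a) + S (\<lambda>e. 2 * f e (\<lambda>i. - a i))" if "sgn a" for a
  proof -
    have up: "G e + 2 * f e a \<le> S (\<lambda>e. 2 * f e a)" "G e - 2 * f e a \<le> S (\<lambda>e. 2 * f e (\<lambda>i. - a i))" if "e \<in> T" for e
      using upper[OF that, of "\<lambda>e. 2 * f e a" "2 * B"] upper[OF that, of "\<lambda>e. 2 * f e (\<lambda>i. - a i)" "2 * B"]
        bnd[OF _ \<open>sgn a\<close>] by (auto simp: odd abs_le_iff)
    have "G s + 2 * \<bar>f s a\<bar> + (G t + - 2 * \<bar>f t a\<bar>) \<le> S (\<lambda>e. 2 * f e a) + S (\<lambda>e. 2 * f e (\<lambda>i. - a i))"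
      if "s \<in> T" "t \<in> T" for s t
      using up[OF that(1)] up[OF that(2)] by (auto simp: abs_if split: if_splits)
    then have "G s + 2 * \<bar>f s a\<bar> \<le>
        S (\<lambda>e. 2 * f e a) + S (\<lambda>e. 2 * f e (\<lambda>i. - a i)) - S (\<lambda>e. - 2 * \<bar>f e a\<bar>)" if "s \<in> T" for s
      using least[of "\<lambda>e. - 2 * \<bar>f e a\<bar>" "S (\<lambda>e. 2 * f e a) + S (\<lambda>e. 2 * f e (\<lambda>i. - a i)) - (G s + 2 * \<bar>f s a\<bar>)"] that
      by force
    from least[OF this] show ?thesis by (simp add: C_def)
  qed
  have "rad n (\<lambda>a. rad n (\<lambda>b. \<Psi> b a)) = (rad n (\<lambda>a. rad n (\<lambda>b. \<Psi> b a)) + rad n (\<lambda>a. rad n (\<lambda>b. \<Psi> a b))) / 2"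
    using rad_rad_swap[of n n \<Psi>] by simp
  also have "\<dots> = rad n (\<lambda>a. rad n (\<lambda>b. \<Psi> b a + \<Psi> a b)) / 2"
    by (simp add: rad_add)
  also have "\<dots> \<le> rad n (\<lambda>a. rad n (\<lambda>b. (C a + C b) / 2)) / 2"
    by (intro divide_right_mono rad_mono 2) (auto simp: sgn_def)
  also have "\<dots> = rad n C / 2"
    using rad_cmult[of n "1/2"] by (simp add: rad_add add_divide_distrib)
  also have "\<dots> \<le> rad n (\<lambda>a. S (\<lambda>e. 2 * f e a) + S (\<lambda>e. 2 * f e (\<lambda>i. - a i))) / 2"
    by (intro divide_right_mono rad_mono 3) (auto simp: sgn_def)
  also have "\<dots> = rad n (\<lambda>a. S (\<lambda>e. 2 * f e a))"
    using rad_uminus[of n "\<lambda>a. S (\<lambda>e. 2 * f e a)"] by (simp add: rad_add)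
  finally have "rad n (\<lambda>a. rad n (\<lambda>b. \<Psi> b a)) \<le> rad n (\<lambda>a. S (\<lambda>e. 2 * f e a))" .
  moreover have "rad n (\<lambda>a. S (\<lambda>e. rad n (\<lambda>b. \<bar>f e b\<bar>) - \<bar>f e a\<bar>)) \<le> rad n (\<lambda>a. rad n (\<lambda>b. \<Psi> b a))"
    by (intro rad_mono 1)
  ultimately show ?thesis by (simp add: S_def)
qed

lemma rad_rows_symmetrization:
  fixes f :: "'e \<Rightarrow> (nat \<Rightarrow> real) \<Rightarrow> real"
  assumes T: "T \<noteq> {}" "bdd_above (G ` T)"
    and bound: "\<And>e a. e \<in> T \<Longrightarrow> (\<And>i. \<bar>a i\<bar> \<le> 1) \<Longrightarrow> \<bar>f e a\<bar> \<le> B"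
    and odd: "\<And>e a. f e (\<lambda>i. - a i) = - f e a"
  shows "rad_rows n m (\<lambda>l. SUP e\<in>T. G e + (\<Sum>a\<leftarrow>l. rad n (\<lambda>a. \<bar>f e a\<bar>) - \<bar>f e a\<bar>))
    \<le> rad_rows n m (\<lambda>l. SUP e\<in>T. G e + (\<Sum>a\<leftarrow>l. 2 * f e a))"
  using T(2)
proof (induction m arbitrary: G)
  case (Suc m)
  have bdd: "bdd_above ((\<lambda>e. G' e + g e) ` T)" if b: "bdd_above (G' ` T)" "\<And>e. e \<in> T \<Longrightarrow> g e \<le> K" for G' g :: "'e \<Rightarrow> real" and K
  proof -
    obtain A where "\<And>e. e \<in> T \<Longrightarrow> G' e \<le> A" using b(1) by (auto simp: bdd_above_def)
    then have "G' e + g e \<le> A + K" if "e \<in> T" for e using that \<open>\<And>e. e \<in> T \<Longrightarrow> g e \<le> K\<close> by (simp add: add_mono)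
    then show ?thesis by (auto simp: bdd_above_def)
  qed
  define D where "D e a = rad n (\<lambda>a. \<bar>f e a\<bar>) - \<bar>f e a\<bar>" for e a
  have "D e a \<le> B" if "e \<in> T" for e a
  proof -
    have "rad n (\<lambda>a. \<bar>f e a\<bar>) \<le> rad n (\<lambda>_. B)" using bound[OF that] by (intro rad_mono) auto
    then show ?thesis by (simp add: D_def)
  qed
  have "rad_rows n (Suc m) (\<lambda>l. SUP e\<in>T. G e + (\<Sum>a\<leftarrow>l. D e a)) =
      rad n (\<lambda>a. rad_rows n m (\<lambda>l. SUP e\<in>T. (G e + D e a) + (\<Sum>a\<leftarrow>l. D e a)))"
    by (simp add: add.assoc)
  also have "\<dots> \<le> rad n (\<lambda>a. rad_rows n m (\<lambda>l. SUP e\<in>T. (G e + D e a) + (\<Sum>a\<leftarrow>l. 2 * f e a)))"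
    using Suc.prems \<open>\<And>e a. e \<in> T \<Longrightarrow> D e a \<le> B\<close> unfolding D_def
    by (intro rad_mono Suc.IH bdd) auto
  also have "\<dots> = rad_rows n m (\<lambda>l. rad n (\<lambda>a. SUP e\<in>T. (G e + (\<Sum>a\<leftarrow>l. 2 * f e a)) + D e a))"
    unfolding rad_rows_swap by (simp add: add_ac)
  also have "\<dots> \<le> rad_rows n m (\<lambda>l. rad n (\<lambda>a. SUP e\<in>T. (G e + (\<Sum>a\<leftarrow>l. 2 * f e a)) + 2 * f e a))"
    unfolding D_def
  proof (intro rad_rows_mono rad_symmetrization T(1) odd)
    fix l :: "(nat \<Rightarrow> real) list" assume l: "l \<in> sign_rows m"
    have "(\<Sum>a\<leftarrow>l. 2 * f e a) \<le> (\<Sum>a\<leftarrow>l. 2 * B)" if "e \<in> T" for e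
      using l bound[OF that] by (intro sum_list_mono) (force simp: sign_rows_def abs_le_iff)
    then show "bdd_above ((\<lambda>e. G e + (\<Sum>a\<leftarrow>l. 2 * f e a)) ` T)"
      by (intro bdd[OF Suc.prems, of _ "(\<Sum>a\<leftarrow>l. 2 * B)"])
  qed (use bound in auto)
  also have "\<dots> = rad_rows n (Suc m) (\<lambda>l. SUP e\<in>T. G e + (\<Sum>a\<leftarrow>l. 2 * f e a))"
    unfolding rad_rows_swap[symmetric] by (simp add: add_ac)
  finally show ?case by (simp add: D_def)
qed simp

section \<open>Spans of orthonormal functions in even Lebesgue norms\<close>

lemma power_add_le_quadratic:
  fixes X :: real
  assumes "X \<ge> 0"
  shows "\<exists>K\<ge>0. \<forall>A h. 0 \<le> A \<longrightarrow> A \<le> X \<longrightarrow> 0 \<le> A + h \<longrightarrow> A + h \<le> X \<longrightarrow>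
    (A + h) ^ r \<le> A ^ r + real r * A ^ (r - 1) * h + K * h\<^sup>2"
proof (induction r)
  case (Suc r)
  then obtain K where K: "K \<ge> 0" "\<And>A h. 0 \<le> A \<Longrightarrow> A \<le> X \<Longrightarrow> 0 \<le> A + h \<Longrightarrow> A + h \<le> X \<Longrightarrow>
    (A + h) ^ r \<le> A ^ r + real r * A ^ (r - 1) * h + K * h\<^sup>2" by blast
  have main: "(A + h) ^ Suc r \<le> A ^ Suc r + real (Suc r) * A ^ (Suc r - 1) * h + (r * X ^ (r - 1) + K * X) * h\<^sup>2"
    if *: "0 \<le> A" "A \<le> X" "0 \<le> A + h" "A + h \<le> X" for A h
  proof -
    have e: "real r * (A * A ^ (r - 1)) = real r * A ^ r" by (cases r) auto
    have "(A + h) ^ Suc r \<le> (A + h) * (A ^ r + real r * A ^ (r - 1) * h + K * h\<^sup>2)"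
      using mult_left_mono[OF K(2)[OF *] *(3)] by simp
    also have "\<dots> = A ^ Suc r + A ^ r * h + (real r * (A * A ^ (r - 1))) * h + (r * A ^ (r - 1) + K * (A + h)) * h\<^sup>2"
      by (simp add: algebra_simps power2_eq_square)
    also have "\<dots> = A ^ Suc r + real (Suc r) * A ^ (Suc r - 1) * h + (r * A ^ (r - 1) + K * (A + h)) * h\<^sup>2"
      unfolding e by (simp add: algebra_simps)
    also have "(r * A ^ (r - 1) + K * (A + h)) * h\<^sup>2 \<le> (r * X ^ (r - 1) + K * X) * h\<^sup>2"
      using * K(1) by (intro mult_right_mono add_mono mult_left_mono power_mono) auto
    finally show ?thesis by simp
  qed
  have "r * X ^ (r - 1) + K * X \<ge> 0" using assms K(1) by simp
  then show ?case using main by (intro exI[of _ "r * X ^ (r - 1) + K * X"] conjI allI impI)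
qed auto

text \<open>
  The gradient of \<open>cmod z ^ (2 * r)\<close> up to the factor \<open>2 * r\<close>. Integrating against it gives the
  functional that norms a function in the Lebesgue space with exponent \<open>2 * r\<close>.
\<close>

definition dual_pow :: "nat \<Rightarrow> complex \<Rightarrow> complex" where
  "dual_pow r z = of_real (cmod z ^ (2 * r - 2)) * z"

lemma dual_pow_self: "r > 0 \<Longrightarrow> z * cnj (dual_pow r z) = of_real (cmod z ^ (2 * r))"
proof -
  assume "r > 0"
  then have "cmod z ^ (2 * r) = cmod z ^ (2 * r - 2) * (cmod z)\<^sup>2"
    by (cases r) (auto simp: power2_eq_square)
  then show ?thesis by (simp add: dual_pow_def complex_norm_square[symmetric] mult_ac)
qed

lemma norm_dual_pow: "r > 0 \<Longrightarrow> cmod (dual_pow r z) = cmod z ^ (2 * r - 1)"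
  by (cases r) (auto simp: dual_pow_def norm_mult norm_power)

lemma dual_pow_mult:
  "dual_pow r (w * z) = of_real (cmod w ^ (2 * r - 2)) * w * dual_pow r z"
  by (simp add: dual_pow_def norm_mult power_mult_distrib)

text \<open>
  The remainder is quadratic uniformly on bounded sets, so the inequality can be integrated and gives
  the first variation of the norm at a near-minimiser.
\<close>

lemma dual_pow_expansion:
  assumes "B \<ge> 0" "r > 0"
  shows "\<exists>K\<ge>0. \<forall>z d (t::real). cmod z \<le> B \<longrightarrow> cmod d \<le> B \<longrightarrow> 0 \<le> t \<longrightarrow> t \<le> 1 \<longrightarrow>
    cmod (z + of_real t * d) ^ (2 * r) \<le>
      cmod z ^ (2 * r) + 2 * real r * t * Re (d * cnj (dual_pow r z)) + K * t\<^sup>2"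
proof -
  obtain K where K: "K \<ge> 0" "\<And>A h. 0 \<le> A \<Longrightarrow> A \<le> 4 * B\<^sup>2 \<Longrightarrow> 0 \<le> A + h \<Longrightarrow> A + h \<le> 4 * B\<^sup>2 \<Longrightarrow>
    (A + h) ^ r \<le> A ^ r + real r * A ^ (r - 1) * h + K * h\<^sup>2"
    using power_add_le_quadratic[of "4 * B\<^sup>2" r] by auto
  define K' where "K' = r * (B\<^sup>2) ^ (r - 1) * B\<^sup>2 + K * (3 * B\<^sup>2)\<^sup>2"
  have main: "cmod (z + of_real t * d) ^ (2 * r) \<le>
      cmod z ^ (2 * r) + 2 * real r * t * Re (d * cnj (dual_pow r z)) + K' * t\<^sup>2"
    if *: "cmod z \<le> B" "cmod d \<le> B" "0 \<le> t" "t \<le> 1" for z d and t :: real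
  proof -
    define A where "A = (cmod z)\<^sup>2"
    define h where "h = t * (2 * Re (d * cnj z) + t * (cmod d)\<^sup>2)"
    have Ah: "A + h = (cmod (z + of_real t * d))\<^sup>2"
      unfolding A_def h_def cmod_power2 by (simp add: power2_eq_square algebra_simps)
    have "cmod (z + of_real t * d) \<le> cmod z + t * cmod d"
      using norm_triangle_ineq[of z "of_real t * d"] * by (simp add: norm_mult)
    also have "\<dots> \<le> B + 1 * B" using * assms by (intro add_mono mult_mono) auto
    finally have "A + h \<le> (2 * B)\<^sup>2" unfolding Ah by (intro power_mono) auto
    then have 1: "A + h \<le> 4 * B\<^sup>2" by (simp add: power_mult_distrib)
    have A: "0 \<le> A" "A \<le> B\<^sup>2" using * by (auto simp: A_def intro: power_mono)
    have h: "\<bar>h\<bar> \<le> t * (3 * B\<^sup>2)"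
    proof -
      have "\<bar>Re (d * cnj z)\<bar> \<le> cmod d * cmod z"
        using abs_Re_le_cmod[of "d * cnj z"] by (simp add: norm_mult)
      also have "\<dots> \<le> B\<^sup>2" unfolding power2_eq_square using * assms by (intro mult_mono) auto
      finally have 1: "\<bar>Re (d * cnj z)\<bar> \<le> B\<^sup>2" .
      have "t * (cmod d)\<^sup>2 \<le> 1 * B\<^sup>2" using * by (intro mult_mono power_mono) auto
      then have "\<bar>2 * Re (d * cnj z) + t * (cmod d)\<^sup>2\<bar> \<le> 3 * B\<^sup>2"
      proof -
        have "0 \<le> t * (cmod d)\<^sup>2" using * by simp
        then show ?thesis using 1 \<open>t * (cmod d)\<^sup>2 \<le> 1 * B\<^sup>2\<close> by linarith
      qed
      then show ?thesis using * unfolding h_def abs_mult by (intro mult_mono) auto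
    qed
    have P: "cmod w ^ (2 * r) = ((cmod w)\<^sup>2) ^ r" for w by (simp add: power_mult)
    have "cmod (z + of_real t * d) ^ (2 * r) \<le> A ^ r + real r * A ^ (r - 1) * h + K * h\<^sup>2"
      unfolding P Ah[symmetric] using A 1 by (intro K(2)) (auto simp: Ah)
    also have "real r * A ^ (r - 1) * h = 2 * real r * t * (A ^ (r - 1) * Re (d * cnj z)) + (r * A ^ (r - 1) * (cmod d)\<^sup>2) * t\<^sup>2"
      by (simp add: h_def power2_eq_square algebra_simps)
    also have "A ^ (r - 1) * Re (d * cnj z) = Re (d * cnj (dual_pow r z))"
    proof -
      have "A ^ (r - 1) = cmod z ^ (2 * r - 2)"
        unfolding A_def power_mult[symmetric] by (simp add: right_diff_distrib')
      then show ?thesis by (simp add: dual_pow_def algebra_simps)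
    qed
    also have "(r * A ^ (r - 1) * (cmod d)\<^sup>2) * t\<^sup>2 \<le> r * (B\<^sup>2) ^ (r - 1) * B\<^sup>2 * t\<^sup>2"
      using A * by (intro mult_right_mono mult_mono power_mono) auto
    also have "K * h\<^sup>2 \<le> K * ((3 * B\<^sup>2)\<^sup>2 * t\<^sup>2)"
    proof -
      have "h\<^sup>2 \<le> (t * (3 * B\<^sup>2))\<^sup>2" using h by (metis power2_abs abs_ge_zero power_mono)
      then show ?thesis using K(1) by (intro mult_left_mono) (auto simp: power_mult_distrib mult_ac)
    qed
    finally show ?thesis unfolding K'_def P[of z] A_def distrib_right mult.assoc by linarith
  qed
  have "K' \<ge> 0" using K(1) by (simp add: K'_def)
  then show ?thesis using main by (intro exI[of _ K'] conjI allI impI)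
qed

lemma borel_measurable_cnj [measurable]: "cnj \<in> borel_measurable borel"
  by (intro borel_measurable_continuous_onI continuous_intros)

lemma (in finite_measure) integrable_bounded:
  fixes f :: "'a \<Rightarrow> 'b::{banach, second_countable_topology}"
  assumes "f \<in> borel_measurable M" "\<And>x. x \<in> space M \<Longrightarrow> norm (f x) \<le> B"
  shows "integrable M f"
  using assms by (intro integrable_const_bound[of _ B]) auto

lemma sum_mult_le_sqrt:
  fixes a b :: "nat \<Rightarrow> complex"
  shows "cmod (\<Sum>j<n. a j * b j) \<le> sqrt (\<Sum>j<n. (cmod (a j))\<^sup>2) * sqrt (\<Sum>j<n. (cmod (b j))\<^sup>2)"
proof -
  have "cmod (\<Sum>j<n. a j * b j) \<le> (\<Sum>j<n. \<bar>cmod (a j)\<bar> * \<bar>cmod (b j)\<bar>)"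
    using norm_sum[of "\<lambda>j. a j * b j" "{..<n}"] by (simp add: norm_mult)
  also have "\<dots> \<le> L2_set (\<lambda>j. cmod (a j)) {..<n} * L2_set (\<lambda>j. cmod (b j)) {..<n}"
    by (rule L2_set_mult_ineq)
  finally show ?thesis by (simp add: L2_set_def)
qed

text \<open>
  An orthonormal system whose squares add up to at most \<open>\<kappa>\<close> pointwise. By the addition theorem a basis of a block of harmonics is
  of this kind with \<open>\<kappa>\<close> equal to its dimension divided by the area of the sphere.
\<close>

locale bounded_orthonormal = finite_measure M for M :: "'a measure" +
  fixes u :: "nat \<Rightarrow> 'a \<Rightarrow> complex" and n :: nat and \<kappa> :: real
  assumes u_meas [measurable]: "\<And>j. u j \<in> borel_measurable M"
    and u_ortho: "\<And>i j. i < n \<Longrightarrow> j < n \<Longrightarrow> (\<integral>x. u i x * cnj (u j x) \<partial>M) = (if i = j then 1 else 0)"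
    and u_bound: "\<And>x. x \<in> space M \<Longrightarrow> (\<Sum>j<n. (cmod (u j x))\<^sup>2) \<le> \<kappa>"
    and kappa_pos: "\<kappa> > 0"
begin

definition lin :: "(nat \<Rightarrow> complex) \<Rightarrow> 'a \<Rightarrow> complex" where
  "lin c x = (\<Sum>j<n. c j * u j x)"

definition len :: "(nat \<Rightarrow> complex) \<Rightarrow> real" where
  "len c = sqrt (\<Sum>j<n. (cmod (c j))\<^sup>2)"

definition J :: "nat \<Rightarrow> ('a \<Rightarrow> complex) \<Rightarrow> real" where
  "J r e = (\<integral>x. cmod (e x) ^ (2 * r) \<partial>M)"

lemma lin_meas [measurable]: "lin c \<in> borel_measurable M"
  unfolding lin_def[abs_def] by measurable

lemma len_nonneg: "len c \<ge> 0"
  unfolding len_def by (intro real_sqrt_ge_zero sum_nonneg) auto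

lemma lin_bound: "x \<in> space M \<Longrightarrow> cmod (lin c x) \<le> len c * sqrt \<kappa>"
proof -
  assume "x \<in> space M"
  then have "sqrt (\<Sum>j<n. (cmod (u j x))\<^sup>2) \<le> sqrt \<kappa>" using u_bound by simp
  then show ?thesis
    using sum_mult_le_sqrt[of c "\<lambda>j. u j x" n] len_nonneg[of c] unfolding lin_def len_def
    by (meson mult_left_mono order_trans)
qed

lemma u_le: "x \<in> space M \<Longrightarrow> j < n \<Longrightarrow> cmod (u j x) \<le> sqrt \<kappa>"
proof -
  assume x: "x \<in> space M" "j < n"
  then have "(cmod (u j x))\<^sup>2 \<le> (\<Sum>j<n. (cmod (u j x))\<^sup>2)"
    by (intro member_le_sum) auto
  then have "(cmod (u j x))\<^sup>2 \<le> \<kappa>" using u_bound[OF x(1)] by linarith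
  then show ?thesis by (rule real_le_rsqrt)
qed

lemma dual_pow_meas [measurable]: "dual_pow r \<in> borel_measurable borel"
  unfolding dual_pow_def[abs_def] by measurable

lemma lin_pow_bound: "x \<in> space M \<Longrightarrow> cmod (lin c x) ^ k \<le> (len c * sqrt \<kappa>) ^ k"
  by (intro power_mono lin_bound) auto

lemma integrable_lin_pow: "integrable M (\<lambda>x. cmod (lin c x) ^ k)"
  by (rule integrable_bounded[of _ "(len c * sqrt \<kappa>) ^ k"]) (auto intro: lin_pow_bound)

lemma integrable_u_dual:
  assumes "j < n" "r > 0" shows "integrable M (\<lambda>x. u j x * cnj (dual_pow r (lin c x)))"
proof (rule integrable_bounded)
  fix x assume "x \<in> space M"
  then show "cmod (u j x * cnj (dual_pow r (lin c x))) \<le> sqrt \<kappa> * (len c * sqrt \<kappa>) ^ (2 * r - 1)"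
    using assms kappa_pos lin_pow_bound[of x c "2 * r - 1"] u_le[of x j]
    by (auto simp: norm_mult norm_dual_pow intro!: mult_mono)
qed measurable

lemma u_ortho_integrable: "i < n \<Longrightarrow> j < n \<Longrightarrow> integrable M (\<lambda>x. u i x * cnj (u j x))"
  using u_le kappa_pos
  by (intro integrable_bounded[of _ "sqrt \<kappa> * sqrt \<kappa>"]) (auto simp del: real_sqrt_mult_self simp: norm_mult intro!: mult_mono)

lemma integral_lin_square: "(\<integral>x. cmod (lin c x) ^ 2 \<partial>M) = (len c)\<^sup>2"
proof -
  have "complex_of_real (\<integral>x. cmod (lin c x) ^ 2 \<partial>M) = (\<integral>x. of_real (cmod (lin c x) ^ 2) \<partial>M)"
    by (rule integral_complex_of_real[symmetric])
  also have "\<dots> = (\<integral>x. (\<Sum>i<n. \<Sum>j<n. (c i * cnj (c j)) * (u i x * cnj (u j x))) \<partial>M)"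
    unfolding complex_norm_square lin_def cnj_sum sum_product complex_cnj_mult by (simp only: mult_ac)
  also have "\<dots> = (\<Sum>i<n. \<Sum>j<n. (c i * cnj (c j)) * (\<integral>x. u i x * cnj (u j x) \<partial>M))"
  proof -
    have I: "integrable M (\<lambda>x. (c i * cnj (c j)) * (u i x * cnj (u j x)))" if "i < n" "j < n" for i j
      by (intro integrable_mult_right u_ortho_integrable that)
    have "(\<integral>x. (\<Sum>i<n. \<Sum>j<n. (c i * cnj (c j)) * (u i x * cnj (u j x))) \<partial>M) =
        (\<Sum>i<n. \<integral>x. (\<Sum>j<n. (c i * cnj (c j)) * (u i x * cnj (u j x))) \<partial>M)"
      using I by (intro Bochner_Integration.integral_sum Bochner_Integration.integrable_sum) auto
    also have "\<dots> = (\<Sum>i<n. \<Sum>j<n. \<integral>x. (c i * cnj (c j)) * (u i x * cnj (u j x)) \<partial>M)"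
      using I by (intro sum.cong refl Bochner_Integration.integral_sum) auto
    finally show ?thesis by (simp only: integral_mult_right_zero)
  qed
  also have "\<dots> = (\<Sum>i<n. \<Sum>j<n. if i = j then c i * cnj (c j) else 0)"
    using u_ortho by (intro sum.cong) auto
  also have "\<dots> = (\<Sum>i<n. of_real ((cmod (c i))\<^sup>2))"
    by (simp add: complex_norm_square del: of_real_power)
  also have "\<dots> = of_real ((len c)\<^sup>2)"
    unfolding len_def by (simp add: sum_nonneg)
  finally show ?thesis by (simp only: of_real_eq_iff)
qed

lemma len_le_J: assumes "r > 0" shows "(len c)\<^sup>2 \<le> measure M (space M) + J r (lin c)"
proof -
  have "t\<^sup>2 \<le> 1 + t ^ (2 * r)" if "t \<ge> 0" for t :: real
  proof (cases "t \<le> 1")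
    case True
    then have "t\<^sup>2 \<le> 1" using that by (simp add: power_le_one)
    then show ?thesis using that by (simp add: add_increasing2)
  next
    case False
    then have "t ^ 2 \<le> t ^ (2 * r)" using assms by (intro power_increasing) auto
    then show ?thesis by linarith
  qed
  then have "(\<integral>x. cmod (lin c x) ^ 2 \<partial>M) \<le> (\<integral>x. 1 + cmod (lin c x) ^ (2 * r) \<partial>M)"
    by (intro integral_mono integrable_lin_pow Bochner_Integration.integrable_add) auto
  then show ?thesis
    unfolding integral_lin_square J_def by (subst (asm) Bochner_Integration.integral_add) (auto intro: integrable_lin_pow)
qed

lemma J_nonneg: "J r e \<ge> 0" unfolding J_def by simp

text \<open>
  The functionals \<open>\<lambda>d. pairing r d c\<close> with \<open>J r (lin c) \<le> 1\<close> play the role of the dual unit ball: they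
  are the norming functionals of the functions in the span.
\<close>

definition pairing :: "nat \<Rightarrow> (nat \<Rightarrow> complex) \<Rightarrow> (nat \<Rightarrow> complex) \<Rightarrow> complex" where
  "pairing r d c = (\<integral>x. lin d x * cnj (dual_pow r (lin c x)) \<partial>M)"

definition dual_coeff :: "nat \<Rightarrow> (nat \<Rightarrow> complex) \<Rightarrow> nat \<Rightarrow> complex" where
  "dual_coeff r c j = (\<integral>x. u j x * cnj (dual_pow r (lin c x)) \<partial>M)"

lemma pairing_eq: "r > 0 \<Longrightarrow> pairing r d c = (\<Sum>j<n. d j * dual_coeff r c j)"
  unfolding pairing_def dual_coeff_def lin_def[of d] sum_distrib_right mult.assoc
  by (subst Bochner_Integration.integral_sum) (auto intro!: integrable_u_dual)

lemma lin_combination: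
  "lin (\<lambda>j. \<alpha> * c j + \<beta> * d j) x = \<alpha> * lin c x + \<beta> * lin d x"
  by (simp add: lin_def sum_distrib_left sum.distrib algebra_simps)

lemma lin_scale: "lin (\<lambda>j. \<alpha> * c j) x = \<alpha> * lin c x"
  by (simp add: lin_def sum_distrib_left algebra_simps)

lemma pairing_self: "r > 0 \<Longrightarrow> pairing r c c = of_real (J r (lin c))"
  unfolding pairing_def J_def by (simp add: dual_pow_self del: of_real_power)

lemma pairing_scale_left: "r > 0 \<Longrightarrow> pairing r (\<lambda>j. \<alpha> * d j) c = \<alpha> * pairing r d c"
  by (simp add: pairing_eq sum_distrib_left mult_ac)

lemma pairing_diff_left: "r > 0 \<Longrightarrow> pairing r (\<lambda>j. d j - e j) c = pairing r d c - pairing r e c"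
  by (simp add: pairing_eq left_diff_distrib sum_subtractf)

lemma dual_coeff_scale:
  "dual_coeff r (\<lambda>j. \<alpha> * c j) j = of_real (cmod \<alpha> ^ (2 * r - 2)) * cnj \<alpha> * dual_coeff r c j"
  unfolding dual_coeff_def lin_scale dual_pow_mult
  by (subst integral_mult_right_zero[symmetric]) (simp add: mult_ac)

lemma J_scale: "J r (lin (\<lambda>j. \<alpha> * c j)) = cmod \<alpha> ^ (2 * r) * J r (lin c)"
  unfolding J_def lin_scale by (simp add: norm_mult power_mult_distrib)

lemma pairing_bound_unit:
  assumes "r > 0" "J r (lin c) \<le> 1" "j < n"
  shows "cmod (dual_coeff r c j) \<le> sqrt \<kappa> * (measure M (space M) + 1)"
proof -
  have pw: "t ^ (2 * r - 1) \<le> 1 + t ^ (2 * r)" if "t \<ge> 0" for t :: real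
  proof (cases "t \<le> 1")
    case True
    then have "t ^ (2 * r - 1) \<le> 1" using that by (simp add: power_le_one)
    then show ?thesis using that by (simp add: add_increasing2)
  next
    case False
    then have "t ^ (2 * r - 1) \<le> t ^ (2 * r)" by (intro power_increasing) auto
    then show ?thesis by linarith
  qed
  have "cmod (dual_coeff r c j) \<le> (\<integral>x. cmod (u j x * cnj (dual_pow r (lin c x))) \<partial>M)"
    unfolding dual_coeff_def by (rule integral_norm_bound)
  also have "\<dots> \<le> (\<integral>x. sqrt \<kappa> * (1 + cmod (lin c x) ^ (2 * r)) \<partial>M)"
  proof (intro integral_mono integrable_norm integrable_u_dual Bochner_Integration.integrable_add integrable_mult_right integrable_lin_pow assms)
    fix x assume x: "x \<in> space M"
    have "cmod (u j x) * cmod (lin c x) ^ (2 * r - 1) \<le> sqrt \<kappa> * (1 + cmod (lin c x) ^ (2 * r))"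
      using x assms kappa_pos by (intro mult_mono u_le pw) auto
    then show "cmod (u j x * cnj (dual_pow r (lin c x))) \<le> sqrt \<kappa> * (1 + cmod (lin c x) ^ (2 * r))"
      using assms(1) by (simp only: norm_mult complex_mod_cnj norm_dual_pow)
  qed auto
  also have "\<dots> = sqrt \<kappa> * (measure M (space M) + J r (lin c))"
    unfolding J_def by (simp, subst Bochner_Integration.integral_add) (auto intro: integrable_lin_pow)
  also have "\<dots> \<le> sqrt \<kappa> * (measure M (space M) + 1)"
    using assms kappa_pos by (intro mult_left_mono) auto
  finally show ?thesis .
qed

text \<open>
  The replacement for the duality theorem: if \<open>c0\<close> is far from the span of the \<open>w i\<close>, then there is
  a functional of nearly norming type which is almost zero on that span and large at \<open>c0\<close>. It comes from the first
  variation of \<open>J\<close> at a near-minimiser \<open>c\<close> of the distance; \<open>\<eta>\<close> measures how far \<open>c\<close> is from a minimiser.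
\<close>

lemma near_extremal:
  fixes w :: "nat \<Rightarrow> nat \<Rightarrow> complex" and m :: nat
  assumes r: "r > 0"
    and D: "\<And>b. D \<le> J r (lin (\<lambda>j. c0 j - (\<Sum>i<m. b i * w i j)))"
    and \<eta>: "\<eta> > 0"
  shows "\<exists>c. D \<le> J r (lin c) \<and> (\<forall>i<m. cmod (pairing r (w i) c) \<le> \<eta>) \<and>
           J r (lin c) \<le> Re (pairing r c0 c) + \<eta>"
proof -
  define V where "V b j = (\<Sum>i<m. b i * w i j)" for b j
  define I where "I = (INF b. J r (lin (\<lambda>j. c0 j - V b j)))"
  define \<mu> where "\<mu> = measure M (space M)"
  have \<mu>: "\<mu> \<ge> 0" by (simp add: \<mu>_def)
  have bdd: "bdd_below (range (\<lambda>b. J r (lin (\<lambda>j. c0 j - V b j))))"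
    using D unfolding V_def by (auto simp: bdd_below_def)
  have I_le: "I \<le> J r (lin (\<lambda>j. c0 j - V b j))" for b
    unfolding I_def by (intro cINF_lower bdd) auto
  have V_lin: "V (\<lambda>i. b i + \<alpha> * b' i) j = V b j + \<alpha> * V b' j" for b b' \<alpha> j
    by (simp add: V_def algebra_simps sum.distrib sum_distrib_left)
  define Be where "Be = sqrt (\<mu> + I + 1) * sqrt \<kappa>"
  define B where "B = Be + len c0 * sqrt \<kappa> + (\<Sum>i<m. len (w i) * sqrt \<kappa>)"
  have I0: "I \<ge> 0" unfolding I_def by (intro cINF_greatest) (auto simp: J_nonneg)
  have Be: "Be \<ge> 0" using kappa_pos I0 \<mu> by (simp add: Be_def)
  have nn: "len c * sqrt \<kappa> \<ge> 0" for c using kappa_pos len_nonneg by simp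
  have sn: "(\<Sum>i<m. len (w i) * sqrt \<kappa>) \<ge> 0" by (intro sum_nonneg nn)
  have B: "B \<ge> 0" "Be \<le> B" "Be + len c0 * sqrt \<kappa> \<le> B" "\<And>i. i < m \<Longrightarrow> len (w i) * sqrt \<kappa> \<le> B"
  proof -
    show "B \<ge> 0" "Be \<le> B" "Be + len c0 * sqrt \<kappa> \<le> B" using Be sn nn[of c0] by (auto simp: B_def)
    fix i assume "i < m"
    then have "len (w i) * sqrt \<kappa> \<le> (\<Sum>i<m. len (w i) * sqrt \<kappa>)"
      by (intro member_le_sum[of i "{..<m}" "\<lambda>i. len (w i) * sqrt \<kappa>"] nn) simp_all
    then show "len (w i) * sqrt \<kappa> \<le> B" using Be nn[of c0] by (simp add: B_def)
  qed
  from dual_pow_expansion[OF B(1) r] obtain K where K: "K \<ge> 0" and expand: "\<forall>z d (t::real). cmod z \<le> B \<longrightarrow> cmod d \<le> B \<longrightarrow> 0 \<le> t \<longrightarrow> t \<le> 1 \<longrightarrow>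
    cmod (z + of_real t * d) ^ (2 * r) \<le>
      cmod z ^ (2 * r) + 2 * real r * t * Re (d * cnj (dual_pow r z)) + K * t\<^sup>2"
    by (elim exE conjE) (rule that, assumption+)
  define t where "t = min 1 (\<eta> / 2 / (1 + K * \<mu>))"
  have K\<mu>: "1 + K * \<mu> > 0" using K \<mu> by (simp add: add_pos_nonneg)
  have t: "0 < t" "t \<le> 1" "(1 + K * \<mu>) * t \<le> \<eta> / 2"
  proof -
    show "0 < t" "t \<le> 1" using \<eta> K\<mu> by (auto simp: t_def)
    have "(1 + K * \<mu>) * t \<le> (1 + K * \<mu>) * (\<eta> / 2 / (1 + K * \<mu>))"
      using K\<mu> unfolding t_def by (intro mult_left_mono) auto
    also have "\<dots> = \<eta> / 2" using K\<mu> by (simp add: divide_simps)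
    finally show "(1 + K * \<mu>) * t \<le> \<eta> / 2" .
  qed
  have "\<exists>b. J r (lin (\<lambda>j. c0 j - V b j)) < I + t\<^sup>2"
    using cInf_lessD[of "range (\<lambda>b. J r (lin (\<lambda>j. c0 j - V b j)))" "I + t\<^sup>2"] t unfolding I_def by auto
  then obtain b where b: "J r (lin (\<lambda>j. c0 j - V b j)) < I + t\<^sup>2" by blast
  define c where "c j = c0 j - V b j" for j
  have Jc: "J r (lin c) < I + t\<^sup>2" using b by (simp add: c_def[abs_def])
  have "t\<^sup>2 \<le> 1" using t by (simp add: power_le_one)
  then have "(len c)\<^sup>2 \<le> \<mu> + I + 1" using len_le_J[OF r, of c] Jc by (simp add: \<mu>_def)
  then have "len c \<le> sqrt (\<mu> + I + 1)" by (rule real_le_rsqrt)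
  then have lc: "len c * sqrt \<kappa> \<le> Be" unfolding Be_def using kappa_pos by (intro mult_right_mono) auto
  have e_bound: "cmod (lin c x) \<le> Be" if "x \<in> space M" for x using lin_bound[OF that, of c] lc by linarith
  (* first variation of J at the near-minimiser in an admissible direction *)
  have var: "- (\<eta> / 2) \<le> Re (pairing r (\<lambda>j. \<alpha> * V b' j) c)"
    if dB: "\<And>x. x \<in> space M \<Longrightarrow> cmod (lin (\<lambda>j. \<alpha> * V b' j) x) \<le> B" for \<alpha> b'
  proof -
    define d where "d j = \<alpha> * V b' j" for j
    have dint: "integrable M (\<lambda>x. lin d x * cnj (dual_pow r (lin c x)))"
      unfolding lin_def[of d] sum_distrib_right mult.assoc
      using r by (intro Bochner_Integration.integrable_sum integrable_mult_right integrable_u_dual) auto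
    have eq: "lin (\<lambda>j. c0 j - V (\<lambda>i. b i + (- of_real t * \<alpha>) * b' i) j) x = lin c x + of_real t * lin d x" for x
      using lin_combination[of 1 c "of_real t" d x] unfolding V_lin by (simp add: c_def d_def algebra_simps)
    have "I \<le> J r (\<lambda>x. lin c x + of_real t * lin d x)"
      using I_le[of "\<lambda>i. b i + (- of_real t * \<alpha>) * b' i"] unfolding eq[abs_def] .
    also have "\<dots> \<le> (\<integral>x. cmod (lin c x) ^ (2 * r) + 2 * real r * t * Re (lin d x * cnj (dual_pow r (lin c x))) + K * t\<^sup>2 \<partial>M)"
      unfolding J_def
    proof (intro integral_mono)
      show "integrable M (\<lambda>x. cmod (lin c x + of_real t * lin d x) ^ (2 * r))"
        using integrable_lin_pow[of "\<lambda>j. 1 * c j + of_real t * d j" "2 * r"] unfolding lin_combination by simp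
      show "integrable M (\<lambda>x. cmod (lin c x) ^ (2 * r) + 2 * real r * t * Re (lin d x * cnj (dual_pow r (lin c x))) + K * t\<^sup>2)"
        using dint by (intro Bochner_Integration.integrable_add integrable_lin_pow integrable_mult_right integrable_Re) auto
      fix x assume x: "x \<in> space M"
      show "cmod (lin c x + of_real t * lin d x) ^ (2 * r) \<le>
         cmod (lin c x) ^ (2 * r) + 2 * real r * t * Re (lin d x * cnj (dual_pow r (lin c x))) + K * t\<^sup>2"
        using e_bound[OF x] dB[OF x] B t by (intro expand[rule_format]) (auto simp: d_def[abs_def])
    qed
    also have "\<dots> = J r (lin c) + 2 * real r * t * Re (pairing r d c) + K * \<mu> * t\<^sup>2"
    proof -
      have "(\<integral>x. cmod (lin c x) ^ (2 * r) + 2 * real r * t * Re (lin d x * cnj (dual_pow r (lin c x))) + K * t\<^sup>2 \<partial>M)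
        = (\<integral>x. cmod (lin c x) ^ (2 * r) + 2 * real r * t * Re (lin d x * cnj (dual_pow r (lin c x))) \<partial>M) + (\<integral>x. K * t\<^sup>2 \<partial>M)"
        using dint by (intro Bochner_Integration.integral_add Bochner_Integration.integrable_add integrable_lin_pow integrable_mult_right integrable_Re) auto
      also have "(\<integral>x. cmod (lin c x) ^ (2 * r) + 2 * real r * t * Re (lin d x * cnj (dual_pow r (lin c x))) \<partial>M)
        = (\<integral>x. cmod (lin c x) ^ (2 * r) \<partial>M) + (\<integral>x. 2 * real r * t * Re (lin d x * cnj (dual_pow r (lin c x))) \<partial>M)"
        using dint by (intro Bochner_Integration.integral_add integrable_lin_pow integrable_mult_right integrable_Re) auto
      also have "(\<integral>x. 2 * real r * t * Re (lin d x * cnj (dual_pow r (lin c x))) \<partial>M) = 2 * real r * t * Re (pairing r d c)"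
        unfolding pairing_def using integral_Re[OF dint] by simp
      finally show ?thesis by (simp add: J_def \<mu>_def)
    qed
    finally have "0 \<le> t\<^sup>2 + 2 * real r * t * Re (pairing r d c) + K * \<mu> * t\<^sup>2"
      using Jc by linarith
    then have "0 \<le> t * ((1 + K * \<mu>) * t + 2 * real r * Re (pairing r d c))"
      by (simp add: power2_eq_square algebra_simps)
    then have 0: "0 \<le> (1 + K * \<mu>) * t + 2 * real r * Re (pairing r d c)"
      using t(1) by (simp add: zero_le_mult_iff)
    have "- (\<eta> / 2) \<le> Re (pairing r d c)"
    proof (rule ccontr)
      assume "\<not> ?thesis"
      then have neg: "Re (pairing r d c) < - (\<eta> / 2)" by simp
      then have "Re (pairing r d c) < 0" using \<eta> by linarith
      then have "2 * real r * Re (pairing r d c) \<le> Re (pairing r d c)"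
        using r mult_right_mono_neg[of 1 "2 * real r" "Re (pairing r d c)"] by simp
      then show False using 0 neg t(3) by linarith
    qed
    then show ?thesis by (simp add: d_def[abs_def])
  qed
  have w: "cmod (pairing r (w i) c) \<le> \<eta>" if i: "i < m" for i
  proof -
    define b' where "b' k = (if k = i then 1 else 0 :: complex)" for k
    have V: "V b' = w i"
    proof
      fix j
      have "V b' j = (\<Sum>k<m. if k = i then w k j else 0)" unfolding V_def b'_def by (intro sum.cong) auto
      then show "V b' j = w i j" using i by simp
    qed
    have "- (\<eta> / 2) \<le> Re (\<alpha> * pairing r (w i) c)" if "cmod \<alpha> = 1" for \<alpha>
    proof -
      have "cmod (lin (\<lambda>j. \<alpha> * V b' j) x) \<le> B" if "x \<in> space M" for x
        unfolding lin_scale V using lin_bound[OF that, of "w i"] B(4)[OF i] \<open>cmod \<alpha> = 1\<close> by (simp add: norm_mult)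
      from var[OF this] show ?thesis using r by (simp add: pairing_scale_left V)
    qed
    from this[of 1] this[of "-1"] this[of \<i>] this[of "-\<i>"]
    have "\<bar>Re (pairing r (w i) c)\<bar> \<le> \<eta> / 2" "\<bar>Im (pairing r (w i) c)\<bar> \<le> \<eta> / 2" by auto
    then show ?thesis using cmod_le[of "pairing r (w i) c"] by linarith
  qed
  have "- (\<eta> / 2) \<le> Re (pairing r (\<lambda>j. 1 * V b j) c)"
  proof (rule var)
    fix x assume x: "x \<in> space M"
    have "lin (\<lambda>j. 1 * V b j) x = lin c0 x - lin c x"
      using lin_combination[of 1 c0 "-1" c x] by (simp add: c_def)
    then have "cmod (lin (\<lambda>j. 1 * V b j) x) \<le> cmod (lin c0 x) + cmod (lin c x)"
      by (simp add: norm_triangle_ineq4)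
    then show "cmod (lin (\<lambda>j. 1 * V b j) x) \<le> B"
      using e_bound[OF x] lin_bound[OF x, of c0] B(3) by linarith
  qed
  then have "- (\<eta> / 2) \<le> Re (pairing r c0 c) - Re (pairing r c c)"
    using pairing_diff_left[OF r, of c0 c c] by (simp add: c_def)
  then have "J r (lin c) \<le> Re (pairing r c0 c) + \<eta>"
    using \<eta> r by (simp add: pairing_self)
  moreover have "D \<le> J r (lin c)" using D[of b] by (simp add: c_def[abs_def] V_def)
  ultimately show ?thesis using w by (intro exI[of _ c] conjI allI impI)
qed

end

context bounded_orthonormal begin

definition row :: "(nat \<Rightarrow> real) \<Rightarrow> nat \<Rightarrow> complex" where
  "row a j = of_real (a j)"

text \<open>
  Hoelder's inequality in Young's form, with a free parameter \<open>\<tau>\<close> in place of the norm of \<open>lin d\<close>.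
\<close>

lemma pairing_le:
  assumes "r > 0" "\<tau> > 0" "J r (lin c) \<le> 1"
  shows "cmod (pairing r d c) \<le> \<tau> * (1 + J r (lin d) / \<tau> ^ (2 * r))"
proof -
  have pw: "x * y ^ (2 * r - 1) \<le> \<tau> * (y ^ (2 * r) + x ^ (2 * r) / \<tau> ^ (2 * r))"
    if "x \<ge> 0" "y \<ge> 0" for x y :: real
  proof -
    have P: "z ^ (2 * r) = z * z ^ (2 * r - 1)" for z :: real
      unfolding power_Suc[symmetric] using assms(1) by simp
    show ?thesis
    proof (cases "x \<le> \<tau> * y")
      case True
      then have "x * y ^ (2 * r - 1) \<le> (\<tau> * y) * y ^ (2 * r - 1)" using that by (intro mult_right_mono) auto
      also have "\<dots> = \<tau> * y ^ (2 * r)" by (simp add: P)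
      also have "\<dots> \<le> \<tau> * (y ^ (2 * r) + x ^ (2 * r) / \<tau> ^ (2 * r))"
        using that assms by (intro mult_left_mono) auto
      finally show ?thesis .
    next
      case False
      then have "y \<le> x / \<tau>" using assms by (simp add: field_simps)
      then have "x * y ^ (2 * r - 1) \<le> x * (x / \<tau>) ^ (2 * r - 1)"
        using that by (intro mult_left_mono power_mono) auto
      also have "\<dots> = \<tau> * (x / \<tau>) ^ (2 * r)" using assms by (simp add: P)
      also have "\<dots> \<le> \<tau> * (y ^ (2 * r) + x ^ (2 * r) / \<tau> ^ (2 * r))"
        using that assms by (intro mult_left_mono) (auto simp: power_divide)
      finally show ?thesis .
    qed
  qed
  have "cmod (pairing r d c) \<le> (\<integral>x. cmod (lin d x * cnj (dual_pow r (lin c x))) \<partial>M)"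
    unfolding pairing_def by (rule integral_norm_bound)
  also have "\<dots> \<le> (\<integral>x. \<tau> * (cmod (lin c x) ^ (2 * r) + cmod (lin d x) ^ (2 * r) / \<tau> ^ (2 * r)) \<partial>M)"
  proof (intro integral_mono integrable_norm)
    show "integrable M (\<lambda>x. lin d x * cnj (dual_pow r (lin c x)))"
      unfolding lin_def[of d] sum_distrib_right mult.assoc
      using assms by (intro Bochner_Integration.integrable_sum integrable_mult_right integrable_u_dual) auto
    show "integrable M (\<lambda>x. \<tau> * (cmod (lin c x) ^ (2 * r) + cmod (lin d x) ^ (2 * r) / \<tau> ^ (2 * r)))"
      by (intro integrable_mult_right Bochner_Integration.integrable_add integrable_divide integrable_lin_pow)
    show "cmod (lin d x * cnj (dual_pow r (lin c x))) \<le> \<tau> * (cmod (lin c x) ^ (2 * r) + cmod (lin d x) ^ (2 * r) / \<tau> ^ (2 * r))" for x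
      unfolding norm_mult complex_mod_cnj norm_dual_pow[OF assms(1)] by (intro pw) auto
  qed
  also have "\<dots> = \<tau> * (J r (lin c) + J r (lin d) / \<tau> ^ (2 * r))"
    unfolding J_def by (simp, subst Bochner_Integration.integral_add) (auto intro: integrable_lin_pow)
  also have "\<dots> \<le> \<tau> * (1 + J r (lin d) / \<tau> ^ (2 * r))"
    using assms by (intro mult_left_mono) auto
  finally show ?thesis .
qed

lemma rows_moment:
  assumes "m > 0" "r > 0" "x \<in> space M"
  shows "rad_rows n m (\<lambda>l. cmod (\<Sum>a\<leftarrow>l. lin (row a) x) ^ (2 * r)) \<le> (64 * (real r * real m * \<kappa>)) ^ r"
proof -
  define X where "X l = (\<Sum>a\<leftarrow>l. \<Sum>j<n. a j * Re (u j x))" for l :: "(nat \<Rightarrow> real) list"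
  define Y where "Y l = (\<Sum>a\<leftarrow>l. \<Sum>j<n. a j * Im (u j x))" for l :: "(nat \<Rightarrow> real) list"
  have XY: "(\<Sum>a\<leftarrow>l. lin (row a) x) = Complex (X l) (Y l)" for l
    unfolding X_def Y_def by (induction l) (auto simp: lin_def row_def complex_eq_iff)
  have le: "cmod (\<Sum>a\<leftarrow>l. lin (row a) x) ^ (2 * r) \<le> 2 ^ r * (X l ^ (2 * r) + Y l ^ (2 * r))" for l
  proof -
    have "cmod (\<Sum>a\<leftarrow>l. lin (row a) x) ^ (2 * r) = ((X l)\<^sup>2 + (Y l)\<^sup>2) ^ r"
      unfolding XY power_mult cmod_power2 by simp
    also have "\<dots> \<le> (2 * max ((X l)\<^sup>2) ((Y l)\<^sup>2)) ^ r"
      by (intro power_mono) (auto simp: max_def)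
    also have "\<dots> = 2 ^ r * (max ((X l)\<^sup>2) ((Y l)\<^sup>2)) ^ r" by (rule power_mult_distrib)
    also have "(max ((X l)\<^sup>2) ((Y l)\<^sup>2)) ^ r \<le> ((X l)\<^sup>2) ^ r + ((Y l)\<^sup>2) ^ r"
      by (auto simp: max_def)
    finally show ?thesis by (simp add: power_mult)
  qed
  have sq: "(\<Sum>j<n. (Re (u j x))\<^sup>2) \<le> \<kappa>" "(\<Sum>j<n. (Im (u j x))\<^sup>2) \<le> \<kappa>"
  proof -
    have "(\<Sum>j<n. (Re (u j x))\<^sup>2) \<le> (\<Sum>j<n. (cmod (u j x))\<^sup>2)" "(\<Sum>j<n. (Im (u j x))\<^sup>2) \<le> (\<Sum>j<n. (cmod (u j x))\<^sup>2)"
      by (auto intro!: sum_mono simp: cmod_power2)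
    then show "(\<Sum>j<n. (Re (u j x))\<^sup>2) \<le> \<kappa>" "(\<Sum>j<n. (Im (u j x))\<^sup>2) \<le> \<kappa>"
      using u_bound[OF assms(3)] by linarith+
  qed
  have "rad_rows n m (\<lambda>l. cmod (\<Sum>a\<leftarrow>l. lin (row a) x) ^ (2 * r))
      \<le> rad_rows n m (\<lambda>l. 2 ^ r * (X l ^ (2 * r) + Y l ^ (2 * r)))"
    by (intro rad_rows_mono le)
  also have "\<dots> \<le> 2 ^ r * (2 * (6 * (real r * real m * \<kappa>)) ^ r + 2 * (6 * (real r * real m * \<kappa>)) ^ r)"
    unfolding rad_rows_cmult rad_rows_add X_def Y_def
    using assms kappa_pos sq by (intro mult_left_mono add_mono rad_rows_even_moment) auto
  also have "\<dots> = 4 * (12 * (real r * real m * \<kappa>)) ^ r"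
  proof -
    have "(12 * x) ^ r = 2 ^ r * (6 * x) ^ r" for x :: real
      by (subst power_mult_distrib[symmetric]) simp
    moreover have "2 ^ r * (2 * P + 2 * P) = 4 * (2 ^ r * P)" for P :: real by (simp add: algebra_simps)
    ultimately show ?thesis by metis
  qed
  also have "\<dots> \<le> 4 ^ r * (12 * (real r * real m * \<kappa>)) ^ r"
    using assms kappa_pos power_increasing[of 1 r "4::real"] by (intro mult_right_mono) auto
  also have "\<dots> = (48 * (real r * real m * \<kappa>)) ^ r"
    by (subst power_mult_distrib[symmetric]) simp
  also have "\<dots> \<le> (64 * (real r * real m * \<kappa>)) ^ r"
    using assms kappa_pos by (intro power_mono mult_right_mono) auto
  finally show ?thesis .
qed

lemma lin_sum_list: "lin (\<lambda>j. \<Sum>a\<leftarrow>l. row a j) x = (\<Sum>a\<leftarrow>l. lin (row a) x)"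
  by (induction l) (auto simp: lin_def sum.distrib distrib_right)

text \<open>
  This is the random choice of the approximating space. Write \<open>f c a\<close> for the real part of the
  functional of \<open>c\<close> on the sign vector \<open>a\<close>. If \<open>f c\<close> is small on every row, then its mean absolute value
  \<open>E c\<close>, which by Khintchine's inequality controls the coefficients, is at most the deviation of the empirical mean.
  Symmetrization bounds the expected supremum of this deviation by the norm of the sum of the rows,
  for which \<open>\<tau>\<close> is a bound.
\<close>

lemma small_dual_coefficients:
  assumes m: "m > 0" and r: "r > 0" and \<tau>: "\<tau> > 0"
    and \<tau>J: "measure M (space M) * (64 * (real r * real m * \<kappa>)) ^ r \<le> \<tau> ^ (2 * r)"
  shows "\<exists>l\<in>sign_rows m. \<forall>c \<eta>. J r (lin c) \<le> 1 \<longrightarrow>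
    (\<forall>a\<in>set l. cmod (pairing r (row a) c) \<le> \<eta>) \<longrightarrow>
    sqrt (\<Sum>j<n. (cmod (dual_coeff r c j))\<^sup>2) \<le> 15 * \<tau> / m + 4 * \<eta>"
proof -
  define T where "T = {c. J r (lin c) \<le> 1}"
  define f where "f c a = Re (pairing r (row a) c)" for c a
  define B where "B = n * (sqrt \<kappa> * (measure M (space M) + 1))"
  have T0: "T \<noteq> {}"
  proof -
    have "J r (lin (\<lambda>_. 0)) = 0" using r by (simp add: J_def lin_def)
    then have "(\<lambda>_. 0) \<in> T" by (simp add: T_def)
    then show ?thesis by blast
  qed
  have f_eq: "f c a = (\<Sum>j<n. a j * Re (dual_coeff r c j))" for c a
    unfolding f_def pairing_eq[OF r] by (simp add: row_def)
  have fB: "\<bar>f c a\<bar> \<le> B" if c: "c \<in> T" and a: "\<And>i. \<bar>a i\<bar> \<le> 1" for c a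
  proof -
    have "\<bar>f c a\<bar> \<le> (\<Sum>j<n. \<bar>a j * Re (dual_coeff r c j)\<bar>)" unfolding f_eq by (rule sum_abs)
    also have "\<dots> \<le> (\<Sum>j<n. 1 * (sqrt \<kappa> * (measure M (space M) + 1)))"
      unfolding abs_mult
    proof (intro sum_mono mult_mono a)
      fix j assume "j \<in> {..<n}"
      then show "\<bar>Re (dual_coeff r c j)\<bar> \<le> sqrt \<kappa> * (measure M (space M) + 1)"
        using pairing_bound_unit[OF r, of c j] c abs_Re_le_cmod[of "dual_coeff r c j"] by (auto simp: T_def)
    qed auto
    finally show ?thesis by (simp add: B_def)
  qed
  define E where "E c = rad n (\<lambda>a. \<bar>f c a\<bar>)" for c
  have EB: "E c \<le> B" if "c \<in> T" for c
    unfolding E_def using rad_mono[of "\<lambda>a. \<bar>f c a\<bar>" "\<lambda>_. B" n] fB[OF that] by simp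
  have sym: "rad_rows n m (\<lambda>l. SUP c\<in>T. 0 + (\<Sum>a\<leftarrow>l. E c - \<bar>f c a\<bar>))
      \<le> rad_rows n m (\<lambda>l. SUP c\<in>T. 0 + (\<Sum>a\<leftarrow>l. 2 * f c a))"
    unfolding E_def by (rule rad_rows_symmetrization[OF T0 _ fB]) (auto simp: f_eq sum_negf)
  define S where "S l = lin (\<lambda>j. \<Sum>a\<leftarrow>l. row a j)" for l
  have "(SUP c\<in>T. 0 + (\<Sum>a\<leftarrow>l. 2 * f c a)) \<le> 2 * (\<tau> * (1 + J r (S l) / \<tau> ^ (2 * r)))" for l
  proof (intro cSUP_least T0)
    fix c assume c: "c \<in> T"
    have "(\<Sum>a\<leftarrow>l. 2 * f c a) = 2 * Re (pairing r (\<lambda>j. \<Sum>a\<leftarrow>l. row a j) c)"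
      unfolding f_def pairing_eq[OF r] by (induction l) (auto simp: sum.distrib distrib_right)
    also have "\<dots> \<le> 2 * cmod (pairing r (\<lambda>j. \<Sum>a\<leftarrow>l. row a j) c)" by (simp add: complex_Re_le_cmod)
    also have "\<dots> \<le> 2 * (\<tau> * (1 + J r (S l) / \<tau> ^ (2 * r)))"
      unfolding S_def using c by (intro mult_left_mono pairing_le r \<tau>) (auto simp: T_def)
    finally show "0 + (\<Sum>a\<leftarrow>l. 2 * f c a) \<le> 2 * (\<tau> * (1 + J r (S l) / \<tau> ^ (2 * r)))" by simp
  qed
  then have "rad_rows n m (\<lambda>l. SUP c\<in>T. 0 + (\<Sum>a\<leftarrow>l. 2 * f c a))
      \<le> rad_rows n m (\<lambda>l. 2 * (\<tau> * (1 + J r (S l) / \<tau> ^ (2 * r))))"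
    by (intro rad_rows_mono)
  also have "\<dots> = rad_rows n m (\<lambda>l. 2 * \<tau> + (2 * \<tau> / \<tau> ^ (2 * r)) * J r (S l))"
    by (rule arg_cong[where f = "rad_rows n m"]) (auto simp: algebra_simps)
  also have "\<dots> = 2 * \<tau> + (2 * \<tau> / \<tau> ^ (2 * r)) * rad_rows n m (\<lambda>l. J r (S l))"
    unfolding rad_rows_add rad_rows_cmult by simp
  also have "\<dots> \<le> 2 * \<tau> + (2 * \<tau> / \<tau> ^ (2 * r)) * \<tau> ^ (2 * r)"
  proof -
    have int: "integrable M (\<lambda>x. cmod (S l x) ^ (2 * r))" for l unfolding S_def by (rule integrable_lin_pow)
    have "rad_rows n m (\<lambda>l. J r (S l)) = (\<integral>x. rad_rows n m (\<lambda>l. cmod (S l x) ^ (2 * r)) \<partial>M)"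
      unfolding J_def using rad_rows_integral[OF int, of n m] by simp
    also have "\<dots> \<le> (\<integral>x. (64 * (real r * real m * \<kappa>)) ^ r \<partial>M)"
      using rad_rows_integral[OF int, of n m] rows_moment[OF m r] unfolding S_def lin_sum_list
      by (intro integral_mono) auto
    also have "\<dots> \<le> \<tau> ^ (2 * r)" using \<tau>J by simp
    finally show ?thesis using \<tau> by (intro add_left_mono mult_left_mono) auto
  qed
  also have "\<dots> = 4 * \<tau>" using \<tau> by simp
  finally have "rad_rows n m (\<lambda>l. SUP c\<in>T. 0 + (\<Sum>a\<leftarrow>l. E c - \<bar>f c a\<bar>)) \<le> 4 * \<tau>"
    using sym by linarith
  then obtain l where l: "l \<in> sign_rows m" and sup: "(SUP c\<in>T. 0 + (\<Sum>a\<leftarrow>l. E c - \<bar>f c a\<bar>)) \<le> 4 * \<tau>"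
    using rad_rows_attained[of m "\<lambda>l. SUP c\<in>T. 0 + (\<Sum>a\<leftarrow>l. E c - \<bar>f c a\<bar>)" n] by fastforce
  have len: "length l = m" using l by (simp add: sign_rows_def)
  have bdd: "bdd_above ((\<lambda>c. 0 + (\<Sum>a\<leftarrow>l. E c - \<bar>f c a\<bar>)) ` T)"
  proof -
    have "(\<Sum>a\<leftarrow>l. E c - \<bar>f c a\<bar>) \<le> (\<Sum>a\<leftarrow>l. B)" if "c \<in> T" for c
      using EB[OF that] by (intro sum_list_mono) (auto simp: diff_le_eq intro: add_increasing2)
    then show ?thesis by (auto simp: bdd_above_def)
  qed
  have re: "sqrt (\<Sum>j<n. (Re (dual_coeff r c j))\<^sup>2) \<le> 9/5 * (4 * \<tau> / m + \<eta>)"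
    if c: "J r (lin c) \<le> 1" and small: "\<forall>a\<in>set l. cmod (pairing r (row a) c) \<le> \<eta>" for c \<eta>
  proof -
    have "0 + (\<Sum>a\<leftarrow>l. E c - \<bar>f c a\<bar>) \<le> (SUP c\<in>T. 0 + (\<Sum>a\<leftarrow>l. E c - \<bar>f c a\<bar>))"
      using c by (intro cSUP_upper bdd) (auto simp: T_def)
    also note sup
    finally have 1: "(\<Sum>a\<leftarrow>l. E c - \<bar>f c a\<bar>) \<le> 4 * \<tau>" by simp
    have "(\<Sum>a\<leftarrow>l. E c - \<eta>) \<le> (\<Sum>a\<leftarrow>l. E c - \<bar>f c a\<bar>)"
    proof (rule sum_list_mono)
      fix a assume "a \<in> set l"
      then have "cmod (pairing r (row a) c) \<le> \<eta>" using small by blast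
      then show "E c - \<eta> \<le> E c - \<bar>f c a\<bar>"
        using abs_Re_le_cmod[of "pairing r (row a) c"] by (simp add: f_def)
    qed
    then have "m * (E c - \<eta>) \<le> 4 * \<tau>" using 1 len by (simp add: sum_list_triv)
    then have "E c \<le> 4 * \<tau> / m + \<eta>" using m by (simp add: field_simps)
    moreover have "5/9 * sqrt (\<Sum>j<n. (Re (dual_coeff r c j))\<^sup>2) \<le> E c"
      unfolding E_def f_eq by (rule rad_abs_lower)
    ultimately have "5/9 * sqrt (\<Sum>j<n. (Re (dual_coeff r c j))\<^sup>2) \<le> 4 * \<tau> / m + \<eta>"
      by (rule order_trans[rotated])
    then have "9/5 * (5/9 * sqrt (\<Sum>j<n. (Re (dual_coeff r c j))\<^sup>2)) \<le> 9/5 * (4 * \<tau> / m + \<eta>)"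
      by (rule mult_left_mono) simp
    then show ?thesis by simp
  qed
  have main: "sqrt (\<Sum>j<n. (cmod (dual_coeff r c j))\<^sup>2) \<le> 15 * \<tau> / m + 4 * \<eta>"
    if c: "J r (lin c) \<le> 1" and small: "\<forall>a\<in>set l. cmod (pairing r (row a) c) \<le> \<eta>" for c \<eta>
  proof -
    have \<eta>0: "\<eta> \<ge> 0"
    proof -
      obtain a where "a \<in> set l" using len m by (cases l) auto
      then show ?thesis using small norm_ge_zero order_trans by blast
    qed
    define A where "A = 9/5 * (4 * \<tau> / m + \<eta>)"
    have A: "A \<ge> 0" using \<tau> \<eta>0 by (simp add: A_def)
    have 1: "(\<Sum>j<n. (Re (dual_coeff r c j))\<^sup>2) \<le> A\<^sup>2"
      using re[OF c small] A unfolding A_def by (meson sqrt_le_D)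
    \<comment> \<open>Multiplying \<open>c\<close> by the imaginary unit turns imaginary parts of coefficients into real parts.\<close>
    have "sqrt (\<Sum>j<n. (Re (dual_coeff r (\<lambda>j. \<i> * c j) j))\<^sup>2) \<le> 9/5 * (4 * \<tau> / m + \<eta>)"
    proof (rule re)
      show "J r (lin (\<lambda>j. \<i> * c j)) \<le> 1" using c by (simp add: J_scale)
      have "cmod (pairing r d (\<lambda>j. \<i> * c j)) = cmod (pairing r d c)" for d
      proof -
        have "pairing r d (\<lambda>j. \<i> * c j) = - \<i> * pairing r d c"
          unfolding pairing_eq[OF r] dual_coeff_scale by (simp add: sum_distrib_left mult_ac sum_negf)
        then show ?thesis by (simp add: norm_mult)
      qed
      then show "\<forall>a\<in>set l. cmod (pairing r (row a) (\<lambda>j. \<i> * c j)) \<le> \<eta>" using small by simp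
    qed
    then have "sqrt (\<Sum>j<n. (Im (dual_coeff r c j))\<^sup>2) \<le> A"
      by (simp add: dual_coeff_scale A_def)
    then have 2: "(\<Sum>j<n. (Im (dual_coeff r c j))\<^sup>2) \<le> A\<^sup>2" using A by (meson sqrt_le_D)
    have "(\<Sum>j<n. (cmod (dual_coeff r c j))\<^sup>2) \<le> A\<^sup>2 + A\<^sup>2"
      using 1 2 by (simp add: cmod_power2 sum.distrib)
    also have "\<dots> \<le> (2 * A)\<^sup>2" by (simp add: power_mult_distrib)
    finally have "sqrt (\<Sum>j<n. (cmod (dual_coeff r c j))\<^sup>2) \<le> 2 * A"
      using A by (intro real_le_lsqrt) (auto simp: sum_nonneg)
    also have "2 * A = (72/5) * (\<tau> / m) + 18/5 * \<eta>" by (simp add: A_def)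
    also have "\<dots> \<le> 15 * (\<tau> / m) + 4 * \<eta>"
      using \<eta>0 \<tau> by (intro add_mono mult_right_mono) auto
    also have "\<dots> = 15 * \<tau> / m + 4 * \<eta>" by (simp only: times_divide_eq_right)
    finally show ?thesis .
  qed
  show ?thesis by (intro bexI[OF _ l] allI impI main)
qed

text \<open>
  If \<open>c0\<close> has distance more than \<open>\<delta> * len c0\<close> from the span of the random rows, the
  functional of \<open>near_extremal\<close> is almost zero on the rows, so its coefficients are small by \<open>small_dual_coefficients\<close>, and
  the Cauchy-Schwarz inequality contradicts its size at \<open>c0\<close>.
\<close>

theorem width_of_euclidean_ball:
  assumes m: "m > 0" and r: "r > 0"
  shows "\<exists>v :: nat \<Rightarrow> nat \<Rightarrow> complex. \<forall>c0. \<exists>b.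
    J r (lin (\<lambda>j. c0 j - (\<Sum>i<m. b i * v i j)))
      \<le> (128 * sqrt (r * \<kappa> / m) * max 1 (measure M (space M)) * len c0) ^ (2 * r)"
proof -
  define \<mu> where "\<mu> = max 1 (measure M (space M))"
  define \<tau> where "\<tau> = 8 * sqrt (real r * real m * \<kappa>) * \<mu>"
  have \<mu>: "\<mu> \<ge> 1" "measure M (space M) \<le> \<mu>" by (auto simp: \<mu>_def)
  have rmk: "real r * real m * \<kappa> > 0" using m r kappa_pos by simp
  have \<tau>: "\<tau> > 0" using rmk \<mu> by (simp add: \<tau>_def)
  have "measure M (space M) * (64 * (real r * real m * \<kappa>)) ^ r \<le> \<mu> ^ (2 * r) * (64 * (real r * real m * \<kappa>)) ^ r"
  proof -
    have "\<mu> ^ 1 \<le> \<mu> ^ (2 * r)" using \<mu> r by (intro power_increasing) auto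
    then have "measure M (space M) \<le> \<mu> ^ (2 * r)" using \<mu>(2) by simp
    then show ?thesis using rmk by (intro mult_right_mono) auto
  qed
  also have "\<dots> = \<tau> ^ (2 * r)"
  proof -
    have "(8 * sqrt (real r * real m * \<kappa>)) ^ 2 = 64 * (real r * real m * \<kappa>)" using rmk by (simp add: power_mult_distrib)
    then have "(8 * sqrt (real r * real m * \<kappa>)) ^ (2 * r) = (64 * (real r * real m * \<kappa>)) ^ r" by (simp add: power_mult)
    then show ?thesis unfolding \<tau>_def power_mult_distrib[of _ \<mu>] by simp
  qed
  finally obtain l where l: "l \<in> sign_rows m" and dual: "\<And>c \<eta>. J r (lin c) \<le> 1 \<Longrightarrow>
    (\<forall>a\<in>set l. cmod (pairing r (row a) c) \<le> \<eta>) \<Longrightarrow>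
    sqrt (\<Sum>j<n. (cmod (dual_coeff r c j))\<^sup>2) \<le> 15 * \<tau> / m + 4 * \<eta>"
    using small_dual_coefficients[OF m r \<tau>] by blast
  have len_l: "length l = m" using l by (simp add: sign_rows_def)
  define \<delta> where "\<delta> = 16 * \<tau> / m"
  have \<delta>: "\<delta> > 0" using \<tau> m by (simp add: \<delta>_def)
  have \<delta>_eq: "\<delta> = 128 * sqrt (r * \<kappa> / m) * \<mu>"
  proof -
    have "sqrt (real r * real m * \<kappa>) = sqrt ((r * \<kappa> / m) * (real m)\<^sup>2)"
      using m by (simp add: power2_eq_square)
    also have "\<dots> = sqrt (r * \<kappa> / m) * m"
      unfolding real_sqrt_mult by simp
    finally show ?thesis using m by (simp add: \<delta>_def \<tau>_def)
  qed
  have main: "\<exists>b. J r (lin (\<lambda>j. c0 j - (\<Sum>i<m. b i * row (l ! i) j))) \<le> (\<delta> * len c0) ^ (2 * r)" for c0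
  proof (rule ccontr)
    define \<nu> where "\<nu> = len c0"
    assume neg: "\<not> ?thesis"
    have \<nu>: "\<nu> > 0"
    proof (rule ccontr)
      assume "\<not> \<nu> > 0"
      then have 0: "len c0 = 0" using len_nonneg[of c0] by (simp add: \<nu>_def)
      have "c0 j = 0" if "j < n" for j
      proof -
        have "(\<Sum>j<n. (cmod (c0 j))\<^sup>2) = 0" using 0 by (simp add: len_def)
        then show ?thesis using that by (subst (asm) sum_nonneg_eq_0_iff) auto
      qed
      then have "J r (lin (\<lambda>j. c0 j - (\<Sum>i<m. 0 * row (l ! i) j))) = 0"
        using r by (simp add: J_def lin_def)
      then have "J r (lin (\<lambda>j. c0 j - (\<Sum>i<m. 0 * row (l ! i) j))) \<le> (\<delta> * len c0) ^ (2 * r)"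
        unfolding 0 by simp
      then show False using neg by (elim notE) (rule exI)
    qed
    define D where "D = (\<delta> * \<nu>) ^ (2 * r)"
    \<comment> \<open>The functional is normalised by \<open>G \<ge> (\<delta> * \<nu>) ^ (2 * r - 1)\<close>; all error terms together amount to
      \<open>(4 * \<nu> + 1) * \<eta>\<close>, and this choice makes them half of a lower bound for the gap between \<open>16\<close> and
      \<open>15\<close> times \<open>(\<tau> * \<nu> / m) * G\<close>.\<close>
    define \<eta> where "\<eta> = (\<tau> * \<nu> / m) * (\<delta> * \<nu>) ^ (2 * r - 1) / (2 * (4 * \<nu> + 1))"
    have \<eta>: "\<eta> > 0" using \<tau> \<nu> \<delta> m by (simp add: \<eta>_def)
    have "D \<le> J r (lin (\<lambda>j. c0 j - (\<Sum>i<m. b i * row (l ! i) j)))" for b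
      using neg unfolding D_def \<nu>_def by (meson linear)
    from near_extremal[OF r this \<eta>] obtain c where c: "D \<le> J r (lin c)"
      "\<And>i. i < m \<Longrightarrow> cmod (pairing r (row (l ! i)) c) \<le> \<eta>" "J r (lin c) \<le> Re (pairing r c0 c) + \<eta>"
      by blast
    define g where "g = root (2 * r) (J r (lin c))"
    have g: "g \<ge> 0" "g ^ (2 * r) = J r (lin c)" using r J_nonneg by (auto simp: g_def)
    have g_ge: "\<delta> * \<nu> \<le> g"
    proof (rule power_le_imp_le_base)
      show "(\<delta> * \<nu>) ^ Suc (2 * r - 1) \<le> g ^ Suc (2 * r - 1)" using c(1) r g(2) by (simp add: D_def)
    qed (use g in auto)
    have \<delta>\<nu>: "\<delta> * \<nu> > 0" using \<delta> \<nu> by simp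
    have g0: "g > 0" using g_ge \<delta>\<nu> by linarith
    define G where "G = g ^ (2 * r - 1)"
    have "G > 0" using g0 by (simp add: G_def)
    moreover have "g ^ (2 * r) = g * G" unfolding G_def power_Suc[symmetric] using r by simp
    ultimately have G: "G > 0" "g ^ (2 * r) = g * G" .
    have G_ge: "(\<delta> * \<nu>) ^ (2 * r - 1) \<le> G" unfolding G_def using g_ge \<delta>\<nu> by (intro power_mono) auto
    define c' where "c' j = of_real (1 / g) * c j" for j
    have coeff': "dual_coeff r c' j = of_real (1 / G) * dual_coeff r c j" for j
    proof -
      have "g ^ (2 * r - 2) * g = G" unfolding G_def using r by (cases r) auto
      then have "(1 / g) ^ (2 * r - 2) * (1 / g) = 1 / G" by (simp add: power_one_over field_simps)
      moreover have "cmod (complex_of_real (1 / g)) = 1 / g" using g0 by (simp add: norm_divide)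
      ultimately show ?thesis unfolding c'_def dual_coeff_scale
        by (metis complex_cnj_complex_of_real of_real_mult)
    qed
    have "sqrt (\<Sum>j<n. (cmod (dual_coeff r c' j))\<^sup>2) \<le> 15 * \<tau> / m + 4 * (\<eta> / G)"
    proof (rule dual)
      have "J r (lin c') = (1 / g) ^ (2 * r) * J r (lin c)"
        unfolding c'_def J_scale using g0 by (simp add: norm_divide)
      also have "\<dots> = 1" using g0 by (simp add: g(2)[symmetric] power_one_over)
      finally show "J r (lin c') \<le> 1" by simp
      have "pairing r d c' = of_real (1 / G) * pairing r d c" for d
        unfolding pairing_eq[OF r] coeff' by (simp add: sum_distrib_left mult_ac)
      then have "cmod (pairing r d c') = cmod (pairing r d c) / G" for d
        using G by (simp add: norm_mult norm_divide)
      then show "\<forall>a\<in>set l. cmod (pairing r (row a) c') \<le> \<eta> / G"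
        using c(2) G len_l by (auto simp: in_set_conv_nth intro!: divide_right_mono)
    qed
    moreover have "sqrt (\<Sum>j<n. (cmod (dual_coeff r c' j))\<^sup>2) = sqrt (\<Sum>j<n. (cmod (dual_coeff r c j))\<^sup>2) / G"
      unfolding coeff' using G
      by (simp add: norm_mult norm_divide power_divide sum_divide_distrib[symmetric] real_sqrt_divide)
    ultimately have s: "sqrt (\<Sum>j<n. (cmod (dual_coeff r c j))\<^sup>2) \<le> G * (15 * \<tau> / m) + 4 * \<eta>"
      using G by (simp add: field_simps)
    have "Re (pairing r c0 c) \<le> \<nu> * (G * (15 * \<tau> / m) + 4 * \<eta>)"
    proof -
      have "Re (pairing r c0 c) \<le> cmod (pairing r c0 c)" by (rule complex_Re_le_cmod)
      also have "\<dots> \<le> \<nu> * sqrt (\<Sum>j<n. (cmod (dual_coeff r c j))\<^sup>2)"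
        unfolding pairing_eq[OF r] \<nu>_def len_def by (rule sum_mult_le_sqrt)
      also have "\<dots> \<le> \<nu> * (G * (15 * \<tau> / m) + 4 * \<eta>)" using s \<nu> by (intro mult_left_mono) auto
      finally show ?thesis .
    qed
    then have "g * G \<le> \<nu> * (G * (15 * \<tau> / m) + 4 * \<eta>) + \<eta>"
      using c(3) g(2) G by simp
    moreover have "16 * (\<tau> * \<nu> / m) * G \<le> g * G"
      using g_ge G by (intro mult_right_mono) (auto simp: \<delta>_def)
    moreover define Q where "Q = (\<tau> * \<nu> / m) * G"
    moreover have "\<nu> * (G * (15 * \<tau> / m) + 4 * \<eta>) + \<eta> = 15 * Q + (4 * \<nu> + 1) * \<eta>"
      by (simp add: Q_def algebra_simps)
    ultimately have "(\<tau> * \<nu> / m) * G \<le> (4 * \<nu> + 1) * \<eta>" by simp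
    moreover have "(\<tau> * \<nu> / m) * (\<delta> * \<nu>) ^ (2 * r - 1) \<le> (\<tau> * \<nu> / m) * G"
      using G_ge \<tau> \<nu> by (intro mult_left_mono) auto
    moreover have "(\<tau> * \<nu> / m) * (\<delta> * \<nu>) ^ (2 * r - 1) = 2 * ((4 * \<nu> + 1) * \<eta>)"
    proof -
      have "2 * (4 * \<nu> + 1) > 0" using \<nu> by simp
      then have "2 * (4 * \<nu> + 1) \<noteq> 0" by (rule less_imp_neq[symmetric])
      then have "\<eta> * (2 * (4 * \<nu> + 1)) = (\<tau> * \<nu> / m) * (\<delta> * \<nu>) ^ (2 * r - 1)"
        unfolding \<eta>_def by (rule nonzero_eq_divide_eq[THEN iffD1, OF _ refl])
      then show ?thesis by (simp only: mult_ac)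
    qed
    moreover have "(4 * \<nu> + 1) * \<eta> > 0" using \<nu> \<eta> by simp
    ultimately show False by linarith
  qed
  show ?thesis
    by (rule exI[of _ "\<lambda>i. row (l ! i)"], rule allI) (rule main[unfolded \<delta>_eq \<mu>_def])
qed

end

section \<open>Lebesgue measure under translations, isometries and dilations\<close>

lemma nn_integral_lborel_translation:
  fixes f :: "'a::euclidean_space \<Rightarrow> ennreal"
  assumes [measurable]: "f \<in> borel_measurable borel"
  shows "(\<integral>\<^sup>+x. f (c + x) \<partial>lborel) = (\<integral>\<^sup>+x. f x \<partial>lborel)"
proof -
  have "(\<integral>\<^sup>+x. f x \<partial>lborel) = (\<integral>\<^sup>+x. f x \<partial>distr lborel borel ((+) c))"
    by (simp add: lborel_distr_plus)
  also have "\<dots> = (\<integral>\<^sup>+x. f (c + x) \<partial>lborel)" by (subst nn_integral_distr) auto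
  finally show ?thesis ..
qed

text \<open>
  Translation invariance and Fubini's theorem imply invariance under isometries: the double integral of \<open>indicator A (T x + y) * indicator B y\<close> for the
  unit ball \<open>B\<close> is evaluated in both orders, and \<open>B\<close> is invariant under \<open>T\<close>.
\<close>

lemma lborel_distr_linear_isometry:
  fixes T :: "'a::euclidean_space \<Rightarrow> 'a"
  assumes T: "linear T" "\<And>x. norm (T x) = norm x"
  shows "distr lborel borel T = lborel"
proof (rule measure_eqI)
  fix A :: "'a set" assume "A \<in> sets (distr lborel borel T)"
  then have A [measurable]: "A \<in> sets borel" by simp
  have cont: "continuous_on UNIV T" using T(1) by (rule linear_continuous_on[OF linear_conv_bounded_linear[THEN iffD1]])
  then have Tm [measurable]: "T \<in> borel \<rightarrow>\<^sub>M borel" by (rule borel_measurable_continuous_onI)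
  have inj: "inj T"
    using T by (metis linear_injective_0 norm_eq_zero)
  then have surj: "surj T" using T(1) by (simp add: linear_injective_imp_surjective)
  define B :: "'a set" where "B = ball 0 1"
  have B [measurable]: "B \<in> sets borel" by (simp add: B_def)
  have b: "emeasure lborel B \<noteq> 0" "emeasure lborel B \<noteq> \<infinity>"
  proof -
    show "emeasure lborel B \<noteq> \<infinity>" using emeasure_lborel_ball_finite[of 0 1] by (simp add: B_def less_top)
    have "measure lebesgue (ball (0::'a) 1) > 0" by (simp add: content_ball_pos)
    then show "emeasure lborel B \<noteq> 0" unfolding B_def measure_def by (auto simp: enn2real_positive_iff)
  qed
  define I where "I = (\<integral>\<^sup>+x. \<integral>\<^sup>+y. indicator A (T x + y) * indicator B y \<partial>lborel \<partial>lborel)"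
  have "I = (\<integral>\<^sup>+y. \<integral>\<^sup>+x. indicator A (T x + y) * indicator B y \<partial>lborel \<partial>lborel)"
    unfolding I_def by (rule lborel_pair.Fubini') measurable
  also have "\<dots> = (\<integral>\<^sup>+y. emeasure lborel (T -` A) * indicator B y \<partial>lborel)"
  proof (rule nn_integral_cong)
    fix y
    obtain y' where y': "y = T y'" using surj by blast
    have "(\<integral>\<^sup>+x. indicator A (T x + y) * indicator B y \<partial>lborel) = (\<integral>\<^sup>+x. indicator A (T (y' + x)) \<partial>lborel) * indicator B y"
      unfolding y' by (subst nn_integral_multc) (simp_all add: linear_add[OF T(1)] add.commute)
    also have "(\<integral>\<^sup>+x. indicator A (T (y' + x)) \<partial>lborel) = (\<integral>\<^sup>+x. indicator A (T x) \<partial>lborel)"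
      by (rule nn_integral_lborel_translation) measurable
    also have "\<dots> = (\<integral>\<^sup>+x. indicator (T -` A) x \<partial>lborel)"
      by (intro nn_integral_cong) (auto simp: indicator_def)
    also have "\<dots> = emeasure lborel (T -` A)"
      using measurable_sets[OF Tm A] by (simp add: nn_integral_indicator)
    finally show "(\<integral>\<^sup>+x. indicator A (T x + y) * indicator B y \<partial>lborel) = emeasure lborel (T -` A) * indicator B y" .
  qed
  also have "\<dots> = emeasure lborel (T -` A) * emeasure lborel B"
    by (simp add: nn_integral_cmult nn_integral_indicator)
  finally have 1: "I = emeasure lborel (T -` A) * emeasure lborel B" .
  have "I = (\<integral>\<^sup>+x. \<integral>\<^sup>+y. indicator A y * indicator B (y - T x) \<partial>lborel \<partial>lborel)"
    unfolding I_def
  proof (rule nn_integral_cong)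
    fix x
    show "(\<integral>\<^sup>+y. indicator A (T x + y) * indicator B y \<partial>lborel) = (\<integral>\<^sup>+y. indicator A y * indicator B (y - T x) \<partial>lborel)"
      using nn_integral_lborel_translation[of "\<lambda>y. indicator A y * indicator B (y - T x)" "T x"] by simp
  qed
  also have "\<dots> = (\<integral>\<^sup>+y. \<integral>\<^sup>+x. indicator A y * indicator B (y - T x) \<partial>lborel \<partial>lborel)"
    by (rule lborel_pair.Fubini') measurable
  also have "\<dots> = (\<integral>\<^sup>+y. indicator A y * emeasure lborel B \<partial>lborel)"
  proof (rule nn_integral_cong)
    fix y
    obtain y' where y': "y = T y'" using surj by blast
    have "(\<integral>\<^sup>+x. indicator A y * indicator B (y - T x) \<partial>lborel) = indicator A y * (\<integral>\<^sup>+x. indicator B (y - T x) \<partial>lborel)"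
      by (rule nn_integral_cmult) measurable
    also have "(\<integral>\<^sup>+x. indicator B (y - T x) \<partial>lborel) = (\<integral>\<^sup>+x. indicator B (- y' + x) \<partial>lborel)"
    proof (rule nn_integral_cong)
      fix x
      have "norm (y - T x) = norm (- y' + x)"
        unfolding y' using T(2)[of "y' - x"] by (simp add: linear_diff[OF T(1)] norm_minus_commute)
      then show "indicator B (y - T x) = (indicator B (- y' + x) :: ennreal)"
        by (simp add: B_def indicator_def)
    qed
    also have "\<dots> = (\<integral>\<^sup>+x. indicator B x \<partial>lborel)" by (rule nn_integral_lborel_translation) measurable
    finally show "(\<integral>\<^sup>+x. indicator A y * indicator B (y - T x) \<partial>lborel) = indicator A y * emeasure lborel B"
      by (simp add: nn_integral_indicator)
  qed
  also have "\<dots> = emeasure lborel A * emeasure lborel B"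
    by (simp add: nn_integral_multc nn_integral_indicator)
  finally have "emeasure lborel (T -` A) * emeasure lborel B = emeasure lborel A * emeasure lborel B"
    using 1 by simp
  then have "emeasure lborel (T -` A) = emeasure lborel A"
    using b ennreal_mult_cancel_left[of "emeasure lborel B"]
    by (simp add: mult.commute[of _ "emeasure lborel B"])
  then show "emeasure (distr lborel borel T) A = emeasure lborel A"
    by (simp add: emeasure_distr)
qed simp

lemma nn_integral_lborel_scaling:
  fixes f :: "'a::euclidean_space \<Rightarrow> ennreal"
  assumes [measurable]: "f \<in> borel_measurable borel" and t: "t > 0"
  shows "(\<integral>\<^sup>+x. f x \<partial>lborel) = ennreal (t ^ DIM('a)) * (\<integral>\<^sup>+x. f (t *\<^sub>R x) \<partial>lborel)"
proof -
  have "(\<integral>\<^sup>+x. f x \<partial>lborel) = (\<integral>\<^sup>+x. f x \<partial>density (distr lborel borel (\<lambda>x. 0 + t *\<^sub>R x)) (\<lambda>_. \<bar>t\<bar> ^ DIM('a)))"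
    using lborel_affine[of t "0::'a"] t by simp
  also have "\<dots> = ennreal (t ^ DIM('a)) * (\<integral>\<^sup>+x. f (t *\<^sub>R x) \<partial>lborel)"
    using t by (simp add: nn_integral_density nn_integral_distr nn_integral_cmult)
  finally show ?thesis .
qed

section \<open>Surface measure\<close>

lemma borel_measurable_indicator_punctured_ball [measurable]:
  "indicator (ball 0 t - {0}) \<in> borel_measurable (borel :: 'a::euclidean_space measure)"
  by (intro borel_measurable_indicator) auto

lemma space_surface_measure [simp]: "space \<sigma> = sphere 0 1"
  by (simp add: surface_measure_def space_scale_measure space_restrict_space)

lemma sets_surface_measure [measurable_cong]:
  "sets (\<sigma> :: (complex^'d::finite) measure) = sets (restrict_space borel (sphere 0 1))"
  by (simp add: surface_measure_def)

lemma borel_measurable_surface: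
  "f \<in> borel_measurable borel \<Longrightarrow> f \<in> borel_measurable (\<sigma> :: (complex^'d::finite) measure)"
  by (subst measurable_cong_sets[OF sets_surface_measure refl]) (rule measurable_restrict_space1)

lemma sets_surfaceI: "A \<in> sets borel \<Longrightarrow> A \<inter> sphere 0 1 \<in> sets (\<sigma> :: (complex^'d::finite) measure)"
  by (auto simp: sets_surface_measure sets_restrict_space)

definition radial_proj :: "complex^'d \<Rightarrow> complex^'d::finite" where
  "radial_proj x = x /\<^sub>R norm x"

lemma radial_proj_measurable [measurable]: "radial_proj \<in> borel_measurable borel"
  unfolding radial_proj_def[abs_def] by measurable

lemma norm_radial_proj: "x \<noteq> 0 \<Longrightarrow> norm (radial_proj x) = 1"
  by (simp add: radial_proj_def)

lemma radial_proj_scale: "t > 0 \<Longrightarrow> radial_proj (t *\<^sub>R x) = radial_proj x"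
  by (simp add: radial_proj_def)

lemma nn_integral_surface:
  fixes f :: "complex^'d::finite \<Rightarrow> ennreal"
  assumes [measurable]: "f \<in> borel_measurable borel"
  shows "(\<integral>\<^sup>+x. f x \<partial>\<sigma>) =
    of_nat DIM(complex^'d) * (\<integral>\<^sup>+x. f (radial_proj x) * indicator (ball 0 1 - {0}) x \<partial>lborel)"
proof -
  have m: "radial_proj \<in> restrict_space lborel (ball 0 1 - {0}) \<rightarrow>\<^sub>M restrict_space borel (sphere 0 1)"
    by (rule measurable_restrict_space2)
       (auto simp: norm_radial_proj space_restrict_space intro!: measurable_restrict_space1)
  have fm: "f \<in> borel_measurable (restrict_space borel (sphere 0 1))"
    by (rule measurable_restrict_space1) measurable
  have "(\<integral>\<^sup>+x. f x \<partial>\<sigma>) = of_nat DIM(complex^'d) *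
     (\<integral>\<^sup>+x. f x \<partial>distr (restrict_space lborel (ball 0 1 - {0})) (restrict_space borel (sphere 0 1)) radial_proj)"
    unfolding surface_measure_def radial_proj_def[abs_def, symmetric] by (rule nn_integral_scale_measure) (use fm in simp)
  also have "(\<integral>\<^sup>+x. f x \<partial>distr (restrict_space lborel (ball 0 1 - {0})) (restrict_space borel (sphere 0 1)) radial_proj)
     = (\<integral>\<^sup>+x. f (radial_proj x) * indicator (ball 0 1 - {0}) x \<partial>lborel)"
    by (subst nn_integral_distr[OF m]) (use fm in \<open>simp_all add: nn_integral_restrict_space\<close>)
  finally show ?thesis .
qed

lemma emeasure_surface:
  assumes [measurable]: "A \<in> sets borel"
  shows "emeasure \<sigma> (A \<inter> sphere 0 1 :: (complex^'d::finite) set) =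
    of_nat DIM(complex^'d) * (\<integral>\<^sup>+x. indicator A (radial_proj x) * indicator (ball 0 1 - {0}) x \<partial>lborel)"
proof -
  have "emeasure \<sigma> (A \<inter> sphere 0 1 :: (complex^'d) set) = (\<integral>\<^sup>+x. indicator (A \<inter> sphere 0 1) x \<partial>\<sigma>)"
    by (rule nn_integral_indicator[symmetric]) (rule sets_surfaceI, measurable)
  also have "\<dots> = (\<integral>\<^sup>+x. indicator A x \<partial>\<sigma>)"
    by (intro nn_integral_cong) (auto simp: indicator_def)
  finally show ?thesis by (simp add: nn_integral_surface)
qed

lemma emeasure_surface_finite: "emeasure (\<sigma> :: (complex^'d::finite) measure) (sphere 0 1) < \<infinity>"
proof -
  have "emeasure (\<sigma> :: (complex^'d) measure) (sphere 0 1)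
     = of_nat DIM(complex^'d) * (\<integral>\<^sup>+x. indicator (ball 0 1 - {0}) x \<partial>(lborel :: (complex^'d) measure))"
    using emeasure_surface[of "UNIV :: (complex^'d) set"] by simp
  also have "\<dots> \<le> of_nat DIM(complex^'d) * emeasure lborel (ball (0::complex^'d) 1)"
    by (intro mult_left_mono) (auto intro!: emeasure_mono simp: nn_integral_indicator)
  also have "\<dots> < \<infinity>"
    using emeasure_lborel_ball_finite[of "0::complex^'d" 1]
    by (auto simp: ennreal_mult_less_top of_nat_less_top)
  finally show ?thesis .
qed

interpretation surf: finite_measure "\<sigma> :: (complex^'d::finite) measure"
  by standard (use emeasure_surface_finite in \<open>simp add: less_top\<close>)

lemma emeasure_surface_open_pos:
  fixes U :: "(complex^'d::finite) set"
  assumes "open U" "U \<inter> sphere 0 1 \<noteq> {}"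
  shows "emeasure \<sigma> (U \<inter> sphere 0 1) > 0"
proof -
  obtain w where w: "w \<in> U" "norm w = 1" using assms by auto
  have "continuous_on (- {0}) (radial_proj :: complex^'d \<Rightarrow> _)"
    unfolding radial_proj_def[abs_def] by (intro continuous_intros) auto
  then have "open (radial_proj -` U \<inter> - {0})"
    using continuous_on_open_vimage[of "- {0}" radial_proj] assms(1) by (auto simp: open_Compl)
  then have O: "open ((radial_proj -` U \<inter> - {0}) \<inter> ball 0 1)" by (rule open_Int[OF _ open_ball])
  have "(1/2) *\<^sub>R w \<in> (radial_proj -` U \<inter> - {0}) \<inter> ball 0 1"
    using w by (auto simp: radial_proj_scale) (simp add: radial_proj_def)
  then have "\<not> negligible ((radial_proj -` U \<inter> - {0}) \<inter> ball 0 1)"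
    using O open_not_negligible by blast
  then have "(radial_proj -` U \<inter> - {0}) \<inter> ball 0 1 \<notin> null_sets lborel"
    by (auto simp: negligible_iff_null_sets intro: null_sets_completionI)
  then have pos: "emeasure lborel ((radial_proj -` U \<inter> - {0}) \<inter> ball 0 1) > 0"
    using O by (auto simp: null_sets_def zero_less_iff_neq_zero)
  have [measurable]: "U \<in> sets borel" using assms by simp
  have "(\<integral>\<^sup>+x. indicator U (radial_proj x) * indicator (ball 0 1 - {0}) x \<partial>lborel)
     = (\<integral>\<^sup>+x. indicator ((radial_proj -` U \<inter> - {0}) \<inter> ball 0 1) x \<partial>lborel)"
    by (intro nn_integral_cong) (auto simp: indicator_def)
  also have "\<dots> = emeasure lborel ((radial_proj -` U \<inter> - {0}) \<inter> ball 0 1)"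
    using O by (intro nn_integral_indicator) simp
  finally show ?thesis using pos by (simp add: emeasure_surface ennreal_zero_less_mult_iff of_nat_0 zero_less_iff_neq_zero)
qed

lemma surface_mass_pos: "measure (\<sigma> :: (complex^'d::finite) measure) (sphere 0 1) > 0"
proof -
  have "(sphere 0 1 :: (complex^'d) set) \<noteq> {}" by simp
  then have "emeasure (\<sigma> :: (complex^'d) measure) (sphere 0 1) > 0"
    using emeasure_surface_open_pos[of "UNIV :: (complex^'d) set"] by simp
  then show ?thesis using emeasure_surface_finite[where 'd = 'd]
    by (simp add: measure_def enn2real_positive_iff)
qed

text \<open>
  Projection to the sphere commutes with linear isometries, so the claim reduces to Lebesgue measure.
\<close>

lemma distr_surface_isometry:
  fixes T :: "complex^'d::finite \<Rightarrow> complex^'d"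
  assumes T: "linear T" "\<And>x. norm (T x) = norm x"
  shows "distr \<sigma> \<sigma> T = \<sigma>"
    and "T \<in> measurable \<sigma> \<sigma>"
proof -
  have cont: "continuous_on UNIV T" using T(1) by (rule linear_continuous_on[OF linear_conv_bounded_linear[THEN iffD1]])
  then have Tm [measurable]: "T \<in> borel \<rightarrow>\<^sub>M borel" by (rule borel_measurable_continuous_onI)
  have "T \<in> restrict_space borel (sphere 0 1) \<rightarrow>\<^sub>M restrict_space borel (sphere 0 1)"
    by (rule measurable_restrict_space2)
       (auto simp: T space_restrict_space intro!: measurable_restrict_space1)
  then show Ts: "T \<in> measurable \<sigma> \<sigma>"
    by (subst measurable_cong_sets[OF sets_surface_measure sets_surface_measure])
  have Tp: "T (radial_proj x) = radial_proj (T x)" for x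
    by (simp add: radial_proj_def linear_scale[OF T(1)] T(2))
  show "distr \<sigma> \<sigma> T = \<sigma>"
  proof (rule measure_eqI)
    fix X assume "X \<in> sets (distr \<sigma> \<sigma> T)"
    then have X: "X \<in> sets \<sigma>" by simp
    then obtain A where A[measurable]: "A \<in> sets borel" and XA: "X = A \<inter> sphere 0 1"
      by (auto simp: sets_surface_measure sets_restrict_space)
    have "T -` X \<inter> sphere 0 1 = (T -` A) \<inter> sphere 0 1" by (auto simp: XA T)
    moreover have [measurable]: "T -` A \<in> sets borel" using measurable_sets[OF Tm A] by simp
    ultimately have "emeasure (distr \<sigma> \<sigma> T) X =
        of_nat DIM(complex^'d) * (\<integral>\<^sup>+x. indicator (T -` A) (radial_proj x) * indicator (ball 0 1 - {0}) x \<partial>lborel)"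
      using emeasure_distr[OF Ts X] by (simp add: emeasure_surface)
    also have "(\<integral>\<^sup>+x. indicator (T -` A) (radial_proj x) * indicator (ball 0 1 - {0}) x \<partial>lborel)
       = (\<integral>\<^sup>+x. indicator A (radial_proj (T x)) * indicator (ball 0 1 - {0}) (T x) \<partial>lborel)"
    proof (rule nn_integral_cong)
      fix x
      have "T x = 0 \<longleftrightarrow> x = 0" using T(2)[of x] by (metis norm_eq_zero)
      then show "indicator (T -` A) (radial_proj x) * indicator (ball 0 1 - {0}) x
         = (indicator A (radial_proj (T x)) * indicator (ball 0 1 - {0}) (T x) :: ennreal)"
        by (simp add: indicator_def Tp T)
    qed
    also have "\<dots> = (\<integral>\<^sup>+x. indicator A (radial_proj x) * indicator (ball 0 1 - {0}) x \<partial>distr lborel borel T)"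
      by (rule nn_integral_distr[symmetric]) measurable
    also have "\<dots> = (\<integral>\<^sup>+x. indicator A (radial_proj x) * indicator (ball 0 1 - {0}) x \<partial>lborel)"
      by (simp add: lborel_distr_linear_isometry[OF T])
    finally show "emeasure (distr \<sigma> \<sigma> T) X = emeasure \<sigma> X"
      unfolding XA by (simp add: emeasure_surface)
  qed simp
qed

lemma integral_surface_isometry:
  fixes T :: "complex^'d::finite \<Rightarrow> complex^'d" and f :: "complex^'d \<Rightarrow> 'b::{banach, second_countable_topology}"
  assumes T: "linear T" "\<And>x. norm (T x) = norm x" and f: "f \<in> borel_measurable \<sigma>"
  shows "(\<integral>x. f (T x) \<partial>\<sigma>) = (\<integral>x. f x \<partial>\<sigma>)"
  using integral_distr[OF distr_surface_isometry(2)[OF T] f] by (simp add: distr_surface_isometry(1)[OF T])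

lemma radial_cone_scaling:
  fixes A :: "(complex^'d::finite) set"
  assumes [measurable]: "A \<in> sets borel" and t: "t > 0"
  shows "(\<integral>\<^sup>+x. indicator A (radial_proj x) * indicator (ball 0 t - {0}) x \<partial>lborel) =
    ennreal (t ^ DIM(complex^'d)) * (\<integral>\<^sup>+x. indicator A (radial_proj x) * indicator (ball 0 1 - {0}) x \<partial>lborel)"
proof -
  have "(\<integral>\<^sup>+x. indicator A (radial_proj x) * indicator (ball 0 t - {0}) x \<partial>lborel) =
    ennreal (t ^ DIM(complex^'d)) * (\<integral>\<^sup>+x. indicator A (radial_proj (t *\<^sub>R x)) * indicator (ball 0 t - {0}) (t *\<^sub>R x) \<partial>lborel)"
    by (rule nn_integral_lborel_scaling[OF _ t]) measurable
  also have "(\<integral>\<^sup>+x. indicator A (radial_proj (t *\<^sub>R x)) * indicator (ball 0 t - {0}) (t *\<^sub>R x) \<partial>lborel) =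
     (\<integral>\<^sup>+x. indicator A (radial_proj x) * indicator (ball 0 1 - {0}) x \<partial>lborel)"
    using t by (intro nn_integral_cong) (auto simp: radial_proj_scale indicator_def)
  finally show ?thesis .
qed

text \<open>
  Polar coordinates for a radial weight \<open>w\<close>. The distributions of the norm on the cone over \<open>A\<close>
  and on the whole space are proportional: they agree up to a factor on each \<open>{..<t}\<close> by scaling, and these
  sets generate the Borel sets.
\<close>

lemma polar_nn_integral:
  fixes A :: "(complex^'d::finite) set" and w :: "real \<Rightarrow> ennreal"
  assumes A [measurable]: "A \<in> sets borel" and w [measurable]: "w \<in> borel_measurable borel"
  shows "emeasure (\<sigma> :: (complex^'d) measure) (sphere 0 1) *
      (\<integral>\<^sup>+x. w (norm x) * (indicator A (radial_proj x) * indicator (- {0}) x) \<partial>lborel) =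
     emeasure \<sigma> (A \<inter> sphere 0 1) * (\<integral>\<^sup>+x. w (norm x) * indicator (- {0}) (x :: complex^'d) \<partial>lborel)"
proof -
  define \<nu> where "\<nu> C = distr (density lborel (\<lambda>x. indicator C (radial_proj x) * indicator (- {0}) x)) borel (norm :: complex^'d \<Rightarrow> real)" for C
  have lt: "emeasure (\<nu> C) {..<t} = (\<integral>\<^sup>+x. indicator C (radial_proj x) * indicator (ball 0 t - {0}) x \<partial>lborel)"
    if [measurable]: "C \<in> sets borel" for C t
  proof -
    have "emeasure (\<nu> C) {..<t} = emeasure (density lborel (\<lambda>x. indicator C (radial_proj x) * indicator (- {0}) x)) (norm -` {..<t} :: (complex^'d) set)"
      unfolding \<nu>_def by (subst emeasure_distr) auto
    moreover have b: "norm -` {..<t} = ball (0 :: complex^'d) t" by auto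
    ultimately have "emeasure (\<nu> C) {..<t} = emeasure (density lborel (\<lambda>x. indicator C (radial_proj x) * indicator (- {0}) x)) (ball (0 :: complex^'d) t)"
      by simp
    also have "\<dots> = (\<integral>\<^sup>+x. indicator C (radial_proj x) * indicator (- {0}) x * indicator (ball 0 t) x \<partial>lborel)"
      by (rule emeasure_density) measurable
    also have "\<dots> = (\<integral>\<^sup>+x. indicator C (radial_proj x) * indicator (ball 0 t - {0}) x \<partial>lborel)"
      by (intro nn_integral_cong) (auto simp: indicator_def)
    finally show ?thesis .
  qed
  define s where "s C = emeasure \<sigma> (C \<inter> sphere 0 1 :: (complex^'d) set)" for C
  have s_fin: "s C \<noteq> \<infinity>" if "C \<in> sets borel" for C
    using surf.emeasure_finite[of "C \<inter> sphere 0 1"] by (simp add: s_def)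
  have lt': "of_nat DIM(complex^'d) * emeasure (\<nu> C) {..<t} = (if t > 0 then ennreal (t ^ DIM(complex^'d)) else 0) * s C"
    if [measurable]: "C \<in> sets borel" for C t
  proof (cases "t > 0")
    case True
    then show ?thesis
      unfolding lt[OF that] radial_cone_scaling[OF that True] s_def emeasure_surface[OF that]
      by (simp only: if_True mult_ac)
  next
    case False
    then have e: "ball (0::complex^'d) t = {}" by auto
    show ?thesis unfolding lt[OF that] e using False by simp
  qed
  have borel_UNIV: "UNIV \<in> sets (borel :: (complex^'d) measure)" by simp
  have D: "of_nat DIM(complex^'d) \<noteq> (0::ennreal)" "of_nat DIM(complex^'d) \<noteq> (top::ennreal)"
    using ennreal_of_nat_neq_top[of "DIM(complex^'d)"] DIM_positive[where 'a = "complex^'d"] by (auto simp del: DIM_cart)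
  have "scale_measure (s UNIV) (\<nu> A) = scale_measure (s A) (\<nu> UNIV)"
  proof (rule measure_eqI_generator_eq)
    show "Int_stable (range lessThan :: real set set)"
    proof (rule Int_stableI)
      fix X Y :: "real set" assume "X \<in> range lessThan" "Y \<in> range lessThan"
      then obtain a b where "X = {..<a}" "Y = {..<b}" by auto
      then have "X \<inter> Y = {..<min a b}" by auto
      then show "X \<inter> Y \<in> range lessThan" by simp
    qed
    show "range lessThan \<subseteq> Pow (UNIV :: real set)" by auto
    show "sets (scale_measure (s UNIV) (\<nu> A)) = sigma_sets UNIV (range lessThan)"
      "sets (scale_measure (s A) (\<nu> UNIV)) = sigma_sets UNIV (range lessThan)"
      by (simp_all add: \<nu>_def borel_Iio)
    fix X :: "real set" assume "X \<in> range lessThan"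
    then obtain t where X: "X = {..<t}" by auto
    have "of_nat DIM(complex^'d) * (s UNIV * emeasure (\<nu> A) {..<t}) = of_nat DIM(complex^'d) * (s A * emeasure (\<nu> UNIV) {..<t})"
      unfolding mult.left_commute[of "of_nat DIM(complex^'d)" "s _"] lt'[OF A] lt'[OF borel_UNIV]
      by (simp only: mult_ac)
    then show "emeasure (scale_measure (s UNIV) (\<nu> A)) X = emeasure (scale_measure (s A) (\<nu> UNIV)) X"
      using D unfolding X by (subst (asm) ennreal_mult_cancel_left) auto
  next
    show "range (\<lambda>i. {..<real i}) \<subseteq> range lessThan" by auto
    show "(\<Union>i. {..<real i}) = UNIV" by (auto simp: reals_Archimedean2)
    fix i :: nat
    have "emeasure (\<nu> A) {..<real i} \<noteq> \<infinity>"
    proof -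
      have "emeasure (\<nu> A) {..<real i} \<le> (\<integral>\<^sup>+x. indicator (ball 0 (real i)) (x::complex^'d) \<partial>lborel)"
        unfolding lt[OF A] by (intro nn_integral_mono) (auto simp: indicator_def)
      also have "\<dots> < \<infinity>" using emeasure_lborel_ball_finite[of "0::complex^'d" "real i"] by (simp add: nn_integral_indicator)
      finally show ?thesis by simp
    qed
    then show "emeasure (scale_measure (s UNIV) (\<nu> A)) {..<real i} \<noteq> \<infinity>"
      using s_fin[of UNIV] by (simp add: ennreal_mult_eq_top_iff)
  qed
  then have "(\<integral>\<^sup>+t. w t \<partial>scale_measure (s UNIV) (\<nu> A)) = (\<integral>\<^sup>+t. w t \<partial>scale_measure (s A) (\<nu> UNIV))" by simp
  then have "s UNIV * (\<integral>\<^sup>+t. w t \<partial>\<nu> A) = s A * (\<integral>\<^sup>+t. w t \<partial>\<nu> UNIV)"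
    by (subst (asm) (1 2) nn_integral_scale_measure) (auto simp: \<nu>_def)
  moreover have "(\<integral>\<^sup>+t. w t \<partial>\<nu> C) = (\<integral>\<^sup>+x. w (norm x) * (indicator C (radial_proj x) * indicator (- {0}) x) \<partial>lborel)"
    if [measurable]: "C \<in> sets borel" for C
    unfolding \<nu>_def by (subst nn_integral_distr, simp, simp, subst nn_integral_density) (auto simp: mult.commute)
  ultimately show ?thesis by (simp add: s_def)
qed

text \<open>
  A radial weight converts volume integrals, for which partial integration is available, into
  surface integrals.
\<close>

lemma polar_integral:
  fixes G :: "'d::finite sfun" and w :: "real \<Rightarrow> real"
  assumes G [measurable]: "G \<in> borel_measurable borel"
    and w [measurable]: "w \<in> borel_measurable borel" and w0: "\<And>t. w t \<ge> 0"
    and wi: "integrable lborel (\<lambda>x::complex^'d. w (norm x))"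
  shows "(\<integral>x. w (norm x) *\<^sub>R G (radial_proj x) \<partial>lborel) =
    ((\<integral>x. w (norm (x::complex^'d)) \<partial>lborel) / measure (\<sigma> :: (complex^'d) measure) (sphere 0 1)) *\<^sub>R
     (\<integral>x. G x \<partial>\<sigma>)"
proof -
  define W where "W = (\<integral>x. w (norm (x::complex^'d)) \<partial>lborel)"
  define \<omega> where "\<omega> = measure (\<sigma> :: (complex^'d) measure) (sphere 0 1)"
  have \<omega>: "\<omega> > 0" by (simp add: \<omega>_def surface_mass_pos)
  have W0: "W \<ge> 0" unfolding W_def using w0 by simp
  have em: "emeasure (\<sigma> :: (complex^'d) measure) (sphere 0 1) = ennreal \<omega>"
    unfolding \<omega>_def by (simp add: surf.emeasure_eq_measure)
  have AE0: "AE x in lborel. (x::complex^'d) \<noteq> 0" by (rule AE_lborel_singleton)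
  have Wnn: "(\<integral>\<^sup>+x. ennreal (w (norm x)) * indicator (- {0}) (x :: complex^'d) \<partial>lborel) = ennreal W"
  proof -
    have "(\<integral>\<^sup>+x. ennreal (w (norm x)) * indicator (- {0}) (x :: complex^'d) \<partial>lborel) = (\<integral>\<^sup>+x. ennreal (w (norm (x::complex^'d))) \<partial>lborel)"
      by (rule nn_integral_cong_AE, use AE0 in eventually_elim) (simp add: indicator_def)
    also have "\<dots> = ennreal W" unfolding W_def using w0 by (intro nn_integral_eq_integral wi) auto
    finally show ?thesis .
  qed
  let ?S = "restrict_space borel (sphere 0 1) :: (complex^'d) measure"
  define \<mu> where "\<mu> = distr (density lborel (\<lambda>x::complex^'d. ennreal (w (norm x)))) borel radial_proj"
  define \<sigma>' where "\<sigma>' = distr (\<sigma> :: (complex^'d) measure) borel (\<lambda>x. x)"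
  have idm: "(\<lambda>x. x) \<in> (\<sigma> :: (complex^'d) measure) \<rightarrow>\<^sub>M borel" by (rule borel_measurable_surface) simp
  have "\<mu> = density \<sigma>' (\<lambda>_. ennreal (W / \<omega>))"
  proof (rule measure_eqI)
    fix A assume "A \<in> sets \<mu>"
    then have A [measurable]: "A \<in> sets borel" by (simp add: \<mu>_def)
    have "emeasure \<mu> A = (\<integral>\<^sup>+x. ennreal (w (norm x)) * indicator (radial_proj -` A) x \<partial>lborel)"
      unfolding \<mu>_def using measurable_sets[OF radial_proj_measurable A]
      by (subst emeasure_distr, simp, simp, subst emeasure_density) auto
    also have "\<dots> = (\<integral>\<^sup>+x. ennreal (w (norm x)) * (indicator A (radial_proj x) * indicator (- {0}) x) \<partial>lborel)"
      by (rule nn_integral_cong_AE, use AE0 in eventually_elim) (simp add: indicator_def)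
    finally have 1: "emeasure \<mu> A = \<dots>" .
    have "ennreal \<omega> * emeasure \<mu> A = emeasure \<sigma> (A \<inter> sphere 0 1) * ennreal W"
      unfolding 1 using polar_nn_integral[OF A, of "\<lambda>t. ennreal (w t)"] by (simp add: em Wnn)
    also have "emeasure \<sigma> (A \<inter> sphere 0 1) * ennreal W =
        ennreal \<omega> * (ennreal (W / \<omega>) * emeasure \<sigma> (A \<inter> sphere 0 1))"
    proof -
      have "ennreal W = ennreal \<omega> * ennreal (W / \<omega>)" using \<omega> W0 by (simp add: ennreal_mult[symmetric])
      then show ?thesis by (simp add: mult_ac)
    qed
    finally have "emeasure \<mu> A = ennreal (W / \<omega>) * emeasure \<sigma> (A \<inter> sphere 0 1)"
      using \<omega> by (simp add: ennreal_mult_cancel_left)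
    also have "\<dots> = emeasure (density \<sigma>' (\<lambda>_. ennreal (W / \<omega>))) A"
      unfolding \<sigma>'_def using A idm
      by (subst emeasure_density_const) (auto simp: emeasure_distr)
    finally show "emeasure \<mu> A = emeasure (density \<sigma>' (\<lambda>_. ennreal (W / \<omega>))) A" .
  qed (simp add: \<mu>_def \<sigma>'_def)
  then have "(\<integral>x. G x \<partial>\<mu>) = (\<integral>x. G x \<partial>density \<sigma>' (\<lambda>_. ennreal (W / \<omega>)))" by simp
  also have "(\<integral>x. G x \<partial>\<mu>) = (\<integral>x. w (norm x) *\<^sub>R G (radial_proj x) \<partial>lborel)"
    unfolding \<mu>_def using w0 by (subst integral_distr, simp, simp, subst integral_density) auto
  also have "(\<integral>x. G x \<partial>density \<sigma>' (\<lambda>_. ennreal (W / \<omega>))) = (\<integral>x. (W / \<omega>) *\<^sub>R G x \<partial>\<sigma>')"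
    using W0 \<omega> by (intro integral_density) (auto simp: \<sigma>'_def)
  also have "\<dots> = (W / \<omega>) *\<^sub>R (\<integral>x. G x \<partial>\<sigma>)"
    unfolding \<sigma>'_def using idm by (subst integral_distr) auto
  finally show ?thesis by (simp add: W_def \<omega>_def)
qed

section \<open>Integration by parts on the sphere\<close>

text \<open>
  Difference quotients have integral zero by translation invariance, and the bound \<open>K\<close> on the
  derivative dominates them.
\<close>

lemma integral_directional_derivative_zero:
  fixes \<Psi> :: "'a::euclidean_space \<Rightarrow> complex"
  assumes der: "\<And>x. (\<Psi> has_derivative D x) (at x)"
    and K: "\<And>x. norm (D x v) \<le> K"
    and R: "\<And>x. norm x \<ge> R \<Longrightarrow> \<Psi> x = 0"
  shows "(\<integral>x. D x v \<partial>lborel) = 0"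
proof -
  have K0: "K \<ge> 0" using K[of 0] norm_ge_zero order_trans by blast
  have cont: "continuous_on S \<Psi>" for S
    using der has_derivative_continuous continuous_at_imp_continuous_on by blast
  have [measurable]: "\<Psi> \<in> borel_measurable borel" by (intro borel_measurable_continuous_onI cont)
  have bound: "norm (\<Psi> (x + s *\<^sub>R v) - \<Psi> x) \<le> K * \<bar>s\<bar>" for x s
  proof -
    have "norm (\<Psi> (x + s *\<^sub>R v) - \<Psi> (x + 0 *\<^sub>R v)) \<le> K * norm (s - 0)"
    proof (rule differentiable_bound[of UNIV "\<lambda>t. \<Psi> (x + t *\<^sub>R v)" "\<lambda>t h. D (x + t *\<^sub>R v) (h *\<^sub>R v)"])
      fix t :: real
      have "((\<Psi> \<circ> (\<lambda>t. x + t *\<^sub>R v)) has_derivative (D (x + t *\<^sub>R v) \<circ> (\<lambda>h. h *\<^sub>R v))) (at t)"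
        by (rule diff_chain_at) (auto intro!: derivative_eq_intros der)
      then show "((\<lambda>t. \<Psi> (x + t *\<^sub>R v)) has_derivative (\<lambda>h. D (x + t *\<^sub>R v) (h *\<^sub>R v))) (at t within UNIV)"
        by (simp add: o_def)
      have "norm (D (x + t *\<^sub>R v) (h *\<^sub>R v)) \<le> K * norm h" for h
        using K[of "x + t *\<^sub>R v"] linear_scale[OF has_derivative_linear[OF der[of "x + t *\<^sub>R v"]], of h v]
        by (simp add: mult.commute[of K] mult_left_mono)
      then show "onorm (\<lambda>h. D (x + t *\<^sub>R v) (h *\<^sub>R v)) \<le> K" by (rule onorm_le)
    qed auto
    then show ?thesis by simp
  qed
  define q where "q i x = (\<Psi> (x + (1 / real (Suc i)) *\<^sub>R v) - \<Psi> x) /\<^sub>R (1 / real (Suc i))" for i x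
  have lim: "(\<lambda>i. q i x) \<longlonglongrightarrow> D x v" for x
  proof -
    have "((\<Psi> \<circ> (\<lambda>t. x + t *\<^sub>R v)) has_derivative (D (x + 0 *\<^sub>R v) \<circ> (\<lambda>h. h *\<^sub>R v))) (at 0)"
      by (rule diff_chain_at) (auto intro!: derivative_eq_intros der)
    then have "((\<lambda>t. \<Psi> (x + t *\<^sub>R v)) has_derivative (\<lambda>h. h *\<^sub>R D x v)) (at 0)"
      using linear_scale[OF has_derivative_linear[OF der[of x]]] by (simp add: o_def)
    then have L: "((\<lambda>h. norm (\<Psi> (x + h *\<^sub>R v) - \<Psi> x - h *\<^sub>R D x v) / norm h) \<longlongrightarrow> 0) (at 0)"
      by (simp add: has_derivative_at)
    have "((\<lambda>h. norm ((\<Psi> (x + h *\<^sub>R v) - \<Psi> x) /\<^sub>R h - D x v)) \<longlongrightarrow> 0) (at 0)"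
    proof (rule Lim_transform_eventually[OF L])
      have "norm (\<Psi> (x + h *\<^sub>R v) - \<Psi> x - h *\<^sub>R D x v) / norm h = norm ((\<Psi> (x + h *\<^sub>R v) - \<Psi> x) /\<^sub>R h - D x v)"
        if "h \<noteq> 0" for h
      proof -
        have "(\<Psi> (x + h *\<^sub>R v) - \<Psi> x) /\<^sub>R h - D x v = (\<Psi> (x + h *\<^sub>R v) - \<Psi> x - h *\<^sub>R D x v) /\<^sub>R h"
          using that by (simp add: scaleR_diff_right)
        then show ?thesis by (simp add: divide_inverse mult.commute)
      qed
      then show "\<forall>\<^sub>F h in at 0. norm (\<Psi> (x + h *\<^sub>R v) - \<Psi> x - h *\<^sub>R D x v) / norm h = norm ((\<Psi> (x + h *\<^sub>R v) - \<Psi> x) /\<^sub>R h - D x v)"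
        by (auto simp: eventually_at_filter)
    qed
    then have "((\<lambda>h. (\<Psi> (x + h *\<^sub>R v) - \<Psi> x) /\<^sub>R h - D x v) \<longlongrightarrow> 0) (at 0)"
      by (rule tendsto_norm_zero_cancel)
    then have "((\<lambda>h. (\<Psi> (x + h *\<^sub>R v) - \<Psi> x) /\<^sub>R h) \<longlongrightarrow> D x v) (at 0)"
      by (rule LIM_zero_cancel)
    moreover have "filterlim (\<lambda>i. 1 / real (Suc i)) (at 0) sequentially"
      by (intro filterlim_atI lim_1_over_n[THEN LIMSEQ_Suc]) auto
    ultimately show ?thesis unfolding q_def by (rule filterlim_compose)
  qed
  have q_meas [measurable]: "q i \<in> borel_measurable borel" for i unfolding q_def[abs_def] by measurable
  have "bounded (\<Psi> ` cball 0 (max R 0))"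
    by (intro compact_imp_bounded compact_continuous_image cont) auto
  then obtain B where "\<forall>y\<in>\<Psi> ` cball 0 (max R 0). norm y \<le> B" unfolding bounded_iff by blast
  then have B: "norm (\<Psi> x) \<le> B" if "x \<in> cball 0 (max R 0)" for x using that by blast
  have int: "integrable lborel \<Psi>"
  proof (rule Bochner_Integration.integrable_bound[of _ "\<lambda>x. B * indicator (cball 0 (max R 0)) x"])
    show "integrable lborel (\<lambda>x. B * indicator (cball (0::'a) (max R 0)) x)"
      using emeasure_lborel_cball_finite by (intro integrable_mult_right integrable_real_indicator) auto
    have "norm (\<Psi> x) \<le> norm (B * indicator (cball 0 (max R 0)) x :: real)" for x
      using B[of x] R[of x] by (cases "x \<in> cball 0 (max R 0)") auto
    then show "AE x in lborel. norm (\<Psi> x) \<le> norm (B * indicator (cball 0 (max R 0)) x :: real)" by simp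
  qed simp
  have trans: "integrable lborel (\<lambda>x. \<Psi> (x + c)) \<and> (\<integral>x. \<Psi> (x + c) \<partial>lborel) = (\<integral>x. \<Psi> x \<partial>lborel)" for c
  proof -
    have "(\<integral>x. \<Psi> x \<partial>lborel) = (\<integral>x. \<Psi> x \<partial>distr lborel borel ((+) c))" by (simp add: lborel_distr_plus)
    also have "\<dots> = (\<integral>x. \<Psi> (c + x) \<partial>lborel)" by (rule integral_distr) auto
    moreover have "integrable (distr lborel borel ((+) c)) \<Psi>" using int by (simp add: lborel_distr_plus)
    then have "integrable lborel (\<lambda>x. \<Psi> (c + x))" by (subst (asm) integrable_distr_eq) auto
    ultimately show ?thesis by (simp add: add.commute)
  qed
  have "(\<lambda>i. \<integral>x. q i x \<partial>lborel) \<longlonglongrightarrow> (\<integral>x. D x v \<partial>lborel)"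
  proof (rule integral_dominated_convergence[where w = "\<lambda>x. K * indicator (cball 0 (max R 0 + norm v)) x"])
    show "(\<lambda>x. D x v) \<in> borel_measurable lborel"
      by (rule borel_measurable_LIMSEQ_metric[of q]) (use lim in auto)
    show "integrable lborel (\<lambda>x. K * indicator (cball (0::'a) (max R 0 + norm v)) x)"
      using emeasure_lborel_cball_finite by (intro integrable_mult_right integrable_real_indicator) auto
    fix i
    have "norm (q i x) \<le> K * indicator (cball 0 (max R 0 + norm v)) x" for x
    proof (cases "x \<in> cball 0 (max R 0 + norm v)")
      case True
      have "norm (q i x) = norm (\<Psi> (x + (1 / real (Suc i)) *\<^sub>R v) - \<Psi> x) * real (Suc i)"
        by (simp add: q_def)
      also have "\<dots> \<le> K * \<bar>1 / real (Suc i)\<bar> * real (Suc i)"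
        by (intro mult_right_mono bound) auto
      finally show ?thesis using True by simp
    next
      case False
      then have x: "norm x > max R 0 + norm v" by simp
      have "norm ((1 / real (Suc i)) *\<^sub>R v) \<le> norm v"
        by (simp add: divide_le_eq mult_le_cancel_left1)
      then have "norm (x + (1 / real (Suc i)) *\<^sub>R v) \<ge> R"
        using x norm_triangle_ineq4[of "x + (1 / real (Suc i)) *\<^sub>R v" "(1 / real (Suc i)) *\<^sub>R v"] by simp
      then have "\<Psi> (x + (1 / real (Suc i)) *\<^sub>R v) = 0" by (rule R)
      moreover have "\<Psi> x = 0" using x norm_ge_zero[of v] by (intro R) linarith
      ultimately show ?thesis using False by (simp add: q_def)
    qed
    then show "AE x in lborel. norm (q i x) \<le> K * indicator (cball 0 (max R 0 + norm v)) x" by simp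
  qed (use lim in auto)
  moreover have "(\<integral>x. q i x \<partial>lborel) = 0" for i
  proof -
    have "(\<integral>x. q i x \<partial>lborel) = (1 / (1 / real (Suc i))) *\<^sub>R (\<integral>x. \<Psi> (x + (1 / real (Suc i)) *\<^sub>R v) - \<Psi> x \<partial>lborel)"
      unfolding q_def by simp
    also have "(\<integral>x. \<Psi> (x + (1 / real (Suc i)) *\<^sub>R v) - \<Psi> x \<partial>lborel) = 0"
      using trans[of "(1 / real (Suc i)) *\<^sub>R v"] int by (subst Bochner_Integration.integral_diff) auto
    finally show ?thesis by simp
  qed
  ultimately show ?thesis by (simp add: LIMSEQ_const_iff)
qed

section \<open>Monomials\<close>

lemma sum_fun_apply: "(\<Sum>i\<in>I. f i) x = (\<Sum>i\<in>I. f i x :: 'b::comm_monoid_add)"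
  by (induction I rule: infinite_finite_induct) (auto simp: zero_fun_def plus_fun_def)

definition monomial :: "('d \<Rightarrow> nat) \<Rightarrow> ('d \<Rightarrow> nat) \<Rightarrow> 'd::finite sfun" where
  "monomial a b z = (\<Prod>j\<in>UNIV. (z $ j) ^ a j) * (\<Prod>j\<in>UNIV. cnj (z $ j) ^ b j)"

lemma finite_multi_indices: "finite {a :: 'd::finite \<Rightarrow> nat. sum a UNIV = m}"
proof (rule finite_subset)
  show "{a :: 'd \<Rightarrow> nat. sum a UNIV = m} \<subseteq> (\<Pi>\<^sub>E j\<in>UNIV. {..m})"
  proof
    fix a :: "'d \<Rightarrow> nat" assume "a \<in> {a. sum a UNIV = m}"
    then have "a j \<le> m" for j using member_le_sum[of j UNIV a] by simp
    then show "a \<in> (\<Pi>\<^sub>E j\<in>UNIV. {..m})" by (auto simp: PiE_def)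
  qed
  show "finite (\<Pi>\<^sub>E j\<in>(UNIV :: 'd set). {..m})" by (intro finite_PiE) auto
qed

definition monomials :: "nat \<Rightarrow> nat \<Rightarrow> ('d::finite sfun) set" where
  "monomials m n = {monomial a b | a b. sum a UNIV = m \<and> sum b UNIV = n}"

lemma finite_monomials: "finite (monomials m n :: ('d::finite sfun) set)"
proof -
  have "monomials m n = (\<lambda>(a, b). monomial a b :: 'd sfun) ` ({a. sum a UNIV = m} \<times> {b. sum b UNIV = n})"
    by (auto simp: monomials_def)
  then show ?thesis by (simp add: finite_multi_indices)
qed

lemma bihomogeneous_polys_eq_span:
  "(bihomogeneous_polys m n :: ('d::finite sfun) set) = cfun.span (monomials m n)"
proof
  show "bihomogeneous_polys m n \<subseteq> cfun.span (monomials m n :: ('d sfun) set)"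
  proof
    fix P :: "'d sfun" assume "P \<in> bihomogeneous_polys m n"
    then obtain c where P: "P = (\<lambda>z. \<Sum>a\<in>{a. sum a UNIV = m}. \<Sum>b\<in>{b. sum b UNIV = n}.
       c a b * (\<Prod>j\<in>UNIV. (z $ j) ^ a j) * (\<Prod>j\<in>UNIV. cnj (z $ j) ^ b j))"
      unfolding bihomogeneous_polys_def by auto
    have "P = (\<Sum>a\<in>{a. sum a UNIV = m}. \<Sum>b\<in>{b. sum b UNIV = n}. (\<lambda>z. c a b * monomial a b z))"
      unfolding P by (auto simp: fun_eq_iff sum_fun_apply monomial_def mult.assoc)
    also have "\<dots> \<in> cfun.span (monomials m n)"
      by (intro cfun.span_sum cfun.span_scale cfun.span_base) (auto simp: monomials_def)
    finally show "P \<in> cfun.span (monomials m n)" .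
  qed
  show "cfun.span (monomials m n) \<subseteq> (bihomogeneous_polys m n :: ('d sfun) set)"
  proof (rule cfun.span_minimal)
    show "monomials m n \<subseteq> (bihomogeneous_polys m n :: ('d sfun) set)"
    proof
      fix P :: "'d sfun" assume "P \<in> monomials m n"
      then obtain a0 b0 where P: "P = monomial a0 b0" and ab: "sum a0 UNIV = m" "sum b0 UNIV = n"
        by (auto simp: monomials_def)
      have "P = (\<lambda>z. \<Sum>a\<in>{a. sum a UNIV = m}. \<Sum>b\<in>{b. sum b UNIV = n}.
         (if a = a0 then if b = b0 then 1 else 0 else 0) * (\<Prod>j\<in>UNIV. (z $ j) ^ a j) * (\<Prod>j\<in>UNIV. cnj (z $ j) ^ b j))"
      proof
        fix z :: "complex^'d"
        have "(\<Sum>a\<in>{a. sum a UNIV = m}. \<Sum>b\<in>{b. sum b UNIV = n}.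
           (if a = a0 then if b = b0 then 1 else 0 else 0) * (\<Prod>j\<in>UNIV. (z $ j) ^ a j) * (\<Prod>j\<in>UNIV. cnj (z $ j) ^ b j)) =
          (\<Sum>a\<in>{a. sum a UNIV = m}. if a = a0 then (\<Sum>b\<in>{b. sum b UNIV = n}. if b = b0 then monomial a b z else 0) else 0)"
          by (intro sum.cong refl) (auto intro!: sum.cong simp: monomial_def)
        also have "\<dots> = P z" using ab by (simp add: P finite_multi_indices)
        finally show "P z = (\<Sum>a\<in>{a. sum a UNIV = m}. \<Sum>b\<in>{b. sum b UNIV = n}.
           (if a = a0 then if b = b0 then 1 else 0 else 0) * (\<Prod>j\<in>UNIV. (z $ j) ^ a j) * (\<Prod>j\<in>UNIV. cnj (z $ j) ^ b j))" by simp
      qed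
      then show "P \<in> bihomogeneous_polys m n"
        unfolding bihomogeneous_polys_def by (intro CollectI) (rule exI)
    qed
    show "cfun.subspace (bihomogeneous_polys m n :: ('d sfun) set)"
    proof (rule cfun.subspaceI)
      show "0 \<in> (bihomogeneous_polys m n :: ('d sfun) set)"
        unfolding bihomogeneous_polys_def by (auto simp: zero_fun_def intro!: exI[of _ "\<lambda>_ _. 0"])
      fix f g :: "'d sfun" and k
      assume f: "f \<in> bihomogeneous_polys m n"
      then obtain c where c: "f = (\<lambda>z. \<Sum>a\<in>{a. sum a UNIV = m}. \<Sum>b\<in>{b. sum b UNIV = n}.
         c a b * (\<Prod>j\<in>UNIV. (z $ j) ^ a j) * (\<Prod>j\<in>UNIV. cnj (z $ j) ^ b j))"
        unfolding bihomogeneous_polys_def by auto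
      show "(\<lambda>x. k * f x) \<in> bihomogeneous_polys m n"
        unfolding bihomogeneous_polys_def c
        by (intro CollectI exI[of _ "\<lambda>a b. k * c a b"]) (simp add: sum_distrib_left mult.assoc)
      assume "g \<in> bihomogeneous_polys m n"
      then obtain d where d: "g = (\<lambda>z. \<Sum>a\<in>{a. sum a UNIV = m}. \<Sum>b\<in>{b. sum b UNIV = n}.
         d a b * (\<Prod>j\<in>UNIV. (z $ j) ^ a j) * (\<Prod>j\<in>UNIV. cnj (z $ j) ^ b j))"
        unfolding bihomogeneous_polys_def by auto
      show "f + g \<in> bihomogeneous_polys m n"
        unfolding bihomogeneous_polys_def c d
        by (intro CollectI exI[of _ "\<lambda>a b. c a b + d a b"]) (simp add: sum.distrib distrib_right plus_fun_def)
    qed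
  qed
qed

lemma bihom_monomial: "monomial a b \<in> bihomogeneous_polys (sum a UNIV) (sum b UNIV)"
  unfolding bihomogeneous_polys_eq_span by (intro cfun.span_base) (auto simp: monomials_def)

text \<open>
  The side conditions that the summands are themselves bihomogeneous are part of the hypotheses, since the derivative
  of a sum can only be split when both derivatives exist.
\<close>

lemma bihom_induct [consumes 1, case_names zero monomial add scale]:
  assumes "f \<in> bihomogeneous_polys m n"
    and "Q (\<lambda>_. 0)"
    and mon: "\<And>a b. sum a UNIV = m \<Longrightarrow> sum b UNIV = n \<Longrightarrow> Q (monomial a b)"
    and add: "\<And>f g. f \<in> bihomogeneous_polys m n \<Longrightarrow> g \<in> bihomogeneous_polys m n \<Longrightarrow> Q f \<Longrightarrow> Q g \<Longrightarrow> Q (\<lambda>z. f z + g z)"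
    and scale: "\<And>c f. f \<in> bihomogeneous_polys m n \<Longrightarrow> Q f \<Longrightarrow> Q (\<lambda>z. c * f z)"
  shows "Q f"
proof -
  have "f \<in> cfun.span (monomials m n)" using assms(1) by (simp add: bihomogeneous_polys_eq_span)
  then have "f \<in> bihomogeneous_polys m n \<and> Q f"
  proof (induction rule: cfun.span_induct_alt)
    case base
    then show ?case using assms(2) cfun.span_zero[of "monomials m n"]
      by (simp add: zero_fun_def bihomogeneous_polys_eq_span)
  next
    case (step c x y)
    have x: "x \<in> bihomogeneous_polys m n" "Q x"
      using step(1) mon by (auto simp: monomials_def bihom_monomial)
    have "(\<lambda>z. c * x z) \<in> bihomogeneous_polys m n"
      using x(1) unfolding bihomogeneous_polys_eq_span by (rule cfun.span_scale)
    moreover from this have "(\<lambda>z. c * x z) + y \<in> bihomogeneous_polys m n"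
      using step(2) unfolding bihomogeneous_polys_eq_span by (intro cfun.span_add) auto
    ultimately show ?case using add[of "\<lambda>z. c * x z" y] scale[OF x] step(2) by (simp add: plus_fun_def)
  qed
  then show ?thesis by simp
qed

lemma bihom_zero: "(\<lambda>_. 0) \<in> bihomogeneous_polys m n"
  using cfun.span_zero[of "monomials m n"] by (simp add: zero_fun_def bihomogeneous_polys_eq_span)

lemma bihom_add: "f \<in> bihomogeneous_polys m n \<Longrightarrow> g \<in> bihomogeneous_polys m n \<Longrightarrow> (\<lambda>z. f z + g z) \<in> bihomogeneous_polys m n"
  using cfun.span_add[of f "monomials m n" g] by (simp add: plus_fun_def bihomogeneous_polys_eq_span)

lemma bihom_scale: "f \<in> bihomogeneous_polys m n \<Longrightarrow> (\<lambda>z. c * f z) \<in> bihomogeneous_polys m n"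
  unfolding bihomogeneous_polys_eq_span by (rule cfun.span_scale)

lemma bihom_diff: "f \<in> bihomogeneous_polys m n \<Longrightarrow> g \<in> bihomogeneous_polys m n \<Longrightarrow> (\<lambda>z. f z - g z) \<in> bihomogeneous_polys m n"
  using bihom_add[OF _ bihom_scale[of g m n "-1"], of f] by simp

lemma bihom_sum: "(\<And>i. i \<in> I \<Longrightarrow> f i \<in> bihomogeneous_polys m n) \<Longrightarrow> (\<lambda>z. \<Sum>i\<in>I. f i z) \<in> bihomogeneous_polys m n"
proof (induction I rule: infinite_finite_induct)
  case (insert i I)
  then show ?case using bihom_add[of "f i" m n "\<lambda>z. \<Sum>i\<in>I. f i z"] by simp
qed (auto simp: bihom_zero)

lemma monomial_mult: "monomial a b z * monomial a' b' z = monomial (\<lambda>j. a j + a' j) (\<lambda>j. b j + b' j) z"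
  by (simp add: monomial_def power_add prod.distrib mult_ac)

lemma bihom_mult:
  assumes "f \<in> bihomogeneous_polys m n" "g \<in> bihomogeneous_polys k l"
  shows "(\<lambda>z. f z * g z) \<in> bihomogeneous_polys (m + k) (n + l)"
  using assms(1)
proof (induction rule: bihom_induct)
  case (monomial a b)
  show ?case using assms(2)
  proof (induction rule: bihom_induct)
    case (monomial a' b')
    then show ?case
      using bihom_monomial[of "\<lambda>j. a j + a' j" "\<lambda>j. b j + b' j"] \<open>sum a UNIV = m\<close> \<open>sum b UNIV = n\<close>
      by (simp add: monomial_mult sum.distrib)
  next
    case (add f g)
    then show ?case using bihom_add[OF add(3,4)] by (simp add: distrib_left)
  next
    case (scale c f)
    then show ?case using bihom_scale[OF scale(2), of c] by (simp add: mult_ac)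
  qed (simp add: bihom_zero)
next
  case (add f g)
  then show ?case using bihom_add[OF add(3,4)] by (simp add: distrib_right)
next
  case (scale c f)
  then show ?case using bihom_scale[OF scale(2), of c] by (simp add: mult_ac)
qed (simp add: bihom_zero)

lemma cnj_monomial: "cnj (monomial a b z) = monomial b a z"
  by (simp add: monomial_def mult.commute)

lemma bihom_cnj: "f \<in> bihomogeneous_polys m n \<Longrightarrow> (\<lambda>z. cnj (f z)) \<in> bihomogeneous_polys n m"
proof (induction rule: bihom_induct)
  case (monomial a b)
  then show ?case using bihom_monomial[of b a] by (simp add: cnj_monomial)
next
  case (add f g)
  then show ?case using bihom_add[OF add(3,4)] by simp
next
  case (scale c f)
  then show ?case using bihom_scale[OF scale(2), of "cnj c"] by simp
qed (simp add: bihom_zero)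

definition unit_index :: "'d \<Rightarrow> 'd \<Rightarrow> nat" where "unit_index j i = (if i = j then 1 else 0)"

lemma sum_unit_index [simp]: "sum (unit_index j) (UNIV :: 'd::finite set) = 1"
  by (simp add: unit_index_def[abs_def])

lemma monomial_unit: "monomial (unit_index j) (\<lambda>_. 0) z = z $ j"
proof -
  have "(\<Prod>i\<in>UNIV. (z $ i) ^ unit_index j i) = (\<Prod>i\<in>UNIV. if i = j then z $ j else 1)"
    by (intro prod.cong) (auto simp: unit_index_def)
  then show ?thesis by (simp add: monomial_def)
qed

lemma monomial_zero: "monomial (\<lambda>_. 0) (\<lambda>_. 0) z = 1"
  by (simp add: monomial_def)

lemma bihom_coord: "(\<lambda>z. z $ j) \<in> bihomogeneous_polys 1 0"
  using bihom_monomial[of "unit_index j" "\<lambda>_. 0"] by (simp add: monomial_unit[abs_def])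

lemma bihom_cnj_coord: "(\<lambda>z. cnj (z $ j)) \<in> bihomogeneous_polys 0 1"
  using bihom_cnj[OF bihom_coord] .

lemma bihom_const: "(\<lambda>_. c) \<in> bihomogeneous_polys 0 0"
  using bihom_scale[OF bihom_monomial[of "\<lambda>_. 0" "\<lambda>_. 0"], of c] by (simp add: monomial_zero)

lemma monomial_scaleR: "monomial a b (t *\<^sub>R z) = of_real (t ^ (sum a UNIV + sum b UNIV)) * monomial a b z"
proof -
  have "(\<Prod>j\<in>UNIV. ((t *\<^sub>R z) $ j) ^ a j) = of_real (t ^ sum a UNIV) * (\<Prod>j\<in>UNIV. (z $ j) ^ a j)" for a
    by (simp add: scaleR_conv_of_real[where 'a = complex] power_mult_distrib prod.distrib power_sum)
  moreover have "(\<Prod>j\<in>UNIV. cnj ((t *\<^sub>R z) $ j) ^ b j) = of_real (t ^ sum b UNIV) * (\<Prod>j\<in>UNIV. cnj (z $ j) ^ b j)" for b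
    by (simp add: scaleR_conv_of_real[where 'a = complex] power_mult_distrib prod.distrib power_sum)
  ultimately show ?thesis by (simp add: monomial_def power_add mult_ac)
qed

lemma bihom_scaleR:
  "f \<in> bihomogeneous_polys m n \<Longrightarrow> f (t *\<^sub>R z) = of_real (t ^ (m + n)) * f z"
proof (induction rule: bihom_induct)
  case (monomial a b)
  then show ?case by (simp add: monomial_scaleR)
qed (auto simp: algebra_simps)

lemma bihom_phase:
  assumes "cmod c = 1"
  shows "f \<in> bihomogeneous_polys m n \<Longrightarrow> f (\<chi> j. c * z $ j) = c ^ m * cnj c ^ n * f z"
proof (induction rule: bihom_induct)
  case (monomial a b)
  have "(\<Prod>j\<in>UNIV. (c * z $ j) ^ a j) = c ^ m * (\<Prod>j\<in>UNIV. (z $ j) ^ a j)"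
    by (simp add: power_mult_distrib prod.distrib power_sum[symmetric] monomial)
  moreover have "(\<Prod>j\<in>UNIV. (cnj c * cnj (z $ j)) ^ b j) = cnj c ^ n * (\<Prod>j\<in>UNIV. cnj (z $ j) ^ b j)"
    by (simp add: power_mult_distrib prod.distrib power_sum[symmetric] monomial)
  ultimately show ?case by (simp add: monomial_def mult_ac)
qed (auto simp: algebra_simps)

section \<open>Wirtinger derivatives of polynomials\<close>

text \<open>
  The derivative of \<open>f\<close> at \<open>z\<close> written in the form \<open>\<alpha> dz + \<beta> dzbar\<close>.
\<close>

definition has_wirtinger where
  "has_wirtinger f z \<alpha> \<beta> \<longleftrightarrow>
    (f has_derivative (\<lambda>h :: complex^'d::finite. \<Sum>j\<in>UNIV. \<alpha> j * h $ j + \<beta> j * cnj (h $ j) :: complex)) (at z)"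

lemma sum_axis:
  "(\<Sum>j\<in>UNIV. \<alpha> j * axis k c $ j + \<beta> j * cnj (axis k c $ j)) = \<alpha> k * c + \<beta> k * cnj (c :: complex)"
proof -
  have "(\<Sum>j\<in>UNIV. \<alpha> j * axis k c $ j + \<beta> j * cnj (axis k c $ j)) =
    (\<Sum>j\<in>UNIV. if j = k then \<alpha> k * c + \<beta> k * cnj c else 0)"
    by (intro sum.cong) (auto simp: axis_def)
  then show ?thesis by simp
qed

lemma has_wirtingerD:
  assumes "has_wirtinger f z \<alpha> \<beta>"
  shows "wirtinger_z j f z = \<alpha> j" "wirtinger_zbar j f z = \<beta> j"
proof -
  have "frechet_derivative f (at z) = (\<lambda>h. \<Sum>j\<in>UNIV. \<alpha> j * h $ j + \<beta> j * cnj (h $ j))"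
    using assms unfolding has_wirtinger_def by (rule frechet_derivative_at[symmetric])
  then show "wirtinger_z j f z = \<alpha> j" "wirtinger_zbar j f z = \<beta> j"
    by (simp_all add: wirtinger_z_def wirtinger_zbar_def sum_axis algebra_simps)
qed

lemma has_wirtinger_add:
  "has_wirtinger f z \<alpha> \<beta> \<Longrightarrow> has_wirtinger g z \<alpha>' \<beta>' \<Longrightarrow>
    has_wirtinger (\<lambda>z. f z + g z) z (\<lambda>j. \<alpha> j + \<alpha>' j) (\<lambda>j. \<beta> j + \<beta>' j)"
  unfolding has_wirtinger_def by (drule (1) has_derivative_add) (simp add: sum.distrib[symmetric] algebra_simps)

lemma has_wirtinger_mult:
  "has_wirtinger f z \<alpha> \<beta> \<Longrightarrow> has_wirtinger g z \<alpha>' \<beta>' \<Longrightarrow>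
    has_wirtinger (\<lambda>z. f z * g z) z (\<lambda>j. f z * \<alpha>' j + \<alpha> j * g z) (\<lambda>j. f z * \<beta>' j + \<beta> j * g z)"
  unfolding has_wirtinger_def
  by (drule (1) has_derivative_mult) (simp add: sum.distrib[symmetric] sum_distrib_left sum_distrib_right algebra_simps)

lemma has_wirtinger_const: "has_wirtinger (\<lambda>_. c) z (\<lambda>_. 0) (\<lambda>_. 0)"
  unfolding has_wirtinger_def by simp

lemma prod_power_lower:
  fixes w :: "'d::finite \<Rightarrow> complex"
  shows "(w k) ^ (a k - 1) * (\<Prod>j\<in>UNIV - {k}. (w j) ^ a j) = (\<Prod>j\<in>UNIV. (w j) ^ (a(k := a k - 1)) j)"
proof -
  have "(\<Prod>j\<in>UNIV. (w j) ^ (a(k := a k - 1)) j) = (w k) ^ (a k - 1) * (\<Prod>j\<in>UNIV - {k}. (w j) ^ (a(k := a k - 1)) j)"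
    by (subst prod.remove[of _ k]) auto
  also have "(\<Prod>j\<in>UNIV - {k}. (w j) ^ (a(k := a k - 1)) j) = (\<Prod>j\<in>UNIV - {k}. (w j) ^ a j)"
    by (intro prod.cong) auto
  finally show ?thesis ..
qed

lemma has_wirtinger_monomial:
  "has_wirtinger (monomial a b) z
     (\<lambda>j. of_nat (a j) * monomial (a(j := a j - 1)) b z) (\<lambda>j. of_nat (b j) * monomial a (b(j := b j - 1)) z)"
proof -
  define A where "A = (\<Prod>j\<in>UNIV. (z $ j) ^ a j)"
  define B where "B = (\<Prod>j\<in>UNIV. cnj (z $ j) ^ b j)"
  have dA: "((\<lambda>z. \<Prod>j\<in>UNIV. (z $ j) ^ a j) has_derivative
     (\<lambda>h. \<Sum>k\<in>UNIV. (of_nat (a k) * h $ k * (z $ k) ^ (a k - 1)) * (\<Prod>j\<in>UNIV - {k}. (z $ j) ^ a j))) (at z)"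
    by (rule has_derivative_prod)
       (auto intro!: derivative_eq_intros bounded_linear_vec_nth[THEN bounded_linear_imp_has_derivative])
  have dB: "((\<lambda>z. \<Prod>j\<in>UNIV. cnj (z $ j) ^ b j) has_derivative
     (\<lambda>h. \<Sum>k\<in>UNIV. (of_nat (b k) * cnj (h $ k) * cnj (z $ k) ^ (b k - 1)) * (\<Prod>j\<in>UNIV - {k}. cnj (z $ j) ^ b j))) (at z)"
    by (rule has_derivative_prod)
       (auto intro!: derivative_eq_intros bounded_linear_vec_nth[THEN bounded_linear_imp_has_derivative])
  have A': "(of_nat (a k) * h $ k * (z $ k) ^ (a k - 1)) * (\<Prod>j\<in>UNIV - {k}. (z $ j) ^ a j) =
     of_nat (a k) * h $ k * (\<Prod>j\<in>UNIV. (z $ j) ^ (a(k := a k - 1)) j)" for h :: "complex^'a" and k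
    by (simp only: mult.assoc prod_power_lower)
  have B': "(of_nat (b k) * cnj (h $ k) * cnj (z $ k) ^ (b k - 1)) * (\<Prod>j\<in>UNIV - {k}. cnj (z $ j) ^ b j) =
     of_nat (b k) * cnj (h $ k) * (\<Prod>j\<in>UNIV. cnj (z $ j) ^ (b(k := b k - 1)) j)" for h :: "complex^'a" and k
    by (simp only: mult.assoc prod_power_lower[of "\<lambda>j. cnj (z $ j)"])
  show ?thesis
    unfolding has_wirtinger_def monomial_def[abs_def]
  proof (rule has_derivative_eq_rhs[OF has_derivative_mult[OF dA dB]], rule ext)
    fix h :: "complex^'a"
    show "(\<Prod>j\<in>UNIV. (z $ j) ^ a j) * (\<Sum>k\<in>UNIV. (of_nat (b k) * cnj (h $ k) * cnj (z $ k) ^ (b k - 1)) * (\<Prod>j\<in>UNIV - {k}. cnj (z $ j) ^ b j))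
       + (\<Sum>k\<in>UNIV. (of_nat (a k) * h $ k * (z $ k) ^ (a k - 1)) * (\<Prod>j\<in>UNIV - {k}. (z $ j) ^ a j)) * (\<Prod>j\<in>UNIV. cnj (z $ j) ^ b j)
      = (\<Sum>j\<in>UNIV. of_nat (a j) * ((\<Prod>i\<in>UNIV. (z $ i) ^ (a(j := a j - 1)) i) * (\<Prod>i\<in>UNIV. cnj (z $ i) ^ b i)) * h $ j
          + of_nat (b j) * ((\<Prod>i\<in>UNIV. (z $ i) ^ a i) * (\<Prod>i\<in>UNIV. cnj (z $ i) ^ (b(j := b j - 1)) i)) * cnj (h $ j))"
      unfolding A' B' sum.distrib sum_distrib_left sum_distrib_right by (simp only: mult_ac add_ac)
  qed
qed

lemma bihom_has_wirtinger:
  assumes "f \<in> bihomogeneous_polys m n"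
  shows "has_wirtinger f z (\<lambda>j. wirtinger_z j f z) (\<lambda>j. wirtinger_zbar j f z)"
proof -
  have "\<exists>\<alpha> \<beta>. has_wirtinger f z \<alpha> \<beta>" using assms
  proof (induction rule: bihom_induct)
    case zero
    then show ?case using has_wirtinger_const by blast
  next
    case (monomial a b)
    then show ?case using has_wirtinger_monomial by blast
  next
    case (add f g)
    then show ?case using has_wirtinger_add by blast
  next
    case (scale c f)
    then show ?case using has_wirtinger_mult[OF has_wirtinger_const] by blast
  qed
  then obtain \<alpha> \<beta> where "has_wirtinger f z \<alpha> \<beta>" by blast
  moreover from has_wirtingerD[OF this] have "(\<lambda>j. wirtinger_z j f z) = \<alpha>" "(\<lambda>j. wirtinger_zbar j f z) = \<beta>" by auto
  ultimately show ?thesis by simp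
qed

lemma wirtinger_const [simp]: "wirtinger_z j (\<lambda>_. c) = (\<lambda>_. 0)" "wirtinger_zbar j (\<lambda>_. c) = (\<lambda>_. 0)"
  using has_wirtingerD[OF has_wirtinger_const] by (auto simp: fun_eq_iff)

lemma wirtinger_monomial:
  "wirtinger_z j (monomial a b) = (\<lambda>z. of_nat (a j) * monomial (a(j := a j - 1)) b z)"
  "wirtinger_zbar j (monomial a b) = (\<lambda>z. of_nat (b j) * monomial a (b(j := b j - 1)) z)"
  using has_wirtingerD[OF has_wirtinger_monomial] by (auto simp: fun_eq_iff)

lemma wirtinger_add:
  assumes "f \<in> bihomogeneous_polys m n" "g \<in> bihomogeneous_polys k l"
  shows "wirtinger_z j (\<lambda>z. f z + g z) = (\<lambda>z. wirtinger_z j f z + wirtinger_z j g z)"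
    "wirtinger_zbar j (\<lambda>z. f z + g z) = (\<lambda>z. wirtinger_zbar j f z + wirtinger_zbar j g z)"
  using has_wirtingerD[OF has_wirtinger_add[OF bihom_has_wirtinger[OF assms(1)] bihom_has_wirtinger[OF assms(2)]]] by auto

lemma wirtinger_scale:
  assumes "f \<in> bihomogeneous_polys m n"
  shows "wirtinger_z j (\<lambda>z. c * f z) = (\<lambda>z. c * wirtinger_z j f z)"
    "wirtinger_zbar j (\<lambda>z. c * f z) = (\<lambda>z. c * wirtinger_zbar j f z)"
  using has_wirtingerD[OF has_wirtinger_mult[OF has_wirtinger_const bihom_has_wirtinger[OF assms]]] by auto

lemma wirtinger_mult:
  assumes "f \<in> bihomogeneous_polys m n" "g \<in> bihomogeneous_polys k l"
  shows "wirtinger_z j (\<lambda>z. f z * g z) = (\<lambda>z. f z * wirtinger_z j g z + wirtinger_z j f z * g z)"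
    "wirtinger_zbar j (\<lambda>z. f z * g z) = (\<lambda>z. f z * wirtinger_zbar j g z + wirtinger_zbar j f z * g z)"
  using has_wirtingerD[OF has_wirtinger_mult[OF bihom_has_wirtinger[OF assms(1)] bihom_has_wirtinger[OF assms(2)]]] by auto

lemma sum_lower: "a j > 0 \<Longrightarrow> sum (a(j := a j - 1)) (UNIV :: 'd::finite set) = sum a UNIV - (1 :: nat)"
proof -
  assume "a j > 0"
  have "sum (a(j := a j - 1)) UNIV = (a j - 1) + sum (a(j := a j - 1)) (UNIV - {j})"
    by (subst sum.remove[of _ j]) auto
  also have "sum (a(j := a j - 1)) (UNIV - {j}) = sum a (UNIV - {j})" by (intro sum.cong) auto
  also have "sum a (UNIV - {j}) = sum a UNIV - a j" by (subst sum.remove[of UNIV j]) auto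
  moreover have "a j \<le> sum a UNIV" by (rule member_le_sum) auto
  ultimately show ?thesis using \<open>a j > 0\<close> by simp
qed

lemma wirtinger_z_bihom:
  assumes "f \<in> bihomogeneous_polys m n"
  shows "wirtinger_z j f \<in> bihomogeneous_polys (m - 1) n"
  using assms
proof (induction rule: bihom_induct)
  case (monomial a b)
  then show ?case
    using bihom_monomial[of "a(j := a j - 1)" b] sum_lower[of a j]
    by (cases "a j = 0") (auto simp: wirtinger_monomial bihom_zero intro!: bihom_scale)
next
  case (add f g)
  then show ?case by (simp add: wirtinger_add[OF add(1,2)] bihom_add)
next
  case (scale c f)
  then show ?case by (simp add: wirtinger_scale[OF scale(1)] bihom_scale)
qed (simp add: bihom_zero)

lemma wirtinger_zbar_bihom:
  assumes "f \<in> bihomogeneous_polys m n"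
  shows "wirtinger_zbar j f \<in> bihomogeneous_polys m (n - 1)"
  using assms
proof (induction rule: bihom_induct)
  case (monomial a b)
  then show ?case
    using bihom_monomial[of a "b(j := b j - 1)"] sum_lower[of b j]
    by (cases "b j = 0") (auto simp: wirtinger_monomial bihom_zero intro!: bihom_scale)
next
  case (add f g)
  then show ?case by (simp add: wirtinger_add[OF add(1,2)] bihom_add)
next
  case (scale c f)
  then show ?case by (simp add: wirtinger_scale[OF scale(1)] bihom_scale)
qed (simp add: bihom_zero)

lemma wirtinger_zbar_holomorphic:
  assumes "f \<in> bihomogeneous_polys m 0"
  shows "wirtinger_zbar j f = (\<lambda>_. 0)"
  using assms
proof (induction rule: bihom_induct)
  case (monomial a b)
  then show ?case by (simp add: wirtinger_monomial)
next
  case (add f g)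
  then show ?case by (simp add: wirtinger_add[OF add(1,2)])
next
  case (scale c f)
  then show ?case by (simp add: wirtinger_scale[OF scale(1)])
qed simp

lemma wirtinger_z_antiholomorphic:
  assumes "f \<in> bihomogeneous_polys 0 n"
  shows "wirtinger_z j f = (\<lambda>_. 0)"
  using assms
proof (induction rule: bihom_induct)
  case (monomial a b)
  then show ?case by (simp add: wirtinger_monomial)
next
  case (add f g)
  then show ?case by (simp add: wirtinger_add[OF add(1,2)])
next
  case (scale c f)
  then show ?case by (simp add: wirtinger_scale[OF scale(1)])
qed simp

lemma wirtinger_commute:
  assumes "f \<in> bihomogeneous_polys m n"
  shows "wirtinger_z i (wirtinger_z j f) = wirtinger_z j (wirtinger_z i f)"
    and "wirtinger_z i (wirtinger_zbar j f) = wirtinger_zbar j (wirtinger_z i f)"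
    and "wirtinger_zbar i (wirtinger_zbar j f) = wirtinger_zbar j (wirtinger_zbar i f)"
proof -
  have "wirtinger_z i (wirtinger_z j f) = wirtinger_z j (wirtinger_z i f) \<and>
    wirtinger_z i (wirtinger_zbar j f) = wirtinger_zbar j (wirtinger_z i f) \<and>
    wirtinger_zbar i (wirtinger_zbar j f) = wirtinger_zbar j (wirtinger_zbar i f)"
    using assms
  proof (induction rule: bihom_induct)
    case (monomial a b)
    note s = wirtinger_scale[OF bihom_monomial]
    have tw: "c(i := p, j := q) = c(j := q, i := p)" if "i \<noteq> j" for c :: "'a \<Rightarrow> nat" and p q
      by (rule fun_upd_twist[OF that])
    show ?case
    proof (cases "i = j")
      case True
      then show ?thesis by (simp add: wirtinger_monomial s mult.left_commute)
    next
      case False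
      then show ?thesis by (simp add: wirtinger_monomial s tw[OF False] mult.left_commute)
    qed
  next
    case (add f g)
    note z = wirtinger_z_bihom[OF add(1)] wirtinger_z_bihom[OF add(2)]
    note zb = wirtinger_zbar_bihom[OF add(1)] wirtinger_zbar_bihom[OF add(2)]
    show ?case
      unfolding wirtinger_add[OF add(1,2)] wirtinger_add[OF z(1) z(2)] wirtinger_add[OF zb(1) zb(2)]
      using add(3,4) by simp
  next
    case (scale c f)
    show ?case
      unfolding wirtinger_scale[OF scale(1)] wirtinger_scale[OF wirtinger_z_bihom[OF scale(1)]]
          wirtinger_scale[OF wirtinger_zbar_bihom[OF scale(1)]]
      using scale(2) by simp
  qed simp
  then show "wirtinger_z i (wirtinger_z j f) = wirtinger_z j (wirtinger_z i f)"
    and "wirtinger_z i (wirtinger_zbar j f) = wirtinger_zbar j (wirtinger_z i f)"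
    and "wirtinger_zbar i (wirtinger_zbar j f) = wirtinger_zbar j (wirtinger_zbar i f)" by auto
qed

text \<open>
  Sums of polynomials of a fixed bidegree can be differentiated term by term.
\<close>

lemma bihom_sum': "(\<And>i. i \<in> I \<Longrightarrow> f i \<in> bihomogeneous_polys m n) \<Longrightarrow> finite I \<Longrightarrow>
   wirtinger_z j (\<lambda>z. \<Sum>i\<in>I. f i z) = (\<lambda>z. \<Sum>i\<in>I. wirtinger_z j (f i) z) \<and>
   wirtinger_zbar j (\<lambda>z. \<Sum>i\<in>I. f i z) = (\<lambda>z. \<Sum>i\<in>I. wirtinger_zbar j (f i) z)"
proof (rotate_tac, induction I rule: finite_induct)
  case (insert i I)
  have "f i \<in> bihomogeneous_polys m n" "(\<lambda>z. \<Sum>i\<in>I. f i z) \<in> bihomogeneous_polys m n"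
    using insert by (auto intro: bihom_sum)
  from wirtinger_add[OF this] show ?case using insert by simp
qed auto

lemma complex_laplacian_eq: "complex_laplacian f = (\<lambda>z. 4 * (\<Sum>k\<in>UNIV. wirtinger_z k (wirtinger_zbar k f) z))"
  by (simp add: complex_laplacian_def fun_eq_iff)

lemma laplacian_bihom:
  assumes "f \<in> bihomogeneous_polys m n"
  shows "complex_laplacian f \<in> bihomogeneous_polys (m - 1) (n - 1)"
  unfolding complex_laplacian_eq
  by (intro bihom_scale bihom_sum wirtinger_z_bihom wirtinger_zbar_bihom assms)

lemma laplacian_add:
  assumes "f \<in> bihomogeneous_polys m n" "g \<in> bihomogeneous_polys m n"
  shows "complex_laplacian (\<lambda>z. f z + g z) = (\<lambda>z. complex_laplacian f z + complex_laplacian g z)"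
  unfolding complex_laplacian_eq
  by (simp add: wirtinger_add[OF assms] wirtinger_add[OF wirtinger_zbar_bihom[OF assms(1)] wirtinger_zbar_bihom[OF assms(2)]]
      sum.distrib distrib_left)

lemma laplacian_scale:
  assumes "f \<in> bihomogeneous_polys m n"
  shows "complex_laplacian (\<lambda>z. c * f z) = (\<lambda>z. c * complex_laplacian f z)"
  unfolding complex_laplacian_eq
  by (simp add: wirtinger_scale[OF assms] wirtinger_scale[OF wirtinger_zbar_bihom[OF assms]] sum_distrib_left mult_ac)

lemma laplacian_wirtinger:
  assumes "f \<in> bihomogeneous_polys m n"
  shows "complex_laplacian (wirtinger_z j f) = wirtinger_z j (complex_laplacian f)"
    and "complex_laplacian (wirtinger_zbar j f) = wirtinger_zbar j (complex_laplacian f)"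
proof -
  have k: "wirtinger_z k (wirtinger_zbar k f) \<in> bihomogeneous_polys (m - 1) (n - 1)" for k
    by (intro wirtinger_z_bihom wirtinger_zbar_bihom assms)
  have s: "(\<lambda>z. \<Sum>k\<in>UNIV. wirtinger_z k (wirtinger_zbar k f) z) \<in> bihomogeneous_polys (m - 1) (n - 1)"
    by (intro bihom_sum k)
  note S = bihom_sum'[of UNIV "\<lambda>k. wirtinger_z k (wirtinger_zbar k f)" "m - 1" "n - 1" j, OF k finite]
  show "complex_laplacian (wirtinger_z j f) = wirtinger_z j (complex_laplacian f)"
    unfolding complex_laplacian_eq wirtinger_scale(1)[OF s] conjunct1[OF S]
    by (simp add: wirtinger_commute(1)[OF wirtinger_zbar_bihom[OF assms], of j] wirtinger_commute(2)[OF assms, of j])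
  show "complex_laplacian (wirtinger_zbar j f) = wirtinger_zbar j (complex_laplacian f)"
    unfolding complex_laplacian_eq wirtinger_scale(2)[OF s] conjunct2[OF S]
    by (simp add: wirtinger_commute(2)[OF wirtinger_zbar_bihom[OF assms], of _ j, symmetric] wirtinger_commute(3)[OF assms, of j])
qed

lemma euler_identity:
  assumes "f \<in> bihomogeneous_polys m n"
  shows "(\<Sum>j\<in>UNIV. cnj (z $ j) * wirtinger_zbar j f z) = of_nat n * f z"
  using assms
proof (induction rule: bihom_induct)
  case (monomial a b)
  have "cnj (z $ j) * wirtinger_zbar j (monomial a b) z = of_nat (b j) * monomial a b z" for j
  proof (cases "b j = 0")
    case False
    have "(\<Prod>i\<in>UNIV. cnj (z $ i) ^ b i) = cnj (z $ j) ^ b j * (\<Prod>i\<in>UNIV - {j}. cnj (z $ i) ^ b i)"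
      by (subst prod.remove[of _ j]) auto
    also have "cnj (z $ j) ^ b j = cnj (z $ j) * cnj (z $ j) ^ (b j - 1)" using False by (cases "b j") auto
    also have "cnj (z $ j) * cnj (z $ j) ^ (b j - 1) * (\<Prod>i\<in>UNIV - {j}. cnj (z $ i) ^ b i) =
        cnj (z $ j) * (\<Prod>i\<in>UNIV. cnj (z $ i) ^ (b(j := b j - 1)) i)"
      unfolding mult.assoc prod_power_lower[of "\<lambda>i. cnj (z $ i)"] ..
    finally show ?thesis by (simp add: wirtinger_monomial monomial_def mult_ac)
  qed (simp add: wirtinger_monomial)
  then show ?case using monomial by (simp add: sum_distrib_right[symmetric] of_nat_sum[symmetric] del: of_nat_sum)
next
  case (add f g)
  then show ?case by (simp add: wirtinger_add[OF add(1,2)] distrib_left sum.distrib)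
next
  case (scale c f)
  then show ?case by (simp add: wirtinger_scale[OF scale(1)] mult.left_commute[of _ c] sum_distrib_left[symmetric])
qed simp

lemma bihom_continuous:
  assumes "f \<in> bihomogeneous_polys m n" shows "continuous_on S f"
  using bihom_has_wirtinger[OF assms] unfolding has_wirtinger_def
  by (meson continuous_at_imp_continuous_on has_derivative_continuous)

lemma surf_integrable_continuous:
  fixes f :: "complex^'d::finite \<Rightarrow> 'b::{banach, second_countable_topology}"
  assumes "continuous_on UNIV f"
  shows "integrable \<sigma> f"
proof -
  have "bounded (f ` sphere 0 1)"
    using assms by (intro compact_imp_bounded compact_continuous_image continuous_on_subset[OF assms]) auto
  then obtain B where B: "\<forall>y\<in>f ` sphere 0 1. norm y \<le> B" unfolding bounded_iff by blast
  show ?thesis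
  proof (rule surf.integrable_const_bound[of _ B])
    show "AE x in \<sigma>. norm (f x) \<le> B" using B by (intro AE_I2) simp
    show "f \<in> borel_measurable \<sigma>"
      by (rule borel_measurable_surface[OF borel_measurable_continuous_onI[OF assms]])
  qed
qed

lemma surf_integrable_bihom: "f \<in> bihomogeneous_polys m n \<Longrightarrow> integrable \<sigma> f"
  by (intro surf_integrable_continuous bihom_continuous)

lemma bihom_radial:
  assumes "f \<in> bihomogeneous_polys m n"
  shows "f z = of_real (norm z ^ (m + n)) * f (radial_proj z)"
proof (cases "z = 0")
  case True
  then show ?thesis using bihom_scaleR[OF assms, of 0 z] by (simp add: radial_proj_def)
next
  case False
  then have "z = norm z *\<^sub>R radial_proj z" by (simp add: radial_proj_def)
  then show ?thesis using bihom_scaleR[OF assms, of "norm z" "radial_proj z"] by simp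
qed

text \<open>
  A radial cut-off function supported in the unit ball. Its square is differentiable, with gradient
  \<open>- 4 * tent\<close> times the position vector, so in a partial integration of the square times a
  polynomial both weights are powers of the same function.
\<close>

definition tent :: "real \<Rightarrow> real" where "tent t = max 0 (1 - t\<^sup>2)"

lemma tent_measurable [measurable]: "tent \<in> borel_measurable borel"
  unfolding tent_def[abs_def] by measurable

lemma tent_nonneg: "tent t \<ge> 0" by (simp add: tent_def)

lemma tent_support: "x \<notin> cball 0 1 \<Longrightarrow> tent (norm x) = 0"
  by (simp add: tent_def max_def power_le_one_iff)

lemma integrable_tent:
  fixes g :: "'a::euclidean_space \<Rightarrow> 'b::{banach, second_countable_topology, real_normed_field}"
  assumes g: "continuous_on UNIV g" and "i > 0"
  shows "integrable lborel (\<lambda>x. of_real (tent (norm x) ^ i) * g x)"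
proof -
  have "bounded (g ` cball 0 1)"
    using g by (intro compact_imp_bounded compact_continuous_image continuous_on_subset[OF g]) auto
  then obtain B where B: "\<forall>y\<in>g ` cball 0 1. norm y \<le> B" unfolding bounded_iff by blast
  have [measurable]: "g \<in> borel_measurable borel" by (rule borel_measurable_continuous_onI[OF g])
  show ?thesis
  proof (rule Bochner_Integration.integrable_bound[of _ "\<lambda>x. B * indicator (cball 0 1) x"])
    show "integrable lborel (\<lambda>x. B * indicator (cball (0::'a) 1) x)"
      using emeasure_lborel_cball_finite by (intro integrable_mult_right integrable_real_indicator) auto
    have "norm (of_real (tent (norm x) ^ i) * g x) \<le> norm (B * indicator (cball 0 1) x :: real)" for x
    proof (cases "x \<in> cball 0 1")
      case True
      have "tent (norm x) ^ i \<le> 1" by (intro power_le_one) (auto simp: tent_def)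
      moreover have "norm (g x) \<le> B" using B True by blast
      ultimately have "tent (norm x) ^ i * norm (g x) \<le> 1 * B" by (intro mult_mono) (auto simp: tent_nonneg)
      then show ?thesis using True by (simp add: norm_mult norm_power tent_nonneg abs_of_nonneg)
    next
      case False
      have "tent (norm x) ^ i = 0" using assms(2) by (simp only: tent_support[OF False] zero_power)
      then show ?thesis using False by simp
    qed
    then show "AE x in lborel. norm (of_real (tent (norm x) ^ i) * g x) \<le> norm (B * indicator (cball 0 1) x :: real)" by simp
    show "(\<lambda>x. of_real (tent (norm x) ^ i) * g x) \<in> borel_measurable lborel" by measurable
  qed
qed

definition tent_mass :: "'d::finite itself \<Rightarrow> nat \<Rightarrow> nat \<Rightarrow> real" where
  "tent_mass _ i k = (\<integral>x. tent (norm x) ^ i * norm x ^ k \<partial>(lborel :: (complex^'d) measure))"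

lemma integrable_tent_norm: "i > 0 \<Longrightarrow> integrable lborel (\<lambda>x::complex^'d::finite. tent (norm x) ^ i * norm x ^ k)"
  using integrable_tent[of "\<lambda>x::complex^'d. norm x ^ k" i] by (auto intro!: continuous_intros)

lemma tent_mass_pos: "i > 0 \<Longrightarrow> tent_mass TYPE('d::finite) i k > 0"
proof -
  assume i: "i > 0"
  let ?f = "\<lambda>x::complex^'d. tent (norm x) ^ i * norm x ^ k"
  have nn: "AE x in lborel. 0 \<le> ?f x" by (auto simp: tent_nonneg)
  have "tent_mass TYPE('d) i k \<noteq> 0"
  proof
    assume "tent_mass TYPE('d) i k = 0"
    then have "AE x in lborel. ?f x = 0"
      unfolding tent_mass_def using integral_nonneg_eq_0_iff_AE[OF integrable_tent_norm[OF i] nn] by simp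
    then have "AE x in lborel. (x::complex^'d) \<notin> ball 0 1 - {0}"
    proof eventually_elim
      case (elim x)
      then show ?case by (auto simp: tent_def max_def power_le_one_iff abs_square_less_1 split: if_splits)
         (metis abs_norm_cancel abs_square_less_1 diff_gt_0_iff_gt less_le_not_le)
    qed
    then have "ball 0 1 - {0::complex^'d} \<in> null_sets lborel" by (subst AE_iff_null_sets) auto
    then have "negligible (ball 0 1 - {0::complex^'d})" by (auto simp: negligible_iff_null_sets intro: null_sets_completionI)
    moreover have "open (ball 0 1 - {0::complex^'d})" by auto
    moreover have "(1/2) *\<^sub>R axis undefined 1 \<in> ball 0 1 - {0::complex^'d}" by (auto simp: norm_axis_1 axis_eq_0_iff)
    ultimately show False using open_not_negligible by blast
  qed
  moreover have "tent_mass TYPE('d) i k \<ge> 0" unfolding tent_mass_def by (rule integral_nonneg_AE[OF nn])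
  ultimately show ?thesis by simp
qed

lemma tent_weighted_integral:
  fixes f :: "'d::finite sfun"
  assumes f: "f \<in> bihomogeneous_polys m n" and i: "i > 0"
  shows "(\<integral>x. of_real (tent (norm x) ^ i) * f x \<partial>lborel) =
    of_real (tent_mass TYPE('d) i (m + n) / measure (\<sigma> :: (complex^'d) measure) (sphere 0 1)) *
      (\<integral>x. f x \<partial>\<sigma>)"
proof -
  define w where "w t = tent t ^ i * \<bar>t\<bar> ^ (m + n)" for t
  have [measurable]: "w \<in> borel_measurable borel" unfolding w_def[abs_def] by measurable
  have "(\<integral>x. of_real (tent (norm x) ^ i) * f x \<partial>lborel) = (\<integral>x. w (norm x) *\<^sub>R f (radial_proj x) \<partial>lborel)"
  proof (rule Bochner_Integration.integral_cong[OF refl])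
    fix x
    show "of_real (tent (norm x) ^ i) * f x = w (norm x) *\<^sub>R f (radial_proj x)"
      by (subst bihom_radial[OF f]) (simp add: w_def scaleR_conv_of_real)
  qed
  also have "\<dots> = ((\<integral>x. w (norm (x::complex^'d)) \<partial>lborel) / measure (\<sigma> :: (complex^'d) measure) (sphere 0 1)) *\<^sub>R
     (\<integral>x. f x \<partial>\<sigma>)"
  proof (rule polar_integral)
    show "f \<in> borel_measurable borel" by (intro borel_measurable_continuous_onI bihom_continuous[OF f])
    show "w t \<ge> 0" for t by (simp add: w_def tent_nonneg)
    show "integrable lborel (\<lambda>x::complex^'d. w (norm x))"
      using integrable_tent_norm[OF i, of "m + n", where 'd = 'd] by (simp add: w_def)
  qed measurable
  finally show ?thesis by (simp add: w_def tent_mass_def scaleR_conv_of_real)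
qed

lemma max_zero_square_has_derivative:
  "((\<lambda>s::real. (max 0 s)\<^sup>2) has_real_derivative 2 * max 0 s) (at s)"
proof (cases s "0::real" rule: linorder_cases)
  case greater
  have "((\<lambda>s::real. s\<^sup>2) has_real_derivative 2 * max 0 s) (at s)"
    using greater by (auto intro!: derivative_eq_intros)
  then show ?thesis
    by (rule has_field_derivative_transform_within_open[where S = "{0<..}"]) (use greater in auto)
next
  case less
  have "((\<lambda>s::real. 0) has_real_derivative 2 * max 0 s) (at s)"
    using less by (auto intro!: derivative_eq_intros)
  then show ?thesis
    by (rule has_field_derivative_transform_within_open[where S = "{..<0}"]) (use less in auto)
next
  case equal
  have lim: "((\<lambda>h::real. max 0 h) \<longlongrightarrow> max 0 0) (at 0)" by (intro tendsto_intros)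
  have "((max 0 (0 + h))\<^sup>2 - (max 0 0)\<^sup>2) / h = max 0 h" for h :: real
    by (simp add: max_def power2_eq_square)
  then show ?thesis unfolding equal DERIV_def using lim by simp
qed

lemma tent_square_has_derivative:
  "((\<lambda>z::'a::euclidean_space. (tent (norm z))\<^sup>2) has_derivative (\<lambda>h. - 4 * tent (norm z) * (z \<bullet> h))) (at z)"
proof -
  have "((\<lambda>z. 1 - z \<bullet> z) has_derivative (\<lambda>h. - 2 * (z \<bullet> h))) (at z)"
    by (auto intro!: derivative_eq_intros simp: inner_commute)
  then have "((\<lambda>z. (max 0 (1 - z \<bullet> z))\<^sup>2) has_derivative (\<lambda>h. (- 2 * (z \<bullet> h)) * (2 * max 0 (1 - z \<bullet> z)))) (at z)"
  proof -
    assume a: "((\<lambda>z. 1 - z \<bullet> z) has_derivative (\<lambda>h. - 2 * (z \<bullet> h))) (at z)"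
    have b: "((\<lambda>s. (max 0 s)\<^sup>2) has_derivative (*) (2 * max 0 (1 - z \<bullet> z))) (at (1 - z \<bullet> z))"
      using max_zero_square_has_derivative[of "1 - z \<bullet> z"] by (simp add: has_field_derivative_def)
    show ?thesis using has_derivative_compose[OF a b] by (simp add: mult.commute)
  qed
  then show ?thesis by (simp add: tent_def power2_norm_eq_inner mult.commute mult.left_commute)
qed

definition ibp_const :: "'d::finite itself \<Rightarrow> nat \<Rightarrow> real" where
  "ibp_const T k = tent_mass T 2 (k - 1) / (2 * tent_mass T 1 (k + 1))"

text \<open>
  The directional derivatives of \<open>tent\<^sup>2 * f\<close> have integral zero over the whole space. Combining the directions \<open>1\<close> and \<open>\<i>\<close> of
  the coordinate \<open>j\<close> gives \<open>2 * tent\<^sup>2 * wirtinger_zbar j f - 4 * tent * z $ j * f\<close>, and by homogeneity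
  each of the two volume integrals is a multiple of a surface integral. The constant depends only on the total degree.
\<close>

theorem sphere_integration_by_parts:
  fixes f :: "'d::finite sfun"
  assumes f: "f \<in> bihomogeneous_polys m n"
  shows "(\<integral>z. z $ j * f z \<partial>\<sigma>) =
    of_real (ibp_const TYPE('d) (m + n)) * (\<integral>z. wirtinger_zbar j f z \<partial>\<sigma>)"
proof -
  define \<omega> where "\<omega> = measure (\<sigma> :: (complex^'d) measure) (sphere 0 1)"
  define L where "L z h = (\<Sum>k\<in>UNIV. wirtinger_z k f z * h $ k + wirtinger_zbar k f z * cnj (h $ k))" for z h
  define \<Psi> where "\<Psi> z = of_real ((tent (norm z))\<^sup>2) * f z" for z
  define D where "D z h = of_real ((tent (norm z))\<^sup>2) * L z h + of_real (- 4 * tent (norm z) * (z \<bullet> h)) * f z" for z h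
  note zf = wirtinger_z_bihom[OF f] and zbf = wirtinger_zbar_bihom[OF f]
  have der: "(\<Psi> has_derivative D z) (at z)" for z
    unfolding \<Psi>_def[abs_def] D_def[abs_def]
    by (intro has_derivative_eq_rhs[OF has_derivative_mult[OF has_derivative_of_real[OF tent_square_has_derivative]
       bihom_has_wirtinger[OF f, unfolded has_wirtinger_def]]]) (auto simp: L_def)
  have "continuous_on UNIV (\<lambda>z. tent (norm z))" unfolding tent_def by (intro continuous_intros)
  note ci = this
  have contL: "continuous_on UNIV (\<lambda>z. L z v)" for v
    unfolding L_def by (intro continuous_intros bihom_continuous[OF zf] bihom_continuous[OF zbf])
  have contD: "continuous_on UNIV (\<lambda>z. D z v)" for v
    unfolding D_def by (intro continuous_intros ci contL bihom_continuous[OF f])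
  have zero: "(\<integral>z. D z v \<partial>lborel) = 0" for v
  proof -
    have "bounded ((\<lambda>z. D z v) ` cball 0 1)"
      by (intro compact_imp_bounded compact_continuous_image continuous_on_subset[OF contD]) auto
    then obtain B where B: "\<forall>y\<in>(\<lambda>z. D z v) ` cball 0 1. norm y \<le> B" unfolding bounded_iff by blast
    have "norm (D z v) \<le> max B 0" for z
    proof (cases "z \<in> cball 0 1")
      case True
      then have "norm (D z v) \<le> B" using B by blast
      then show ?thesis by simp
    next
      case False
      then show ?thesis by (simp add: D_def tent_support)
    qed
    moreover have "\<Psi> z = 0" if "norm z \<ge> 1" for z
      using that by (simp add: \<Psi>_def tent_def max_def power_le_one_iff)
    ultimately show ?thesis by (intro integral_directional_derivative_zero[OF der]) auto
  qed
  have contj: "continuous_on UNIV (\<lambda>z::complex^'d. z $ j)" by (intro continuous_intros)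
  have int1: "integrable lborel (\<lambda>z. of_real (tent (norm z) ^ 2) * wirtinger_zbar j f z)"
    by (intro integrable_tent bihom_continuous[OF zbf]) auto
  have int2: "integrable lborel (\<lambda>z. of_real (tent (norm z) ^ 1) * (z $ j * f z))"
    by (intro integrable_tent continuous_on_mult contj bihom_continuous[OF f]) auto
  have intD: "integrable lborel (\<lambda>z. D z v)" for v
  proof -
    have "integrable lborel (\<lambda>z. of_real (tent (norm z) ^ 2) * L z v)"
      by (intro integrable_tent contL) auto
    moreover have "integrable lborel (\<lambda>z. of_real (tent (norm z) ^ 1) * (of_real (- 4 * (z \<bullet> v)) * f z))"
      by (intro integrable_tent) (auto intro!: continuous_intros bihom_continuous[OF f])
    ultimately show ?thesis unfolding D_def by (auto simp: mult_ac intro!: Bochner_Integration.integrable_add)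
  qed
  have comb: "D z (axis j 1) + \<i> * D z (axis j \<i>) =
      2 * (of_real (tent (norm z) ^ 2) * wirtinger_zbar j f z) - 4 * (of_real (tent (norm z) ^ 1) * (z $ j * f z))" for z
  proof -
    have L1: "L z (axis j 1) = wirtinger_z j f z + wirtinger_zbar j f z"
      "L z (axis j \<i>) = \<i> * wirtinger_z j f z - \<i> * wirtinger_zbar j f z"
      unfolding L_def sum_axis by simp_all
    have i1: "z \<bullet> axis j 1 = Re (z $ j)" "z \<bullet> axis j \<i> = Im (z $ j)"
      by (simp_all add: inner_axis inner_complex_def)
    have z: "z $ j = of_real (Re (z $ j)) + \<i> * of_real (Im (z $ j))" by (rule complex_eq)
    have "D z (axis j 1) + \<i> * D z (axis j \<i>) =
      2 * (of_real ((tent (norm z))\<^sup>2) * wirtinger_zbar j f z) - 4 * of_real (tent (norm z)) * (of_real (Re (z $ j)) + \<i> * of_real (Im (z $ j))) * f z"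
      unfolding D_def L1 i1 by (simp add: algebra_simps)
    then show ?thesis using z by (simp add: mult.assoc)
  qed
  have "0 = (\<integral>z. D z (axis j 1) + \<i> * D z (axis j \<i>) \<partial>lborel)"
    using zero intD by (subst Bochner_Integration.integral_add) auto
  also have "\<dots> = 2 * (\<integral>z. of_real (tent (norm z) ^ 2) * wirtinger_zbar j f z \<partial>lborel)
      - 4 * (\<integral>z. of_real (tent (norm z) ^ 1) * (z $ j * f z) \<partial>lborel)"
    unfolding comb using int1 int2 by (subst Bochner_Integration.integral_diff) auto
  finally have eq: "(\<integral>z. of_real (tent (norm z) ^ 2) * wirtinger_zbar j f z \<partial>lborel) =
      2 * (\<integral>z. of_real (tent (norm z) ^ 1) * (z $ j * f z) \<partial>lborel)" by simp
  have r: "(\<integral>z. of_real (tent (norm z) ^ 1) * (z $ j * f z) \<partial>lborel) =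
     of_real (tent_mass TYPE('d) 1 (1 + m + (0 + n)) / \<omega>) * (\<integral>z. z $ j * f z \<partial>\<sigma>)"
    unfolding \<omega>_def by (rule tent_weighted_integral[OF bihom_mult[OF bihom_coord f]]) simp
  have l: "(\<integral>z. of_real (tent (norm z) ^ 2) * wirtinger_zbar j f z \<partial>lborel) =
     of_real (tent_mass TYPE('d) 2 (m + n - 1) / \<omega>) * (\<integral>z. wirtinger_zbar j f z \<partial>\<sigma>)"
  proof (cases "n = 0")
    case True
    then have "wirtinger_zbar j f = (\<lambda>_. 0)" using f wirtinger_zbar_holomorphic by blast
    then show ?thesis by simp
  next
    case False
    then have "m + (n - 1) = m + n - 1" by simp
    then show ?thesis using tent_weighted_integral[OF zbf, of 2 j] by (simp add: \<omega>_def)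
  qed
  have \<omega>: "\<omega> > 0" unfolding \<omega>_def by (rule surface_mass_pos)
  have p: "tent_mass TYPE('d) 1 (m + n + 1) > 0" by (rule tent_mass_pos) simp
  define A where "A = (\<integral>z. z $ j * f z \<partial>\<sigma>)"
  define B where "B = (\<integral>z. wirtinger_zbar j f z \<partial>\<sigma>)"
  have "complex_of_real (tent_mass TYPE('d) 2 (m + n - 1) / \<omega>) * B = 2 * (of_real (tent_mass TYPE('d) 1 (m + n + 1) / \<omega>) * A)"
    using eq unfolding r l A_def B_def by (simp add: add_ac)
  then have "complex_of_real (tent_mass TYPE('d) 2 (m + n - 1)) * B = 2 * (of_real (tent_mass TYPE('d) 1 (m + n + 1)) * A)"
    using \<omega> by (simp add: field_simps)
  then have "A = of_real (ibp_const TYPE('d) (m + n)) * B"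
    using p by (simp add: ibp_const_def field_simps)
  then show ?thesis by (simp add: A_def B_def)
qed

lemma wirtinger_cnj:
  assumes "f \<in> bihomogeneous_polys m n"
  shows "wirtinger_zbar j (\<lambda>z. cnj (f z)) = (\<lambda>z. cnj (wirtinger_z j f z))"
    and "wirtinger_z j (\<lambda>z. cnj (f z)) = (\<lambda>z. cnj (wirtinger_zbar j f z))"
proof -
  have "wirtinger_zbar j (\<lambda>z. cnj (f z)) = (\<lambda>z. cnj (wirtinger_z j f z)) \<and>
    wirtinger_z j (\<lambda>z. cnj (f z)) = (\<lambda>z. cnj (wirtinger_zbar j f z))"
    using assms
  proof (induction rule: bihom_induct)
    case (monomial a b)
    then show ?case by (simp add: cnj_monomial[abs_def] wirtinger_monomial cnj_monomial)
  next
    case (add f g)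
    then show ?case
      by (simp add: wirtinger_add[OF add(1,2)] wirtinger_add[OF bihom_cnj[OF add(1)] bihom_cnj[OF add(2)]])
  next
    case (scale c f)
    then show ?case by (simp add: wirtinger_scale[OF scale(1)] wirtinger_scale[OF bihom_cnj[OF scale(1)]])
  qed simp
  then show "wirtinger_zbar j (\<lambda>z. cnj (f z)) = (\<lambda>z. cnj (wirtinger_z j f z))"
    and "wirtinger_z j (\<lambda>z. cnj (f z)) = (\<lambda>z. cnj (wirtinger_zbar j f z))" by auto
qed

lemma sphere_integration_by_parts_cnj:
  fixes f :: "'d::finite sfun"
  assumes f: "f \<in> bihomogeneous_polys m n"
  shows "(\<integral>z. cnj (z $ j) * f z \<partial>\<sigma>) =
    of_real (ibp_const TYPE('d) (m + n)) * (\<integral>z. wirtinger_z j f z \<partial>\<sigma>)"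
proof -
  have "(\<integral>z. z $ j * cnj (f z) \<partial>\<sigma>) =
    of_real (ibp_const TYPE('d) (n + m)) * (\<integral>z. cnj (wirtinger_z j f z) \<partial>\<sigma>)"
    using sphere_integration_by_parts[OF bihom_cnj[OF f], of j] by (simp add: wirtinger_cnj[OF f])
  then have "cnj (\<integral>z. z $ j * cnj (f z) \<partial>\<sigma>) =
    cnj (of_real (ibp_const TYPE('d) (n + m)) * (\<integral>z. cnj (wirtinger_z j f z) \<partial>\<sigma>))" by simp
  moreover have "cnj (\<integral>z. z $ j * cnj (f z) \<partial>\<sigma>) = (\<integral>z. cnj (z $ j) * f z \<partial>\<sigma>)"
    unfolding Bochner_Integration.integral_cnj[symmetric] by (simp only: complex_cnj_mult complex_cnj_cnj)
  ultimately show ?thesis by (simp add: add.commute)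
qed

section \<open>Orthogonality\<close>

lemma monomial_split:
  fixes z :: "complex^'d::finite"
  assumes "a j > 0"
  shows "monomial a b z = z $ j * monomial (a(j := a j - 1)) b z"
proof -
  have "(\<Prod>i\<in>UNIV. (z $ i) ^ a i) = (z $ j) ^ a j * (\<Prod>i\<in>UNIV - {j}. (z $ i) ^ a i)"
    by (subst prod.remove[of _ j]) auto
  also have "(z $ j) ^ a j = z $ j * (z $ j) ^ (a j - 1)" using assms by (cases "a j") auto
  also have "z $ j * (z $ j) ^ (a j - 1) * (\<Prod>i\<in>UNIV - {j}. (z $ i) ^ a i) = z $ j * (\<Prod>i\<in>UNIV. (z $ i) ^ (a(j := a j - 1)) i)"
    unfolding mult.assoc prod_power_lower ..
  finally show ?thesis by (simp add: monomial_def)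
qed

text \<open>
  Partial integration in a coordinate lowers both exponents of that coordinate, so it preserves their difference,
  until one of the two is missing and the derivative vanishes.
\<close>

lemma integral_monomial_zero:
  "a \<noteq> b \<Longrightarrow> (\<integral>z. monomial a b z \<partial>(\<sigma> :: (complex^'d::finite) measure)) = 0"
proof (induction "sum a UNIV" arbitrary: a b rule: less_induct)
  case less
  show ?case
  proof (cases "a = (\<lambda>_. 0)")
    case False
    then obtain j where j: "a j > 0" by (auto simp: fun_eq_iff)
    define a' where "a' = a(j := a j - 1)"
    have "(\<integral>z. monomial a b z \<partial>(\<sigma> :: (complex^'d) measure)) = (\<integral>z. z $ j * monomial a' b z \<partial>\<sigma>)"
      by (simp only: monomial_split[where a = a and j = j, OF j] a'_def)
    also have "\<dots> = of_real (ibp_const TYPE('d) (sum a' UNIV + sum b UNIV)) *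
        (\<integral>z. of_nat (b j) * monomial a' (b(j := b j - 1)) z \<partial>\<sigma>)"
      using sphere_integration_by_parts[OF bihom_monomial[of a' b], of j] by (simp add: wirtinger_monomial)
    also have "(\<integral>z. of_nat (b j) * monomial a' (b(j := b j - 1)) z \<partial>(\<sigma> :: (complex^'d) measure)) = 0"
    proof (cases "b j = 0")
      case False
      have "a' \<noteq> b(j := b j - 1)"
      proof
        assume eq: "a' = b(j := b j - 1)"
        have "a i = b i" for i
          using fun_cong[OF eq, of i] j False by (cases "i = j") (auto simp: a'_def)
        then show False using less.prems by auto
      qed
      moreover have "sum a UNIV > 0" using j member_le_sum[of j UNIV a] by simp
      then have "sum a' UNIV < sum a UNIV" unfolding a'_def sum_lower[of a j, OF j] by simp
      ultimately have "(\<integral>z. monomial a' (b(j := b j - 1)) z \<partial>(\<sigma> :: (complex^'d) measure)) = 0"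
        using less.hyps by blast
      then show ?thesis by simp
    qed simp
    finally show ?thesis by simp
  next
    case True
    then obtain j where j: "b j > 0" using less.prems by (auto simp: fun_eq_iff)
    define b' where "b' = b(j := b j - 1)"
    have "monomial a b z = cnj (z $ j) * monomial a b' z" for z
      using arg_cong[OF monomial_split[where a = b and j = j and b = a and z = z, OF j], of cnj] by (simp add: cnj_monomial b'_def)
    then have "(\<integral>z. monomial a b z \<partial>(\<sigma> :: (complex^'d) measure)) = (\<integral>z. cnj (z $ j) * monomial a b' z \<partial>\<sigma>)"
      by simp
    also have "\<dots> = 0"
      using sphere_integration_by_parts_cnj[OF bihom_monomial[of a b'], of j] True by (simp add: wirtinger_monomial)
    finally show ?thesis .
  qed
qed

lemma integral_bihom_zero:
  assumes "f \<in> bihomogeneous_polys m n" "m \<noteq> n"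
  shows "(\<integral>z. f z \<partial>\<sigma>) = 0"
  using assms(1)
proof (induction rule: bihom_induct)
  case (monomial a b)
  then have "a \<noteq> b" using assms(2) by auto
  then show ?case by (rule integral_monomial_zero)
next
  case (add f g)
  then show ?case by (simp add: surf_integrable_bihom[OF add(1)] surf_integrable_bihom[OF add(2)])
qed auto

text \<open>
  The harmonic polynomials on the whole space whose restrictions to the sphere form \<open>harmonics m n\<close>.
\<close>

definition solid_harmonics :: "nat \<Rightarrow> nat \<Rightarrow> ('d::finite sfun) set" where
  "solid_harmonics m n = {f \<in> bihomogeneous_polys m n. complex_laplacian f = (\<lambda>_. 0)}"

lemma solid_harmonics_zbar:
  "f \<in> solid_harmonics m n \<Longrightarrow> wirtinger_zbar j f \<in> solid_harmonics m (n - 1)"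
  using wirtinger_zbar_bihom[of f m n j] by (auto simp: solid_harmonics_def laplacian_wirtinger)

lemma solid_harmonics_cnj: "f \<in> solid_harmonics m n \<Longrightarrow> (\<lambda>z. cnj (f z)) \<in> solid_harmonics n m"
proof -
  assume "f \<in> solid_harmonics m n"
  then have f: "f \<in> bihomogeneous_polys m n" "complex_laplacian f = (\<lambda>_. 0)" by (auto simp: solid_harmonics_def)
  have "wirtinger_z k (wirtinger_zbar k (\<lambda>z. cnj (f z))) = (\<lambda>z. cnj (wirtinger_z k (wirtinger_zbar k f) z))" for k
    unfolding wirtinger_cnj(1)[OF f(1)] wirtinger_cnj(2)[OF wirtinger_z_bihom[OF f(1)]]
    by (simp only: wirtinger_commute(2)[OF f(1)])
  then have "complex_laplacian (\<lambda>z. cnj (f z)) = (\<lambda>z. cnj (complex_laplacian f z))"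
    by (simp add: complex_laplacian_eq)
  then show ?thesis using f by (simp add: solid_harmonics_def bihom_cnj)
qed

text \<open>
  Euler's identity writes \<open>n * f\<close> as a sum of \<open>cnj (z $ j) * wirtinger_zbar j f\<close>; partial integration
  turns its integral into that of the Laplacian.
\<close>

lemma integral_solid_harmonic_zero:
  fixes f :: "'d::finite sfun"
  assumes "f \<in> solid_harmonics m n" "m + n > 0"
  shows "(\<integral>z. f z \<partial>\<sigma>) = 0"
proof (cases "m = n")
  case False
  then show ?thesis using assms integral_bihom_zero by (auto simp: solid_harmonics_def)
next
  case True
  have f: "f \<in> bihomogeneous_polys m n" "complex_laplacian f = (\<lambda>_. 0)" using assms by (auto simp: solid_harmonics_def)
  note zb = wirtinger_zbar_bihom[OF f(1)]
  have "of_nat n * (\<integral>z. f z \<partial>\<sigma>) = (\<integral>z. (\<Sum>j\<in>UNIV. cnj (z $ j) * wirtinger_zbar j f z) \<partial>\<sigma>)"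
    by (simp add: euler_identity[OF f(1)])
  also have "\<dots> = (\<Sum>j\<in>UNIV. \<integral>z. cnj (z $ j) * wirtinger_zbar j f z \<partial>\<sigma>)"
    by (intro Bochner_Integration.integral_sum surf_integrable_bihom[OF bihom_mult[OF bihom_cnj_coord zb]])
  also have "\<dots> = (\<Sum>j\<in>UNIV. of_real (ibp_const TYPE('d) (m + (n - 1))) * (\<integral>z. wirtinger_z j (wirtinger_zbar j f) z \<partial>\<sigma>))"
    by (simp only: sphere_integration_by_parts_cnj[OF zb])
  also have "\<dots> = of_real (ibp_const TYPE('d) (m + (n - 1))) * (\<integral>z. (\<Sum>j\<in>UNIV. wirtinger_z j (wirtinger_zbar j f) z) \<partial>\<sigma>)"
    unfolding sum_distrib_left[symmetric]
    by (subst Bochner_Integration.integral_sum) (auto intro!: surf_integrable_bihom[OF wirtinger_z_bihom[OF zb]])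
  also have "(\<lambda>z. \<Sum>j\<in>UNIV. wirtinger_z j (wirtinger_zbar j f) z) = (\<lambda>_. 0)"
    using f(2) by (simp add: complex_laplacian_eq fun_eq_iff)
  finally show ?thesis using True assms(2) by simp
qed

text \<open>
  Partial integration with respect to a coordinate of the monomial either differentiates \<open>f\<close>, which stays
  harmonic, or lowers the degree of the monomial further. Exponents of the conjugate coordinates are reduced to
  this case by conjugation.
\<close>

lemma solid_harmonic_orthogonal_monomial:
  fixes f :: "'d::finite sfun"
  assumes "f \<in> solid_harmonics m n" "sum a UNIV + sum b UNIV < m + n"
  shows "(\<integral>z. monomial a b z * f z \<partial>\<sigma>) = 0"
  using assms
proof (induction "sum a UNIV + sum b UNIV" arbitrary: a b m n f rule: less_induct)
  case less
  have main: "(\<integral>z. monomial a b z * f z \<partial>(\<sigma> :: (complex^'d) measure)) = 0"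
    if f: "f \<in> solid_harmonics m n" and lt: "sum a UNIV + sum b UNIV < m + n" and j: "a j > 0"
      and IH: "\<And>a' b' m n f. sum a' UNIV + sum b' UNIV < sum a UNIV + sum b UNIV \<Longrightarrow> f \<in> solid_harmonics m n \<Longrightarrow>
        sum a' UNIV + sum b' UNIV < m + n \<Longrightarrow> (\<integral>z. monomial a' b' z * f z \<partial>(\<sigma> :: (complex^'d) measure)) = 0"
    for a b :: "'d \<Rightarrow> nat" and m n and f :: "'d sfun" and j
  proof -
    have fb: "f \<in> bihomogeneous_polys m n" using f by (simp add: solid_harmonics_def)
    define a' where "a' = a(j := a j - 1)"
    have "sum a UNIV > 0" using j member_le_sum[of j UNIV a] by simp
    then have sa: "sum a UNIV = Suc (sum a' UNIV)" unfolding a'_def sum_lower[of a j, OF j] by simp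
    have "(\<integral>z. monomial a b z * f z \<partial>\<sigma>) = (\<integral>z. z $ j * (monomial a' b z * f z) \<partial>\<sigma>)"
      by (simp only: monomial_split[where a = a and j = j, OF j] a'_def mult.assoc)
    also have "\<dots> = of_real (ibp_const TYPE('d) (sum a' UNIV + m + (sum b UNIV + n))) *
       (\<integral>z. monomial a' b z * wirtinger_zbar j f z + of_nat (b j) * monomial a' (b(j := b j - 1)) z * f z \<partial>\<sigma>)"
      using sphere_integration_by_parts[OF bihom_mult[OF bihom_monomial[of a' b] fb], of j]
      by (simp add: wirtinger_mult[OF bihom_monomial[of a' b] fb] wirtinger_monomial)
    also have "(\<integral>z. monomial a' b z * wirtinger_zbar j f z + of_nat (b j) * monomial a' (b(j := b j - 1)) z * f z \<partial>\<sigma>)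
       = (\<integral>z. monomial a' b z * wirtinger_zbar j f z \<partial>\<sigma>) + (\<integral>z. of_nat (b j) * (monomial a' (b(j := b j - 1)) z * f z) \<partial>\<sigma>)"
      unfolding mult.assoc
      by (intro Bochner_Integration.integral_add integrable_mult_right surf_integrable_bihom[OF bihom_mult[OF bihom_monomial fb]]
           surf_integrable_bihom[OF bihom_mult[OF bihom_monomial wirtinger_zbar_bihom[OF fb]]])
    also have "(\<integral>z. monomial a' b z * wirtinger_zbar j f z \<partial>\<sigma>) = 0"
    proof (cases "n = 0")
      case True
      then show ?thesis using wirtinger_zbar_holomorphic[of f m j] fb by simp
    next
      case False
      then show ?thesis using lt sa by (intro IH[OF _ solid_harmonics_zbar[OF f]]) auto
    qed
    also have "(\<integral>z. of_nat (b j) * (monomial a' (b(j := b j - 1)) z * f z) \<partial>\<sigma>) = 0"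
    proof (cases "b j = 0")
      case False
      then have "sum (b(j := b j - 1)) UNIV \<le> sum b UNIV" by (subst sum_lower) auto
      then have "(\<integral>z. monomial a' (b(j := b j - 1)) z * f z \<partial>\<sigma>) = 0"
        using lt sa by (intro IH[OF _ f]) auto
      then show ?thesis by simp
    qed simp
    finally show ?thesis by simp
  qed
  have IH: "sum a' UNIV + sum b' UNIV < sum a UNIV + sum b UNIV \<Longrightarrow> f \<in> solid_harmonics m n \<Longrightarrow>
      sum a' UNIV + sum b' UNIV < m + n \<Longrightarrow> (\<integral>z. monomial a' b' z * f z \<partial>(\<sigma> :: (complex^'d) measure)) = 0"
    for a' b' m n f using less.hyps by blast
  show ?case
  proof (cases "a = (\<lambda>_. 0)")
    case False
    then obtain j where j: "a j > 0" by (auto simp: fun_eq_iff)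
    show ?thesis using main[where a = a and b = b and j = j, OF less.prems j IH] by simp
  next
    case a: True
    show ?thesis
    proof (cases "b = (\<lambda>_. 0)")
      case True
      have "sum a UNIV = 0" "sum b UNIV = 0" using a True by simp_all
      then have "m + n > 0" using less.prems(2) by simp
      then show ?thesis using integral_solid_harmonic_zero[OF less.prems(1)] by (simp add: monomial_zero a True)
    next
      case False
      then obtain j where j: "b j > 0" by (auto simp: fun_eq_iff)
      have IH': "sum a' UNIV + sum b' UNIV < sum b UNIV + sum a UNIV \<Longrightarrow> f \<in> solid_harmonics m n \<Longrightarrow>
        sum a' UNIV + sum b' UNIV < m + n \<Longrightarrow> (\<integral>z. monomial a' b' z * f z \<partial>(\<sigma> :: (complex^'d) measure)) = 0"
        for a' b' m n f using IH[of a' b' f m n] by (simp add: add.commute)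
      have "sum b UNIV + sum a UNIV < n + m" using less.prems(2) by simp
      then have "(\<integral>z. monomial b a z * cnj (f z) \<partial>\<sigma>) = 0"
        by (rule main[where a = b and b = a and j = j, OF solid_harmonics_cnj[OF less.prems(1)] _ j IH'])
      then have "cnj (\<integral>z. monomial b a z * cnj (f z) \<partial>\<sigma>) = 0" by simp
      then show ?thesis unfolding Bochner_Integration.integral_cnj[symmetric] complex_cnj_mult complex_cnj_cnj cnj_monomial .
    qed
  qed
qed

lemma solid_harmonic_orthogonal_lower:
  fixes f :: "'d::finite sfun"
  assumes f: "f \<in> solid_harmonics m n" and g: "g \<in> bihomogeneous_polys k l" and "k + l < m + n"
  shows "(\<integral>z. g z * f z \<partial>\<sigma>) = 0"
  using g
proof (induction rule: bihom_induct)
  case (monomial a b)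
  then show ?case using solid_harmonic_orthogonal_monomial[OF f, of a b] assms(3) by simp
next
  case (add g h)
  have fb: "f \<in> bihomogeneous_polys m n" using f by (simp add: solid_harmonics_def)
  show ?case using add(3,4)
    by (simp add: distrib_right surf_integrable_bihom[OF bihom_mult[OF add(1) fb]] surf_integrable_bihom[OF bihom_mult[OF add(2) fb]])
qed (auto simp: mult.assoc)

text \<open>
  Different total degrees are separated by \<open>solid_harmonic_orthogonal_lower\<close>; for equal total degrees and different
  bidegrees the product has different degrees in \<open>z\<close> and in its conjugate.
\<close>

lemma solid_harmonics_orthogonal:
  assumes f: "f \<in> solid_harmonics m n" and g: "g \<in> solid_harmonics k l" and ne: "(m, n) \<noteq> (k, l)"
  shows "(\<integral>z. f z * cnj (g z) \<partial>\<sigma>) = 0"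
proof -
  have fb: "f \<in> bihomogeneous_polys m n" and gb: "g \<in> bihomogeneous_polys k l" using f g by (auto simp: solid_harmonics_def)
  consider "k + l < m + n" | "m + n < k + l" | "m + l \<noteq> n + k" | "m + n = k + l" "m + l = n + k" by linarith
  then show ?thesis
  proof cases
    case 1
    then show ?thesis using solid_harmonic_orthogonal_lower[OF f bihom_cnj[OF gb]] by (simp add: mult.commute add.commute)
  next
    case 2
    then show ?thesis using solid_harmonic_orthogonal_lower[OF solid_harmonics_cnj[OF g] fb] by (simp add: add.commute)
  next
    case 3
    then show ?thesis using integral_bihom_zero[OF bihom_mult[OF fb bihom_cnj[OF gb]]] by blast
  next
    case 4
    then show ?thesis using ne by auto
  qed
qed

section \<open>Decomposition of polynomials into harmonics\<close>

definition restr :: "('d::finite sfun) \<Rightarrow> 'd sfun" where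
  "restr f = (\<lambda>z. if z \<in> sphere 0 1 then f z else 0)"

lemma harmonics_eq_image: "harmonics m n = restr ` solid_harmonics m n"
  by (auto simp: harmonics_def solid_harmonics_def restr_def fun_eq_iff)

lemma integral_restr:
  "(\<integral>z. restr f z * g z \<partial>\<sigma>) = (\<integral>z. f z * g z \<partial>\<sigma>)"
  "(\<integral>z. g z * restr f z \<partial>\<sigma>) = (\<integral>z. g z * f z \<partial>\<sigma>)"
  "(\<integral>z. g z * cnj (restr f z) \<partial>\<sigma>) = (\<integral>z. g z * cnj (f z) \<partial>\<sigma>)"
  by (auto intro!: Bochner_Integration.integral_cong simp: restr_def)

lemma surf_continuous_zero:
  fixes f :: "'d::finite sfun"
  assumes cont: "continuous_on UNIV f" and 0: "(\<integral>z. f z * cnj (f z) \<partial>\<sigma>) = 0" and w: "w \<in> sphere 0 1"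
  shows "f w = 0"
proof (rule ccontr)
  assume fw: "f w \<noteq> 0"
  have int: "integrable \<sigma> (\<lambda>z. (cmod (f z))\<^sup>2)"
    by (intro surf_integrable_continuous continuous_intros cont)
  have "complex_of_real (\<integral>z. (cmod (f z))\<^sup>2 \<partial>\<sigma>) = (\<integral>z. of_real ((cmod (f z))\<^sup>2) \<partial>\<sigma>)"
    by (rule integral_complex_of_real[symmetric])
  also have "\<dots> = 0" using 0 unfolding complex_norm_square .
  finally have "(\<integral>z. (cmod (f z))\<^sup>2 \<partial>\<sigma>) = 0" by simp
  then have "AE z in \<sigma>. (cmod (f z))\<^sup>2 = 0"
    using integral_nonneg_eq_0_iff_AE[OF int] by simp
  then have ae: "AE z in \<sigma>. z \<notin> (f -` (- {0})) \<inter> sphere 0 1" by eventually_elim auto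
  have U: "open (f -` (- {0}))" by (rule open_vimage[OF _ cont]) auto
  then have "f -` (- {0}) \<inter> sphere 0 1 \<in> sets \<sigma>" by (intro sets_surfaceI) auto
  then have "f -` (- {0}) \<inter> sphere 0 1 \<in> null_sets \<sigma>"
    using ae by (subst AE_iff_null_sets) auto
  moreover have "emeasure \<sigma> (f -` (- {0}) \<inter> sphere 0 1) > 0"
    using fw w by (intro emeasure_surface_open_pos U) auto
  ultimately show False by (auto simp: null_sets_def)
qed

lemma bihom_eq_zero:
  assumes f: "f \<in> bihomogeneous_polys m n" and 0: "\<And>z. z \<in> sphere 0 1 \<Longrightarrow> f z = 0"
  shows "f = (\<lambda>_. 0)"
proof
  fix z
  show "f z = 0"
  proof (cases "z = 0")
    case True
    have "axis undefined 1 \<in> sphere (0::complex^'a) 1" by (simp add: norm_axis_1)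
    then have "f (axis undefined 1) = 0" by (rule 0)
    then show ?thesis using bihom_scaleR[OF f, of 0 "axis undefined 1"] True by simp
  next
    case False
    then show ?thesis by (subst bihom_radial[OF f]) (simp add: 0 norm_radial_proj)
  qed
qed

definition norm_sq :: "'d::finite sfun" where
  "norm_sq z = (\<Sum>j\<in>UNIV. z $ j * cnj (z $ j))"

lemma norm_sq_bihom: "norm_sq \<in> bihomogeneous_polys 1 1"
  unfolding norm_sq_def[abs_def]
proof (rule bihom_sum)
  show "(\<lambda>z. z $ j * cnj (z $ j)) \<in> bihomogeneous_polys 1 1" for j
    using bihom_mult[OF bihom_coord[of j] bihom_cnj_coord[of j]] by simp
qed

lemma norm_sq_eq: "norm_sq z = of_real ((norm z)\<^sup>2)"
  by (simp add: norm_sq_def norm_vec_def L2_set_def sum_nonneg complex_norm_square del: of_real_power)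

text \<open>
  Multiplication by \<open>norm_sq\<close> followed by the Laplacian, an endomorphism of each space of
  bihomogeneous polynomials. Its bijectivity is the Fischer decomposition.
\<close>

definition fischer :: "('d::finite sfun) \<Rightarrow> 'd sfun" where
  "fischer Q = complex_laplacian (\<lambda>z. norm_sq z * Q z)"

lemma norm_sq_mult_bihom: "Q \<in> bihomogeneous_polys m n \<Longrightarrow> (\<lambda>z. norm_sq z * Q z) \<in> bihomogeneous_polys (Suc m) (Suc n)"
  using bihom_mult[OF norm_sq_bihom] by fastforce

lemma fischer_bihom: "Q \<in> bihomogeneous_polys m n \<Longrightarrow> fischer Q \<in> bihomogeneous_polys m n"
  unfolding fischer_def using laplacian_bihom[OF norm_sq_mult_bihom] by simp

lemma fischer_add:
  assumes "P \<in> bihomogeneous_polys m n" "Q \<in> bihomogeneous_polys m n"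
  shows "fischer (\<lambda>z. P z + Q z) = (\<lambda>z. fischer P z + fischer Q z)"
  unfolding fischer_def distrib_left by (rule laplacian_add[OF norm_sq_mult_bihom[OF assms(1)] norm_sq_mult_bihom[OF assms(2)]])

lemma fischer_scale:
  assumes "P \<in> bihomogeneous_polys m n"
  shows "fischer (\<lambda>z. c * P z) = (\<lambda>z. c * fischer P z)"
  unfolding fischer_def mult.left_commute[of "norm_sq _"] by (rule laplacian_scale[OF norm_sq_mult_bihom[OF assms]])

lemma fischer_sum:
  assumes "finite I" "\<And>i. i \<in> I \<Longrightarrow> P i \<in> bihomogeneous_polys m n"
  shows "fischer (\<lambda>z. \<Sum>i\<in>I. c i * P i z) = (\<lambda>z. \<Sum>i\<in>I. c i * fischer (P i) z)"
  using assms
proof (induction I rule: finite_induct)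
  case empty
  then show ?case using fischer_scale[OF bihom_zero, of 0] by simp
next
  case (insert i I)
  have "(\<lambda>z. c i * P i z) \<in> bihomogeneous_polys m n" "(\<lambda>z. \<Sum>i\<in>I. c i * P i z) \<in> bihomogeneous_polys m n"
    using insert by (auto intro!: bihom_scale bihom_sum)
  from fischer_add[OF this] show ?case using insert fischer_scale[of "P i" m n "c i"] by simp
qed

text \<open>
  If \<open>norm_sq * Q\<close> is harmonic, it is orthogonal to \<open>Q\<close>, whose degree is lower; but on the sphere \<open>norm_sq\<close> is
  \<open>1\<close>.
\<close>

lemma fischer_injective:
  assumes Q: "Q \<in> bihomogeneous_polys m n" and 0: "fischer Q = (\<lambda>_. 0)"
  shows "Q = (\<lambda>_. 0)"
proof -
  have h: "(\<lambda>z. norm_sq z * Q z) \<in> solid_harmonics (Suc m) (Suc n)"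
    using norm_sq_mult_bihom[OF Q] 0 by (simp add: solid_harmonics_def fischer_def)
  have "(\<integral>z. cnj (Q z) * (norm_sq z * Q z) \<partial>\<sigma>) = 0"
    by (rule solid_harmonic_orthogonal_lower[OF h bihom_cnj[OF Q]]) simp
  also have "(\<integral>z. cnj (Q z) * (norm_sq z * Q z) \<partial>\<sigma>) = (\<integral>z. Q z * cnj (Q z) \<partial>\<sigma>)"
    by (intro Bochner_Integration.integral_cong) (auto simp: norm_sq_eq)
  finally have "(\<integral>z. Q z * cnj (Q z) \<partial>\<sigma>) = 0" .
  then show ?thesis using surf_continuous_zero[OF bihom_continuous[OF Q]] by (intro bihom_eq_zero[OF Q])
qed

text \<open>
  An injective endomorphism of a finite-dimensional space. The dimension count is carried out
  with a basis of monomials.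
\<close>

lemma fischer_surjective:
  fixes g :: "'d::finite sfun"
  assumes g: "g \<in> bihomogeneous_polys m n"
  shows "\<exists>Q\<in>bihomogeneous_polys m n. fischer Q = g"
proof -
  let ?P = "bihomogeneous_polys m n :: ('d sfun) set"
  obtain B where B: "B \<subseteq> monomials m n" "cfun.independent B" "cfun.span B = cfun.span (monomials m n :: ('d sfun) set)"
    using cfun.maximal_independent_subset[of "monomials m n :: ('d sfun) set"]
    by (metis cfun.span_mono cfun.span_span subset_antisym)
  have span: "cfun.span B = ?P" using B(3) by (simp add: bihomogeneous_polys_eq_span)
  have fin: "finite B" using B(1) finite_monomials finite_subset by blast
  have BP: "v \<in> ?P" if "v \<in> B" for v using cfun.span_base[OF that] span by simp
  have inj: "inj_on fischer B"
  proof (rule inj_onI)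
    fix v w assume v: "v \<in> B" and w: "w \<in> B" and eq: "fischer v = fischer w"
    have "fischer (\<lambda>z. v z + (-1) * w z) = (\<lambda>z. fischer v z + (-1) * fischer w z)"
      using fischer_add[OF BP[OF v] bihom_scale[OF BP[OF w], of "-1"]] fischer_scale[OF BP[OF w], of "-1"] by simp
    then have "(\<lambda>z. v z + (-1) * w z) = (\<lambda>_. 0)"
      using eq by (intro fischer_injective[OF bihom_add[OF BP[OF v] bihom_scale[OF BP[OF w], of "-1"]]]) simp
    then show "v = w" by (auto simp: fun_eq_iff)
  qed
  have comb: "(\<lambda>z. \<Sum>v\<in>B. c v * v z) \<in> ?P" for c
    by (rule bihom_sum, rule bihom_scale, rule BP)
  have ind: "cfun.independent (fischer ` B)"
  proof
    assume "cfun.dependent (fischer ` B)"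
    then obtain c y where c: "y \<in> fischer ` B" "c y \<noteq> 0" "(\<Sum>v\<in>fischer ` B. (\<lambda>z. c v * v z)) = 0"
      using cfun.dependent_finite[of "fischer ` B"] fin by auto
    have "(\<lambda>z. \<Sum>v\<in>B. c (fischer v) * fischer v z) = 0"
      using c(3) unfolding sum.reindex[OF inj] by (simp add: fun_eq_iff sum_fun_apply)
    then have "fischer (\<lambda>z. \<Sum>v\<in>B. c (fischer v) * v z) = (\<lambda>_. 0)"
      using fischer_sum[of B "\<lambda>v. v" m n "\<lambda>v. c (fischer v)"] fin BP by (simp add: zero_fun_def)
    then have "(\<lambda>z. \<Sum>v\<in>B. c (fischer v) * v z) = (\<lambda>_. 0)"
      by (rule fischer_injective[OF comb])
    then have "(\<Sum>v\<in>B. (\<lambda>z. c (fischer v) * v z)) = 0" by (simp add: fun_eq_iff sum_fun_apply)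
    moreover obtain v where "v \<in> B" "y = fischer v" using c(1) by auto
    ultimately have "cfun.dependent B"
      using cfun.dependent_finite[OF fin] c(2) by (auto intro!: exI[of _ "\<lambda>v. c (fischer v)"])
    then show False using B(2) by simp
  qed
  have "fischer ` B \<subseteq> cfun.span B" using fischer_bihom BP span by auto
  have "g \<in> cfun.span (fischer ` B)"
  proof (rule ccontr)
    assume g': "g \<notin> cfun.span (fischer ` B)"
    then have "cfun.independent (insert g (fischer ` B))" using ind by (rule cfun.independent_insertI)
    moreover have "insert g (fischer ` B) \<subseteq> cfun.span B" using g span \<open>fischer ` B \<subseteq> cfun.span B\<close> by simp
    ultimately have "card (insert g (fischer ` B)) \<le> card B" by (rule cfun.independent_span_bound[OF fin, THEN conjunct2])
    moreover have "g \<notin> fischer ` B" using g' cfun.span_base[of g "fischer ` B"] by (elim contrapos_nn) assumption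
    ultimately show False using fin inj by (simp add: card_image)
  qed
  then obtain c where "g = (\<Sum>v\<in>fischer ` B. (\<lambda>z. c v * v z))"
    using fin by (auto simp: cfun.span_finite)
  then have "g = fischer (\<lambda>z. \<Sum>v\<in>B. c (fischer v) * v z)"
    using fischer_sum[of B "\<lambda>v. v" m n "\<lambda>v. c (fischer v)"] fin BP
    unfolding sum.reindex[OF inj] by (simp add: fun_eq_iff sum_fun_apply)
  then show ?thesis using comb[of "\<lambda>v. c (fischer v)"] by (intro bexI) auto
qed

lemma fischer_decomposition:
  assumes f: "f \<in> bihomogeneous_polys (Suc m) (Suc n)"
  shows "\<exists>h\<in>solid_harmonics (Suc m) (Suc n). \<exists>Q\<in>bihomogeneous_polys m n. \<forall>z\<in>sphere 0 1. f z = h z + Q z"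
proof -
  have "complex_laplacian f \<in> bihomogeneous_polys m n" using laplacian_bihom[OF f] by simp
  then obtain Q where Q: "Q \<in> bihomogeneous_polys m n" "fischer Q = complex_laplacian f"
    using fischer_surjective by blast
  define h where "h z = f z + (-1) * (norm_sq z * Q z)" for z
  have h: "h \<in> bihomogeneous_polys (Suc m) (Suc n)"
    unfolding h_def[abs_def] by (rule bihom_add[OF f bihom_scale[OF norm_sq_mult_bihom[OF Q(1)]]])
  have "complex_laplacian h = (\<lambda>z. complex_laplacian f z + complex_laplacian (\<lambda>z. (-1) * (norm_sq z * Q z)) z)"
    unfolding h_def[abs_def] by (rule laplacian_add[OF f bihom_scale[OF norm_sq_mult_bihom[OF Q(1)]]])
  also have "complex_laplacian (\<lambda>z. (-1) * (norm_sq z * Q z)) = (\<lambda>z. (-1) * fischer Q z)"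
    unfolding fischer_def by (rule laplacian_scale[OF norm_sq_mult_bihom[OF Q(1)]])
  finally have "h \<in> solid_harmonics (Suc m) (Suc n)" using h by (simp add: Q(2) solid_harmonics_def)
  moreover have "\<forall>z\<in>sphere 0 1. f z = h z + Q z" by (auto simp: h_def norm_sq_eq)
  ultimately show ?thesis using Q(1) by blast
qed

lemma solid_harmonics_trivial:
  assumes "f \<in> bihomogeneous_polys m n" "m = 0 \<or> n = 0"
  shows "f \<in> solid_harmonics m n"
proof -
  have "wirtinger_z k (wirtinger_zbar k f) = (\<lambda>_. 0)" for k
    using assms wirtinger_zbar_holomorphic[of f m k] wirtinger_z_antiholomorphic[of "wirtinger_zbar k f" "n - 1" k]
      wirtinger_zbar_bihom[of f m n k] by auto
  then show ?thesis using assms by (simp add: solid_harmonics_def complex_laplacian_eq)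
qed

lemma restr_add: "restr (\<lambda>z. f z + g z) = restr f + restr g"
  by (auto simp: restr_def fun_eq_iff)

lemma restr_scale: "restr (\<lambda>z. c * f z) = (\<lambda>z. c * restr f z)"
  by (auto simp: restr_def fun_eq_iff)

lemma restr_cong: "(\<And>z. z \<in> sphere 0 1 \<Longrightarrow> f z = g z) \<Longrightarrow> restr f = restr g"
  by (auto simp: restr_def fun_eq_iff)

lemma bihom_in_span_harmonics:
  "f \<in> bihomogeneous_polys m n \<Longrightarrow> m \<le> R \<Longrightarrow> n \<le> R \<Longrightarrow> restr f \<in> cfun.span (\<Union>(m, n)\<in>{..R} \<times> {..R}. harmonics m n)"
proof (induction m arbitrary: n f)
  case 0
  then show ?case using solid_harmonics_trivial[of f 0 n]
    by (intro cfun.span_base) (force simp: harmonics_eq_image)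
next
  case (Suc m)
  show ?case
  proof (cases n)
    case 0
    then show ?thesis using Suc.prems solid_harmonics_trivial[of f "Suc m" n]
      by (intro cfun.span_base) (force simp: harmonics_eq_image)
  next
    case (Suc n')
    obtain h Q where h: "h \<in> solid_harmonics (Suc m) n" and Q: "Q \<in> bihomogeneous_polys m n'"
      and eq: "\<And>z. z \<in> sphere 0 1 \<Longrightarrow> f z = h z + Q z"
      using fischer_decomposition[of f m n'] Suc.prems(1) Suc by auto
    have "restr f = restr h + restr Q"
      unfolding restr_add[symmetric] by (rule restr_cong) (rule eq)
    moreover have "restr h \<in> cfun.span (\<Union>(m, n)\<in>{..R} \<times> {..R}. harmonics m n)"
      using h Suc.prems by (intro cfun.span_base UN_I[of "(Suc m, n)"]) (auto simp: harmonics_eq_image)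
    moreover have "restr Q \<in> cfun.span (\<Union>(m, n)\<in>{..R} \<times> {..R}. harmonics m n)"
      using Suc.prems Suc by (intro Suc.IH[OF Q]) auto
    ultimately show ?thesis by (simp only: cfun.span_add)
  qed
qed

text \<open>
  Among the bihomogeneous polynomials the restrictions of harmonic ones are characterised by orthogonality to
  lower degrees. Unlike the Laplace equation, this property is evidently
  invariant under isometries.
\<close>

lemma restr_harmonic_if_orthogonal:
  fixes f :: "'d::finite sfun"
  assumes f: "f \<in> bihomogeneous_polys m n"
    and orth: "\<And>a b. sum a UNIV + sum b UNIV < m + n \<Longrightarrow> (\<integral>z. monomial a b z * f z \<partial>\<sigma>) = 0"
  shows "restr f \<in> harmonics m n"
proof (cases "m = 0 \<or> n = 0")
  case True
  then show ?thesis using solid_harmonics_trivial[OF f] by (simp add: harmonics_eq_image)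
next
  case False
  then obtain m' n' where mn: "m = Suc m'" "n = Suc n'" by (cases m; cases n) auto
  obtain h Q where h: "h \<in> solid_harmonics m n" and Q: "Q \<in> bihomogeneous_polys m' n'"
    and eq: "\<And>z. z \<in> sphere 0 1 \<Longrightarrow> f z = h z + Q z"
    using fischer_decomposition[of f m' n'] f mn by auto
  have hb: "h \<in> bihomogeneous_polys m n" using h by (simp add: solid_harmonics_def)
  have f0: "(\<integral>z. g z * f z \<partial>\<sigma>) = 0" if "g \<in> bihomogeneous_polys n' m'" for g
    using that
  proof (induction rule: bihom_induct)
    case (monomial a b)
    then show ?case using mn by (intro orth) simp
  next
    case (add g1 g2)
    then show ?case
      by (simp add: distrib_right surf_integrable_bihom[OF bihom_mult[OF add(1) f]] surf_integrable_bihom[OF bihom_mult[OF add(2) f]])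
  qed (auto simp: mult.assoc)
  have h0: "(\<integral>z. cnj (Q z) * h z \<partial>\<sigma>) = 0"
    using mn by (intro solid_harmonic_orthogonal_lower[OF h bihom_cnj[OF Q]]) simp
  have "0 = (\<integral>z. cnj (Q z) * f z \<partial>\<sigma>)" using f0[OF bihom_cnj[OF Q]] by simp
  also have "\<dots> = (\<integral>z. cnj (Q z) * h z + Q z * cnj (Q z) \<partial>\<sigma>)"
    by (intro Bochner_Integration.integral_cong) (auto simp: eq algebra_simps)
  also have "\<dots> = (\<integral>z. cnj (Q z) * h z \<partial>\<sigma>) + (\<integral>z. Q z * cnj (Q z) \<partial>\<sigma>)"
    by (intro Bochner_Integration.integral_add surf_integrable_bihom[OF bihom_mult[OF bihom_cnj[OF Q] hb]]
        surf_integrable_bihom[OF bihom_mult[OF Q bihom_cnj[OF Q]]])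
  finally have "(\<integral>z. Q z * cnj (Q z) \<partial>\<sigma>) = 0" using h0 by simp
  then have "Q z = 0" if "z \<in> sphere 0 1" for z
    using surf_continuous_zero[OF bihom_continuous[OF Q] _ that] by blast
  then have "restr f = restr h" using eq by (intro restr_cong) simp
  then show ?thesis using h by (simp add: harmonics_eq_image)
qed

section \<open>Invariance under reflections\<close>

lemma bihom_power: "g \<in> bihomogeneous_polys 1 0 \<Longrightarrow> (\<lambda>z. g z ^ k) \<in> bihomogeneous_polys k 0"
proof (induction k)
  case (Suc k)
  then show ?case using bihom_mult[of g 1 0 "\<lambda>z. g z ^ k" k 0] by simp
qed (simp add: bihom_const)

lemma bihom_prod:
  assumes "finite J" "\<And>j. j \<in> J \<Longrightarrow> g j \<in> bihomogeneous_polys 1 0"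
  shows "(\<lambda>z. \<Prod>j\<in>J. g j z ^ a j) \<in> bihomogeneous_polys (sum a J) 0"
  using assms
proof (induction J rule: finite_induct)
  case (insert j J)
  then show ?case using bihom_mult[OF bihom_power[of "g j" "a j"], of "\<lambda>z. \<Prod>j\<in>J. g j z ^ a j" "sum a J" 0] by simp
qed (simp add: bihom_const)

lemma bihom_linear_substitution:
  fixes T :: "complex^'d::finite \<Rightarrow> complex^'d"
  assumes T: "\<And>j. (\<lambda>z. T z $ j) \<in> bihomogeneous_polys 1 0"
  shows "f \<in> bihomogeneous_polys m n \<Longrightarrow> (\<lambda>z. f (T z)) \<in> bihomogeneous_polys m n"
proof (induction rule: bihom_induct)
  case (monomial a b)
  have "(\<lambda>z. (\<Prod>j\<in>UNIV. (T z $ j) ^ a j) * cnj (\<Prod>j\<in>UNIV. (T z $ j) ^ b j)) \<in> bihomogeneous_polys (sum a UNIV + 0) (0 + sum b UNIV)"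
    by (intro bihom_mult bihom_cnj bihom_prod T) auto
  then show ?case using monomial by (simp add: monomial_def)
qed (auto intro: bihom_zero bihom_add bihom_scale)

text \<open>
  The orthogonality that characterises harmonics is transported by the substitution \<open>T\<close>, which
  is an involution and preserves the surface measure.
\<close>

lemma harmonics_isometry:
  fixes T :: "complex^'d::finite \<Rightarrow> complex^'d"
  assumes T: "\<And>j. (\<lambda>z. T z $ j) \<in> bihomogeneous_polys 1 0" "linear T" "\<And>x. norm (T x) = norm x" "\<And>x. T (T x) = x"
    and f: "f \<in> harmonics m n"
  shows "(\<lambda>z. f (T z)) \<in> harmonics m n"
proof -
  obtain g where g: "g \<in> solid_harmonics m n" "f = restr g" using f by (auto simp: harmonics_eq_image)
  have gb: "g \<in> bihomogeneous_polys m n" using g by (simp add: solid_harmonics_def)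
  have gT: "(\<lambda>z. g (T z)) \<in> bihomogeneous_polys m n" by (rule bihom_linear_substitution[OF T(1) gb])
  have "restr (\<lambda>z. g (T z)) \<in> harmonics m n"
  proof (rule restr_harmonic_if_orthogonal[OF gT])
    fix a b :: "'d \<Rightarrow> nat" assume lt: "sum a UNIV + sum b UNIV < m + n"
    have mT: "(\<lambda>z. monomial a b (T z)) \<in> bihomogeneous_polys (sum a UNIV) (sum b UNIV)"
      by (rule bihom_linear_substitution[OF T(1) bihom_monomial])
    have meas: "(\<lambda>z. monomial a b (T z) * g z) \<in> borel_measurable \<sigma>"
      using surf_integrable_bihom[OF bihom_mult[OF mT gb]] by (rule borel_measurable_integrable)
    have "(\<integral>z. monomial a b z * g (T z) \<partial>\<sigma>) = (\<integral>z. monomial a b (T z) * g z \<partial>\<sigma>)"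
      using integral_surface_isometry[OF T(2,3) meas] by (simp add: T(4))
    also have "\<dots> = 0" by (rule solid_harmonic_orthogonal_lower[OF g(1) mT lt])
    finally show "(\<integral>z. monomial a b z * g (T z) \<partial>\<sigma>) = 0" .
  qed
  moreover have "restr (\<lambda>z. g (T z)) = (\<lambda>z. f (T z))" by (auto simp: g(2) restr_def T(3))
  ultimately show ?thesis by simp
qed

definition herm :: "complex^'d::finite \<Rightarrow> complex^'d \<Rightarrow> complex" where
  "herm z w = (\<Sum>j\<in>UNIV. z $ j * cnj (w $ j))"

text \<open>
  The unitary reflection that changes the sign of \<open>v\<close> and fixes the orthogonal complement of \<open>v\<close>.
\<close>

definition reflection :: "complex^'d::finite \<Rightarrow> complex^'d \<Rightarrow> complex^'d" where
  "reflection v z = (\<chi> j. z $ j - 2 * herm z v / herm v v * v $ j)"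

lemma herm_self: "herm z z = of_real ((norm z)\<^sup>2)"
  using norm_sq_eq[of z] by (simp add: herm_def norm_sq_def)

lemma herm_cnj: "cnj (herm z w) = herm w z"
  by (simp add: herm_def mult.commute)

lemma herm_diff: "herm (\<chi> j. x $ j - c * y $ j) w = herm x w - c * herm y w"
  by (simp add: herm_def left_diff_distrib sum_subtractf sum_distrib_left mult.assoc)

lemma reflection_involution:
  assumes "v \<noteq> 0" shows "reflection v (reflection v z) = z"
proof -
  have vv: "herm v v \<noteq> 0" using assms by (simp add: herm_self)
  have "herm (reflection v z) v = herm z v - 2 * herm z v / herm v v * herm v v"
    unfolding reflection_def by (rule herm_diff)
  then have "herm (reflection v z) v = - herm z v" using vv by simp
  then show ?thesis unfolding reflection_def[of v "reflection v z"] by (simp add: vec_eq_iff reflection_def)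
qed

lemma norm_reflection:
  assumes "v \<noteq> 0" shows "norm (reflection v z) = norm z"
proof -
  have vv: "herm v v \<noteq> 0" using assms by (simp add: herm_self)
  define c where "c = 2 * herm z v / herm v v"
  have cvv: "cnj (herm v v) = herm v v" by (rule herm_cnj)
  have A: "herm (reflection v z) w = herm z w - c * herm v w" for w
    unfolding reflection_def c_def by (rule herm_diff)
  have "herm (reflection v z) (reflection v z) = herm z (reflection v z) - c * herm v (reflection v z)"
    by (rule A)
  also have "herm z (reflection v z) = cnj (herm z z - c * herm v z)"
    using herm_cnj[of "reflection v z" z] by (simp only: A)
  also have "herm v (reflection v z) = cnj (herm z v - c * herm v v)"
    using herm_cnj[of "reflection v z" v] by (simp only: A)
  also have "herm z v - c * herm v v = - herm z v" using vv by (simp add: c_def)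
  also have "cnj (herm z z - c * herm v z) - c * cnj (- herm z v) = herm z z - cnj c * herm z v + c * herm v z"
    by (simp add: herm_cnj)
  also have "cnj c * herm z v = c * herm v z"
    by (simp add: c_def herm_cnj)
  finally have "of_real ((norm (reflection v z))\<^sup>2) = (of_real ((norm z)\<^sup>2) :: complex)"
    by (simp add: herm_self)
  then have "(norm (reflection v z))\<^sup>2 = (norm z)\<^sup>2" by (simp only: of_real_eq_iff)
  then show ?thesis by simp
qed

lemma linear_reflection: "linear (reflection v)"
proof (rule linearI)
  show "reflection v (x + y) = reflection v x + reflection v y" for x y
    by (simp add: reflection_def vec_eq_iff herm_def sum.distrib add_divide_distrib distrib_left distrib_right)
  show "reflection v (r *\<^sub>R x) = r *\<^sub>R reflection v x" for r x
    by (simp add: reflection_def vec_eq_iff herm_def scaleR_conv_of_real[where 'a = complex] sum_distrib_left[symmetric] mult.assoc right_diff_distrib mult.left_commute)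
qed

lemma reflection_bihom: "(\<lambda>z. reflection v z $ j) \<in> bihomogeneous_polys 1 0"
proof -
  have "(\<lambda>z. z $ j - (2 / herm v v * v $ j) * (\<Sum>k\<in>UNIV. cnj (v $ k) * z $ k)) \<in> bihomogeneous_polys 1 0"
    by (rule bihom_diff[OF bihom_coord bihom_scale[OF bihom_sum[OF bihom_scale[OF bihom_coord]]]])
  then show ?thesis by (simp add: reflection_def herm_def mult_ac)
qed

text \<open>
  Reality of \<open>herm x y\<close> is necessary: a unitary reflection only exchanges two unit vectors whose
  inner product is real. This is why a phase is adjusted in \<open>kernel_diagonal_le\<close>.
\<close>

lemma reflection_maps:
  fixes x y :: "complex^'d::finite"
  assumes "norm x = 1" "norm y = 1" "herm x y \<in> \<real>" "x \<noteq> y"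
  shows "reflection (x - y) x = y"
proof -
  define v where "v = x - y"
  have v0: "herm v v \<noteq> 0" using assms(4) by (simp add: v_def herm_self)
  have hd: "herm (x - y) w = herm x w - herm y w" for x y w :: "complex^'d"
    by (simp add: herm_def left_diff_distrib sum_subtractf)
  have hd': "herm w (x - y) = herm w x - herm w y" for x y w :: "complex^'d"
    by (simp add: herm_def right_diff_distrib sum_subtractf)
  have "herm y x = herm x y" using assms(3) herm_cnj[of x y] by (simp add: Reals_cnj_iff)
  moreover have "herm x x = 1" "herm y y = 1" using assms by (simp_all add: herm_self)
  ultimately have "herm v v = 2 * herm x v" unfolding v_def hd hd' by simp
  then have "2 * herm x v / herm v v = 1" using v0 by simp
  then show ?thesis unfolding v_def[symmetric] by (simp add: reflection_def vec_eq_iff) (simp add: v_def)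
qed

section \<open>Orthonormal systems of continuous functions on the sphere\<close>

text \<open>
  Functions are extended by zero off the sphere, as in \<open>harmonics\<close>, so that the inner product \<open>sip\<close> is definite
  on this space and not only modulo null functions.
\<close>

definition csphere :: "('d::finite sfun) set" where
  "csphere = restr ` {g. continuous_on UNIV g}"

definition sip :: "('d::finite sfun) \<Rightarrow> ('d sfun) \<Rightarrow> complex" where
  "sip f g = (\<integral>z. f z * cnj (g z) \<partial>\<sigma>)"

lemma csphereI: "continuous_on UNIV g \<Longrightarrow> f = restr g \<Longrightarrow> f \<in> csphere"
  by (auto simp: csphere_def)

lemma csphereE:
  assumes "f \<in> csphere"
  obtains g where "continuous_on UNIV g" "f = restr g"
  using assms by (auto simp: csphere_def)

lemma csphere_scale: "f \<in> csphere \<Longrightarrow> (\<lambda>z. c * f z) \<in> csphere"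
proof -
  assume "f \<in> csphere"
  then obtain g where g: "continuous_on UNIV g" "f = restr g" by (rule csphereE)
  show ?thesis by (rule csphereI[of "\<lambda>z. c * g z"]) (auto intro!: continuous_intros g(1) simp: g(2) restr_def)
qed

lemma csphere_add: "f \<in> csphere \<Longrightarrow> g \<in> csphere \<Longrightarrow> (\<lambda>z. f z + g z) \<in> csphere"
proof -
  assume "f \<in> csphere" "g \<in> csphere"
  then obtain f' g' where g: "continuous_on UNIV f'" "f = restr f'" "continuous_on UNIV g'" "g = restr g'" by (metis csphereE)
  show ?thesis by (rule csphereI[of "\<lambda>z. f' z + g' z"]) (auto intro!: continuous_intros g(1,3) simp: g(2,4) restr_def)
qed

lemma csphere_mult: "f \<in> csphere \<Longrightarrow> g \<in> csphere \<Longrightarrow> (\<lambda>z. f z * g z) \<in> csphere"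
proof -
  assume "f \<in> csphere" "g \<in> csphere"
  then obtain f' g' where g: "continuous_on UNIV f'" "f = restr f'" "continuous_on UNIV g'" "g = restr g'" by (metis csphereE)
  show ?thesis by (rule csphereI[of "\<lambda>z. f' z * g' z"]) (auto intro!: continuous_intros g(1,3) simp: g(2,4) restr_def)
qed

lemma csphere_cnj: "f \<in> csphere \<Longrightarrow> (\<lambda>z. cnj (f z)) \<in> csphere"
proof -
  assume "f \<in> csphere"
  then obtain g where g: "continuous_on UNIV g" "f = restr g" by (rule csphereE)
  show ?thesis by (rule csphereI[of "\<lambda>z. cnj (g z)"]) (auto intro!: continuous_intros g(1) simp: g(2) restr_def)
qed

lemma csphere_zero: "(\<lambda>_. 0) \<in> csphere"
  by (rule csphereI[of "\<lambda>_. 0"]) (auto simp: restr_def)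

lemma csphere_sum: "(\<And>i. i \<in> I \<Longrightarrow> f i \<in> csphere) \<Longrightarrow> (\<lambda>z. \<Sum>i\<in>I. f i z) \<in> csphere"
proof (induction I rule: infinite_finite_induct)
  case (insert i I)
  then show ?case using csphere_add[of "f i" "\<lambda>z. \<Sum>i\<in>I. f i z"] by simp
qed (auto simp: csphere_zero)

lemma csphere_lincomb: "(\<And>u. u \<in> B \<Longrightarrow> u \<in> csphere) \<Longrightarrow> (\<lambda>z. \<Sum>u\<in>B. c u * u z) \<in> csphere"
  by (rule csphere_sum, rule csphere_scale)

lemma csphere_integrable: "f \<in> csphere \<Longrightarrow> integrable \<sigma> f"
proof -
  assume "f \<in> csphere"
  then obtain g where g: "continuous_on UNIV g" "f = restr g" by (rule csphereE)
  have "integrable \<sigma> f \<longleftrightarrow> integrable \<sigma> g"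
    by (rule Bochner_Integration.integrable_cong) (auto simp: g(2) restr_def)
  then show ?thesis using surf_integrable_continuous[OF g(1)] by simp
qed

lemma csphere_bounded: "f \<in> csphere \<Longrightarrow> \<exists>B\<ge>0. \<forall>z. cmod (f z) \<le> B"
proof -
  assume "f \<in> csphere"
  then obtain g where g: "continuous_on UNIV g" "f = restr g" by (rule csphereE)
  have "bounded (g ` sphere 0 1)"
    by (intro compact_imp_bounded compact_continuous_image continuous_on_subset[OF g(1)]) auto
  then obtain B where B: "\<forall>y\<in>g ` sphere 0 1. norm y \<le> B" unfolding bounded_iff by blast
  show ?thesis using B by (intro exI[of _ "max B 0"]) (auto simp: g(2) restr_def le_max_iff_disj)
qed

lemma csphere_off: "f \<in> csphere \<Longrightarrow> z \<notin> sphere 0 1 \<Longrightarrow> f z = 0"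
  by (auto simp: csphere_def restr_def)

lemma sip_integrable: "f \<in> csphere \<Longrightarrow> g \<in> csphere \<Longrightarrow> integrable \<sigma> (\<lambda>z. f z * cnj (g z))"
  by (intro csphere_integrable csphere_mult csphere_cnj)

lemma sip_add: "f \<in> csphere \<Longrightarrow> g \<in> csphere \<Longrightarrow> h \<in> csphere \<Longrightarrow> sip (\<lambda>z. f z + g z) h = sip f h + sip g h"
  unfolding sip_def distrib_right by (intro Bochner_Integration.integral_add sip_integrable)

lemma sip_scale: "sip (\<lambda>z. c * f z) h = c * sip f h"
  unfolding sip_def mult.assoc by (rule integral_mult_right_zero)

lemma sip_cnj: "sip g f = cnj (sip f g)"
  unfolding sip_def Bochner_Integration.integral_cnj[symmetric] complex_cnj_mult complex_cnj_cnj by (simp only: mult.commute)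

lemma sip_zero: "sip (\<lambda>_. 0) h = 0"
  by (simp add: sip_def)

lemma sip_lincomb:
  "(\<And>u. u \<in> B \<Longrightarrow> u \<in> csphere) \<Longrightarrow> h \<in> csphere \<Longrightarrow> sip (\<lambda>z. \<Sum>u\<in>B. c u * u z) h = (\<Sum>u\<in>B. c u * sip u h)"
proof (induction B rule: infinite_finite_induct)
  case (insert u B)
  have "sip (\<lambda>z. c u * u z + (\<Sum>u\<in>B. c u * u z)) h = sip (\<lambda>z. c u * u z) h + sip (\<lambda>z. \<Sum>u\<in>B. c u * u z) h"
    using insert.prems by (intro sip_add csphere_scale csphere_lincomb) auto
  then show ?case using insert by (simp add: sip_scale)
qed (auto simp: sip_zero)

lemma sip_self: "f \<in> csphere \<Longrightarrow> sip f f = of_real (\<integral>z. (cmod (f z))\<^sup>2 \<partial>\<sigma>)"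
  unfolding sip_def complex_norm_square[symmetric] by (rule integral_complex_of_real)

lemma sip_self_zero: assumes "f \<in> csphere" "sip f f = 0" shows "f = (\<lambda>_. 0)"
proof -
  obtain g where g: "continuous_on UNIV g" "f = restr g" using assms(1) by (rule csphereE)
  have "(\<integral>z. g z * cnj (g z) \<partial>\<sigma>) = 0"
    using assms(2) unfolding sip_def g(2) integral_restr .
  then have "g z = 0" if "z \<in> sphere 0 1" for z using surf_continuous_zero[OF g(1) _ that] by blast
  then show ?thesis by (auto simp: g(2) restr_def)
qed

lemma span_finite_fun: "finite B \<Longrightarrow> f \<in> cfun.span B \<longleftrightarrow> (\<exists>c. f = (\<lambda>z. \<Sum>u\<in>B. c u * u z))"
  by (auto simp: cfun.span_finite fun_eq_iff sum_fun_apply)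

lemma lincomb_span: "finite B \<Longrightarrow> (\<lambda>z. \<Sum>u\<in>B. c u * u z) \<in> cfun.span B"
  unfolding span_finite_fun by (rule exI, rule refl)

lemma orthogonal_independent:
  assumes fin: "finite B" and B: "B \<subseteq> csphere"
    and orth: "\<And>u v. u \<in> B \<Longrightarrow> v \<in> B \<Longrightarrow> u \<noteq> v \<Longrightarrow> sip u v = 0" and nz: "\<And>u. u \<in> B \<Longrightarrow> sip u u \<noteq> 0"
  shows "cfun.independent B"
proof
  assume "cfun.dependent B"
  then obtain c v where v: "v \<in> B" "c v \<noteq> 0" "(\<Sum>u\<in>B. (\<lambda>z. c u * u z)) = 0"
    using cfun.dependent_finite[OF fin] by auto
  then have 0: "(\<lambda>z. \<Sum>u\<in>B. c u * u z) = (\<lambda>_. 0)" by (simp add: fun_eq_iff sum_fun_apply)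
  have "(\<Sum>u\<in>B. c u * sip u v) = 0"
    using sip_lincomb[of B v c] B v(1) sip_zero[of v] unfolding 0 by auto
  moreover have "(\<Sum>u\<in>B. c u * sip u v) = (\<Sum>u\<in>B. if u = v then c v * sip v v else 0)"
    using orth v(1) by (intro sum.cong) auto
  ultimately show False using v nz[OF v(1)] fin by simp
qed

definition orthonormal :: "('d::finite sfun) set \<Rightarrow> bool" where
  "orthonormal B \<longleftrightarrow> finite B \<and> B \<subseteq> csphere \<and> (\<forall>u\<in>B. \<forall>v\<in>B. sip u v = (if u = v then 1 else 0))"

lemma orthonormal_independent: "orthonormal B \<Longrightarrow> cfun.independent B"
  unfolding orthonormal_def by (rule orthogonal_independent) auto

lemma orthonormal_coeff:
  assumes "orthonormal B" "v \<in> B"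
  shows "sip (\<lambda>z. \<Sum>u\<in>B. c u * u z) v = c v"
proof -
  have "sip (\<lambda>z. \<Sum>u\<in>B. c u * u z) v = (\<Sum>u\<in>B. c u * sip u v)"
    using assms by (intro sip_lincomb) (auto simp: orthonormal_def)
  also have "\<dots> = (\<Sum>u\<in>B. if u = v then c v else 0)"
    using assms by (intro sum.cong) (auto simp: orthonormal_def)
  finally show ?thesis using assms by (simp add: orthonormal_def)
qed

lemma orthonormal_expand:
  assumes B: "orthonormal B" and f: "f \<in> cfun.span B"
  shows "f = (\<lambda>z. \<Sum>u\<in>B. sip f u * u z)"
proof -
  have "finite B" using B by (simp add: orthonormal_def)
  then obtain c where c: "f = (\<lambda>z. \<Sum>u\<in>B. c u * u z)" using f span_finite_fun by blast
  have "sip f u = c u" if "u \<in> B" for u unfolding c by (rule orthonormal_coeff[OF B that])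
  then have "(\<lambda>z. \<Sum>u\<in>B. sip f u * u z) = (\<lambda>z. \<Sum>u\<in>B. c u * u z)" by (intro ext sum.cong) auto
  then show ?thesis using c by simp
qed

lemma parseval:
  assumes B: "orthonormal B"
  shows "sip (\<lambda>z. \<Sum>u\<in>B. c u * u z) (\<lambda>z. \<Sum>u\<in>B. c u * u z) = of_real (\<Sum>u\<in>B. (cmod (c u))\<^sup>2)"
proof -
  let ?f = "\<lambda>z. \<Sum>u\<in>B. c u * u z"
  have fc: "?f \<in> csphere" using B by (intro csphere_lincomb) (auto simp: orthonormal_def)
  have "sip ?f ?f = (\<Sum>u\<in>B. c u * sip u ?f)"
    using B fc by (intro sip_lincomb) (auto simp: orthonormal_def)
  also have "\<dots> = (\<Sum>u\<in>B. c u * cnj (c u))"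
  proof (rule sum.cong[OF refl])
    fix u assume u: "u \<in> B"
    have "sip u ?f = cnj (sip ?f u)" by (rule sip_cnj)
    then show "c u * sip u ?f = c u * cnj (c u)" by (simp only: orthonormal_coeff[OF B u])
  qed
  finally show ?thesis by (simp add: complex_norm_square del: of_real_power)
qed

lemma gram_schmidt:
  assumes "finite S" "S \<subseteq> csphere"
  shows "\<exists>B. orthonormal B \<and> cfun.span B = cfun.span S"
  using assms
proof (induction S rule: finite_induct)
  case empty
  then show ?case by (intro exI[of _ "{}"]) (simp add: orthonormal_def)
next
  case (insert x S)
  then obtain B where B: "orthonormal B" "cfun.span B = cfun.span S" by auto
  have fin: "finite B" and Bc: "B \<subseteq> csphere" using B(1) by (auto simp: orthonormal_def)
  have xc: "x \<in> csphere" using insert.prems by simp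
  define p where "p = (\<lambda>z. \<Sum>u\<in>B. sip x u * u z)"
  have pB: "p \<in> cfun.span B" unfolding p_def by (rule lincomb_span[OF fin])
  have pc: "p \<in> csphere" unfolding p_def using Bc by (intro csphere_lincomb) auto
  define y where "y = (\<lambda>z. x z + (-1) * p z)"
  have yc: "y \<in> csphere" unfolding y_def by (rule csphere_add[OF xc csphere_scale[OF pc]])
  have yB: "sip y v = 0" if "v \<in> B" for v
  proof -
    have vc: "v \<in> csphere" using that Bc by auto
    have "sip y v = sip x v + (-1) * sip p v"
      unfolding y_def sip_add[OF xc csphere_scale[OF pc] vc] sip_scale ..
    also have "sip p v = sip x v" unfolding p_def by (rule orthonormal_coeff[OF B(1) that])
    finally show ?thesis by simp
  qed
  show ?case
  proof (cases "y = (\<lambda>_. 0)")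
    case True
    then have "x = p" by (auto simp: y_def fun_eq_iff)
    then have "x \<in> cfun.span S" using pB B(2) by simp
    then have "cfun.span (insert x S) = cfun.span S" by (rule cfun.span_redundant)
    then show ?thesis using B by auto
  next
    case False
    define N where "N = (\<integral>z. (cmod (y z))\<^sup>2 \<partial>\<sigma>)"
    have N0: "N \<ge> 0" by (simp add: N_def)
    have yy: "sip y y = of_real N" unfolding N_def by (rule sip_self[OF yc])
    have "N \<noteq> 0" using yy sip_self_zero[OF yc] False by auto
    then have N: "N > 0" using N0 by simp
    define e where "e = (\<lambda>z. of_real (1 / sqrt N) * y z)"
    have ec: "e \<in> csphere" unfolding e_def by (rule csphere_scale[OF yc])
    have eB: "sip e v = 0" if "v \<in> B" for v unfolding e_def sip_scale yB[OF that] by simp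
    have Be: "sip v e = 0" if "v \<in> B" for v using sip_cnj[of v e] eB[OF that] by simp
    have ee: "sip e e = 1"
    proof -
      have "sip e e = of_real (1 / sqrt N) * cnj (sip e y)"
        unfolding e_def[THEN arg_cong[where f = "\<lambda>g. sip g e"]] sip_scale by (subst sip_cnj) (rule refl)
      also have "sip e y = of_real (1 / sqrt N) * of_real N" unfolding e_def sip_scale yy ..
      also have "of_real (1 / sqrt N) * cnj (of_real (1 / sqrt N) * of_real N) = (of_real ((1 / sqrt N) * ((1 / sqrt N) * N)) :: complex)"
        by (simp only: complex_cnj_complex_of_real complex_cnj_mult of_real_mult)
      also have "(1 / sqrt N) * ((1 / sqrt N) * N) = 1" using N by (simp add: field_simps)
      finally show ?thesis by simp
    qed
    have "orthonormal (insert e B)"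
      unfolding orthonormal_def
    proof (intro conjI ballI)
      fix u v assume uv: "u \<in> insert e B" "v \<in> insert e B"
      have "e \<notin> B" using eB ee by force
      then show "sip u v = (if u = v then 1 else 0)"
        using uv ee eB Be B(1) by (auto simp: orthonormal_def)
    qed (use fin Bc ec in auto)
    moreover have "cfun.span (insert e B) = cfun.span (insert x S)"
    proof
      have xS: "x \<in> cfun.span (insert x S)" by (rule cfun.span_base) simp
      have sub: "cfun.span B \<subseteq> cfun.span (insert x S)" unfolding B(2) by (rule cfun.span_mono) auto
      have "x + (\<lambda>z. (-1) * p z) \<in> cfun.span (insert x S)"
        using xS sub pB by (intro cfun.span_add cfun.span_scale) auto
      then have "y \<in> cfun.span (insert x S)" by (simp add: y_def plus_fun_def)
      then have "e \<in> cfun.span (insert x S)" unfolding e_def by (rule cfun.span_scale)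
      moreover have "B \<subseteq> cfun.span (insert x S)" using sub cfun.span_superset[of B] by (rule subset_trans[rotated])
      ultimately show "cfun.span (insert e B) \<subseteq> cfun.span (insert x S)"
        by (intro cfun.span_minimal cfun.subspace_span) simp
      have "(\<lambda>z. of_real (sqrt N) * e z) + p \<in> cfun.span (insert e B)"
      proof (intro cfun.span_add cfun.span_scale)
        show "e \<in> cfun.span (insert e B)" by (rule cfun.span_base) simp
        show "p \<in> cfun.span (insert e B)" using pB cfun.span_mono[of B "insert e B"] by auto
      qed
      moreover have "(\<lambda>z. of_real (sqrt N) * e z) + p = x"
        using N by (simp add: fun_eq_iff e_def y_def)
      ultimately have "x \<in> cfun.span (insert e B)" by simp
      moreover have "S \<subseteq> cfun.span (insert e B)"
        using cfun.span_superset[of S] cfun.span_mono[of B "insert e B"] unfolding B(2)[symmetric] by auto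
      ultimately show "cfun.span (insert x S) \<subseteq> cfun.span (insert e B)"
        by (intro cfun.span_minimal cfun.subspace_span) simp
    qed
    ultimately show ?thesis by blast
  qed
qed

section \<open>Orthonormal bases of the spaces of harmonics\<close>

lemma harmonics_csphere: "harmonics m n \<subseteq> csphere"
  by (auto simp: harmonics_eq_image solid_harmonics_def intro!: csphereI bihom_continuous)

lemma harmonics_subspace: "cfun.subspace (harmonics m n :: ('d::finite sfun) set)"
proof (rule cfun.subspaceI)
  have "restr (\<lambda>_. 0) \<in> (harmonics m n :: ('d sfun) set)"
    unfolding harmonics_eq_image by (rule imageI) (simp add: solid_harmonics_def bihom_zero complex_laplacian_eq)
  then show "0 \<in> (harmonics m n :: ('d sfun) set)" by (simp add: restr_def zero_fun_def)
  fix x y :: "'d sfun" and c :: complex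
  assume x: "x \<in> harmonics m n"
  then obtain f where f: "f \<in> solid_harmonics m n" "x = restr f" by (auto simp: harmonics_eq_image)
  have "(\<lambda>z. c * f z) \<in> solid_harmonics m n"
    using f(1) by (auto simp: solid_harmonics_def bihom_scale laplacian_scale)
  then show "(\<lambda>z. c * x z) \<in> harmonics m n"
    unfolding harmonics_eq_image f(2) restr_scale[symmetric] by (rule imageI)
  assume y: "y \<in> harmonics m n"
  then obtain g where g: "g \<in> solid_harmonics m n" "y = restr g" by (auto simp: harmonics_eq_image)
  have "(\<lambda>z. f z + g z) \<in> solid_harmonics m n"
    using f(1) g(1) by (auto simp: solid_harmonics_def bihom_add laplacian_add)
  then show "x + y \<in> harmonics m n"
    unfolding harmonics_eq_image f(2) g(2) restr_add[symmetric] by (rule imageI)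
qed

lemma restr_bihom_span:
  "f \<in> bihomogeneous_polys m n \<Longrightarrow> restr f \<in> cfun.span (restr ` monomials m n)"
proof (induction rule: bihom_induct)
  case zero
  show ?case using cfun.span_zero[of "restr ` monomials m n"] by (simp add: restr_def zero_fun_def)
next
  case (monomial a b)
  then show ?case by (intro cfun.span_base imageI) (auto simp: monomials_def)
next
  case (add f g)
  then show ?case unfolding restr_add by (intro cfun.span_add)
next
  case (scale c f)
  then show ?case unfolding restr_scale by (intro cfun.span_scale)
qed

lemma harmonics_span_monomials: "harmonics m n \<subseteq> cfun.span (restr ` monomials m n)"
  by (auto simp: harmonics_eq_image solid_harmonics_def intro: restr_bihom_span)

lemma harmonics_orthonormal_basis:
  "\<exists>B. orthonormal B \<and> cfun.span B = (harmonics m n :: ('d::finite sfun) set)"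
proof -
  obtain S where S: "S \<subseteq> (harmonics m n :: ('d sfun) set)" "cfun.independent S" "harmonics m n \<subseteq> cfun.span S"
    using cfun.maximal_independent_subset[of "harmonics m n :: ('d sfun) set"] by auto
  have "finite S"
    using cfun.independent_span_bound[of "restr ` (monomials m n :: ('d sfun) set)" S] S(2)
      finite_monomials subset_trans[OF S(1) harmonics_span_monomials] by blast
  moreover have "S \<subseteq> csphere" using S(1) harmonics_csphere by (rule subset_trans)
  moreover have "cfun.span S = harmonics m n"
    using S(1,3) harmonics_subspace by (intro subset_antisym cfun.span_minimal)
  ultimately show ?thesis using gram_schmidt[of S] by simp
qed

text \<open>
  An arbitrary orthonormal basis of \<open>harmonics m n\<close>.
\<close>

definition hbasis :: "nat \<Rightarrow> nat \<Rightarrow> ('d::finite sfun) set" where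
  "hbasis m n = (SOME B. orthonormal B \<and> cfun.span B = harmonics m n)"

lemma hbasis: "orthonormal (hbasis m n)" "cfun.span (hbasis m n) = harmonics m n"
  unfolding hbasis_def using someI_ex[OF harmonics_orthonormal_basis[of m n]] by auto

lemma finite_hbasis: "finite (hbasis m n)" and hbasis_csphere: "hbasis m n \<subseteq> csphere"
  using hbasis(1)[of m n] by (auto simp: orthonormal_def)

lemma hbasis_harmonics: "hbasis m n \<subseteq> harmonics m n"
  using cfun.span_superset[of "hbasis m n"] by (simp add: hbasis(2))

lemma sip_restr: "sip (restr f) (restr g) = (\<integral>z. f z * cnj (g z) \<partial>\<sigma>)"
  unfolding sip_def integral_restr ..

lemma harmonics_sip_zero:
  assumes "u \<in> harmonics m n" "v \<in> harmonics k l" "(m, n) \<noteq> (k, l)" shows "sip u v = 0"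
  using assms solid_harmonics_orthogonal[of _ m n _ k l] by (auto simp: harmonics_eq_image sip_restr)

lemma lincomb_at_zonal:
  fixes \<phi> :: "'d::finite sfun"
  shows "zonal m n w = (\<lambda>z. \<Sum>u\<in>hbasis m n. cnj (u w) * u z)"
  unfolding zonal_def
proof (rule the_equality)
  let ?Z = "\<lambda>z. \<Sum>u\<in>hbasis m n. cnj (u w) * u z"
  have Zh: "?Z \<in> harmonics m n"
    unfolding hbasis(2)[symmetric] by (rule lincomb_span[OF finite_hbasis])
  have rep: "f w = sip f ?Z" if f: "f \<in> harmonics m n" for f
  proof -
    have fe: "f = (\<lambda>z. \<Sum>u\<in>hbasis m n. sip f u * u z)"
      by (rule orthonormal_expand[OF hbasis(1)]) (simp add: hbasis(2) f)
    have fc: "f \<in> csphere" using f harmonics_csphere by auto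
    have "sip f ?Z = cnj (sip ?Z f)" by (rule sip_cnj)
    also have "sip ?Z f = (\<Sum>u\<in>hbasis m n. cnj (u w) * sip u f)"
      using hbasis_csphere fc by (intro sip_lincomb) auto
    also have "cnj \<dots> = (\<Sum>u\<in>hbasis m n. sip f u * u w)"
      unfolding cnj_sum complex_cnj_mult complex_cnj_cnj sip_cnj[of f, symmetric] by (simp only: mult.commute)
    also have "\<dots> = f w" using fun_cong[OF fe, of w] by simp
    finally show ?thesis by simp
  qed
  then show "?Z \<in> harmonics m n \<and> (\<forall>f\<in>harmonics m n. f w = (\<integral>z. f z * cnj (?Z z) \<partial>\<sigma>))"
    using Zh by (simp add: sip_def)
  fix Y assume Y: "Y \<in> harmonics m n \<and> (\<forall>f\<in>harmonics m n. f w = (\<integral>z. f z * cnj (Y z) \<partial>\<sigma>))"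
  define D where "D = (\<lambda>z. Y z + (-1) * ?Z z)"
  have "Y + (\<lambda>z. (-1) * ?Z z) \<in> harmonics m n"
    using Y Zh harmonics_subspace[of m n] by (intro cfun.subspace_add cfun.subspace_scale) auto
  then have Dh: "D \<in> harmonics m n" by (simp add: D_def plus_fun_def)
  have Yc: "Y \<in> csphere" and Zc: "?Z \<in> csphere" and Dc: "D \<in> csphere" using Y Zh Dh harmonics_csphere by auto
  have "sip D Y = sip D ?Z" using rep[OF Dh] Y Dh by (simp add: sip_def)
  then have "sip Y D = sip ?Z D" using sip_cnj[of Y D] sip_cnj[of ?Z D] by (simp only:)
  moreover have "sip D D = sip Y D + (-1) * sip ?Z D"
    unfolding D_def[THEN arg_cong[where f = "\<lambda>g. sip g D"]] sip_add[OF Yc csphere_scale[OF Zc] Dc] sip_scale ..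
  ultimately have "sip D D = 0" by simp
  then have "D = (\<lambda>_. 0)" by (rule sip_self_zero[OF Dc])
  then show "Y = ?Z" by (auto simp: D_def fun_eq_iff)
qed

lemma csphere_mult_integrable:
  assumes "integrable \<sigma> \<phi>" "u \<in> csphere"
  shows "integrable \<sigma> (\<lambda>z. \<phi> z * cnj (u z))"
proof -
  obtain B where B: "B \<ge> 0" "\<And>z. cmod (u z) \<le> B" using csphere_bounded[OF assms(2)] by blast
  have [measurable]: "u \<in> borel_measurable \<sigma>" "\<phi> \<in> borel_measurable \<sigma>"
    using csphere_integrable[OF assms(2)] assms(1) by (auto intro: borel_measurable_integrable)
  have cnjm [measurable]: "cnj \<in> borel_measurable borel"
    by (intro borel_measurable_continuous_onI continuous_intros)
  show ?thesis
  proof (rule Bochner_Integration.integrable_bound[of _ "\<lambda>z. B * cmod (\<phi> z)"])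
    show "integrable \<sigma> (\<lambda>z. B * cmod (\<phi> z))" using assms(1) by auto
    show "AE z in \<sigma>. cmod (\<phi> z * cnj (u z)) \<le> norm (B * cmod (\<phi> z))"
      using B by (intro AE_I2) (simp add: norm_mult mult.commute[of B] mult_left_mono)
  qed measurable
qed

lemma zonal_conv_eq:
  assumes "integrable \<sigma> \<phi>"
  shows "zonal_conv \<phi> m n w = (\<Sum>u\<in>hbasis m n. sip \<phi> u * u w)"
proof -
  have "zonal_conv \<phi> m n w = (\<integral>z. (\<Sum>u\<in>hbasis m n. u w * (\<phi> z * cnj (u z))) \<partial>\<sigma>)"
    unfolding zonal_conv_def lincomb_at_zonal by (simp add: sum_distrib_left mult_ac)
  also have "\<dots> = (\<Sum>u\<in>hbasis m n. \<integral>z. u w * (\<phi> z * cnj (u z)) \<partial>\<sigma>)"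
    using hbasis_csphere by (intro Bochner_Integration.integral_sum integrable_mult_right csphere_mult_integrable assms) auto
  also have "\<dots> = (\<Sum>u\<in>hbasis m n. sip \<phi> u * u w)"
    unfolding sip_def by (simp add: mult.commute)
  finally show ?thesis .
qed

section \<open>The addition theorem\<close>

lemma bessel_pointwise:
  assumes B: "orthonormal B" and f: "f \<in> cfun.span B"
  shows "(cmod (f x))\<^sup>2 \<le> (\<integral>z. (cmod (f z))\<^sup>2 \<partial>\<sigma>) * (\<Sum>u\<in>B. (cmod (u x))\<^sup>2)"
proof -
  have fe: "f = (\<lambda>z. \<Sum>u\<in>B. sip f u * u z)" by (rule orthonormal_expand[OF B f])
  have fc: "f \<in> csphere" using B by (subst fe) (intro csphere_lincomb, auto simp: orthonormal_def)
  have "sip f f = of_real (\<Sum>u\<in>B. (cmod (sip f u))\<^sup>2)"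
    using parseval[OF B, of "sip f"] fe by simp
  then have N: "(\<integral>z. (cmod (f z))\<^sup>2 \<partial>\<sigma>) = (\<Sum>u\<in>B. (cmod (sip f u))\<^sup>2)"
    unfolding sip_self[OF fc] by (simp only: of_real_eq_iff)
  have "cmod (f x) \<le> (\<Sum>u\<in>B. cmod (sip f u * u x))" by (subst fe) (rule norm_sum)
  also have "\<dots> = (\<Sum>u\<in>B. \<bar>cmod (sip f u)\<bar> * \<bar>cmod (u x)\<bar>)" by (simp add: norm_mult)
  also have "\<dots> \<le> L2_set (\<lambda>u. cmod (sip f u)) B * L2_set (\<lambda>u. cmod (u x)) B" by (rule L2_set_mult_ineq)
  finally have "(cmod (f x))\<^sup>2 \<le> (L2_set (\<lambda>u. cmod (sip f u)) B * L2_set (\<lambda>u. cmod (u x)) B)\<^sup>2"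
    by (intro power_mono) auto
  then show ?thesis unfolding N L2_set_def power_mult_distrib by (simp add: sum_nonneg)
qed

text \<open>
  After a change of phase, which does not affect the moduli by bihomogeneity, a reflection \<open>T\<close> maps \<open>x\<close> to \<open>y\<close>.
  The reproducing kernel \<open>f\<close> at \<open>y\<close> has square norm and value at \<open>y\<close> equal to \<open>K y\<close>, and its composition with \<open>T\<close> is again harmonic, has the same norm and
  takes that value at \<open>x\<close>; the extremal property of \<open>K x\<close> gives \<open>(K y)\<^sup>2 \<le> K y * K x\<close>.
\<close>

lemma kernel_diagonal_le:
  fixes x y :: "complex^'d::finite"
  assumes x: "x \<in> sphere 0 1" and y: "y \<in> sphere 0 1"
  shows "(\<Sum>u\<in>hbasis m n. (cmod (u y))\<^sup>2) \<le> (\<Sum>u\<in>hbasis m n. (cmod (u x))\<^sup>2)"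
proof -
  define K where "K = (\<lambda>x::complex^'d. \<Sum>u\<in>hbasis m n. (cmod (u x))\<^sup>2)"
  define c where "c = (if herm x y = 0 then 1 else herm x y / of_real (cmod (herm x y)))"
  have c1: "cmod c = 1" by (auto simp: c_def norm_divide)
  define y' where "y' = (\<chi> j. c * y $ j)"
  have ny: "norm y' = norm y" using c1 by (simp add: y'_def norm_vec_def norm_mult)
  have real: "herm x y' \<in> \<real>"
  proof -
    have "herm x y' = cnj c * herm x y" by (simp add: herm_def y'_def sum_distrib_left mult_ac)
    also have "\<dots> = of_real (cmod (herm x y))"
    proof (cases "herm x y = 0")
      case False
      have "cnj (herm x y) * herm x y = of_real ((cmod (herm x y))\<^sup>2)" by (simp add: complex_norm_square mult.commute del: of_real_power)
      then show ?thesis using False by (simp add: c_def power2_eq_square)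
    qed simp
    finally show ?thesis by simp
  qed
  have phase: "cmod (u y') = cmod (u y)" if u: "u \<in> hbasis m n" for u
  proof -
    obtain g where g: "g \<in> solid_harmonics m n" "u = restr g" using hbasis_harmonics[THEN subsetD, OF u] by (auto simp: harmonics_eq_image)
    have "g y' = c ^ m * cnj c ^ n * g y"
      unfolding y'_def using g(1) by (intro bihom_phase[OF c1]) (simp add: solid_harmonics_def)
    then show ?thesis using y ny c1 by (simp add: g(2) restr_def norm_mult norm_power)
  qed
  then have Ky: "K y' = K y" unfolding K_def by (intro sum.cong) auto
  have "K y' \<le> K x"
  proof (cases "x = y'")
    case False
    define T where "T = reflection (x - y')"
    have v: "x - y' \<noteq> 0" using False by simp
    have Tb: "(\<lambda>z. T z $ j) \<in> bihomogeneous_polys 1 0" for j unfolding T_def by (rule reflection_bihom)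
    have Tl: "linear T" unfolding T_def by (rule linear_reflection)
    have Tn: "norm (T z) = norm z" for z unfolding T_def by (rule norm_reflection[OF v])
    have Ti: "T (T z) = z" for z unfolding T_def by (rule reflection_involution[OF v])
    have Tx: "T x = y'" unfolding T_def using x y ny real False by (intro reflection_maps) auto
    define f where "f = (\<lambda>z. \<Sum>u\<in>hbasis m n. cnj (u y') * u z)"
    have fh: "f \<in> harmonics m n" unfolding f_def hbasis(2)[symmetric] by (rule lincomb_span[OF finite_hbasis])
    have fy: "f y' = of_real (K y')"
      unfolding f_def K_def by (simp add: complex_norm_square mult.commute del: of_real_power)
    have gh: "(\<lambda>z. f (T z)) \<in> harmonics m n"
      by (rule harmonics_isometry[of T, OF Tb Tl Tn Ti fh])
    have fc: "f \<in> csphere" using fh harmonics_csphere by auto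
    have ff: "sip f f = of_real (K y')"
      unfolding f_def parseval[OF hbasis(1)] by (simp add: K_def)
    then have If: "(\<integral>z. (cmod (f z))\<^sup>2 \<partial>\<sigma>) = K y'"
      unfolding sip_self[OF fc] by (simp only: of_real_eq_iff)
    have "(\<lambda>z. (cmod (f z))\<^sup>2) \<in> borel_measurable \<sigma>"
      using csphere_integrable[OF fc, THEN borel_measurable_integrable] by measurable
    then have "(\<integral>z. (cmod (f (T z)))\<^sup>2 \<partial>\<sigma>) = (\<integral>z. (cmod (f z))\<^sup>2 \<partial>\<sigma>)"
      by (rule integral_surface_isometry[OF Tl Tn])
    moreover have "(cmod (f (T x)))\<^sup>2 \<le> (\<integral>z. (cmod (f (T z)))\<^sup>2 \<partial>\<sigma>) * K x"
      unfolding K_def by (rule bessel_pointwise[OF hbasis(1)]) (simp add: hbasis(2) gh)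
    ultimately have le: "(K y')\<^sup>2 \<le> K y' * K x" unfolding If Tx fy by simp
    have K0: "K z \<ge> 0" for z by (simp add: K_def sum_nonneg)
    show ?thesis
    proof (cases "K y' = 0")
      case False
      then have "K y' > 0" using K0[of y'] by simp
      then show ?thesis using le by (simp add: power2_eq_square)
    qed (simp add: K0)
  qed simp
  then show ?thesis unfolding Ky unfolding K_def .
qed

text \<open>
  The sum is constant on the sphere by \<open>kernel_diagonal_le\<close>, and its integral is the number of basis elements.
\<close>

theorem addition_theorem:
  fixes x :: "complex^'d::finite"
  assumes x: "x \<in> sphere 0 1"
  shows "(\<Sum>u\<in>hbasis m n. (cmod (u x))\<^sup>2) =
    card (hbasis m n :: ('d sfun) set) / measure (\<sigma> :: (complex^'d) measure) (sphere 0 1)"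
proof -
  let ?B = "hbasis m n :: ('d sfun) set"
  define k where "k = (\<Sum>u\<in>?B. (cmod (u x))\<^sup>2)"
  have const: "(\<Sum>u\<in>?B. (cmod (u y))\<^sup>2) = k" if "y \<in> sphere 0 1" for y
    unfolding k_def by (intro antisym kernel_diagonal_le x that)
  have int: "integrable \<sigma> (\<lambda>z. (cmod (u z))\<^sup>2)" if "u \<in> ?B" for u
  proof -
    have "u \<in> csphere" using that hbasis_csphere by auto
    then have "integrable \<sigma> (\<lambda>z. cmod (u z * cnj (u z)))" by (intro integrable_norm sip_integrable)
    then show ?thesis by (simp add: norm_mult power2_eq_square)
  qed
  have one: "(\<integral>z. (cmod (u z))\<^sup>2 \<partial>\<sigma>) = 1" if "u \<in> ?B" for u
  proof -
    have "complex_of_real (\<integral>z. (cmod (u z))\<^sup>2 \<partial>\<sigma>) = 1"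
      using that hbasis(1)[of m n] sip_self[of u] by (auto simp: orthonormal_def)
    then show ?thesis by simp
  qed
  have "k * measure (\<sigma> :: (complex^'d) measure) (sphere 0 1) = (\<integral>z. k \<partial>(\<sigma> :: (complex^'d) measure))"
    by simp
  also have "\<dots> = (\<integral>z. (\<Sum>u\<in>?B. (cmod (u z))\<^sup>2) \<partial>\<sigma>)"
    by (rule Bochner_Integration.integral_cong) (auto simp: const)
  also have "\<dots> = (\<Sum>u\<in>?B. \<integral>z. (cmod (u z))\<^sup>2 \<partial>\<sigma>)"
    by (intro Bochner_Integration.integral_sum int)
  also have "\<dots> = card ?B" by (simp add: one)
  finally show ?thesis using surface_mass_pos[where 'd = 'd] unfolding k_def by (simp add: field_simps)
qed

section \<open>Blocks of levels\<close>

definition hblock :: "(nat \<times> nat) set \<Rightarrow> ('d::finite sfun) set" where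
  "hblock I = (\<Union>(m, n)\<in>I. hbasis m n)"

lemma hbasis_disjoint: "(m, n) \<noteq> (k, l) \<Longrightarrow> hbasis m n \<inter> (hbasis k l :: ('d::finite sfun) set) = {}"
proof (rule ccontr)
  assume ne: "(m, n) \<noteq> (k, l)" and "hbasis m n \<inter> (hbasis k l :: ('d sfun) set) \<noteq> {}"
  then obtain u where u: "u \<in> hbasis m n" "u \<in> (hbasis k l :: ('d sfun) set)" by blast
  then have "sip u u = 0"
    by (intro harmonics_sip_zero[OF _ _ ne] hbasis_harmonics[THEN subsetD])
  moreover have "sip u u = 1" using u hbasis(1)[of m n] by (auto simp: orthonormal_def)
  ultimately show False by simp
qed

lemma orthonormal_hblock: "finite I \<Longrightarrow> orthonormal (hblock I :: ('d::finite sfun) set)"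
  unfolding orthonormal_def
proof (intro conjI ballI)
  assume I: "finite I"
  show "finite (hblock I :: ('d sfun) set)" unfolding hblock_def using I finite_hbasis by auto
  show "hblock I \<subseteq> (csphere :: ('d sfun) set)" unfolding hblock_def using hbasis_csphere by auto
  fix u v :: "'d sfun" assume "u \<in> hblock I" "v \<in> hblock I"
  then obtain m n k l where u: "u \<in> hbasis m n" and v: "v \<in> hbasis k l" by (auto simp: hblock_def)
  show "sip u v = (if u = v then 1 else 0)"
  proof (cases "(m, n) = (k, l)")
    case True
    then show ?thesis using u v hbasis(1)[of m n] by (auto simp: orthonormal_def)
  next
    case False
    then have "u \<noteq> v" using hbasis_disjoint[OF False] u v by auto
    moreover have "sip u v = 0"
      using u v by (intro harmonics_sip_zero[OF _ _ False] hbasis_harmonics[THEN subsetD])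
    ultimately show ?thesis by simp
  qed
qed

lemma hblock_disjoint: "I \<inter> J = {} \<Longrightarrow> hblock I \<inter> (hblock J :: ('d::finite sfun) set) = {}"
proof (rule ccontr)
  assume IJ: "I \<inter> J = {}" and "hblock I \<inter> (hblock J :: ('d sfun) set) \<noteq> {}"
  then obtain u :: "'d sfun" and m n k l where "u \<in> hbasis m n" "u \<in> hbasis k l" "(m, n) \<in> I" "(k, l) \<in> J" by (auto simp: hblock_def)
  then show False using IJ hbasis_disjoint[of m n k l, where 'd = 'd] by auto
qed

lemma sum_hblock:
  fixes g :: "('d::finite sfun) \<Rightarrow> real"
  assumes "finite I"
  shows "(\<Sum>u\<in>hblock I. g u) = (\<Sum>(m, n)\<in>I. \<Sum>u\<in>hbasis m n. g u)"
proof -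
  have "(\<Sum>u\<in>(\<Union>p\<in>I. hbasis (fst p) (snd p)). g u) = (\<Sum>p\<in>I. \<Sum>u\<in>hbasis (fst p) (snd p). g u)"
  proof (rule sum.UNION_disjoint)
    show "\<forall>i\<in>I. \<forall>j\<in>I. i \<noteq> j \<longrightarrow> hbasis (fst i) (snd i) \<inter> (hbasis (fst j) (snd j) :: ('d sfun) set) = {}"
      using hbasis_disjoint by (metis prod.collapse)
  qed (use assms finite_hbasis in auto)
  then show ?thesis by (simp add: hblock_def split_def)
qed

lemma hblock_kernel:
  fixes x :: "complex^'d::finite"
  assumes "finite I" "x \<in> sphere 0 1"
  shows "(\<Sum>u\<in>hblock I. (cmod (u x))\<^sup>2) =
    card (hblock I :: ('d sfun) set) / measure (\<sigma> :: (complex^'d) measure) (sphere 0 1)"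
proof -
  have "real (card (hblock I :: ('d sfun) set)) = (\<Sum>u\<in>(hblock I :: ('d sfun) set). 1)" by simp
  also have "\<dots> = (\<Sum>(m, n)\<in>I. real (card (hbasis m n :: ('d sfun) set)))"
    unfolding sum_hblock[OF assms(1)] by simp
  finally show ?thesis
    unfolding sum_hblock[OF assms(1)] by (simp add: addition_theorem[OF assms(2)] sum_divide_distrib split_def)
qed

lemma finite_max_le: "finite {(m, n). (max m n :: nat) \<le> R}"
  by (rule finite_subset[of _ "{..R} \<times> {..R}"]) auto

definition levels :: "nat \<Rightarrow> nat \<Rightarrow> (nat \<times> nat) set" where
  "levels a b = {(m, n). a < max m n \<and> max m n \<le> b}"

lemma finite_levels: "finite (levels a b)"
  by (rule finite_subset[OF _ finite_max_le[of b]]) (auto simp: levels_def)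

lemma span_hblock:
  "cfun.span (hblock I :: ('d::finite sfun) set) = cfun.span (\<Union>(m, n)\<in>I. harmonics m n)"
proof
  show "cfun.span (hblock I :: ('d sfun) set) \<subseteq> cfun.span (\<Union>(m, n)\<in>I. harmonics m n)"
    unfolding hblock_def using hbasis_harmonics by (intro cfun.span_mono UN_mono) auto
  have "harmonics m n \<subseteq> cfun.span (hblock I :: ('d sfun) set)" if "(m, n) \<in> I" for m n
    unfolding hbasis(2)[symmetric] using that by (intro cfun.span_mono) (auto simp: hblock_def)
  then show "cfun.span (\<Union>(m, n)\<in>I. harmonics m n) \<subseteq> cfun.span (hblock I :: ('d sfun) set)"
    by (intro cfun.span_minimal cfun.subspace_span) auto
qed

lemma theta_eq_card: "theta TYPE('d::finite) a b = card (hblock (levels a b) :: ('d sfun) set)"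
proof -
  have lv: "cfun.dim (harmonics_level j :: ('d sfun) set) = card (hblock {(m, n). max m n = j} :: ('d sfun) set)" for j
  proof -
    have fin: "finite {(m, n). (max m n :: nat) = j}" by (rule finite_subset[OF _ finite_max_le[of j]]) auto
    show ?thesis unfolding harmonics_level_def span_hblock[symmetric]
      by (rule cfun.dim_span_eq_card_independent[OF orthonormal_independent[OF orthonormal_hblock[OF fin]]])
  qed
  have "hblock (levels a b) = (\<Union>j\<in>{a + 1..b}. hblock {(m, n). max m n = j} :: ('d sfun) set)"
    unfolding hblock_def levels_def by (auto; force)
  moreover have "card (\<Union>j\<in>{a + 1..b}. hblock {(m, n). max m n = j} :: ('d sfun) set)
     = (\<Sum>j = a + 1..b. card (hblock {(m, n). max m n = j} :: ('d sfun) set))"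
  proof (intro card_UN_disjoint ballI impI)
    fix j
    have "finite {(m, n). (max m n :: nat) = j}" by (rule finite_subset[OF _ finite_max_le[of j]]) auto
    then show "finite (hblock {(m, n). max m n = j} :: ('d sfun) set)"
      using orthonormal_hblock by (auto simp: orthonormal_def)
    fix k assume "j \<noteq> k"
    then show "hblock {(m, n). max m n = j} \<inter> (hblock {(m, n). max m n = k} :: ('d sfun) set) = {}"
      by (intro hblock_disjoint) auto
  qed simp
  ultimately show ?thesis by (simp add: theta_def lv)
qed

text \<open>
  For at least two coordinates there are already \<open>l + 1\<close> holomorphic monomials of degree \<open>l\<close> in two of them.
  They are orthogonal and harmonic.
\<close>

lemma card_hbasis_holomorphic:
  assumes "CARD('d::finite) \<ge> 2"
  shows "l + 1 \<le> card (hbasis l 0 :: ('d sfun) set)"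
proof -
  obtain j1 j2 :: 'd where j: "j1 \<noteq> j2"
    using assms card_le_Suc0_iff_eq[of "UNIV :: 'd set"] by auto
  define a where "a i = (\<lambda>j. if j = j1 then i else if j = j2 then l - i else 0)" for i
  have sa: "sum (a i) UNIV = l" if "i \<le> l" for i
  proof -
    have "sum (a i) UNIV = sum (a i) {j1, j2}" by (rule sum.mono_neutral_right) (auto simp: a_def)
    then show ?thesis using j that by (simp add: a_def)
  qed
  define g where "g i = restr (monomial (a i) (\<lambda>_. 0) :: 'd sfun)" for i
  have gm: "monomial (a i) (\<lambda>_. 0) \<in> (bihomogeneous_polys l 0 :: ('d sfun) set)" if "i \<le> l" for i
    using bihom_monomial[of "a i" "\<lambda>_. 0"] sa[OF that] by simp
  have gh: "g i \<in> harmonics l 0" if "i \<le> l" for i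
    unfolding harmonics_eq_image g_def by (intro imageI solid_harmonics_trivial gm that) simp
  have gc: "g i \<in> csphere" if "i \<le> l" for i using gh[OF that] harmonics_csphere by auto
  have orth: "sip (g i) (g k) = 0" if "i \<noteq> k" for i k
  proof -
    have "a i \<noteq> a k"
    proof
      assume "a i = a k"
      then have "a i j1 = a k j1" by simp
      then show False using that by (simp add: a_def)
    qed
    then show ?thesis
      unfolding g_def sip_restr cnj_monomial monomial_mult using integral_monomial_zero[of "a i" "a k"] by simp
  qed
  have nz: "sip (g i) (g i) \<noteq> 0" if "i \<le> l" for i
  proof
    assume "sip (g i) (g i) = 0"
    then have g0: "g i = (\<lambda>_. 0)" by (rule sip_self_zero[OF gc[OF that]])
    have "monomial (a i) (\<lambda>_. 0) z = 0" if "z \<in> sphere (0::complex^'d) 1" for z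
      using that fun_cong[OF g0, of z] by (simp add: g_def restr_def)
    then have "monomial (a i) (\<lambda>_. 0) = (\<lambda>_::complex^'d. 0)" by (rule bihom_eq_zero[OF gm[OF that]])
    then have "monomial (a i) (\<lambda>_. 0) (\<chi> j. 1 :: complex^'d) = 0" by (rule fun_cong)
    then show False by (simp add: monomial_def)
  qed
  have inj: "inj_on g {..l}"
    using orth nz by (intro inj_onI) (metis atMost_iff)
  have "cfun.independent (g ` {..l})"
  proof (rule orthogonal_independent)
    fix u v assume "u \<in> g ` {..l}" "v \<in> g ` {..l}" "u \<noteq> v"
    then obtain i k where "u = g i" "v = g k" "i \<noteq> k" by blast
    then show "sip u v = 0" using orth by simp
  qed (use gc nz in auto)
  moreover have "g ` {..l} \<subseteq> cfun.span (hbasis l 0)" using gh by (auto simp: hbasis(2))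
  ultimately have "card (g ` {..l}) \<le> card (hbasis l 0 :: ('d sfun) set)"
    by (rule cfun.independent_span_bound[OF finite_hbasis, THEN conjunct2])
  then show ?thesis by (simp add: card_image[OF inj])
qed

lemma theta_lower:
  assumes "CARD('d::finite) \<ge> 2" "a < b"
  shows "b + 1 \<le> theta TYPE('d) a b"
proof -
  have "hbasis b 0 \<subseteq> (hblock (levels a b) :: ('d sfun) set)"
    using assms(2) by (force simp: hblock_def levels_def)
  then have "card (hbasis b 0 :: ('d sfun) set) \<le> card (hblock (levels a b) :: ('d sfun) set)"
    using orthonormal_hblock[OF finite_levels] by (intro card_mono) (auto simp: orthonormal_def)
  then show ?thesis using card_hbasis_holomorphic[OF assms(1), of b] by (simp add: theta_eq_card)
qed

text \<open>
  A crude polynomial bound; only its logarithm matters for \<open>q = \<infinity>\<close>.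
\<close>

lemma card_hblock_upper:
  "card (hblock ({..R} \<times> {..R}) :: ('d::finite sfun) set) \<le> ((R + 1) ^ CARD('d)) ^ 2"
proof -
  let ?A = "(\<Pi>\<^sub>E j\<in>(UNIV :: 'd set). {..R})"
  let ?M = "restr ` (\<lambda>(a, b). monomial a b :: 'd sfun) ` (?A \<times> ?A)"
  have finA: "finite ?A" by (intro finite_PiE) auto
  have mem: "a \<in> ?A" if "sum a UNIV \<le> R" for a :: "'d \<Rightarrow> nat"
  proof -
    have "a j \<le> R" for j using member_le_sum[of j UNIV a] that by simp
    then show ?thesis by (auto simp: PiE_def)
  qed
  have mon: "monomials m n \<subseteq> (\<lambda>(a, b). monomial a b :: 'd sfun) ` (?A \<times> ?A)" if "m \<le> R" "n \<le> R" for m n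
  proof
    fix p :: "'d sfun" assume "p \<in> monomials m n"
    then obtain a b where p: "p = monomial a b" "sum a UNIV = m" "sum b UNIV = n" by (auto simp: monomials_def)
    show "p \<in> (\<lambda>(a, b). monomial a b) ` (?A \<times> ?A)"
      by (rule image_eqI[of _ _ "(a, b)"]) (use p that mem in simp_all)
  qed
  have "hblock ({..R} \<times> {..R}) \<subseteq> cfun.span ?M"
  proof
    fix u :: "'d sfun" assume "u \<in> hblock ({..R} \<times> {..R})"
    then obtain m n where mn: "m \<le> R" "n \<le> R" "u \<in> hbasis m n" by (auto simp: hblock_def)
    have "u \<in> cfun.span (restr ` monomials m n)"
      using hbasis_harmonics harmonics_span_monomials mn(3) by (rule subsetD[OF subset_trans])
    then show "u \<in> cfun.span ?M"
      using cfun.span_mono[OF image_mono[OF mon[OF mn(1,2)]], of restr] by (rule subsetD[rotated])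
  qed
  then have "card (hblock ({..R} \<times> {..R}) :: ('d sfun) set) \<le> card ?M"
    using finA orthonormal_independent[OF orthonormal_hblock[of "{..R} \<times> {..R}"]]
    by (intro cfun.independent_span_bound[THEN conjunct2]) auto
  also have "\<dots> \<le> card (?A \<times> ?A)"
    using finA by (intro order_trans[OF card_image_le card_image_le]) auto
  also have "\<dots> = ((R + 1) ^ CARD('d)) ^ 2"
    by (simp add: card_cartesian_product card_PiE power2_eq_square)
  finally show ?thesis .
qed

section \<open>Completeness of the harmonics\<close>

definition polys_le :: "nat \<Rightarrow> ('d::finite sfun) set" where
  "polys_le R = cfun.span (hblock ({..R} \<times> {..R}))"

lemma polys_le_eq: "polys_le R = cfun.span (\<Union>(m, n)\<in>{..R} \<times> {..R}. harmonics m n)"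
  unfolding polys_le_def by (rule span_hblock)

lemma polys_le_mono: "R \<le> S \<Longrightarrow> polys_le R \<subseteq> polys_le S"
  unfolding polys_le_eq by (rule cfun.span_mono) fastforce

lemma restr_bihom_polys_le: "f \<in> bihomogeneous_polys m n \<Longrightarrow> m \<le> R \<Longrightarrow> n \<le> R \<Longrightarrow> restr f \<in> polys_le R"
  unfolding polys_le_eq by (rule bihom_in_span_harmonics)

lemma polys_le_add: "f \<in> polys_le R \<Longrightarrow> g \<in> polys_le R \<Longrightarrow> (\<lambda>z. f z + g z) \<in> polys_le R"
  unfolding polys_le_def using cfun.span_add[of f _ g] by (simp add: plus_fun_def)

lemma polys_le_scale: "f \<in> polys_le R \<Longrightarrow> (\<lambda>z. c * f z) \<in> polys_le R"
  unfolding polys_le_def by (rule cfun.span_scale)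

lemma polys_le_zero: "(\<lambda>_. 0) \<in> polys_le R"
  unfolding polys_le_def using cfun.span_zero by (simp add: zero_fun_def)

lemma polys_le_induct [consumes 1, case_names zero harmonic add scale]:
  assumes f: "f \<in> polys_le R" and Q0: "Q (\<lambda>_. 0)"
    and harm: "\<And>m n h. m \<le> R \<Longrightarrow> n \<le> R \<Longrightarrow> h \<in> bihomogeneous_polys m n \<Longrightarrow> Q (restr h)"
    and add: "\<And>f g. Q f \<Longrightarrow> Q g \<Longrightarrow> Q (\<lambda>z. f z + g z)"
    and scale: "\<And>c f. Q f \<Longrightarrow> Q (\<lambda>z. c * f z)"
  shows "Q f"
  using f unfolding polys_le_eq
proof (induction rule: cfun.span_induct_alt)
  case base
  then show ?case using Q0 by (simp add: zero_fun_def)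
next
  case (step c x y)
  obtain m n where mn: "m \<le> R" "n \<le> R" "x \<in> harmonics m n" using step(1) by auto
  then obtain h where "h \<in> bihomogeneous_polys m n" "x = restr h" by (auto simp: harmonics_eq_image solid_harmonics_def)
  then have "Q x" using harm mn by simp
  then show ?case using add[OF scale[of x c] step(2)] by (simp add: plus_fun_def)
qed

text \<open>
  Stability under products is what the harmonic spaces alone do not have; it needs the Fischer
  decomposition of all bihomogeneous polynomials.
\<close>

lemma polys_le_mult:
  assumes "f \<in> polys_le R" "g \<in> polys_le S"
  shows "(\<lambda>z. f z * g z) \<in> polys_le (R + S)"
  using assms(1)
proof (induction rule: polys_le_induct)
  case (harmonic m n h)
  show ?case using assms(2)
  proof (induction rule: polys_le_induct)
    case (harmonic k l h')
    have "restr (\<lambda>z. h z * h' z) \<in> polys_le (R + S)"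
      by (rule restr_bihom_polys_le[OF bihom_mult[OF \<open>h \<in> bihomogeneous_polys m n\<close> harmonic(3)]])
         (use harmonic \<open>m \<le> R\<close> \<open>n \<le> R\<close> in auto)
    moreover have "restr (\<lambda>z. h z * h' z) = (\<lambda>z. restr h z * restr h' z)" by (auto simp: restr_def)
    ultimately show ?case by simp
  next
    case (add f g)
    then show ?case using polys_le_add[OF add] by (simp add: distrib_left)
  next
    case (scale c f)
    then show ?case using polys_le_scale[OF scale, of c] by (simp add: mult.left_commute)
  qed (simp add: polys_le_zero)
next
  case (add f g)
  then show ?case using polys_le_add[OF add] by (simp add: distrib_right)
next
  case (scale c f)
  then show ?case using polys_le_scale[OF scale, of c] by (simp add: mult.assoc)
qed (simp add: polys_le_zero)

lemma polys_le_power: "f \<in> polys_le R \<Longrightarrow> (\<lambda>z. f z ^ Suc r) \<in> polys_le (Suc r * R)"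
proof (induction r)
  case (Suc r)
  then show ?case using polys_le_mult[of f R "\<lambda>z. f z ^ Suc r" "Suc r * R"] by simp
qed simp

lemma integrable_mult_continuous:
  fixes f g :: "'d::finite sfun"
  assumes f: "integrable \<sigma> f" and g: "continuous_on UNIV g"
  shows "integrable \<sigma> (\<lambda>z. f z * g z)"
proof -
  have "restr (\<lambda>z. cnj (g z)) \<in> csphere" by (rule csphereI[OF _ refl]) (intro continuous_intros g)
  from csphere_mult_integrable[OF f this] have "integrable \<sigma> (\<lambda>z. f z * cnj (restr (\<lambda>z. cnj (g z)) z))" .
  moreover have "integrable \<sigma> (\<lambda>z. f z * cnj (restr (\<lambda>z. cnj (g z)) z)) \<longleftrightarrow> integrable \<sigma> (\<lambda>z. f z * g z)"
    by (rule Bochner_Integration.integrable_cong) (auto simp: restr_def)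
  ultimately show ?thesis by simp
qed

lemma sip_lincomb_right:
  assumes f: "integrable \<sigma> f" and B: "\<And>u. u \<in> B \<Longrightarrow> u \<in> csphere"
  shows "sip f (\<lambda>z. \<Sum>u\<in>B. c u * u z) = (\<Sum>u\<in>B. cnj (c u) * sip f u)"
proof -
  have "sip f (\<lambda>z. \<Sum>u\<in>B. c u * u z) = (\<integral>z. (\<Sum>u\<in>B. cnj (c u) * (f z * cnj (u z))) \<partial>\<sigma>)"
    unfolding sip_def by (simp add: sum_distrib_left mult.left_commute)
  also have "\<dots> = (\<Sum>u\<in>B. \<integral>z. cnj (c u) * (f z * cnj (u z)) \<partial>\<sigma>)"
    using B by (intro Bochner_Integration.integral_sum integrable_mult_right csphere_mult_integrable f)
  finally show ?thesis unfolding sip_def by simp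
qed

context
  fixes f :: "'d::finite sfun"
  assumes f: "integrable \<sigma> f"
    and zero: "\<And>m n u. u \<in> hbasis m n \<Longrightarrow> sip f u = 0"
begin

lemma integral_bihom_annihilated:
  assumes p: "p \<in> bihomogeneous_polys m n"
  shows "(\<integral>z. f z * p z \<partial>\<sigma>) = 0"
proof -
  have p': "(\<lambda>z. cnj (p z)) \<in> bihomogeneous_polys n m" by (rule bihom_cnj[OF p])
  let ?B = "hblock ({..max m n} \<times> {..max m n}) :: ('d sfun) set"
  have on: "orthonormal ?B" by (rule orthonormal_hblock) auto
  then have fin: "finite ?B" by (simp add: orthonormal_def)
  have "restr (\<lambda>z. cnj (p z)) \<in> cfun.span ?B"
    using restr_bihom_polys_le[OF p', of "max m n"] by (simp add: polys_le_def)
  then obtain c where c: "restr (\<lambda>z. cnj (p z)) = (\<lambda>z. \<Sum>u\<in>?B. c u * u z)"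
    using span_finite_fun[OF fin] by blast
  have "sip f (restr (\<lambda>z. cnj (p z))) = (\<Sum>u\<in>?B. cnj (c u) * sip f u)"
    unfolding c using on by (intro sip_lincomb_right f) (auto simp: orthonormal_def)
  also have "\<dots> = 0" using zero by (intro sum.neutral) (auto simp: hblock_def)
  finally show ?thesis unfolding sip_def integral_restr by simp
qed

definition all_polys :: "('d sfun) set" where
  "all_polys = cfun.span (\<Union>(m, n)\<in>UNIV. bihomogeneous_polys m n)"

lemma all_polys_add: "g \<in> all_polys \<Longrightarrow> h \<in> all_polys \<Longrightarrow> (\<lambda>z. g z + h z) \<in> all_polys"
  unfolding all_polys_def using cfun.span_add[of g _ h] by (simp add: plus_fun_def)

lemma all_polys_scale: "g \<in> all_polys \<Longrightarrow> (\<lambda>z. c * g z) \<in> all_polys"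
  unfolding all_polys_def by (rule cfun.span_scale)

lemma all_polys_bihom: "g \<in> bihomogeneous_polys m n \<Longrightarrow> g \<in> all_polys"
  unfolding all_polys_def by (intro cfun.span_base) auto

lemma all_polys_zero: "(\<lambda>_. 0) \<in> all_polys"
  by (rule all_polys_bihom[OF bihom_zero[of 0 0]])

lemma all_polys_sum: "(\<And>i. i \<in> I \<Longrightarrow> g i \<in> all_polys) \<Longrightarrow> (\<lambda>z. \<Sum>i\<in>I. g i z) \<in> all_polys"
proof (induction I rule: infinite_finite_induct)
  case (insert i I)
  then show ?case using all_polys_add[of "g i" "\<lambda>z. \<Sum>i\<in>I. g i z"] by simp
qed (auto simp: all_polys_zero)

lemma all_polys_induct [consumes 1, case_names zero bihom add scale]:
  assumes g: "g \<in> all_polys" and Q0: "Q (\<lambda>_. 0)"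
    and bihom: "\<And>m n h. h \<in> bihomogeneous_polys m n \<Longrightarrow> Q h"
    and add: "\<And>g h. Q g \<Longrightarrow> Q h \<Longrightarrow> Q (\<lambda>z. g z + h z)"
    and scale: "\<And>c g. Q g \<Longrightarrow> Q (\<lambda>z. c * g z)"
  shows "Q g"
  using g unfolding all_polys_def
proof (induction rule: cfun.span_induct_alt)
  case base
  then show ?case using Q0 by (simp add: zero_fun_def)
next
  case (step c x y)
  then have "Q x" using bihom by auto
  then show ?case using add[OF scale[of x c] step(2)] by (simp add: plus_fun_def)
qed

lemma all_polys_mult:
  assumes "g \<in> all_polys" "h \<in> all_polys" shows "(\<lambda>z. g z * h z) \<in> all_polys"
  using assms(1)
proof (induction rule: all_polys_induct)
  case (bihom m n p)
  show ?case using assms(2)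
  proof (induction rule: all_polys_induct)
    case (bihom k l q)
    show ?case by (rule all_polys_bihom[OF bihom_mult[OF \<open>p \<in> bihomogeneous_polys m n\<close> bihom]])
  next
    case (add g h)
    then show ?case using all_polys_add[OF add] by (simp add: distrib_left)
  next
    case (scale c g)
    then show ?case using all_polys_scale[OF scale, of c] by (simp add: mult.left_commute)
  qed (simp add: all_polys_zero)
next
  case (add g h)
  then show ?case using all_polys_add[OF add] by (simp add: distrib_right)
next
  case (scale c g)
  then show ?case using all_polys_scale[OF scale, of c] by (simp add: mult.assoc)
qed (simp add: all_polys_zero)

lemma integral_poly_annihilated:
  assumes "p \<in> all_polys"
  shows "continuous_on UNIV p \<and> (\<integral>z. f z * p z \<partial>\<sigma>) = 0"
  using assms
proof (induction rule: all_polys_induct)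
  case (bihom m n h)
  then show ?case using integral_bihom_annihilated bihom_continuous by blast
next
  case (add g h)
  then have "continuous_on UNIV (\<lambda>z. g z + h z)" by (intro continuous_on_add) auto
  moreover have "(\<integral>z. f z * (g z + h z) \<partial>\<sigma>) = 0"
    unfolding distrib_left using add f
    by (subst Bochner_Integration.integral_add) (auto intro!: integrable_mult_continuous)
  ultimately show ?case by blast
next
  case (scale c g)
  then have "continuous_on UNIV (\<lambda>z. c * g z)" by (intro continuous_on_mult) auto
  moreover have "(\<integral>z. f z * (c * g z) \<partial>\<sigma>) = 0"
    unfolding mult.left_commute[of _ c] using scale by simp
  ultimately show ?case by blast
qed auto

lemma coordinate_all_polys:
  assumes "b \<in> (Basis :: (complex^'d) set)"
  shows "(\<lambda>z. of_real (z \<bullet> b)) \<in> all_polys"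
proof -
  obtain j and c :: complex where c: "b = axis j c" "c \<in> Basis" using assms by (auto simp: Basis_vec_def)
  have re: "(\<lambda>z. (1/2) * (z $ j + cnj (z $ j))) \<in> all_polys"
    by (intro all_polys_scale all_polys_add all_polys_bihom[OF bihom_coord] all_polys_bihom[OF bihom_cnj_coord])
  have im: "(\<lambda>z. (- \<i>/2) * (z $ j + (-1) * cnj (z $ j))) \<in> all_polys"
    by (rule all_polys_scale[OF all_polys_add[OF all_polys_bihom[OF bihom_coord] all_polys_scale[OF all_polys_bihom[OF bihom_cnj_coord]]]])
  have "c = 1 \<or> c = \<i>" using c(2) by (auto simp: Basis_complex_def)
  then show ?thesis
  proof
    assume "c = 1"
    then have "(\<lambda>z. complex_of_real (z \<bullet> b)) = (\<lambda>z. (1/2) * (z $ j + cnj (z $ j)))"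
      by (auto simp: fun_eq_iff c(1) inner_axis inner_complex_def complex_eq_iff)
    then show ?thesis using re by simp
  next
    assume "c = \<i>"
    then have "(\<lambda>z. complex_of_real (z \<bullet> b)) = (\<lambda>z. (- \<i>/2) * (z $ j + (-1) * cnj (z $ j)))"
      by (auto simp: fun_eq_iff c(1) inner_axis inner_complex_def complex_eq_iff)
    then show ?thesis using im by simp
  qed
qed

lemma real_polynomial_all_polys:
  fixes p :: "complex^'d \<Rightarrow> real"
  assumes "real_polynomial_function p"
  shows "(\<lambda>z. of_real (p z)) \<in> all_polys"
  using assms
proof (induction rule: real_polynomial_function.induct)
  case (linear h)
  have lin: "linear h" using linear by (rule bounded_linear.linear)
  have h: "h z = (\<Sum>b\<in>Basis. h b * (z \<bullet> b))" for z
  proof -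
    have "h z = h (\<Sum>b\<in>Basis. (z \<bullet> b) *\<^sub>R b)" by (simp only: euclidean_representation)
    also have "\<dots> = (\<Sum>b\<in>Basis. h b * (z \<bullet> b))"
      by (simp add: linear_sum[OF lin] linear_scale[OF lin] mult.commute)
    finally show ?thesis .
  qed
  have "(\<lambda>z. \<Sum>b\<in>Basis. of_real (h b) * complex_of_real (z \<bullet> b)) \<in> all_polys"
    by (rule all_polys_sum) (rule all_polys_scale[OF coordinate_all_polys])
  moreover have "(\<lambda>z. complex_of_real (h z)) = (\<lambda>z. \<Sum>b\<in>Basis. of_real (h b) * complex_of_real (z \<bullet> b))"
    by (rule ext) (subst h, simp)
  ultimately show ?case by simp
next
  case (const c)
  show ?case by (rule all_polys_bihom[OF bihom_const])
next
  case (add p q)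
  then show ?case using all_polys_add[OF add(3,4)] by simp
next
  case (mult p q)
  then show ?case using all_polys_mult[OF mult(3,4)] by simp
qed

lemma integral_continuous_annihilated:
  fixes g :: "complex^'d \<Rightarrow> real"
  assumes g: "continuous_on UNIV g"
  shows "(\<integral>z. f z * of_real (g z) \<partial>\<sigma>) = 0"
proof (rule ccontr)
  define I where "I = (\<integral>z. cmod (f z) \<partial>\<sigma>)"
  assume "(\<integral>z. f z * of_real (g z) \<partial>\<sigma>) \<noteq> 0"
  then have pos: "cmod (\<integral>z. f z * of_real (g z) \<partial>\<sigma>) > 0" (is "?A > 0") by simp
  have I0: "I \<ge> 0" by (simp add: I_def)
  define e where "e = ?A / (2 * (I + 1))"
  have e: "e > 0" using pos I0 by (simp add: e_def)
  obtain p where p: "real_polynomial_function p" "\<And>z. z \<in> sphere 0 1 \<Longrightarrow> \<bar>g z - p z\<bar> < e"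
    using Stone_Weierstrass_real_polynomial_function[of "sphere 0 1" g e] continuous_on_subset[OF g, of "sphere 0 1"] e by auto
  have P: "continuous_on UNIV (\<lambda>z. complex_of_real (p z))" "(\<integral>z. f z * of_real (p z) \<partial>\<sigma>) = 0"
    using integral_poly_annihilated[OF real_polynomial_all_polys[OF p(1)]] by auto
  have gi: "integrable \<sigma> (\<lambda>z. f z * of_real (g z))"
    by (intro integrable_mult_continuous f continuous_intros g)
  have pi: "integrable \<sigma> (\<lambda>z. f z * of_real (p z))"
    by (rule integrable_mult_continuous[OF f P(1)])
  have "?A = cmod ((\<integral>z. f z * of_real (g z) \<partial>\<sigma>) - (\<integral>z. f z * of_real (p z) \<partial>\<sigma>))"
    by (simp add: P(2))
  also have "\<dots> = cmod (\<integral>z. f z * of_real (g z) - f z * of_real (p z) \<partial>\<sigma>)"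
    using gi pi by simp
  also have "\<dots> \<le> (\<integral>z. cmod (f z * of_real (g z) - f z * of_real (p z)) \<partial>\<sigma>)"
    by (rule integral_norm_bound)
  also have "\<dots> \<le> (\<integral>z. e * cmod (f z) \<partial>\<sigma>)"
  proof (intro integral_mono integrable_norm Bochner_Integration.integrable_diff gi pi)
    show "integrable \<sigma> (\<lambda>z. e * cmod (f z))" using f by auto
    fix z assume "z \<in> space (\<sigma> :: (complex^'d) measure)"
    then have "\<bar>g z - p z\<bar> \<le> e" using p(2)[of z] by simp
    then have "cmod (f z) * \<bar>g z - p z\<bar> \<le> cmod (f z) * e" by (intro mult_left_mono) auto
    moreover have "cmod (f z * of_real (g z) - f z * of_real (p z)) = cmod (f z) * \<bar>g z - p z\<bar>"
      unfolding right_diff_distrib[symmetric] of_real_diff[symmetric] norm_mult norm_of_real ..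
    ultimately show "cmod (f z * of_real (g z) - f z * of_real (p z)) \<le> e * cmod (f z)" by (simp add: mult.commute)
  qed
  also have "\<dots> = e * I" by (simp add: I_def)
  also have "\<dots> \<le> e * (I + 1)" using e by (intro mult_left_mono) auto
  also have "\<dots> = ?A / 2"
  proof -
    have "I + 1 \<noteq> 0" using I0 by simp
    then show ?thesis unfolding e_def by (simp add: divide_simps)
  qed
  finally show False using pos by simp
qed

lemma integral_mult_indicator_integrable:
  "A \<in> sets borel \<Longrightarrow> integrable \<sigma> (\<lambda>z. f z * indicator A z)"
proof -
  assume "A \<in> sets borel"
  then have [measurable]: "(indicator A :: 'd sfun) \<in> borel_measurable \<sigma>"
    by (intro borel_measurable_surface borel_measurable_indicator)
  have [measurable]: "f \<in> borel_measurable \<sigma>" using f by (rule borel_measurable_integrable)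
  show ?thesis
    by (rule Bochner_Integration.integrable_bound[OF f]) (measurable, auto simp: indicator_def)
qed

lemma integral_closed_annihilated:
  assumes F: "closed F"
  shows "(\<integral>z. f z * indicator F z \<partial>\<sigma>) = 0"
proof (cases "F = {}")
  case False
  define g where "g i z = max 0 (1 - real i * infdist z F)" for i :: nat and z
  have gc: "continuous_on UNIV (g i)" for i unfolding g_def[abs_def] by (intro continuous_intros)
  have g01: "0 \<le> g i z" "g i z \<le> 1" for i z using infdist_nonneg[of z F] by (auto simp: g_def)
  have lim: "(\<lambda>i. complex_of_real (g i z)) \<longlonglongrightarrow> indicator F z" for z
  proof (cases "z \<in> F")
    case True
    then have "g i z = 1" for i by (simp add: g_def)
    then show ?thesis using True by simp
  next
    case nz: False
    then have d: "infdist z F > 0" using F False in_closed_iff_infdist_zero[of F z] infdist_nonneg[of z F] by (simp add: less_le)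
    obtain N :: nat where N: "real N > 1 / infdist z F" using reals_Archimedean2 by blast
    have "g i z = 0" if "i \<ge> N" for i
    proof -
      have "1 < real N * infdist z F" using N d by (simp add: field_simps)
      also have "\<dots> \<le> real i * infdist z F" using that d by (intro mult_right_mono) auto
      finally show ?thesis by (simp add: g_def)
    qed
    then have "eventually (\<lambda>i. complex_of_real (g i z) = 0) sequentially" by (auto simp: eventually_sequentially)
    then have "(\<lambda>i. complex_of_real (g i z)) \<longlonglongrightarrow> 0" by (rule tendsto_eventually)
    then show ?thesis using nz by simp
  qed
  have [measurable]: "f \<in> borel_measurable \<sigma>" using f by (rule borel_measurable_integrable)
  have "(\<lambda>i. \<integral>z. f z * of_real (g i z) \<partial>\<sigma>) \<longlonglongrightarrow> (\<integral>z. f z * indicator F z \<partial>\<sigma>)"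
  proof (rule integral_dominated_convergence[where w = "\<lambda>z. cmod (f z)"])
    show "(\<lambda>z. f z * indicator F z) \<in> borel_measurable \<sigma>"
      using integral_mult_indicator_integrable[of F] F by (intro borel_measurable_integrable) auto
    show "(\<lambda>z. f z * of_real (g i z)) \<in> borel_measurable \<sigma>" for i
      by (intro borel_measurable_integrable integrable_mult_continuous f continuous_intros gc)
    show "integrable \<sigma> (\<lambda>z. cmod (f z))" using f by auto
    show "AE z in \<sigma>. (\<lambda>i. f z * of_real (g i z)) \<longlonglongrightarrow> f z * indicator F z"
      by (intro AE_I2 tendsto_intros lim)
    fix i
    have "cmod (f z * of_real (g i z)) \<le> cmod (f z)" for z
      using g01[where i = i and z = z] by (simp add: norm_mult mult_left_le)
    then show "AE z in \<sigma>. cmod (f z * of_real (g i z)) \<le> cmod (f z)" by (intro AE_I2)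
  qed
  then have "(\<lambda>i::nat. 0) \<longlonglongrightarrow> (\<integral>z. f z * indicator F z \<partial>\<sigma>)"
    by (simp only: integral_continuous_annihilated[OF gc])
  then show ?thesis by (simp add: LIMSEQ_const_iff)
qed simp

lemma integral_borel_annihilated:
  assumes A: "A \<in> sets borel"
  shows "(\<integral>z. f z * indicator A z \<partial>\<sigma>) = 0"
proof -
  have sb: "sets (borel :: (complex^'d) measure) = sigma_sets UNIV (Collect closed)"
    unfolding borel_eq_closed by (rule sets_measure_of) simp
  have "A \<in> sigma_sets UNIV (Collect closed)" using A sb by simp
  moreover have "Int_stable (Collect closed :: (complex^'d) set set)" by (auto simp: Int_stable_def)
  moreover have "Collect closed \<subseteq> Pow (UNIV :: (complex^'d) set)" by simp
  ultimately show ?thesis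
  proof -
    assume "A \<in> sigma_sets UNIV (Collect closed)" "Int_stable (Collect closed :: (complex^'d) set set)"
      "Collect closed \<subseteq> Pow (UNIV :: (complex^'d) set)"
    from this(2,3,1) show ?thesis
  proof (induction rule: sigma_sets_induct_disjoint)
    case (basic A)
    then show ?case using integral_closed_annihilated by simp
  next
    case (compl A)
    have "(\<integral>z. f z * indicator (UNIV - A) z \<partial>\<sigma>) = (\<integral>z. f z * indicator UNIV z - f z * indicator A z \<partial>\<sigma>)"
      by (intro Bochner_Integration.integral_cong) (auto simp: indicator_def)
    also have "\<dots> = (\<integral>z. f z * indicator UNIV z \<partial>\<sigma>) - (\<integral>z. f z * indicator A z \<partial>\<sigma>)"
      using compl(1) sb by (intro Bochner_Integration.integral_diff integral_mult_indicator_integrable) auto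
    also have "\<dots> = 0" using compl(2) integral_closed_annihilated[OF closed_UNIV] by simp
    finally show ?case .
  next
    case (union A)
    have Ab: "A i \<in> sets borel" for i using union(2) sb by auto
    have [measurable]: "f \<in> borel_measurable \<sigma>" using f by (rule borel_measurable_integrable)
    have "(\<lambda>n. \<integral>z. f z * indicator (\<Union>i<n. A i) z \<partial>\<sigma>) \<longlonglongrightarrow> (\<integral>z. f z * indicator (\<Union>i. A i) z \<partial>\<sigma>)"
    proof (rule integral_dominated_convergence[where w = "\<lambda>z. cmod (f z)"])
      show "(\<lambda>z. f z * indicator (\<Union>i. A i) z) \<in> borel_measurable \<sigma>"
        using Ab by (intro borel_measurable_integrable integral_mult_indicator_integrable) auto
      show "(\<lambda>z. f z * indicator (\<Union>i<n. A i) z) \<in> borel_measurable \<sigma>" for n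
        using Ab by (intro borel_measurable_integrable integral_mult_indicator_integrable) auto
      show "integrable \<sigma> (\<lambda>z. cmod (f z))" using f by auto
      show "AE z in \<sigma>. (\<lambda>n. f z * indicator (\<Union>i<n. A i) z) \<longlonglongrightarrow> f z * indicator (\<Union>i. A i) z"
        by (intro AE_I2 tendsto_intros LIMSEQ_indicator_UN)
      show "AE z in \<sigma>. cmod (f z * indicator (\<Union>i<n. A i) z) \<le> cmod (f z)" for n
        by (intro AE_I2) (auto simp: indicator_def)
    qed
    moreover have "(\<integral>z. f z * indicator (\<Union>i<n. A i) z \<partial>\<sigma>) = 0" for n
    proof -
      have "indicator (\<Union>i<n. A i) z = (\<Sum>i<n. indicator (A i) z :: complex)" for z
        using union(1) by (intro indicator_UN_disjoint) (auto simp: disjoint_family_on_def)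
      then have "(\<integral>z. f z * indicator (\<Union>i<n. A i) z \<partial>\<sigma>) = (\<integral>z. (\<Sum>i<n. f z * indicator (A i) z) \<partial>\<sigma>)"
        by (simp add: sum_distrib_left)
      also have "\<dots> = (\<Sum>i<n. \<integral>z. f z * indicator (A i) z \<partial>\<sigma>)"
        by (intro Bochner_Integration.integral_sum integral_mult_indicator_integrable Ab)
      finally show ?thesis using union(3) by simp
    qed
    ultimately show ?case by (simp add: LIMSEQ_const_iff)
  qed simp
  qed
qed

text \<open>
  By the Fischer decomposition \<open>f\<close> annihilates all polynomials, by the Stone-Weierstrass theorem all
  continuous functions, hence by dominated convergence the indicators of closed sets, and by Dynkin's lemma those of Borel
  sets.
\<close>

theorem harmonics_complete: "AE z in \<sigma>. f z = 0"
proof (rule surf.density_zero[OF f])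
  fix X assume X: "X \<in> sets (\<sigma> :: (complex^'d) measure)"
  then obtain A where A: "A \<in> sets borel" "X = A \<inter> sphere 0 1" by (auto simp: sets_surface_measure sets_restrict_space)
  have "set_lebesgue_integral \<sigma> X f = (\<integral>z. f z * indicator A z \<partial>\<sigma>)"
    unfolding set_lebesgue_integral_def A(2) by (intro Bochner_Integration.integral_cong) (auto simp: indicator_def)
  then show "set_lebesgue_integral \<sigma> X f = 0" using integral_borel_annihilated[OF A(1)] by simp
qed

end

section \<open>Lebesgue norms\<close>

text \<open>
  The bound \<open>b\<close> for the norm of \<open>f\<close> in \<open>L\<^sup>q\<close>, stated with the nonnegative integral so that it includes
  integrability and passes to limits by Fatou's lemma.
\<close>

definition Lq_le :: "ennreal \<Rightarrow> 'a measure \<Rightarrow> ('a \<Rightarrow> complex) \<Rightarrow> real \<Rightarrow> bool" where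
  "Lq_le q M f b \<longleftrightarrow> (if q = \<infinity> then AE x in M. cmod (f x) \<le> b
     else (\<integral>\<^sup>+x. ennreal (cmod (f x) powr enn2real q) \<partial>M) \<le> ennreal (b powr enn2real q))"

lemma enn2real_ge:
  assumes "ennreal a \<le> q" "q \<noteq> \<infinity>" "0 \<le> a" shows "a \<le> enn2real q"
  using assms by (cases q rule: ennreal_cases) auto

lemma Lq_le_Lp:
  assumes f [measurable]: "f \<in> borel_measurable M" and b: "b \<ge> 0" and q: "1 \<le> q" and le: "Lq_le q M f b"
  shows "f \<in> Lp_space q M" "Lp_norm q M f \<le> b"
proof -
  have "f \<in> Lp_space q M \<and> Lp_norm q M f \<le> b"
  proof (cases "q = \<infinity>")
    case True
    then have "AE x in M. ennreal (cmod (f x)) \<le> ennreal b"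
      using le by (auto simp: Lq_le_def elim!: eventually_mono intro: ennreal_leI)
    then have e: "esssup M (\<lambda>x. ennreal (cmod (f x))) \<le> ennreal b" by (intro esssup_I) auto
    then have "esssup M (\<lambda>x. ennreal (cmod (f x))) < \<infinity>" by (auto simp: le_less_trans)
    then show ?thesis using True e b by (auto simp: Lp_space_def Lp_norm_def intro: enn2real_leI)
  next
    case False
    define r where "r = enn2real q"
    have r: "r \<ge> 1" unfolding r_def using q False by (intro enn2real_ge) auto
    have nn: "(\<integral>\<^sup>+x. ennreal (cmod (f x) powr r) \<partial>M) \<le> ennreal (b powr r)"
      using le False by (simp add: Lq_le_def r_def)
    then have int: "integrable M (\<lambda>x. cmod (f x) powr r)"
      by (intro integrableI_bounded) (auto simp: le_less_trans)
    have "ennreal (\<integral>x. cmod (f x) powr r \<partial>M) \<le> ennreal (b powr r)"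
      using nn nn_integral_eq_integral[OF int] by simp
    then have "(\<integral>x. cmod (f x) powr r \<partial>M) \<le> b powr r" by (simp add: ennreal_le_iff)
    then have "(\<integral>x. cmod (f x) powr r \<partial>M) powr (1 / r) \<le> (b powr r) powr (1 / r)"
      using r by (intro powr_mono2) auto
    also have "\<dots> = b" using r b by (simp add: powr_powr)
    finally show ?thesis using False int by (simp add: Lp_space_def Lp_norm_def r_def)
  qed
  then show "f \<in> Lp_space q M" "Lp_norm q M f \<le> b" by auto
qed

lemma Lp_ball_integral:
  assumes \<phi>: "\<phi> \<in> Lp_ball p M" and p: "1 \<le> p" "p \<noteq> \<infinity>"
  shows "\<phi> \<in> borel_measurable M" "integrable M (\<lambda>x. cmod (\<phi> x) powr enn2real p)"
    "(\<integral>x. cmod (\<phi> x) powr enn2real p \<partial>M) \<le> 1"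
proof -
  define r where "r = enn2real p"
  have r: "r \<ge> 1" unfolding r_def using p by (intro enn2real_ge) auto
  show "\<phi> \<in> borel_measurable M" "integrable M (\<lambda>x. cmod (\<phi> x) powr enn2real p)"
    using \<phi> p by (auto simp: Lp_ball_def Lp_space_def)
  have le: "(\<integral>x. cmod (\<phi> x) powr r \<partial>M) powr (1 / r) \<le> 1"
    using \<phi> p by (auto simp: Lp_ball_def Lp_norm_def r_def)
  have "((\<integral>x. cmod (\<phi> x) powr r \<partial>M) powr (1 / r)) powr r \<le> 1 powr r"
    using r le by (intro powr_mono2) auto
  then show "(\<integral>x. cmod (\<phi> x) powr enn2real p \<partial>M) \<le> 1"
    using r by (simp add: powr_powr r_def)
qed

lemma le_one_plus_powr: "(x::real) \<ge> 0 \<Longrightarrow> r \<ge> 1 \<Longrightarrow> x \<le> 1 + x powr r"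
proof (cases "x \<le> 1")
  case False
  assume "x \<ge> 0" "r \<ge> 1"
  then have "x powr 1 \<le> x powr r" using False by (intro powr_mono) auto
  then show ?thesis using False by simp
qed (simp add: add_increasing2)

lemma (in finite_measure) Lp_space_integrable:
  assumes f: "f \<in> Lp_space q M" and q: "1 \<le> q"
  shows "integrable M f"
proof (cases "q = \<infinity>")
  case True
  have m [measurable]: "f \<in> borel_measurable M" and e: "esssup M (\<lambda>x. ennreal (cmod (f x))) < \<infinity>"
    using f True by (auto simp: Lp_space_def)
  have "AE x in M. ennreal (cmod (f x)) \<le> esssup M (\<lambda>x. ennreal (cmod (f x)))" by (rule esssup_AE)
  then have "AE x in M. cmod (f x) \<le> enn2real (esssup M (\<lambda>x. ennreal (cmod (f x))))"
    using e by (elim eventually_mono) (metis enn2real_ennreal enn2real_mono infinity_ennreal_def norm_ge_zero)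
  then show ?thesis by (rule integrable_const_bound) simp
next
  case False
  define r where "r = enn2real q"
  have r: "r \<ge> 1" unfolding r_def using q False by (intro enn2real_ge) auto
  have m: "f \<in> borel_measurable M" and int: "integrable M (\<lambda>x. cmod (f x) powr r)"
    using f False by (auto simp: Lp_space_def r_def)
  show ?thesis
  proof (rule Bochner_Integration.integrable_bound[OF _ m])
    show "integrable M (\<lambda>x. 1 + cmod (f x) powr r)" using int by auto
    show "AE x in M. cmod (f x) \<le> norm (1 + cmod (f x) powr r)"
      using le_one_plus_powr[OF norm_ge_zero r] by (intro AE_I2) (simp add: abs_of_nonneg add_nonneg_nonneg)
  qed
qed

lemma (in finite_measure) Lq_le_L1:
  assumes f [measurable]: "f \<in> borel_measurable M" and b: "b > 0" and q: "1 \<le> q" and le: "Lq_le q M f b"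
  shows "(\<integral>\<^sup>+x. ennreal (cmod (f x)) \<partial>M) \<le> ennreal ((measure M (space M) + 1) * b)"
proof (cases "q = \<infinity>")
  case True
  have "(\<integral>\<^sup>+x. ennreal (cmod (f x)) \<partial>M) \<le> (\<integral>\<^sup>+x. ennreal b \<partial>M)"
    using le True by (intro nn_integral_mono_AE) (auto simp: Lq_le_def elim!: eventually_mono intro: ennreal_leI)
  also have "\<dots> = ennreal (b * measure M (space M))"
    using b by (simp add: emeasure_eq_measure ennreal_mult)
  also have "\<dots> \<le> ennreal ((measure M (space M) + 1) * b)" using b by (intro ennreal_leI) (simp add: algebra_simps)
  finally show ?thesis .
next
  case False
  define r where "r = enn2real q"
  have r: "r \<ge> 1" unfolding r_def using q False by (intro enn2real_ge) auto
  have nn: "(\<integral>\<^sup>+x. ennreal (cmod (f x) powr r) \<partial>M) \<le> ennreal (b powr r)"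
    using le False by (simp add: Lq_le_def r_def)
  have pw: "x \<le> b + (b / b powr r) * x powr r" if "x \<ge> 0" for x
  proof -
    have "x / b \<le> 1 + (x / b) powr r" using that b r by (intro le_one_plus_powr) auto
    then have "x \<le> b * (1 + (x / b) powr r)" using b by (simp add: field_simps)
    then show ?thesis using that b by (simp add: powr_divide algebra_simps)
  qed
  have "(\<integral>\<^sup>+x. ennreal (cmod (f x)) \<partial>M) \<le> (\<integral>\<^sup>+x. ennreal b + ennreal (b / b powr r) * ennreal (cmod (f x) powr r) \<partial>M)"
  proof (rule nn_integral_mono)
    fix x
    have "ennreal (cmod (f x)) \<le> ennreal (b + (b / b powr r) * cmod (f x) powr r)" by (intro ennreal_leI pw) auto
    also have "\<dots> = ennreal b + ennreal (b / b powr r) * ennreal (cmod (f x) powr r)"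
      by (simp only: ennreal_plus[of b "(b / b powr r) * cmod (f x) powr r"] ennreal_mult[of "b / b powr r" "cmod (f x) powr r"]
          b less_imp_le divide_nonneg_nonneg powr_ge_zero mult_nonneg_nonneg)
    finally show "ennreal (cmod (f x)) \<le> ennreal b + ennreal (b / b powr r) * ennreal (cmod (f x) powr r)" .
  qed
  also have "\<dots> = ennreal b * emeasure M (space M) + ennreal (b / b powr r) * (\<integral>\<^sup>+x. ennreal (cmod (f x) powr r) \<partial>M)"
    by (subst nn_integral_add) (auto simp: nn_integral_cmult)
  also have "\<dots> \<le> ennreal b * emeasure M (space M) + ennreal (b / b powr r) * ennreal (b powr r)"
    by (intro add_left_mono mult_left_mono nn) auto
  also have "\<dots> = ennreal (b * measure M (space M) + b)"
    using b by (simp add: emeasure_eq_measure ennreal_mult[symmetric] ennreal_plus[symmetric] del: ennreal_plus)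
  also have "\<dots> = ennreal ((measure M (space M) + 1) * b)" by (simp add: algebra_simps)
  finally show ?thesis .
qed

lemma powr_convex_on_nonneg:
  assumes "r \<ge> 1" shows "convex_on {0..} (\<lambda>x::real. x powr r)"
proof (rule convex_onI)
  have small: "(v * y) powr r \<le> v * y powr r" if "0 \<le> v" "v \<le> 1" "y \<ge> 0" for v y :: real
  proof -
    have "v powr r \<le> v powr 1" using that assms by (intro powr_mono') auto
    then have "v powr r \<le> v" using that by simp
    then have "v powr r * y powr r \<le> v * y powr r" by (intro mult_right_mono) auto
    then show ?thesis using that by (simp add: powr_mult)
  qed
  fix t x y :: real assume t: "0 < t" "t < 1" and xy: "x \<in> {0..}" "y \<in> {0..}"
  show "((1 - t) *\<^sub>R x + t *\<^sub>R y) powr r \<le> (1 - t) * x powr r + t * y powr r"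
  proof (cases "x = 0 \<or> y = 0")
    case True
    then show ?thesis using small[of t y] small[of "1 - t" x] t xy by auto
  next
    case False
    then show ?thesis
      using convex_onD[OF powr_convex[OF assms], of t x y] t xy by auto
  qed
qed simp

text \<open>
  Minkowski's inequality for given bounds \<open>b k\<close>, from the convexity of \<open>\<lambda>x. x powr r\<close>
  with the weights \<open>b k / S\<close>.
\<close>

lemma Lq_le_finite_sum:
  fixes h :: "nat \<Rightarrow> 'a \<Rightarrow> complex"
  assumes h [measurable]: "\<And>k. h k \<in> borel_measurable M" and b: "\<And>k. b k > 0" and r: "r \<ge> 1"
    and le: "\<And>k. (\<integral>\<^sup>+x. ennreal (cmod (h k x) powr r) \<partial>M) \<le> ennreal (b k powr r)"
  shows "(\<integral>\<^sup>+x. ennreal (cmod (\<Sum>k<n. h k x) powr r) \<partial>M) \<le> ennreal ((\<Sum>k<n. b k) powr r)"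
proof (cases "n = 0")
  case False
  define S where "S = (\<Sum>k<n. b k)"
  have S: "S > 0" unfolding S_def using False b by (intro sum_pos) auto
  define w where "w k = (b k / S) * (S / b k) powr r" for k
  have w0: "w k \<ge> 0" for k using b[of k] S by (simp add: w_def)
  have pw: "cmod (\<Sum>k<n. h k x) powr r \<le> (\<Sum>k<n. w k * cmod (h k x) powr r)" for x
  proof -
    have "cmod (\<Sum>k<n. h k x) powr r \<le> (\<Sum>k<n. cmod (h k x)) powr r"
      using r by (intro powr_mono2 norm_sum) auto
    also have "(\<Sum>k<n. cmod (h k x)) = (\<Sum>k<n. (b k / S) *\<^sub>R (cmod (h k x) * (S / b k)))"
      using b S by (intro sum.cong refl) (simp add: less_imp_neq[symmetric])
    also have "\<dots> powr r \<le> (\<Sum>k<n. (b k / S) * (cmod (h k x) * (S / b k)) powr r)"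
    proof (rule convex_on_sum[OF _ _ powr_convex_on_nonneg[OF r]])
      show "(\<Sum>k<n. b k / S) = 1" using S by (simp add: sum_divide_distrib[symmetric] S_def)
      show "b k / S \<ge> 0" for k using b[of k] S by simp
      show "cmod (h k x) * (S / b k) \<in> {0..}" for k using b[of k] S by simp
    qed (use False in auto)
    also have "\<dots> = (\<Sum>k<n. w k * cmod (h k x) powr r)"
    proof (rule sum.cong[OF refl])
      fix k
      have "(cmod (h k x) * (S / b k)) powr r = cmod (h k x) powr r * (S / b k) powr r"
        by (rule powr_mult)
      then show "(b k / S) * (cmod (h k x) * (S / b k)) powr r = w k * cmod (h k x) powr r"
        by (simp only: w_def mult_ac)
    qed
    finally show ?thesis .
  qed
  have "(\<integral>\<^sup>+x. ennreal (cmod (\<Sum>k<n. h k x) powr r) \<partial>M) \<le> (\<integral>\<^sup>+x. (\<Sum>k<n. ennreal (w k) * ennreal (cmod (h k x) powr r)) \<partial>M)"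
  proof (rule nn_integral_mono)
    fix x
    have "ennreal (cmod (\<Sum>k<n. h k x) powr r) \<le> ennreal (\<Sum>k<n. w k * cmod (h k x) powr r)" by (intro ennreal_leI pw)
    also have "\<dots> = (\<Sum>k<n. ennreal (w k * cmod (h k x) powr r))" using w0 by (intro sum_ennreal[symmetric]) auto
    also have "\<dots> = (\<Sum>k<n. ennreal (w k) * ennreal (cmod (h k x) powr r))" using w0 by (simp add: ennreal_mult)
    finally show "ennreal (cmod (\<Sum>k<n. h k x) powr r) \<le> (\<Sum>k<n. ennreal (w k) * ennreal (cmod (h k x) powr r))" .
  qed
  also have "\<dots> = (\<Sum>k<n. ennreal (w k) * (\<integral>\<^sup>+x. ennreal (cmod (h k x) powr r) \<partial>M))"
    by (subst nn_integral_sum) (auto simp: nn_integral_cmult)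
  also have "\<dots> \<le> (\<Sum>k<n. ennreal (w k) * ennreal (b k powr r))" by (intro sum_mono mult_left_mono le) auto
  also have "\<dots> = (\<Sum>k<n. ennreal ((b k / S) * S powr r))"
  proof (rule sum.cong[OF refl])
    fix k
    have "w k * b k powr r = (b k / S) * S powr r" using b[of k] S by (simp add: w_def powr_divide)
    then show "ennreal (w k) * ennreal (b k powr r) = ennreal ((b k / S) * S powr r)"
      using w0[of k] by (simp add: ennreal_mult[symmetric])
  qed
  also have "\<dots> = ennreal (\<Sum>k<n. (b k / S) * S powr r)"
    using b S by (intro sum_ennreal) (simp add: less_imp_le)
  also have "(\<Sum>k<n. (b k / S) * S powr r) = S powr r"
    using S by (simp add: sum_distrib_right[symmetric] sum_divide_distrib[symmetric] S_def)
  finally show ?thesis by (simp add: S_def)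
qed simp

lemma Lq_le_series:
  fixes h :: "nat \<Rightarrow> 'a \<Rightarrow> complex"
  assumes h [measurable]: "\<And>k. h k \<in> borel_measurable M" and b: "\<And>k. b k > 0" and q: "1 \<le> q"
    and le: "\<And>k. Lq_le q M (h k) (b k)" and B: "summable b"
    and F: "AE x in M. (\<lambda>n. \<Sum>k<n. h k x) \<longlonglongrightarrow> F x"
  shows "Lq_le q M F (\<Sum>k. b k)"
proof (cases "q = \<infinity>")
  case True
  have "AE x in M. \<forall>k. cmod (h k x) \<le> b k"
    using le True by (simp add: AE_all_countable Lq_le_def)
  then have "AE x in M. cmod (F x) \<le> (\<Sum>k. b k)"
    using F
  proof eventually_elim
    case (elim x)
    have "cmod (\<Sum>k<n. h k x) \<le> (\<Sum>k. b k)" for n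
    proof -
      have "cmod (\<Sum>k<n. h k x) \<le> (\<Sum>k<n. b k)" using elim(1) by (intro order_trans[OF norm_sum] sum_mono) auto
      also have "\<dots> \<le> (\<Sum>k. b k)" using b by (intro sum_le_suminf B) (auto simp: less_imp_le)
      finally show ?thesis .
    qed
    then show ?case by (intro LIMSEQ_le_const2[OF tendsto_norm[OF elim(2)]]) auto
  qed
  then show ?thesis using True by (simp add: Lq_le_def)
next
  case False
  define r where "r = enn2real q"
  have r: "r \<ge> 1" unfolding r_def using q False by (intro enn2real_ge) auto
  have le': "(\<integral>\<^sup>+x. ennreal (cmod (h k x) powr r) \<partial>M) \<le> ennreal (b k powr r)" for k
    using le[of k] False by (simp add: Lq_le_def r_def)
  have part: "(\<integral>\<^sup>+x. ennreal (cmod (\<Sum>k<n. h k x) powr r) \<partial>M) \<le> ennreal ((\<Sum>k. b k) powr r)" for n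
  proof -
    have "(\<Sum>k<n. b k) powr r \<le> (\<Sum>k. b k) powr r"
      using b r by (intro powr_mono2 sum_le_suminf B sum_nonneg) (auto simp: less_imp_le)
    then show ?thesis using Lq_le_finite_sum[where n = n, OF h b r le'] by (meson ennreal_leI order_trans)
  qed
  have "(\<integral>\<^sup>+x. ennreal (cmod (F x) powr r) \<partial>M) = (\<integral>\<^sup>+x. liminf (\<lambda>n. ennreal (cmod (\<Sum>k<n. h k x) powr r)) \<partial>M)"
  proof (rule nn_integral_cong_AE)
    show "AE x in M. ennreal (cmod (F x) powr r) = liminf (\<lambda>n. ennreal (cmod (\<Sum>k<n. h k x) powr r))"
      using F
    proof eventually_elim
      case (elim x)
      have "(\<lambda>n. cmod (\<Sum>k<n. h k x) powr r) \<longlonglongrightarrow> cmod (F x) powr r"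
        using r by (intro tendsto_powr' tendsto_norm elim tendsto_const) auto
      then have "(\<lambda>n. ennreal (cmod (\<Sum>k<n. h k x) powr r)) \<longlonglongrightarrow> ennreal (cmod (F x) powr r)"
        by (rule tendsto_ennrealI)
      then show ?case by (intro lim_imp_Liminf[symmetric]) auto
    qed
  qed
  also have "\<dots> \<le> liminf (\<lambda>n. \<integral>\<^sup>+x. ennreal (cmod (\<Sum>k<n. h k x) powr r) \<partial>M)"
    by (rule nn_integral_liminf) measurable
  also have "\<dots> \<le> limsup (\<lambda>n. \<integral>\<^sup>+x. ennreal (cmod (\<Sum>k<n. h k x) powr r) \<partial>M)"
    by (rule Liminf_le_Limsup) simp
  also have "\<dots> \<le> ennreal ((\<Sum>k. b k) powr r)"
    by (rule Limsup_bounded) (simp add: part)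
  finally show ?thesis using False by (simp add: Lq_le_def r_def)
qed

section \<open>Norms on blocks of harmonics\<close>

definition L2n :: "('d::finite sfun) \<Rightarrow> real" where
  "L2n g = sqrt (\<integral>z. (cmod (g z))\<^sup>2 \<partial>\<sigma>)"

definition sphere_area :: "'d::finite itself \<Rightarrow> real" where
  "sphere_area _ = measure (\<sigma> :: (complex^'d) measure) (sphere 0 1)"

lemma sphere_area_pos: "sphere_area TYPE('d::finite) > 0"
  unfolding sphere_area_def by (rule surface_mass_pos)

lemma L2n_square: "(L2n g)\<^sup>2 = (\<integral>z. (cmod (g z))\<^sup>2 \<partial>\<sigma>)"
  unfolding L2n_def by simp

lemma L2n_nonneg: "L2n g \<ge> 0"
  unfolding L2n_def by simp

lemma L2n_lincomb:
  assumes B: "orthonormal B"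
  shows "(L2n (\<lambda>z. \<Sum>u\<in>B. c u * u z))\<^sup>2 = (\<Sum>u\<in>B. (cmod (c u))\<^sup>2)"
proof -
  have "(\<lambda>z. \<Sum>u\<in>B. c u * u z) \<in> csphere" using B by (intro csphere_lincomb) (auto simp: orthonormal_def)
  from sip_self[OF this] show ?thesis unfolding parseval[OF B] L2n_square by (simp only: of_real_eq_iff)
qed

lemma span_orthonormal_csphere: "orthonormal B \<Longrightarrow> f \<in> cfun.span B \<Longrightarrow> f \<in> csphere"
  using orthonormal_expand[of B f] csphere_lincomb[of B "sip f"] by (auto simp: orthonormal_def)

definition block_density :: "('d::finite sfun) set \<Rightarrow> real" where
  "block_density B = card B / sphere_area TYPE('d)"

text \<open>
  Bessel's inequality at a point, with the value of the kernel on the diagonal.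
\<close>

lemma block_sup_bound:
  fixes g :: "'d::finite sfun"
  assumes I: "finite I" and g: "g \<in> cfun.span (hblock I)"
  shows "cmod (g x) \<le> sqrt (block_density (hblock I :: ('d sfun) set)) * L2n g"
proof (cases "x \<in> sphere 0 1")
  case True
  have "(cmod (g x))\<^sup>2 \<le> (L2n g)\<^sup>2 * block_density (hblock I :: ('d sfun) set)"
    using bessel_pointwise[OF orthonormal_hblock[OF I] g, of x] hblock_kernel[OF I True]
    by (simp add: L2n_square block_density_def sphere_area_def)
  then have "cmod (g x) \<le> sqrt ((L2n g)\<^sup>2 * block_density (hblock I :: ('d sfun) set))" by (rule real_le_rsqrt)
  then show ?thesis using L2n_nonneg[of g] by (simp add: real_sqrt_mult mult.commute)
next
  case False
  then have "g x = 0" by (rule csphere_off[OF span_orthonormal_csphere[OF orthonormal_hblock[OF I] g]])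
  moreover have "block_density (hblock I :: ('d sfun) set) \<ge> 0"
    using sphere_area_pos[where 'd = 'd] by (simp add: block_density_def)
  ultimately show ?thesis using L2n_nonneg[of g] by simp
qed

lemma csphere_square_integrable: "g \<in> csphere \<Longrightarrow> integrable \<sigma> (\<lambda>z. (cmod (g z))\<^sup>2)"
proof -
  assume "g \<in> csphere"
  then have "integrable \<sigma> (\<lambda>z. cmod (g z * cnj (g z)))" by (intro integrable_norm sip_integrable)
  then show ?thesis by (simp add: norm_mult power2_eq_square)
qed

lemma L2n_zero: "g \<in> csphere \<Longrightarrow> L2n g = 0 \<Longrightarrow> g = (\<lambda>_. 0)"
  using sip_self[of g] L2n_square[of g] by (intro sip_self_zero) auto

text \<open>
  The cases \<open>q = 2\<close> and \<open>q = \<infinity>\<close> are immediate; in between, \<open>r - 2\<close> of the \<open>r\<close> powers are estimated by the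
  maximum.
\<close>

lemma block_Lq_bound:
  fixes g :: "'d::finite sfun"
  assumes I: "finite I" and g: "g \<in> cfun.span (hblock I)" and q: "2 \<le> q"
    and \<kappa>: "\<kappa> = block_density (hblock I :: ('d sfun) set)" "\<kappa> > 0"
  shows "Lq_le q \<sigma> g (\<kappa> powr (1/2 - enn2real (1 / q)) * L2n g)"
proof (cases "q = \<infinity>")
  case True
  then show ?thesis using block_sup_bound[OF I g] \<kappa> by (simp add: Lq_le_def powr_half_sqrt)
next
  case False
  define r where "r = enn2real q"
  have r: "r \<ge> 2" unfolding r_def using q False by (intro enn2real_ge) auto
  have qr: "enn2real (1 / q) = 1 / r"
    using False r unfolding r_def by (cases q rule: ennreal_cases) (auto simp: divide_ennreal[symmetric] ennreal_1[symmetric] simp del: ennreal_1)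
  have gc: "g \<in> csphere" by (rule span_orthonormal_csphere[OF orthonormal_hblock[OF I] g])
  define N where "N = L2n g"
  have N0: "N \<ge> 0" by (simp add: N_def L2n_nonneg)
  show ?thesis
  proof (cases "N = 0")
    case True
    then have "g = (\<lambda>_. 0)" using L2n_zero[OF gc] by (simp add: N_def)
    then show ?thesis using False r by (simp add: Lq_le_def r_def[symmetric])
  next
    case Nn: False
    then have N: "N > 0" using N0 by simp
    define A where "A = (sqrt \<kappa> * N) powr (r - 2)"
    have pw: "cmod (g x) powr r \<le> A * (cmod (g x))\<^sup>2" for x
    proof (cases "g x = 0")
      case gx: False
      have "cmod (g x) powr r = cmod (g x) powr ((r - 2) + 2)" by simp
      also have "\<dots> = cmod (g x) powr (r - 2) * cmod (g x) powr 2" by (rule powr_add)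
      also have "cmod (g x) powr 2 = (cmod (g x))\<^sup>2" using gx by simp
      also have "cmod (g x) powr (r - 2) \<le> A"
        unfolding A_def using r block_sup_bound[OF I g, of x] by (intro powr_mono2) (auto simp: \<kappa>(1) N_def)
      finally show ?thesis by (simp add: mult_right_mono)
    qed simp
    have "(\<integral>\<^sup>+x. ennreal (cmod (g x) powr r) \<partial>\<sigma>) \<le> (\<integral>\<^sup>+x. ennreal (A * (cmod (g x))\<^sup>2) \<partial>\<sigma>)"
      by (intro nn_integral_mono ennreal_leI pw)
    also have "\<dots> = ennreal (\<integral>x. A * (cmod (g x))\<^sup>2 \<partial>\<sigma>)"
      by (intro nn_integral_eq_integral integrable_mult_right csphere_square_integrable gc) (auto simp: A_def)
    also have "(\<integral>x. A * (cmod (g x))\<^sup>2 \<partial>\<sigma>) = A * N\<^sup>2" by (simp add: N_def L2n_square)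
    also have "A * N\<^sup>2 = (\<kappa> powr (1/2 - 1 / r) * N) powr r"
    proof -
      have "A = \<kappa> powr ((r - 2) / 2) * N powr (r - 2)"
        using N \<kappa>(2) by (simp add: A_def powr_mult powr_half_sqrt[symmetric] powr_powr)
      moreover have "N powr (r - 2) * N\<^sup>2 = N powr r"
      proof -
        have "N\<^sup>2 = N powr 2" using N by simp
        then show ?thesis by (simp only: powr_add[symmetric]) simp
      qed
      moreover have "(\<kappa> powr (1/2 - 1 / r) * N) powr r = \<kappa> powr ((1/2 - 1/r) * r) * N powr r"
        using N \<kappa>(2) by (simp add: powr_mult powr_powr)
      moreover have "(1/2 - 1/r) * r = (r - 2) / 2" using r by (simp add: field_simps)
      ultimately show ?thesis by (simp add: mult.assoc)
    qed
    finally show ?thesis using False qr by (simp add: Lq_le_def r_def N_def)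
  qed
qed

text \<open>
  With \<open>P\<close> the projection of \<open>\<phi>\<close> and \<open>G\<close> its norm, \<open>G\<^sup>2\<close> is the integral of \<open>\<phi> * cnj P\<close>. Where
  \<open>\<phi>\<close> exceeds the height \<open>T\<close>, the maximum of \<open>P\<close> is used, elsewhere Young's inequality in \<open>L\<^sup>2\<close>. The
  three resulting terms are each \<open>t * G\<close>, which is the origin of the factor \<open>3\<close>.
\<close>

lemma projection_L2_bound:
  fixes \<phi> :: "'d::finite sfun"
  assumes I: "finite I" and \<phi>: "\<phi> \<in> Lp_ball p \<sigma>" and p: "1 \<le> p" "p \<le> 2"
    and \<kappa>: "\<kappa> = block_density (hblock I :: ('d sfun) set)" "\<kappa> > 0"
  shows "L2n (\<lambda>z. \<Sum>u\<in>hblock I. sip \<phi> u * u z) \<le> 3 * \<kappa> powr (enn2real (1 / p) - 1/2)"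
proof -
  have p_fin: "p \<noteq> \<infinity>" using p(2) by (auto simp: top_unique)
  define r where "r = enn2real p"
  have r1: "r \<ge> 1" unfolding r_def using p p_fin by (intro enn2real_ge) auto
  have r2: "r \<le> 2" unfolding r_def using enn2real_mono[OF p(2)] by simp
  have pr: "enn2real (1 / p) = 1 / r"
    using p_fin r1 unfolding r_def by (cases p rule: ennreal_cases) (auto simp: divide_ennreal[symmetric] ennreal_1[symmetric] simp del: ennreal_1)
  note \<phi>i = Lp_ball_integral[OF \<phi> p(1) p_fin, folded r_def]
  have \<phi>_int: "integrable \<sigma> \<phi>"
    using \<phi> p(1) by (intro surf.Lp_space_integrable) (auto simp: Lp_ball_def)
  let ?B = "hblock I :: ('d sfun) set"
  have on: "orthonormal ?B" by (rule orthonormal_hblock[OF I])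
  then have fin: "finite ?B" and Bc: "\<And>u. u \<in> ?B \<Longrightarrow> u \<in> csphere" by (auto simp: orthonormal_def)
  define P where "P = (\<lambda>z. \<Sum>u\<in>?B. sip \<phi> u * u z)"
  have Ps: "P \<in> cfun.span ?B" unfolding P_def by (rule lincomb_span[OF fin])
  have Pc: "P \<in> csphere" by (rule span_orthonormal_csphere[OF on Ps])
  define G where "G = L2n P"
  have G0: "G \<ge> 0" by (simp add: G_def L2n_nonneg)
  have G2: "G\<^sup>2 = (\<Sum>u\<in>?B. (cmod (sip \<phi> u))\<^sup>2)" unfolding G_def P_def by (rule L2n_lincomb[OF on])
  have "sip \<phi> P = (\<Sum>u\<in>?B. cnj (sip \<phi> u) * sip \<phi> u)" unfolding P_def by (rule sip_lincomb_right[OF \<phi>_int Bc])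
  also have "\<dots> = of_real (G\<^sup>2)" unfolding G2 by (simp add: complex_norm_square mult.commute del: of_real_power)
  finally have sP: "sip \<phi> P = of_real (G\<^sup>2)" .
  show ?thesis
  proof (cases "G = 0")
    case True
    then show ?thesis by (simp add: G_def P_def)
  next
    case False
    then have G: "G > 0" using G0 by simp
    \<comment> \<open>The height \<open>T\<close> balances the two truncated parts, and \<open>\<alpha>\<close> balances the two terms of Young's inequality.\<close>
    define T where "T = \<kappa> powr (1 / r)"
    define A where "A = sqrt \<kappa> * G"
    define t where "t = \<kappa> powr (1 / r - 1/2)"
    define \<alpha> where "\<alpha> = t / G"
    have T: "T > 0" and t: "t > 0" and \<alpha>: "\<alpha> > 0" using \<kappa>(2) G by (auto simp: T_def t_def \<alpha>_def)
    have PA: "cmod (P z) \<le> A" for z using block_sup_bound[OF I Ps, of z] by (simp add: A_def G_def \<kappa>(1))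
    have A0: "A \<ge> 0" using \<kappa>(2) G by (simp add: A_def)
    have pw: "cmod (\<phi> z) * cmod (P z) \<le> (T powr (1 - r) * A + T powr (2 - r) / \<alpha>) * cmod (\<phi> z) powr r + \<alpha> * (cmod (P z))\<^sup>2" for z
    proof -
      define x where "x = cmod (\<phi> z)"
      define y where "y = cmod (P z)"
      have x0: "x \<ge> 0" "y \<ge> 0" "y \<le> A" using PA by (auto simp: x_def y_def)
      have n1: "T powr (1 - r) * A * x powr r \<ge> 0" "T powr (2 - r) / \<alpha> * x powr r \<ge> 0" "\<alpha> * y\<^sup>2 \<ge> 0"
        using A0 \<alpha> by auto
      have "x * y \<le> T powr (1 - r) * A * x powr r + T powr (2 - r) / \<alpha> * x powr r + \<alpha> * y\<^sup>2"
      proof (cases "x \<le> T")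
        case False
        have "x = x powr (1 - r) * x powr r" using False T by (simp add: powr_add[symmetric])
        also have "\<dots> \<le> T powr (1 - r) * x powr r"
          using False T r1 by (intro mult_right_mono powr_mono2') auto
        finally have "x * y \<le> (T powr (1 - r) * x powr r) * A" using x0 by (intro mult_mono) auto
        then show ?thesis using n1 by (simp add: mult_ac)
      next
        case True
        show ?thesis
        proof (cases "x = 0")
          case False
          then have x: "x > 0" using x0 by simp
          have "x\<^sup>2 = x powr 2" using x by simp
          also have "\<dots> = x powr (2 - r) * x powr r" by (simp add: powr_add[symmetric])
          also have "\<dots> \<le> T powr (2 - r) * x powr r"
            using True x r2 by (intro mult_right_mono powr_mono2) auto
          finally have x2: "x\<^sup>2 / \<alpha> \<le> T powr (2 - r) / \<alpha> * x powr r" using \<alpha> by (simp add: divide_right_mono)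
          have "0 \<le> (x - \<alpha> * y)\<^sup>2" by simp
          then have "2 * \<alpha> * (x * y) \<le> x\<^sup>2 + \<alpha>\<^sup>2 * y\<^sup>2" by (simp add: power2_eq_square algebra_simps)
          moreover have "0 \<le> \<alpha> * (x * y)" using \<alpha> x0 by simp
          ultimately have "\<alpha> * (x * y) \<le> x\<^sup>2 + \<alpha>\<^sup>2 * y\<^sup>2" by linarith
          then have "x * y \<le> x\<^sup>2 / \<alpha> + \<alpha> * y\<^sup>2" using \<alpha> by (simp add: field_simps power2_eq_square)
          then show ?thesis using x2 n1 by linarith
        qed (use n1 in simp)
      qed
      then show ?thesis unfolding x_def y_def by (simp add: algebra_simps)
    qed
    have int1: "integrable \<sigma> (\<lambda>z. (T powr (1 - r) * A + T powr (2 - r) / \<alpha>) * cmod (\<phi> z) powr r)"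
      using \<phi>i(2) by (intro integrable_mult_right)
    have int2: "integrable \<sigma> (\<lambda>z. \<alpha> * (cmod (P z))\<^sup>2)"
      by (intro integrable_mult_right csphere_square_integrable Pc)
    have "G\<^sup>2 = cmod (sip \<phi> P)" using sP by (simp add: norm_power)
    also have "\<dots> \<le> (\<integral>z. cmod (\<phi> z * cnj (P z)) \<partial>\<sigma>)" unfolding sip_def by (rule integral_norm_bound)
    also have "\<dots> \<le> (\<integral>z. (T powr (1 - r) * A + T powr (2 - r) / \<alpha>) * cmod (\<phi> z) powr r + \<alpha> * (cmod (P z))\<^sup>2 \<partial>\<sigma>)"
      using pw by (intro integral_mono integrable_norm csphere_mult_integrable \<phi>_int Pc Bochner_Integration.integrable_add int1 int2)
        (simp add: norm_mult)
    also have "\<dots> = (T powr (1 - r) * A + T powr (2 - r) / \<alpha>) * (\<integral>z. cmod (\<phi> z) powr r \<partial>\<sigma>) + \<alpha> * G\<^sup>2"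
      by (subst Bochner_Integration.integral_add[OF int1 int2]) (simp add: G_def L2n_square)
    also have "\<dots> \<le> (T powr (1 - r) * A + T powr (2 - r) / \<alpha>) * 1 + \<alpha> * G\<^sup>2"
      using \<phi>i(3) A0 \<alpha> by (intro add_right_mono mult_left_mono) auto
    also have "T powr (1 - r) * A = t * G"
    proof -
      have "T powr (1 - r) * sqrt \<kappa> = \<kappa> powr (1 / r * (1 - r) + 1/2)"
        using \<kappa>(2) by (simp add: T_def powr_powr powr_half_sqrt[symmetric] powr_add)
      also have "1 / r * (1 - r) + 1/2 = 1 / r - 1/2" using r1 by (simp add: field_simps)
      finally show ?thesis by (simp add: A_def t_def)
    qed
    also have "T powr (2 - r) / \<alpha> = t * G"
    proof -
      have "T powr (2 - r) = \<kappa> powr (1 / r * (2 - r))" using \<kappa>(2) by (simp add: T_def powr_powr)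
      also have "1 / r * (2 - r) = (1 / r - 1/2) + (1 / r - 1/2)" using r1 by (simp add: field_simps)
      also have "\<kappa> powr \<dots> = t * t" unfolding t_def by (rule powr_add)
      finally show ?thesis using t G by (simp add: \<alpha>_def)
    qed
    also have "\<alpha> * G\<^sup>2 = t * G" using G by (simp add: \<alpha>_def power2_eq_square)
    finally have "G * G \<le> (3 * t) * G" by (simp add: power2_eq_square algebra_simps)
    then have "G \<le> 3 * t" using G by (simp only: mult_le_cancel_right_pos)
    then show ?thesis by (simp add: G_def P_def t_def pr)
  qed
qed

section \<open>Approximation of a single block\<close>

lemma surf_mass: "measure (\<sigma> :: (complex^'d) measure) (space \<sigma>) = sphere_area TYPE('d::finite)"
  by (simp add: sphere_area_def space_surface_measure)

lemma csphere_measurable: "f \<in> csphere \<Longrightarrow> f \<in> borel_measurable \<sigma>"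
  by (rule borel_measurable_integrable[OF csphere_integrable])

text \<open>
  A basis of the block, extended by zero functions, is a system as in \<open>bounded_orthonormal\<close>, with
  the constant \<open>\<kappa>\<close> given by the addition theorem.
\<close>

lemma block_width:
  fixes I :: "(nat \<times> nat) set"
  assumes I: "finite I" and \<kappa>: "\<kappa> = block_density (hblock I :: ('d::finite sfun) set)" "\<kappa> > 0"
    and m: "m > 0" and r: "r > 0"
  shows "\<exists>V \<subseteq> cfun.span (hblock I :: ('d sfun) set). finite V \<and> card V \<le> m \<and>
    (\<forall>f \<in> cfun.span (hblock I). \<exists>y \<in> cfun.span V.
      (\<integral>z. cmod (f z - y z) ^ (2 * r) \<partial>\<sigma>)
        \<le> (128 * sqrt (real r * \<kappa> / real m) * max 1 (sphere_area TYPE('d)) * L2n f) ^ (2 * r))"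
proof -
  let ?B = "hblock I :: ('d sfun) set"
  define n where "n = card ?B"
  have on: "orthonormal ?B" by (rule orthonormal_hblock[OF I])
  then have fin: "finite ?B" and Bc: "\<And>u. u \<in> ?B \<Longrightarrow> u \<in> csphere" by (auto simp: orthonormal_def)
  obtain e where e: "bij_betw e {..<n} ?B" using ex_bij_betw_nat_finite[OF fin] by (auto simp: n_def lessThan_atLeast0)
  define u where "u j = (if j < n then e j else (\<lambda>_. 0))" for j
  have eB: "e j \<in> ?B" if "j < n" for j using e that by (auto simp: bij_betw_def)
  have uc: "u j \<in> csphere" for j using eB Bc by (simp add: u_def csphere_zero)
  have reidx: "(\<Sum>v\<in>?B. g v) = (\<Sum>j<n. g (u j))" for g :: "_ \<Rightarrow> 'x::comm_monoid_add"
    unfolding sum.reindex_bij_betw[OF e, symmetric] by (intro sum.cong) (auto simp: u_def)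
  interpret U: bounded_orthonormal "\<sigma> :: (complex^'d) measure" u n \<kappa>
  proof
    show "u j \<in> borel_measurable \<sigma>" for j by (rule csphere_measurable[OF uc])
    show "(\<integral>x. u i x * cnj (u j x) \<partial>\<sigma>) = (if i = j then 1 else 0)" if "i < n" "j < n" for i j
    proof -
      have "sip (e i) (e j) = (if e i = e j then 1 else 0)" using on eB that by (simp add: orthonormal_def)
      moreover have "e i = e j \<longleftrightarrow> i = j" using e that by (auto simp: bij_betw_def inj_on_def)
      ultimately show ?thesis using that by (simp add: sip_def u_def)
    qed
    show "(\<Sum>j<n. (cmod (u j x))\<^sup>2) \<le> \<kappa>" if "x \<in> space \<sigma>" for x
      using hblock_kernel[OF I, of x] that unfolding reidx \<kappa>(1) by (simp add: block_density_def sphere_area_def space_surface_measure)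
    show "\<kappa> > 0" by (rule \<kappa>(2))
  qed
  obtain v where v: "\<forall>c0. \<exists>b. U.J r (U.lin (\<lambda>j. c0 j - (\<Sum>i<m. b i * v i j)))
      \<le> (128 * sqrt (r * \<kappa> / m) * max 1 (sphere_area TYPE('d)) * U.len c0) ^ (2 * r)"
    using U.width_of_euclidean_ball[OF m r] unfolding surf_mass by blast
  define V where "V = (\<lambda>i. U.lin (v i)) ` {..<m}"
  have lin_span: "U.lin c \<in> cfun.span ?B" for c
  proof -
    have "U.lin c = (\<Sum>j<n. (\<lambda>z. c j * u j z))" by (auto simp: U.lin_def fun_eq_iff sum_fun_apply)
    also have "\<dots> \<in> cfun.span ?B"
      by (intro cfun.span_sum cfun.span_scale cfun.span_base) (auto simp: u_def eB)
    finally show ?thesis .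
  qed
  show ?thesis
  proof (intro exI[of _ V] conjI ballI)
    show "V \<subseteq> cfun.span ?B" unfolding V_def using lin_span by auto
    show "finite V" by (simp add: V_def)
    show "card V \<le> m" unfolding V_def using card_image_le[of "{..<m}"] by simp
    fix f assume f: "f \<in> cfun.span ?B"
    define c0 where "c0 j = sip f (u j)" for j
    have fe: "f = (\<lambda>z. \<Sum>w\<in>?B. sip f w * w z)" by (rule orthonormal_expand[OF on f])
    have f_lin: "f = U.lin c0"
    proof
      fix z show "f z = U.lin c0 z" by (subst fe) (simp add: reidx U.lin_def c0_def)
    qed
    have "(L2n f)\<^sup>2 = (\<Sum>w\<in>?B. (cmod (sip f w))\<^sup>2)" by (subst fe) (rule L2n_lincomb[OF on])
    then have "L2n f = U.len c0"
      unfolding reidx U.len_def c0_def using L2n_nonneg[of f] by (metis real_sqrt_unique)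
    moreover obtain b where b: "U.J r (U.lin (\<lambda>j. c0 j - (\<Sum>i<m. b i * v i j)))
      \<le> (128 * sqrt (r * \<kappa> / m) * max 1 (sphere_area TYPE('d)) * U.len c0) ^ (2 * r)" using v by blast
    define y where "y = (\<lambda>z. \<Sum>i<m. b i * U.lin (v i) z)"
    have "U.lin (\<lambda>j. c0 j - (\<Sum>i<m. b i * v i j)) = (\<lambda>z. f z - y z)"
      unfolding f_lin y_def U.lin_def
      by (simp add: fun_eq_iff left_diff_distrib sum_subtractf sum_distrib_right sum_distrib_left mult.assoc sum.swap[of _ "{..<n}"])
    moreover have "y \<in> cfun.span V"
    proof -
      have "y = (\<Sum>i<m. (\<lambda>z. b i * U.lin (v i) z))" by (auto simp: y_def fun_eq_iff sum_fun_apply)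
      also have "\<dots> \<in> cfun.span V" by (intro cfun.span_sum cfun.span_scale cfun.span_base) (auto simp: V_def)
      finally show ?thesis .
    qed
    ultimately show "\<exists>y\<in>cfun.span V. (\<integral>z. cmod (f z - y z) ^ (2 * r) \<partial>\<sigma>)
        \<le> (128 * sqrt (real r * \<kappa> / real m) * max 1 (sphere_area TYPE('d)) * L2n f) ^ (2 * r)"
      using b by (intro bexI[of _ y]) (simp_all add: U.J_def)
  qed
qed

lemma csphere_power: "e \<in> csphere \<Longrightarrow> (\<lambda>z. e z ^ Suc r) \<in> csphere"
proof (induction r)
  case (Suc r)
  then show ?case using csphere_mult[of e "\<lambda>z. e z ^ Suc r"] by simp
qed simp

lemma csphere_even_power_integrable:
  assumes "e \<in> csphere" "r > 0" shows "integrable \<sigma> (\<lambda>z. cmod (e z) ^ (2 * r))"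
proof -
  obtain s where s: "r = Suc s" using assms(2) by (cases r) auto
  have "integrable \<sigma> (\<lambda>z. (cmod (e z ^ r))\<^sup>2)"
    unfolding s by (intro csphere_square_integrable csphere_power assms(1))
  then show ?thesis by (simp add: norm_power power_mult[symmetric] mult.commute)
qed

lemma Lq_le_even_moment:
  fixes e :: "'d::finite sfun"
  assumes e: "e \<in> csphere" and q: "1 \<le> q" "q \<noteq> \<infinity>" and r: "r > 0" "enn2real q \<le> 2 * real r" and D: "D > 0"
    and le: "(\<integral>z. cmod (e z) ^ (2 * r) \<partial>\<sigma>) \<le> D ^ (2 * r)"
  shows "Lq_le q \<sigma> e (D * (sphere_area TYPE('d) + 1))"
proof -
  define s where "s = enn2real q"
  define \<omega> where "\<omega> = sphere_area TYPE('d)"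
  have \<omega>: "\<omega> > 0" by (simp add: \<omega>_def sphere_area_pos)
  have s: "s \<ge> 1" unfolding s_def using q by (intro enn2real_ge) auto
  have [measurable]: "e \<in> borel_measurable \<sigma>" by (rule csphere_measurable[OF e])
  let ?g = "\<lambda>z. D powr s + (D powr s / D ^ (2 * r)) * cmod (e z) ^ (2 * r)"
  have pw: "cmod (e z) powr s \<le> ?g z" for z
  proof -
    define x where "x = cmod (e z) / D"
    have x0: "x \<ge> 0" using D by (simp add: x_def)
    have "x powr s \<le> 1 + x ^ (2 * r)"
    proof (cases "x \<le> 1")
      case True
      then have "x powr s \<le> 1" using x0 s powr_mono2[of s x 1] by simp
      then show ?thesis using x0 by (simp add: add_increasing2)
    next
      case False
      then have "x powr s \<le> x powr (real (2 * r))" using r s_def by (intro powr_mono) auto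
      also have "\<dots> = x ^ (2 * r)" using False by (intro powr_realpow) auto
      finally show ?thesis by simp
    qed
    then have "D powr s * x powr s \<le> D powr s * (1 + x ^ (2 * r))" by (intro mult_left_mono) auto
    moreover have "D powr s * x powr s = cmod (e z) powr s"
      using D by (simp add: powr_mult[symmetric] x_def)
    ultimately show ?thesis by (simp add: x_def power_divide algebra_simps)
  qed
  have gi: "integrable \<sigma> ?g"
    using csphere_even_power_integrable[OF e r(1)] by (intro Bochner_Integration.integrable_add integrable_mult_right) auto
  have g0: "?g z \<ge> 0" for z using D by (intro add_nonneg_nonneg mult_nonneg_nonneg divide_nonneg_nonneg) auto
  have "(\<integral>\<^sup>+z. ennreal (cmod (e z) powr s) \<partial>\<sigma>) \<le> (\<integral>\<^sup>+z. ennreal (?g z) \<partial>\<sigma>)"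
    by (intro nn_integral_mono ennreal_leI pw)
  also have "\<dots> = ennreal (\<integral>z. ?g z \<partial>\<sigma>)"
    using g0 by (intro nn_integral_eq_integral gi) auto
  also have "(\<integral>z. ?g z \<partial>\<sigma>) = D powr s * \<omega> + (D powr s / D ^ (2 * r)) * (\<integral>z. cmod (e z) ^ (2 * r) \<partial>\<sigma>)"
    using csphere_even_power_integrable[OF e r(1)]
    by (subst Bochner_Integration.integral_add) (auto simp: surf_mass[unfolded space_surface_measure] space_surface_measure \<omega>_def)
  also have "ennreal \<dots> \<le> ennreal (D powr s * \<omega> + (D powr s / D ^ (2 * r)) * D ^ (2 * r))"
    using D le by (intro ennreal_leI add_left_mono mult_left_mono) auto
  also have "D powr s * \<omega> + (D powr s / D ^ (2 * r)) * D ^ (2 * r) = D powr s * (\<omega> + 1)" using D by (simp add: algebra_simps)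
  also have "ennreal \<dots> \<le> ennreal ((D * (\<omega> + 1)) powr s)"
  proof (intro ennreal_leI)
    have "\<omega> + 1 = (\<omega> + 1) powr 1" using \<omega> by simp
    also have "\<dots> \<le> (\<omega> + 1) powr s" using \<omega> s by (intro powr_mono) auto
    finally show "D powr s * (\<omega> + 1) \<le> (D * (\<omega> + 1)) powr s" unfolding powr_mult by (intro mult_left_mono) auto
  qed
  finally show ?thesis using q(2) by (simp add: Lq_le_def s_def \<omega>_def)
qed

text \<open>
  The power \<open>e ^ r\<close> belongs to a space of polynomials in which the maximum is at most \<open>sqrt \<kappa>\<close> times the
  norm in \<open>L\<^sup>2\<close>. Taking the \<open>r\<close>-th root makes the factor bounded, because \<open>\<kappa>\<close> is at most a constant times a
  power of \<open>r * R + 1\<close>, hence exponential in \<open>r\<close>.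
\<close>

lemma sup_le_even_moment:
  fixes e :: "'d::finite sfun"
  assumes e: "e \<in> polys_le R" and r: "r > 0" and R: "real r * real R + 1 \<le> exp (2 * real r)" and D: "D > 0"
    and le: "(\<integral>z. cmod (e z) ^ (2 * r) \<partial>\<sigma>) \<le> D ^ (2 * r)"
  shows "cmod (e x) \<le> D * (exp (2 * real CARD('d)) * max 1 (1 / sphere_area TYPE('d)))"
proof -
  define CI where "CI = max 1 (1 / sphere_area TYPE('d))"
  have CI: "CI \<ge> 1" "1 / sphere_area TYPE('d) \<le> CI" by (auto simp: CI_def)
  obtain s where s: "r = Suc s" using r by (cases r) auto
  define I where "I = {..r * R} \<times> {..r * R}"
  have er: "(\<lambda>z. e z ^ r) \<in> cfun.span (hblock I)" using polys_le_power[OF e, of s] unfolding polys_le_def I_def s .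
  have fI: "finite I" by (simp add: I_def)
  define \<kappa> where "\<kappa> = block_density (hblock I :: ('d sfun) set)"
  have L2: "(L2n (\<lambda>z. e z ^ r))\<^sup>2 \<le> (D ^ r)\<^sup>2"
    unfolding L2n_square using le by (simp add: norm_power power_mult[symmetric] mult.commute)
  then have L2': "L2n (\<lambda>z. e z ^ r) \<le> D ^ r" by (rule power2_le_imp_le) (use D in auto)
  have "\<kappa> \<le> (exp (2 * real r) ^ CARD('d))\<^sup>2 * CI"
  proof -
    have "real (card (hblock I :: ('d sfun) set)) \<le> real (((r * R + 1) ^ CARD('d))\<^sup>2)"
      unfolding I_def using card_hblock_upper[of "r * R", where 'd = 'd] by (simp only: of_nat_le_iff)
    also have "\<dots> = ((real r * real R + 1) ^ CARD('d))\<^sup>2" by (simp add: add.commute)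
    also have "\<dots> \<le> (exp (2 * real r) ^ CARD('d))\<^sup>2" using R by (intro power_mono) auto
    finally have "real (card (hblock I :: ('d sfun) set)) * (1 / sphere_area TYPE('d))
        \<le> (exp (2 * real r) ^ CARD('d))\<^sup>2 * CI"
      using CI sphere_area_pos[where 'd = 'd] by (intro mult_mono) auto
    then show ?thesis by (simp add: \<kappa>_def block_density_def)
  qed
  then have "sqrt \<kappa> \<le> sqrt ((exp (2 * real r) ^ CARD('d))\<^sup>2 * CI)" by simp
  also have "\<dots> = exp (2 * real r) ^ CARD('d) * sqrt CI" by (simp add: real_sqrt_mult)
  also have "\<dots> \<le> exp (2 * real r) ^ CARD('d) * CI"
    using CI by (intro mult_left_mono real_le_lsqrt) (auto simp: power2_eq_square)
  also have "exp (2 * real r) ^ CARD('d) = exp (2 * real CARD('d)) ^ r"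
    by (simp add: exp_of_nat_mult[symmetric] mult_ac)
  also have "exp (2 * real CARD('d)) ^ r * CI \<le> exp (2 * real CARD('d)) ^ r * CI ^ r"
    using CI r by (intro mult_left_mono self_le_power) auto
  finally have k: "sqrt \<kappa> \<le> (exp (2 * real CARD('d)) * CI) ^ r" by (simp add: power_mult_distrib)
  have "cmod (e x) ^ r = cmod (e x ^ r)" by (simp add: norm_power)
  also have "\<dots> \<le> sqrt \<kappa> * L2n (\<lambda>z. e z ^ r)" unfolding \<kappa>_def by (rule block_sup_bound[OF fI er])
  also have "\<dots> \<le> (exp (2 * real CARD('d)) * CI) ^ r * D ^ r"
    using CI by (intro mult_mono k L2' L2n_nonneg) auto
  also have "\<dots> = (D * (exp (2 * real CARD('d)) * CI)) ^ r" by (simp add: power_mult_distrib mult_ac)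
  finally show ?thesis unfolding CI_def[symmetric]
    by (rule power_le_imp_le_base[where n = s, folded s]) (use D CI in auto)
qed

text \<open>
  The last factor of \<open>rho\<close> as a real number.
\<close>

definition rho_factor :: "ennreal \<Rightarrow> nat \<Rightarrow> real" where
  "rho_factor q t = (if q = \<infinity> then sqrt (ln (real t)) else sqrt (enn2real q))"

definition block_const :: "'d::finite itself \<Rightarrow> real" where
  "block_const _ = 256 * max 1 (sphere_area TYPE('d)) * max 1 (1 / sphere_area TYPE('d)) *
     (sphere_area TYPE('d) + 1 + exp (2 * real CARD('d)) * max 1 (1 / sphere_area TYPE('d)))"

lemma density_levels: "block_density (hblock (levels a b) :: ('d::finite sfun) set) = theta TYPE('d) a b / sphere_area TYPE('d)"
  by (simp add: block_density_def theta_eq_card)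

lemma levels_polys_le: "cfun.span (hblock (levels a b)) \<subseteq> polys_le b"
  unfolding polys_le_def by (intro cfun.span_mono) (force simp: hblock_def levels_def)

lemma Lq_le_mono: "Lq_le q M f b \<Longrightarrow> 0 \<le> b \<Longrightarrow> b \<le> c \<Longrightarrow> Lq_le q M f c"
  by (cases "q = \<infinity>") (auto simp: Lq_le_def elim!: eventually_mono order_trans intro!: ennreal_leI intro: powr_mono2[OF enn2real_nonneg])

theorem block_approximation:
  assumes d: "CARD('d::finite) \<ge> 2" and ab: "a < b" and m: "m > 0" and q: "2 \<le> q"
  shows "\<exists>V \<subseteq> cfun.span (hblock (levels a b) :: ('d sfun) set). finite V \<and> card V \<le> m \<and>
    (\<forall>f \<in> cfun.span (hblock (levels a b)). \<forall>L>0. L2n f \<le> L \<longrightarrow> (\<exists>y \<in> cfun.span V.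
      Lq_le q \<sigma> (\<lambda>z. f z - y z)
        (block_const TYPE('d) * sqrt (theta TYPE('d) a b / real m) * rho_factor q (theta TYPE('d) a b) * L)))"
proof -
  define \<theta> where "\<theta> = theta TYPE('d) a b"
  define \<omega> where "\<omega> = sphere_area TYPE('d)"
  define CI where "CI = max 1 (1 / \<omega>)"
  define \<omega>1 where "\<omega>1 = max 1 \<omega>"
  define F where "F = \<omega> + 1 + exp (2 * real CARD('d)) * CI"
  define \<kappa> where "\<kappa> = block_density (hblock (levels a b) :: ('d sfun) set)"
  define P where "P = rho_factor q \<theta>"
  have \<omega>: "\<omega> > 0" by (simp add: \<omega>_def sphere_area_pos)
  have CI: "CI \<ge> 1" "1 / \<omega> \<le> CI" and \<omega>1: "\<omega>1 \<ge> 1" by (auto simp: CI_def \<omega>1_def)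
  have \<theta>b: "b + 1 \<le> \<theta>" unfolding \<theta>_def by (rule theta_lower[OF d ab])
  then have \<theta>: "\<theta> \<ge> 2" using ab by simp
  have \<kappa>eq: "\<kappa> = \<theta> / \<omega>" by (simp add: \<kappa>_def density_levels \<theta>_def \<omega>_def)
  have \<kappa>: "\<kappa> > 0" using \<theta> \<omega> by (simp add: \<kappa>eq)
  have F: "F \<ge> \<omega> + 1" "F \<ge> exp (2 * real CARD('d)) * CI" "F > 0"
    using CI \<omega> by (auto simp: F_def add_pos_pos intro!: add_nonneg_nonneg)
  have ln2: "ln (real \<theta>) \<ge> 1/2"
  proof -
    have "1/2 \<le> ln (2::real)" using ln2_ge_two_thirds by simp
    also have "\<dots> \<le> ln (real \<theta>)" using \<theta> by simp
    finally show ?thesis .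
  qed
  \<comment> \<open>The even exponent that represents the norm up to constants.\<close>
  obtain r :: nat where r: "r > 0" "sqrt (real r) \<le> 2 * P" "P > 0"
    and r_fin: "q \<noteq> \<infinity> \<Longrightarrow> enn2real q \<le> 2 * real r"
    and r_inf: "q = \<infinity> \<Longrightarrow> real r * real b + 1 \<le> exp (2 * real r)"
  proof (cases "q = \<infinity>")
    case True
    define r where "r = nat \<lceil>ln (real \<theta>)\<rceil>"
    have r: "ln (real \<theta>) \<le> real r" "real r \<le> ln (real \<theta>) + 1" using ln2 unfolding r_def by linarith+
    have r0: "r > 0" using r ln2 by (cases r) auto
    have "real r \<le> 4 * ln (real \<theta>)" using r ln2 by linarith
    then have "sqrt (real r) \<le> sqrt (4 * ln (real \<theta>))" by simp
    also have "\<dots> = 2 * P" using True by (simp add: P_def rho_factor_def real_sqrt_mult)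
    finally have 1: "sqrt (real r) \<le> 2 * P" .
    have "real \<theta> = exp (ln (real \<theta>))" using \<theta> by simp
    also have "\<dots> \<le> exp (real r)" using r by simp
    finally have \<theta>e: "real \<theta> \<le> exp (real r)" .
    have "real r * real b + 1 \<le> real r * (real b + 1)" using r0 by (simp add: algebra_simps)
    also have "\<dots> \<le> real r * real \<theta>" using \<theta>b by (intro mult_left_mono) auto
    also have "\<dots> \<le> exp (real r) * exp (real r)"
    proof (rule mult_mono[OF _ \<theta>e])
      show "real r \<le> exp (real r)" using exp_ge_add_one_self[of "real r"] by linarith
    qed auto
    also have "\<dots> = exp (2 * real r)" by (simp add: exp_add[symmetric])
    finally have 2: "real r * real b + 1 \<le> exp (2 * real r)" .
    have 3: "P > 0" using True ln2 by (simp add: P_def rho_factor_def)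
    show ?thesis by (rule that[OF r0 1 3]) (use True 2 in auto)
  next
    case False
    define s where "s = enn2real q"
    have s: "s \<ge> 2" unfolding s_def using q False by (intro enn2real_ge) auto
    define r where "r = nat \<lceil>s / 2\<rceil>"
    have r: "s / 2 \<le> real r" "real r \<le> s / 2 + 1" using s unfolding r_def by linarith+
    have r0: "r > 0" using r s by (cases r) auto
    have 3: "P > 0" and P: "P = sqrt s" using False s by (auto simp: P_def rho_factor_def s_def)
    have "real r \<le> s" using r s by simp
    then have "sqrt (real r) \<le> sqrt s" by simp
    then have 1: "sqrt (real r) \<le> 2 * P" using 3 unfolding P by linarith
    show ?thesis by (rule that[OF r0 1 3]) (use False r s_def in auto)
  qed
  obtain V where V: "V \<subseteq> cfun.span (hblock (levels a b) :: ('d sfun) set)" "finite V" "card V \<le> m"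
    and approx: "\<And>f. f \<in> cfun.span (hblock (levels a b)) \<Longrightarrow> \<exists>y \<in> cfun.span V.
      (\<integral>z. cmod (f z - y z) ^ (2 * r) \<partial>\<sigma>) \<le> (128 * sqrt (real r * \<kappa> / real m) * \<omega>1 * L2n f) ^ (2 * r)"
    using block_width[OF finite_levels \<kappa>_def \<kappa> m r(1)] unfolding \<omega>1_def \<omega>_def by blast
  show ?thesis
  proof (intro exI[of _ V] conjI ballI allI impI V)
    fix f :: "'d sfun" and L :: real
    assume f: "f \<in> cfun.span (hblock (levels a b))" and L: "L > 0" "L2n f \<le> L"
    obtain y where y: "y \<in> cfun.span V" and yle: "(\<integral>z. cmod (f z - y z) ^ (2 * r) \<partial>\<sigma>)
        \<le> (128 * sqrt (real r * \<kappa> / real m) * \<omega>1 * L2n f) ^ (2 * r)" using approx[OF f] by blast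
    define D where "D = 256 * \<omega>1 * CI * sqrt (real \<theta> / real m) * P * L"
    have D: "D > 0" using \<omega>1 CI \<theta> m r(3) L by (simp add: D_def)
    have "sqrt (real r * \<kappa> / real m) = sqrt (real r) * sqrt (real \<theta> / real m) * sqrt (1 / \<omega>)"
      by (simp add: \<kappa>eq real_sqrt_mult real_sqrt_divide)
    also have "\<dots> \<le> (2 * P) * sqrt (real \<theta> / real m) * CI"
    proof (intro mult_mono r)
      have "sqrt (1 / \<omega>) \<le> sqrt CI" using CI by simp
      also have "\<dots> \<le> CI" using CI by (intro real_le_lsqrt) (auto simp: power2_eq_square)
      finally show "sqrt (1 / \<omega>) \<le> CI" .
    qed (use r \<omega> in auto)
    finally have "128 * sqrt (real r * \<kappa> / real m) * \<omega>1 * L2n f \<le> 128 * ((2 * P) * sqrt (real \<theta> / real m) * CI) * \<omega>1 * L"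
      using L L2n_nonneg[of f] \<omega>1 r CI by (intro mult_mono mult_left_mono) auto
    also have "\<dots> = D" by (simp add: D_def)
    finally have "(128 * sqrt (real r * \<kappa> / real m) * \<omega>1 * L2n f) ^ (2 * r) \<le> D ^ (2 * r)"
      using L2n_nonneg[of f] \<omega>1 \<kappa> by (intro power_mono) auto
    then have le: "(\<integral>z. cmod (f z - y z) ^ (2 * r) \<partial>\<sigma>) \<le> D ^ (2 * r)" using yle by (rule order_trans[rotated])
    have ys: "y \<in> cfun.span (hblock (levels a b))"
      using y V(1) cfun.span_mono[of V "cfun.span (hblock (levels a b))"] by (auto simp: cfun.span_span)
    have fy: "(\<lambda>z. f z - y z) \<in> cfun.span (hblock (levels a b))"
      using cfun.span_diff[OF f ys] by (simp add: fun_diff_def)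
    have "Lq_le q \<sigma> (\<lambda>z. f z - y z) (D * F)"
    proof (cases "q = \<infinity>")
      case True
      have "cmod (f x - y x) \<le> D * F" for x
      proof -
        have "cmod (f x - y x) \<le> D * (exp (2 * real CARD('d)) * CI)" unfolding CI_def \<omega>_def
          by (rule sup_le_even_moment[OF levels_polys_le[THEN subsetD, OF fy] r(1) r_inf[OF True] D le])
        also have "\<dots> \<le> D * F" using D F by (intro mult_left_mono) auto
        finally show ?thesis .
      qed
      then show ?thesis using True by (simp add: Lq_le_def)
    next
      case False
      have q1: "1 \<le> q" using q by (rule order_trans[rotated]) simp
      have "Lq_le q \<sigma> (\<lambda>z. f z - y z) (D * (\<omega> + 1))" unfolding \<omega>_def
        by (rule Lq_le_even_moment[OF span_orthonormal_csphere[OF orthonormal_hblock[OF finite_levels] fy] q1 False r(1) r_fin[OF False] D le])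
      then show ?thesis using D F \<omega> by (rule_tac Lq_le_mono) auto
    qed
    moreover have "D * F = block_const TYPE('d) * sqrt (\<theta> / real m) * P * L"
      by (simp add: D_def block_const_def F_def CI_def \<omega>1_def \<omega>_def)
    ultimately show "\<exists>y \<in> cfun.span V. Lq_le q \<sigma> (\<lambda>z. f z - y z)
        (block_const TYPE('d) * sqrt (theta TYPE('d) a b / real m) * rho_factor q (theta TYPE('d) a b) * L)"
      unfolding \<theta>_def[symmetric] P_def[symmetric] using y by auto
  qed
qed

section \<open>Multipliers on blocks\<close>

definition block_proj :: "nat \<Rightarrow> nat \<Rightarrow> ('d::finite sfun) \<Rightarrow> 'd sfun" where
  "block_proj a b f z = (\<Sum>u\<in>hblock (levels a b). sip f u * u z)"

lemma block_proj_span: "block_proj a b f \<in> cfun.span (hblock (levels a b))"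
  unfolding block_proj_def[abs_def]
  using orthonormal_hblock[OF finite_levels] by (intro lincomb_span) (auto simp: orthonormal_def)

lemma block_proj_csphere: "block_proj a b f \<in> csphere"
  by (rule span_orthonormal_csphere[OF orthonormal_hblock[OF finite_levels] block_proj_span])

text \<open>
  The expansion only prescribes the values of the projections on the sphere; off the
  sphere all functions involved vanish, so the basis coefficients can be compared.
\<close>

lemma multiplier_coefficient:
  fixes f \<phi> :: "'d::finite sfun"
  assumes \<phi>: "integrable \<sigma> \<phi>" and f: "integrable \<sigma> f"
    and ex: "has_multiplier_expansion lam \<phi> f" and u: "u \<in> hbasis m n"
  shows "sip f u = of_real (lam m n) * sip \<phi> u"
proof -
  have "(\<lambda>z. \<Sum>v\<in>hbasis m n. sip f v * v z) = (\<lambda>z. \<Sum>v\<in>hbasis m n. (of_real (lam m n) * sip \<phi> v) * v z)"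
  proof
    fix z
    show "(\<Sum>v\<in>hbasis m n. sip f v * v z) = (\<Sum>v\<in>hbasis m n. (of_real (lam m n) * sip \<phi> v) * v z)"
    proof (cases "z \<in> sphere 0 1")
      case True
      then have "zonal_conv f m n z = of_real (lam m n) * zonal_conv \<phi> m n z"
        using ex by (auto simp: has_multiplier_expansion_def)
      then show ?thesis unfolding zonal_conv_eq[OF \<phi>] zonal_conv_eq[OF f] by (simp add: sum_distrib_left mult.assoc)
    next
      case False
      have "(\<Sum>v\<in>hbasis m n. c v * v z) = 0" for c
      proof (rule sum.neutral, rule ballI)
        fix v :: "'d sfun" assume "v \<in> hbasis m n"
        then have "v z = 0" using False hbasis_csphere csphere_off by blast
        then show "c v * v z = 0" by simp
      qed
      then show ?thesis by simp
    qed
  qed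
  then show ?thesis
    using orthonormal_coeff[OF hbasis(1) u, of "sip f"] orthonormal_coeff[OF hbasis(1) u, of "\<lambda>v. of_real (lam m n) * sip \<phi> v"]
    by simp
qed

lemma L2n_block_proj: "(L2n (block_proj a b f))\<^sup>2 = (\<Sum>u\<in>hblock (levels a b). (cmod (sip f u))\<^sup>2)"
  unfolding block_proj_def[abs_def] by (rule L2n_lincomb[OF orthonormal_hblock[OF finite_levels]])

lemma multiplier_block_L2:
  fixes f \<phi> :: "'d::finite sfun"
  assumes \<phi>: "integrable \<sigma> \<phi>" and f: "integrable \<sigma> f"
    and ex: "has_multiplier_expansion (\<lambda>i j. lam (real (max i j))) \<phi> f"
    and pos: "\<And>x. x > 0 \<Longrightarrow> lam x > (0::real)" and anti: "antimono_on {0<..} lam" and a: "a \<ge> 1"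
  shows "L2n (block_proj a b f) \<le> lam (real a) * L2n (block_proj a b \<phi>)"
proof (rule power2_le_imp_le)
  have la: "lam (real a) > 0" using pos a by simp
  show "0 \<le> lam (real a) * L2n (block_proj a b \<phi>)" using la L2n_nonneg[of "block_proj a b \<phi>"] by simp
  have "(\<Sum>u\<in>hblock (levels a b). (cmod (sip f u))\<^sup>2) \<le> (\<Sum>u\<in>hblock (levels a b). (lam (real a))\<^sup>2 * (cmod (sip \<phi> u))\<^sup>2)"
  proof (rule sum_mono)
    fix u :: "'d sfun" assume "u \<in> hblock (levels a b)"
    then obtain i j where ij: "a < max i j" "u \<in> hbasis i j" by (auto simp: hblock_def levels_def)
    have l: "lam (real (max i j)) > 0" using ij a by (intro pos) auto
    have "lam (real (max i j)) \<le> lam (real a)"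
      using monotone_onD[OF anti, of "real a" "real (max i j)"] ij a by auto
    then have "cmod (sip f u) \<le> lam (real a) * cmod (sip \<phi> u)"
      using l unfolding multiplier_coefficient[OF \<phi> f ex ij(2)] by (simp add: norm_mult mult_right_mono)
    then have "(cmod (sip f u))\<^sup>2 \<le> (lam (real a) * cmod (sip \<phi> u))\<^sup>2" by (intro power_mono) auto
    then show "(cmod (sip f u))\<^sup>2 \<le> (lam (real a))\<^sup>2 * (cmod (sip \<phi> u))\<^sup>2" by (simp add: power_mult_distrib)
  qed
  then show "(L2n (block_proj a b f))\<^sup>2 \<le> (lam (real a) * L2n (block_proj a b \<phi>))\<^sup>2"
    by (simp add: L2n_block_proj power_mult_distrib sum_distrib_left)
qed

lemma inv_area_powr_le:
  assumes "0 \<le> s" "s \<le> 1" "t \<ge> 0"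
  shows "(t / sphere_area TYPE('d::finite)) powr s \<le> max 1 (1 / sphere_area TYPE('d)) * t powr s"
proof -
  define CI where "CI = max 1 (1 / sphere_area TYPE('d))"
  have CI: "CI \<ge> 1" "1 / sphere_area TYPE('d) \<le> CI" by (auto simp: CI_def)
  have "(t / sphere_area TYPE('d)) powr s \<le> (CI * t) powr s"
    using CI assms sphere_area_pos[where 'd = 'd] mult_right_mono[OF CI(2), of t] by (intro powr_mono2) auto
  also have "\<dots> = CI powr s * t powr s" by (rule powr_mult)
  also have "\<dots> \<le> CI powr 1 * t powr s" using CI assms by (intro mult_right_mono powr_mono) auto
  finally show ?thesis using CI by (simp add: CI_def)
qed

lemma conjugate_exponent_bounds:
  assumes "1 \<le> p" "p \<le> (2::ennreal)"
  shows "1/2 \<le> enn2real (1 / p)" "enn2real (1 / p) \<le> 1"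
proof -
  have pf: "p \<noteq> \<infinity>" using assms(2) by (auto simp: top_unique)
  then obtain x where x: "p = ennreal x" "x \<ge> 0" by (cases p rule: ennreal_cases) auto
  have x1: "x \<ge> 1" "x \<le> 2"
    using enn2real_ge[of 1 p] pf assms(1) x enn2real_mono[OF assms(2)] by auto
  have "1 / p = ennreal (1 / x)" using x x1 divide_ennreal[of 1 x] by simp
  then show "1/2 \<le> enn2real (1 / p)" "enn2real (1 / p) \<le> 1" using x1 by (auto simp: field_simps)
qed

lemma exponent_le_half:
  assumes "2 \<le> (q::ennreal)"
  shows "0 \<le> enn2real (1 / q)" "enn2real (1 / q) \<le> 1/2"
proof -
  show "enn2real (1 / q) \<le> 1/2"
  proof (cases "q = \<infinity>")
    case False
    then obtain x where x: "q = ennreal x" "x \<ge> 0" by (cases q rule: ennreal_cases) auto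
    have x1: "x \<ge> 2" using enn2real_ge[of 2 q] False assms x by auto
    have "1 / q = ennreal (1 / x)" using x x1 divide_ennreal[of 1 x] by simp
    then show ?thesis using x1 by (auto simp: field_simps)
  qed simp
qed simp

lemma multiplier_block_bound:
  fixes f \<phi> :: "'d::finite sfun"
  assumes d: "CARD('d) \<ge> 2" and \<phi>: "\<phi> \<in> Lp_ball p \<sigma>" and p: "1 \<le> p" "p \<le> 2"
    and f: "integrable \<sigma> f"
    and ex: "has_multiplier_expansion (\<lambda>i j. lam (real (max i j))) \<phi> f"
    and pos: "\<And>x. x > 0 \<Longrightarrow> lam x > (0::real)" and anti: "antimono_on {0<..} lam" and a: "a \<ge> 1" "a < b"
  shows "L2n (block_proj a b f)
    \<le> 3 * max 1 (1 / sphere_area TYPE('d)) * lam (real a) * theta TYPE('d) a b powr (enn2real (1 / p) - 1/2)"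
proof -
  have \<phi>i: "integrable \<sigma> \<phi>"
    using \<phi> p(1) by (intro surf.Lp_space_integrable) (auto simp: Lp_ball_def)
  have \<theta>: "theta TYPE('d) a b > 0" using theta_lower[OF d a(2)] by simp
  have la: "lam (real a) > 0" using pos a by simp
  have "L2n (block_proj a b f) \<le> lam (real a) * L2n (block_proj a b \<phi>)"
    by (rule multiplier_block_L2[OF \<phi>i f ex pos anti a(1)])
  also have "L2n (block_proj a b \<phi>) \<le> 3 * (theta TYPE('d) a b / sphere_area TYPE('d)) powr (enn2real (1 / p) - 1/2)"
    unfolding block_proj_def[abs_def]
    by (rule projection_L2_bound[OF finite_levels \<phi> p]) (use \<theta> sphere_area_pos[where 'd = 'd] in \<open>auto simp: density_levels\<close>)
  also have "(theta TYPE('d) a b / sphere_area TYPE('d)) powr (enn2real (1 / p) - 1/2)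
      \<le> max 1 (1 / sphere_area TYPE('d)) * theta TYPE('d) a b powr (enn2real (1 / p) - 1/2)"
    using conjugate_exponent_bounds[OF p] by (intro inv_area_powr_le) auto
  finally show ?thesis using la by (simp add: mult_ac)
qed

text \<open>
  The two exponents \<open>1/p - 1/2\<close> and \<open>1/2 - 1/q\<close> add up to the exponent of the tail terms.
\<close>

lemma multiplier_block_Lq:
  fixes f \<phi> :: "'d::finite sfun"
  assumes d: "CARD('d) \<ge> 2" and \<phi>: "\<phi> \<in> Lp_ball p \<sigma>" and p: "1 \<le> p" "p \<le> 2" and q: "2 \<le> q"
    and f: "integrable \<sigma> f"
    and ex: "has_multiplier_expansion (\<lambda>i j. lam (real (max i j))) \<phi> f"
    and pos: "\<And>x. x > 0 \<Longrightarrow> lam x > (0::real)" and anti: "antimono_on {0<..} lam" and a: "a \<ge> 1" "a < b"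
  shows "Lq_le q \<sigma> (block_proj a b f) (3 * (max 1 (1 / sphere_area TYPE('d)))\<^sup>2 *
    (lam (real a) * theta TYPE('d) a b powr (enn2real (1 / p) - enn2real (1 / q))))"
proof -
  define CI where "CI = max 1 (1 / sphere_area TYPE('d))"
  define t where "t = real (theta TYPE('d) a b)"
  define s where "s = enn2real (1 / p)"
  define s' where "s' = enn2real (1 / q)"
  have CI: "CI \<ge> 1" by (simp add: CI_def)
  have t: "t > 0" using theta_lower[OF d a(2)] by (simp add: t_def)
  have la: "lam (real a) > 0" using pos a by simp
  let ?\<kappa> = "t / sphere_area TYPE('d)"
  have \<kappa>: "?\<kappa> > 0" using t sphere_area_pos[where 'd = 'd] by simp
  have Lq: "Lq_le q \<sigma> (block_proj a b f) (?\<kappa> powr (1/2 - s') * L2n (block_proj a b f))"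
    unfolding s'_def by (rule block_Lq_bound[OF finite_levels block_proj_span q _ \<kappa>]) (simp add: density_levels t_def)
  have le: "?\<kappa> powr (1/2 - s') * L2n (block_proj a b f) \<le> 3 * CI\<^sup>2 * (lam (real a) * t powr (s - s'))"
  proof -
    have "?\<kappa> powr (1/2 - s') * L2n (block_proj a b f) \<le> (CI * t powr (1/2 - s')) * (3 * CI * lam (real a) * t powr (s - 1/2))"
    proof (intro mult_mono)
      show "?\<kappa> powr (1/2 - s') \<le> CI * t powr (1/2 - s')"
        unfolding CI_def s'_def by (rule inv_area_powr_le) (use exponent_le_half[OF q] t in linarith)+
      show "L2n (block_proj a b f) \<le> 3 * CI * lam (real a) * t powr (s - 1/2)"
        unfolding CI_def s_def t_def by (rule multiplier_block_bound[OF d \<phi> p f ex pos anti a])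
    qed (use CI L2n_nonneg in auto)
    also have "\<dots> = 3 * CI\<^sup>2 * (lam (real a) * (t powr (1/2 - s') * t powr (s - 1/2)))"
      by (simp add: power2_eq_square mult_ac)
    also have "t powr (1/2 - s') * t powr (s - 1/2) = t powr (s - s')" by (simp add: powr_add[symmetric])
    finally show ?thesis .
  qed
  show ?thesis unfolding CI_def[symmetric] t_def[symmetric] s_def[symmetric] s'_def[symmetric]
    by (rule Lq_le_mono[OF Lq _ le]) (simp add: L2n_nonneg)
qed

section \<open>Expansion in blocks\<close>

lemma sip_block_proj:
  fixes f :: "'d::finite sfun"
  assumes u: "u \<in> hbasis i j"
  shows "sip (block_proj a b f) u = (if (i, j) \<in> levels a b then sip f u else 0)"
proof (cases "(i, j) \<in> levels a b")
  case True
  then have "u \<in> hblock (levels a b)" using u by (auto simp: hblock_def)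
  then show ?thesis using True orthonormal_coeff[OF orthonormal_hblock[OF finite_levels], of u a b "sip f"]
    by (simp add: block_proj_def[abs_def])
next
  case False
  have "sip (block_proj a b f) u = (\<Sum>v\<in>hblock (levels a b). sip f v * sip v u)"
    unfolding block_proj_def[abs_def] using orthonormal_hblock[OF finite_levels[of a b], where 'd = 'd] u hbasis_csphere
    by (intro sip_lincomb) (auto simp: orthonormal_def)
  also have "\<dots> = 0"
  proof (rule sum.neutral, rule ballI)
    fix v :: "'d sfun" assume "v \<in> hblock (levels a b)"
    then obtain k l where kl: "(k, l) \<in> levels a b" "v \<in> hbasis k l" by (auto simp: hblock_def)
    then have "(k, l) \<noteq> (i, j)" using False by auto
    then have "sip v u = 0" by (rule harmonics_sip_zero[OF hbasis_harmonics[THEN subsetD, OF kl(2)] hbasis_harmonics[THEN subsetD, OF u]])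
    then show "sip f v * sip v u = 0" by simp
  qed
  finally show ?thesis using False by simp
qed

lemma AE_summable_of_L1:
  fixes F :: "nat \<Rightarrow> 'a \<Rightarrow> complex"
  assumes F: "\<And>k. integrable M (F k)" and B: "summable B" "\<And>k. (\<integral>x. cmod (F k x) \<partial>M) \<le> B k"
  shows "AE x in M. summable (\<lambda>k. cmod (F k x))" "summable (\<lambda>k. \<integral>x. cmod (F k x) \<partial>M)"
proof -
  have [measurable]: "F k \<in> borel_measurable M" for k using F by auto
  show s: "summable (\<lambda>k. \<integral>x. cmod (F k x) \<partial>M)" using B by (intro summable_comparison_test'[OF B(1)]) auto
  have "(\<integral>\<^sup>+x. (\<Sum>k. ennreal (cmod (F k x))) \<partial>M) = (\<Sum>k. \<integral>\<^sup>+x. ennreal (cmod (F k x)) \<partial>M)"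
    by (rule nn_integral_suminf) measurable
  also have "\<dots> = (\<Sum>k. ennreal (\<integral>x. cmod (F k x) \<partial>M))"
    using F by (intro suminf_cong nn_integral_eq_integral) auto
  also have "\<dots> = ennreal (\<Sum>k. \<integral>x. cmod (F k x) \<partial>M)" using s by (intro suminf_ennreal2) auto
  finally have "(\<integral>\<^sup>+x. (\<Sum>k. ennreal (cmod (F k x))) \<partial>M) \<noteq> \<infinity>" by simp
  then have "AE x in M. (\<Sum>k. ennreal (cmod (F k x))) \<noteq> \<infinity>" by (intro nn_integral_PInf_AE) measurable
  then show "AE x in M. summable (\<lambda>k. cmod (F k x))"
    by (elim eventually_mono) (auto intro: summable_suminf_not_top)
qed

text \<open>
  The series converges almost everywhere because it converges absolutely in \<open>L\<^sup>1\<close>. Its sum has the same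
  coefficients as \<open>f\<close>, so completeness of the harmonics applies. The condition \<open>N 0 = 0\<close> makes the blocks
  cover all levels except \<open>0\<close>.
\<close>

lemma block_series_converges:
  fixes f :: "'d::finite sfun"
  assumes f: "integrable \<sigma> f" and f0: "\<And>u. u \<in> hbasis 0 0 \<Longrightarrow> sip f u = 0"
    and N: "\<And>k. N k < N (k + 1)" "N 0 = 0"
    and B: "summable B" "\<And>k. (\<integral>z. cmod (block_proj (N k) (N (k + 1)) f z) \<partial>\<sigma>) \<le> B k"
  shows "AE z in \<sigma>. (\<lambda>k. block_proj (N k) (N (k + 1)) f z) sums f z"
proof -
  define F where "F k = block_proj (N k) (N (k + 1)) f" for k
  have mono: "strict_mono N" using N(1) by (simp add: strict_mono_Suc_iff)
  have Fi: "integrable \<sigma> (F k)" for k unfolding F_def by (rule csphere_integrable[OF block_proj_csphere])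
  note su = AE_summable_of_L1[OF Fi B[folded F_def]]
  define g where "g z = (\<Sum>k. F k z)" for z
  have gi: "integrable \<sigma> g" unfolding g_def by (rule integrable_suminf[OF Fi]) (use su in simp_all)
  have "AE z in \<sigma>. f z - g z = 0"
  proof (rule harmonics_complete)
    show "integrable \<sigma> (\<lambda>z. f z - g z)" using f gi by simp
    fix i j and u :: "'d sfun" assume u: "u \<in> hbasis i j"
    have uc: "u \<in> csphere" using u hbasis_csphere by auto
    obtain K where K: "\<And>z. cmod (u z) \<le> K" using csphere_bounded[OF uc] by blast
    let ?G = "\<lambda>k z. F k z * cnj (u z)"
    have Gi: "integrable \<sigma> (?G k)" for k by (rule csphere_mult_integrable[OF Fi uc])
    have GB: "(\<integral>z. cmod (?G k z) \<partial>\<sigma>) \<le> K * B k" for k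
    proof -
      have "(\<integral>z. cmod (?G k z) \<partial>\<sigma>) \<le> (\<integral>z. K * cmod (F k z) \<partial>\<sigma>)"
        using Gi Fi K by (intro integral_mono integrable_mult_right integrable_norm) (auto simp: norm_mult mult.commute intro: mult_right_mono)
      also have "\<dots> = K * (\<integral>z. cmod (F k z) \<partial>\<sigma>)" by simp
      also have "\<dots> \<le> K * B k" using B(2)[of k] order_trans[OF norm_ge_zero K] by (intro mult_left_mono) (auto simp: F_def)
      finally show ?thesis .
    qed
    note suG = AE_summable_of_L1[OF Gi summable_mult[OF B(1)] GB]
    have "sip g u = (\<integral>z. (\<Sum>k. ?G k z) \<partial>\<sigma>)"
      unfolding sip_def
    proof (rule integral_cong_AE)
      show "(\<lambda>z. g z * cnj (u z)) \<in> borel_measurable \<sigma>"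
        by (rule borel_measurable_integrable[OF csphere_mult_integrable[OF gi uc]])
      show "(\<lambda>z. \<Sum>k. ?G k z) \<in> borel_measurable \<sigma>"
        by (rule borel_measurable_integrable[OF integrable_suminf[OF Gi]]) (use suG in simp_all)
      show "AE z in \<sigma>. g z * cnj (u z) = (\<Sum>k. ?G k z)"
        using su(1) by (elim eventually_mono) (auto simp: g_def intro!: suminf_mult2 summable_norm_cancel)
    qed
    also have "\<dots> = (\<Sum>k. sip (F k) u)"
      unfolding sip_def by (rule integral_suminf[OF Gi]) (use suG in simp_all)
    also have "\<dots> = sip f u"
    proof (cases "max i j = 0")
      case True
      then have "sip f u = 0" using f0[of u] u by auto
      moreover have "sip (F k) u = 0" for k using \<open>sip f u = 0\<close> by (simp add: F_def sip_block_proj[OF u])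
      ultimately show ?thesis by simp
    next
      case False
      define l where "l = max i j"
      have "l \<le> N l" using mono by (rule strict_mono_imp_increasing)
      define k0 where "k0 = (LEAST k. l \<le> N k)"
      have k0: "l \<le> N k0" unfolding k0_def by (rule LeastI) fact
      then obtain k where k: "k0 = Suc k" using False N(2) by (cases k0) (auto simp: l_def)
      have nk: "N k < l" using not_less_Least[of k "\<lambda>k. l \<le> N k"] k unfolding k0_def by auto
      have "(i, j) \<in> levels (N k') (N (k' + 1)) \<longleftrightarrow> k' = k" for k'
      proof
        assume "(i, j) \<in> levels (N k') (N (k' + 1))"
        then have "N k' < l" "l \<le> N (Suc k')" by (auto simp: levels_def l_def)
        then have "N k' < N (Suc k)" "N k < N (Suc k')" using k0 k nk by auto
        then show "k' = k" using strict_mono_less[OF mono] by auto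
      next
        assume "k' = k" then show "(i, j) \<in> levels (N k') (N (k' + 1))" using k0 k nk by (auto simp: levels_def l_def)
      qed
      then have "(\<lambda>k'. sip (F k') u) = (\<lambda>k'. if k' = k then sip f u else 0)"
        by (auto simp: F_def sip_block_proj[OF u])
      then show ?thesis using sums_single[of k "\<lambda>_. sip f u"] by (simp add: sums_iff)
    qed
    finally have "sip g u = sip f u" .
    moreover have "sip (\<lambda>z. f z - g z) u = sip f u - sip g u"
      unfolding sip_def left_diff_distrib
      by (rule Bochner_Integration.integral_diff) (intro csphere_mult_integrable f gi uc)+
    ultimately show "sip (\<lambda>z. f z - g z) u = 0" by simp
  qed
  then show ?thesis using su(1)
  proof eventually_elim
    case (elim z)
    have "(\<lambda>k. F k z) sums g z" unfolding g_def by (rule summable_sums[OF summable_norm_cancel[OF elim(2)]])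
    moreover have "g z = f z" using elim(1) by simp
    ultimately show ?case unfolding F_def by (simp only:)
  qed
qed

section \<open>Spaces of prescribed dimension\<close>

lemma csphere_Lp_space:
  assumes "f \<in> csphere" "1 \<le> q" shows "f \<in> Lp_space q (\<sigma> :: (complex^'d::finite) measure)"
proof -
  obtain K where K: "K \<ge> 0" "\<And>z. cmod (f z) \<le> K" using csphere_bounded[OF assms(1)] by blast
  have [measurable]: "f \<in> borel_measurable \<sigma>" by (rule csphere_measurable[OF assms(1)])
  show ?thesis
  proof (cases "q = \<infinity>")
    case True
    show ?thesis
      by (rule Lq_le_Lp(1)[of _ _ K]) (use K assms True in \<open>auto simp: Lq_le_def\<close>)
  next
    case False
    have "integrable \<sigma> (\<lambda>x. cmod (f x) powr enn2real q)"
      by (rule surf.integrable_const_bound[where B = "K powr enn2real q"]) (use K in \<open>auto intro!: powr_mono2\<close>)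
    then show ?thesis using False by (simp add: Lp_space_def)
  qed
qed

lemma csphere_Lp_norm_zero:
  fixes f :: "'d::finite sfun"
  assumes f: "f \<in> csphere" and q: "1 \<le> q" and n: "Lp_norm q \<sigma> f = 0"
  shows "f = (\<lambda>_. 0)"
proof (rule sip_self_zero[OF f])
  note fs = csphere_Lp_space[OF f q]
  have "AE z in \<sigma>. f z = 0"
  proof (cases "q = \<infinity>")
    case True
    then have "esssup \<sigma> (\<lambda>z. ennreal (cmod (f z))) = 0"
      using n fs by (auto simp: Lp_norm_def Lp_space_def enn2real_eq_0_iff)
    then show ?thesis using esssup_AE[of "\<lambda>z. ennreal (cmod (f z))" \<sigma>] by (elim eventually_mono) simp
  next
    case False
    then have i: "integrable \<sigma> (\<lambda>x. cmod (f x) powr enn2real q)" using fs by (simp add: Lp_space_def)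
    have "(\<integral>x. cmod (f x) powr enn2real q \<partial>\<sigma>) = 0" using n False by (simp add: Lp_norm_def)
    then have "AE x in \<sigma>. cmod (f x) powr enn2real q = 0"
      using integral_nonneg_eq_0_iff_AE[OF i] by simp
    then show ?thesis by (elim eventually_mono) simp
  qed
  then show "sip f f = 0" unfolding sip_def by (intro integral_eq_zero_AE) (auto elim: eventually_mono)
qed

text \<open>
  Subspaces of dimension exactly \<open>\<beta>\<close> are required, so a basis of the span of \<open>W\<close> is
  extended by harmonics of high degree. They are continuous, hence independent also modulo functions of seminorm zero.
\<close>

lemma kolmogorov_width_le:
  fixes W :: "('d::finite sfun) set"
  assumes d: "CARD('d) \<ge> 2" and W: "finite W" "W \<subseteq> polys_le R" "card W \<le> \<beta>" and q: "1 \<le> q"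
    and approx: "\<And>f. f \<in> A \<Longrightarrow> \<exists>y \<in> cfun.span W. Lp_norm q \<sigma> (\<lambda>z. f z - y z) \<le> b"
  shows "kolmogorov_width (Lp_space q \<sigma>) (Lp_norm q \<sigma>) \<beta> A \<le> ennreal b"
proof -
  define L where "L = max \<beta> R"
  define E where "E = (hblock ({..L} \<times> {..L}) :: ('d sfun) set)"
  have on: "orthonormal E" unfolding E_def by (rule orthonormal_hblock) simp
  then have fE: "finite E" and Ec: "E \<subseteq> csphere" by (auto simp: orthonormal_def)
  have "\<beta> \<le> card (hbasis L 0 :: ('d sfun) set)" using card_hbasis_holomorphic[OF d, of L] by (simp add: L_def)
  also have "\<dots> \<le> card E" by (rule card_mono[OF fE]) (auto simp: E_def hblock_def)
  finally have \<beta>E: "\<beta> \<le> card E" .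
  have WE: "W \<subseteq> cfun.span E" using W(2) polys_le_mono[of R L] by (auto simp: E_def polys_le_def[symmetric] L_def)
  obtain W' where W': "W' \<subseteq> W" "cfun.independent W'" "W \<subseteq> cfun.span W'" using cfun.maximal_independent_subset[of W] by auto
  obtain S where S: "W' \<subseteq> S" "S \<subseteq> W' \<union> E" "cfun.independent S" "W' \<union> E \<subseteq> cfun.span S"
    using cfun.maximal_independent_subset_extend[of W' "W' \<union> E"] W'(2) by auto
  have fS: "finite S" by (rule finite_subset[OF S(2)]) (use fE W W' finite_subset in auto)
  have "card E \<le> card S"
    using cfun.independent_span_bound[OF fS orthonormal_independent[OF on]] S(4) by auto
  moreover have "card W' \<le> \<beta>" using card_mono[OF W(1) W'(1)] W(3) by simp
  ultimately obtain B where B: "W' \<subseteq> B" "B \<subseteq> S" "card B = \<beta>"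
    using exists_subset_between[of W' \<beta> S] \<beta>E S(1) fS by auto
  have fB: "finite B" and Bi: "cfun.independent B"
    using finite_subset[OF B(2) fS] cfun.independent_mono[OF S(3) B(2)] by auto
  have Bc: "B \<subseteq> csphere"
  proof
    fix v assume "v \<in> B"
    then have "v \<in> cfun.span E" using B(2) S(2) W'(1) WE cfun.span_superset[of E] by blast
    then show "v \<in> csphere" by (rule span_orthonormal_csphere[OF on])
  qed
  obtain g where g: "bij_betw g {..<\<beta>} B" using ex_bij_betw_nat_finite[OF fB] B(3) by (auto simp: lessThan_atLeast0)
  have gB: "g ` {..<\<beta>} = B" using g by (simp add: bij_betw_def)
  have "cfun.span B \<in> subspaces_of_dim (Lp_space q \<sigma>) (Lp_norm q \<sigma>) \<beta>"
    unfolding subspaces_of_dim_def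
  proof (intro CollectI exI[of _ g] conjI allI impI)
    show "cfun.span B = cfun.span (g ` {..<\<beta>})" by (simp add: gB)
    show "g i \<in> Lp_space q \<sigma>" if "i < \<beta>" for i
      using that gB Bc by (intro csphere_Lp_space[OF _ q]) auto
    fix c :: "nat \<Rightarrow> complex" and i assume z: "Lp_norm q \<sigma> (\<lambda>x. \<Sum>i<\<beta>. c i * g i x) = 0" and i: "i < \<beta>"
    have "(\<lambda>x. \<Sum>i<\<beta>. c i * g i x) \<in> csphere" using gB Bc by (intro csphere_sum csphere_scale) auto
    from csphere_Lp_norm_zero[OF this q z] have z': "(\<lambda>x. \<Sum>i<\<beta>. c i * g i x) = (\<lambda>_. 0)" .
    define c' where "c' v = c (the_inv_into {..<\<beta>} g v)" for v
    have inv: "the_inv_into {..<\<beta>} g (g i) = i" if "i < \<beta>" for i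
      using g that by (intro the_inv_into_f_f) (auto simp: bij_betw_def)
    have "(\<Sum>v\<in>B. (\<lambda>x. c' v * v x)) = (\<Sum>i<\<beta>. (\<lambda>x. c i * g i x))"
      unfolding sum.reindex_bij_betw[OF g, symmetric] by (intro sum.cong) (auto simp: c'_def inv)
    also have "\<dots> = 0" using z' by (auto simp: fun_eq_iff sum_fun_apply)
    finally have "c' (g i) = 0" using i gB by (intro cfun.independentD[OF Bi fB subset_refl]) auto
    then show "c i = 0" using i by (simp add: c'_def inv)
  qed
  moreover have "(SUP x \<in> A. INF y \<in> cfun.span B. ennreal (Lp_norm q \<sigma> (\<lambda>t. x t - y t))) \<le> ennreal b"
  proof (rule SUP_least)
    fix f assume "f \<in> A"
    then obtain y where y: "y \<in> cfun.span W" "Lp_norm q \<sigma> (\<lambda>z. f z - y z) \<le> b" using approx by blast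
    have "W \<subseteq> cfun.span B" using W'(3) cfun.span_mono[OF B(1)] by auto
    then have "y \<in> cfun.span B" using y(1) cfun.span_mono[of W "cfun.span B"] by (auto simp: cfun.span_span)
    then show "(INF y \<in> cfun.span B. ennreal (Lp_norm q \<sigma> (\<lambda>t. f t - y t))) \<le> ennreal b"
      by (rule INF_lower2) (use y in \<open>simp add: ennreal_leI\<close>)
  qed
  ultimately show ?thesis unfolding kolmogorov_width_def by (rule INF_lower2)
qed

section \<open>The width of the multiplier class\<close>

lemma rho_factor_pos: "t \<ge> 2 \<Longrightarrow> 2 \<le> q \<Longrightarrow> rho_factor q t > 0"
proof (cases "q = \<infinity>")
  case False
  assume "2 \<le> q"
  then have "enn2real q \<ge> 2" using False by (intro enn2real_ge) auto
  then show ?thesis using False by (simp add: rho_factor_def)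
qed (simp add: rho_factor_def)

lemma block_const_pos: "block_const TYPE('d::finite) > 0"
proof -
  have "sphere_area TYPE('d) + 1 + exp (2 * real CARD('d)) * max 1 (1 / sphere_area TYPE('d)) > 0"
    using sphere_area_pos[where 'd = 'd] by (intro add_pos_pos mult_pos_pos) auto
  then show ?thesis unfolding block_const_def by (intro mult_pos_pos) auto
qed

definition head_const :: "'d::finite itself \<Rightarrow> real" where
  "head_const _ = 3 * max 1 (1 / sphere_area TYPE('d)) * block_const TYPE('d)"

definition tail_const :: "'d::finite itself \<Rightarrow> real" where
  "tail_const _ = 3 * (max 1 (1 / sphere_area TYPE('d)))\<^sup>2"

lemma head_const_pos: "head_const TYPE('d::finite) > 0"
  unfolding head_const_def using block_const_pos[where 'd = 'd] by (intro mult_pos_pos) auto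

lemma tail_const_pos: "tail_const TYPE('d::finite) > 0"
  unfolding tail_const_def by (intro mult_pos_pos) auto

text \<open>
  The approximant of \<open>f\<close> is the sum of \<open>Z k\<close>: the whole component for \<open>k = 0\<close>, the approximant from
  \<open>block_approximation\<close> for \<open>1 \<le> k \<le> M\<close>, and zero beyond. The error series therefore starts at
  \<open>k = 1\<close>.
\<close>

lemma width_of_multiplier_class:
  fixes lam :: "real \<Rightarrow> real" and p q :: ennreal and N m :: "nat \<Rightarrow> nat"
  assumes d: "CARD('d::finite) \<ge> 2" and pos: "\<And>x. x > 0 \<Longrightarrow> lam x > 0" and anti: "antimono_on {0<..} lam" and lam0: "lam 0 = 0"
    and p: "1 \<le> p" "p \<le> 2" and q: "2 \<le> q" and N: "\<And>k. N k < N (k + 1)" "N 0 = 0"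
    and \<beta>: "(\<Sum>k = 0..M. m k) \<le> \<beta>" and m0: "theta TYPE('d) (N 0) (N 1) \<le> m 0"
    and mpos: "\<And>k. 1 \<le> k \<Longrightarrow> k \<le> M \<Longrightarrow> m k > 0"
    and sm: "summable (\<lambda>k. lam (N (M + 1 + k)) * theta TYPE('d) (N (M + 1 + k)) (N (M + 1 + k + 1)) powr (enn2real (1 / p) - enn2real (1 / q)))"
  shows "kolmogorov_width (Lp_space q (\<sigma> :: (complex^'d) measure)) (Lp_norm q \<sigma>) \<beta>
      (multiplier_image (\<lambda>i j. lam (real (max i j))) (Lp_ball p \<sigma>) q)
    \<le> ennreal (head_const TYPE('d) * (\<Sum>k = 1..M. lam (N k) *
          (theta TYPE('d) (N k) (N (k + 1)) powr enn2real (1 / p) / sqrt (m k) * rho_factor q (theta TYPE('d) (N k) (N (k + 1))))) +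
        tail_const TYPE('d) * (\<Sum>k. lam (N (M + 1 + k)) *
          theta TYPE('d) (N (M + 1 + k)) (N (M + 1 + k + 1)) powr (enn2real (1 / p) - enn2real (1 / q))))"
proof -
  define \<theta> where "\<theta> k = theta TYPE('d) (N k) (N (k + 1))" for k
  define s where "s = enn2real (1 / p)"
  define s' where "s' = enn2real (1 / q)"
  define H where "H = (\<lambda>k. hblock (levels (N k) (N (k + 1))) :: ('d sfun) set)"
  define CI where "CI = max 1 (1 / sphere_area TYPE('d))"
  have CI: "CI \<ge> 1" by (simp add: CI_def)
  have q1: "1 \<le> q" using q by (rule order_trans[rotated]) simp
  have mono: "strict_mono N" using N(1) by (simp add: strict_mono_Suc_iff)
  have Npos: "N k \<ge> 1" if "k \<ge> 1" for k using strict_mono_imp_increasing[OF mono, of k] that by simp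
  have \<theta>: "\<theta> k \<ge> 2" for k using theta_lower[OF d N(1)[of k]] N(1)[of k] by (simp add: \<theta>_def)
  have lN: "lam (N k) > 0" if "k \<ge> 1" for k using pos Npos[OF that] by simp
  have Honb: "orthonormal (H k)" for k unfolding H_def by (rule orthonormal_hblock[OF finite_levels])
  have Hc: "f \<in> csphere" if "f \<in> cfun.span (H k)" for f k by (rule span_orthonormal_csphere[OF Honb that])
  define T where "T k = lam (N k) * (\<theta> k powr s / sqrt (m k) * rho_factor q (\<theta> k))" for k
  define t where "t k = lam (N k) * \<theta> k powr (s - s')" for k
  define b where "b k = (if k \<le> M then head_const TYPE('d) * T k else tail_const TYPE('d) * t k)" for k
  have bpos: "b k > 0" if "k \<ge> 1" for k
  proof (cases "k \<le> M")
    case True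
    then have "T k > 0" unfolding T_def using lN mpos that \<theta>[of k] rho_factor_pos[OF \<theta> q] by (intro mult_pos_pos divide_pos_pos) auto
    then show ?thesis using True head_const_pos[where 'd = 'd] by (simp add: b_def)
  next
    case False
    have "t k > 0" unfolding t_def using lN[OF that] \<theta>[of k] by (intro mult_pos_pos) auto
    then show ?thesis using False tail_const_pos[where 'd = 'd] by (simp add: b_def)
  qed
  have tsum: "summable (\<lambda>k. t (M + 1 + k))" using sm unfolding t_def \<theta>_def s_def s'_def .
  have btail: "b (k + (M + 1)) = tail_const TYPE('d) * t (M + 1 + k)" for k by (simp add: b_def add.commute)
  have bsum: "summable b"
    unfolding summable_iff_shift[of b "M + 1", symmetric] btail by (intro summable_mult tsum)
  have bsum': "summable (\<lambda>k. b (Suc k))" using bsum by (simp add: summable_Suc_iff)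
  have total: "(\<Sum>k. b (Suc k)) = head_const TYPE('d) * (\<Sum>k = 1..M. T k) + tail_const TYPE('d) * (\<Sum>k. t (M + 1 + k))"
  proof -
    have "(\<Sum>k. b (Suc k)) = (\<Sum>k. b (Suc (k + M))) + (\<Sum>k<M. b (Suc k))"
      by (rule suminf_split_initial_segment[OF bsum'])
    also have "(\<Sum>k. b (Suc (k + M))) = (\<Sum>k. tail_const TYPE('d) * t (M + 1 + k))"
      using btail by (intro suminf_cong) simp
    also have "\<dots> = tail_const TYPE('d) * (\<Sum>k. t (M + 1 + k))" by (rule suminf_mult[OF tsum])
    also have "(\<Sum>k<M. b (Suc k)) = (\<Sum>k = 1..M. b k)"
      using sum.atLeast1_atMost_eq[of b M] by simp
    also have "\<dots> = head_const TYPE('d) * (\<Sum>k = 1..M. T k)" by (simp add: b_def sum_distrib_left)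
    finally show ?thesis by simp
  qed
  have "\<forall>k\<in>{1..M}. \<exists>V \<subseteq> cfun.span (H k). finite V \<and> card V \<le> m k \<and>
    (\<forall>f \<in> cfun.span (H k). \<forall>L>0. L2n f \<le> L \<longrightarrow> (\<exists>y \<in> cfun.span V.
      Lq_le q \<sigma> (\<lambda>z. f z - y z) (block_const TYPE('d) * sqrt (\<theta> k / real (m k)) * rho_factor q (\<theta> k) * L)))"
    using block_approximation[OF d N(1) mpos q] unfolding H_def \<theta>_def by simp
  then obtain V where V: "\<forall>k\<in>{1..M}. V k \<subseteq> cfun.span (H k) \<and> finite (V k) \<and> card (V k) \<le> m k \<and>
    (\<forall>f \<in> cfun.span (H k). \<forall>L>0. L2n f \<le> L \<longrightarrow> (\<exists>y \<in> cfun.span (V k).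
      Lq_le q \<sigma> (\<lambda>z. f z - y z) (block_const TYPE('d) * sqrt (\<theta> k / real (m k)) * rho_factor q (\<theta> k) * L)))"
    by (rule bchoice[THEN exE])
  define W where "W = H 0 \<union> (\<Union>k\<in>{1..M}. V k)"
  have W_fin: "finite W" unfolding W_def using V Honb by (auto simp: orthonormal_def)
  have W_polys: "W \<subseteq> polys_le (N (M + 1))"
  proof -
    have HP: "cfun.span (H k) \<subseteq> polys_le (N (M + 1))" if "k \<le> M" for k
      unfolding H_def using that
      by (intro order_trans[OF levels_polys_le] polys_le_mono strict_mono_leD[OF mono]) simp
    have "H 0 \<subseteq> polys_le (N (M + 1))" using HP[of 0] cfun.span_superset[of "H 0"] by auto
    moreover have "V k \<subseteq> polys_le (N (M + 1))" if "k \<in> {1..M}" for k using V HP[of k] that by (meson atLeastAtMost_iff order_trans)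
    ultimately show ?thesis unfolding W_def by blast
  qed
  have W_card: "card W \<le> \<beta>"
  proof -
    have "card W \<le> card (H 0) + card (\<Union>k\<in>{1..M}. V k)" unfolding W_def by (rule card_Un_le)
    also have "card (\<Union>k\<in>{1..M}. V k) \<le> (\<Sum>k\<in>{1..M}. card (V k))" by (rule card_UN_le) simp
    also have "\<dots> \<le> (\<Sum>k\<in>{1..M}. m k)" using V by (intro sum_mono) auto
    also have "card (H 0) \<le> m 0" using m0 unfolding theta_eq_card by (simp add: H_def)
    also have "m 0 + (\<Sum>k\<in>{1..M}. m k) = (\<Sum>k = 0..M. m k)" by (simp add: sum.atLeast_Suc_atMost)
    finally show ?thesis using \<beta> by simp
  qed
  have "kolmogorov_width (Lp_space q (\<sigma> :: (complex^'d) measure)) (Lp_norm q \<sigma>) \<beta>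
      (multiplier_image (\<lambda>i j. lam (real (max i j))) (Lp_ball p \<sigma>) q) \<le> ennreal (\<Sum>k. b (Suc k))"
  proof (rule kolmogorov_width_le[OF d W_fin W_polys W_card q1])
    fix f :: "'d sfun"
    assume f: "f \<in> multiplier_image (\<lambda>i j. lam (real (max i j))) (Lp_ball p \<sigma>) q"
    then obtain \<phi> where \<phi>: "\<phi> \<in> Lp_ball p \<sigma>" and ex: "has_multiplier_expansion (\<lambda>i j. lam (real (max i j))) \<phi> f"
      by (auto simp: multiplier_image_def)
    have fi: "integrable \<sigma> f" using f q1 by (intro surf.Lp_space_integrable) (auto simp: multiplier_image_def)
    have \<phi>i: "integrable \<sigma> \<phi>"
      using \<phi> p(1) by (intro surf.Lp_space_integrable) (auto simp: Lp_ball_def)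
    define F where "F k = block_proj (N k) (N (k + 1)) f" for k
    have Fs: "F k \<in> cfun.span (H k)" for k unfolding F_def H_def by (rule block_proj_span)
    have head: "\<exists>y\<in>cfun.span (V k). Lq_le q \<sigma> (\<lambda>z. F k z - y z) (b k)" if k: "k \<in> {1..M}" for k
    proof -
      define L where "L = 3 * CI * lam (N k) * \<theta> k powr (s - 1/2)"
      have L: "L > 0" unfolding L_def using CI lN k \<theta>[of k] by (intro mult_pos_pos) auto
      have "L2n (F k) \<le> L" unfolding F_def L_def CI_def s_def \<theta>_def
        using Npos k by (intro multiplier_block_bound[OF d \<phi> p fi ex pos anti] N) auto
      then obtain y where y: "y \<in> cfun.span (V k)" "Lq_le q \<sigma> (\<lambda>z. F k z - y z)
          (block_const TYPE('d) * sqrt (\<theta> k / real (m k)) * rho_factor q (\<theta> k) * L)"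
        using V k Fs[of k] L by blast
      have "sqrt (real (\<theta> k)) * real (\<theta> k) powr (s - 1/2) = real (\<theta> k) powr s"
        by (simp add: powr_half_sqrt[symmetric] powr_add[symmetric])
      then have "block_const TYPE('d) * sqrt (\<theta> k / real (m k)) * rho_factor q (\<theta> k) * L = b k"
        using k by (simp add: b_def T_def L_def head_const_def CI_def[symmetric] real_sqrt_divide)
      then show ?thesis using y by metis
    qed
    obtain Y where Y: "\<And>k. k \<in> {1..M} \<Longrightarrow> Y k \<in> cfun.span (V k)"
      "\<And>k. k \<in> {1..M} \<Longrightarrow> Lq_le q \<sigma> (\<lambda>z. F k z - Y k z) (b k)"
      using head by metis
    have tail: "Lq_le q \<sigma> (F k) (b k)" if k: "k > M" for k
    proof -
      have "Lq_le q \<sigma> (F k) (3 * CI\<^sup>2 * (lam (N k) * \<theta> k powr (s - s')))"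
        unfolding F_def CI_def s_def s'_def \<theta>_def
        using Npos[of k] k by (intro multiplier_block_Lq[OF d \<phi> p q fi ex pos anti] N) auto
      then show ?thesis using k by (simp add: b_def t_def tail_const_def CI_def)
    qed
    define Z where "Z k = (if k = 0 then F 0 else if k \<le> M then Y k else (\<lambda>_. 0))" for k
    have Zs: "Z k \<in> cfun.span W" if "k \<le> M" for k
    proof (cases "k = 0")
      case True
      then show ?thesis using Fs[of 0] cfun.span_mono[of "H 0" W] by (auto simp: Z_def W_def)
    next
      case False
      then have k: "k \<in> {1..M}" using that by auto
      have "cfun.span (V k) \<subseteq> cfun.span W" by (rule cfun.span_mono) (use k in \<open>auto simp: W_def\<close>)
      then show ?thesis using Y(1)[OF k] False that by (auto simp: Z_def)
    qed
    have Zc: "Z k \<in> csphere" for k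
    proof (cases "k \<in> {1..M}")
      case True
      then have "cfun.span (V k) \<subseteq> cfun.span (H k)"
        using V cfun.span_mono[of "V k" "cfun.span (H k)"] by (auto simp: cfun.span_span)
      then show ?thesis using Y(1)[OF True] True Hc by (auto simp: Z_def)
    next
      case False
      then show ?thesis using Hc[OF Fs] by (auto simp: Z_def csphere_zero)
    qed
    define h where "h k = (\<lambda>z. F k z - Z k z)" for k
    have hm: "h k \<in> borel_measurable \<sigma>" for k
      unfolding h_def by (intro borel_measurable_diff csphere_measurable Zc Hc[OF Fs])
    have hb: "Lq_le q \<sigma> (h (Suc k)) (b (Suc k))" for k
      using Y(2)[of "Suc k"] tail[of "Suc k"] by (cases "Suc k \<le> M") (auto simp: h_def Z_def)
    define y where "y = (\<lambda>z. \<Sum>k\<le>M. Z k z)"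
    have ys: "y \<in> cfun.span W"
    proof -
      have "y = (\<Sum>k\<le>M. Z k)" by (auto simp: y_def fun_eq_iff sum_fun_apply)
      also have "\<dots> \<in> cfun.span W" by (intro cfun.span_sum Zs) auto
      finally show ?thesis .
    qed
    have yc: "y \<in> csphere" unfolding y_def by (rule csphere_sum[OF Zc])
    have "AE z in \<sigma>. (\<lambda>k. F k z) sums f z"
      unfolding F_def
    proof (rule block_series_converges[OF fi _ N])
      fix u :: "'d sfun" assume u: "u \<in> hbasis 0 0"
      show "sip f u = 0" using multiplier_coefficient[OF \<phi>i fi ex u] lam0 by simp
    next
      define B where "B k = (if k \<le> M then (\<integral>z. cmod (F k z) \<partial>\<sigma>) else (sphere_area TYPE('d) + 1) * b k)" for k
      have "B (k + (M + 1)) = (sphere_area TYPE('d) + 1) * b (k + (M + 1))" for k by (simp add: B_def)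
      moreover have "summable (\<lambda>k. (sphere_area TYPE('d) + 1) * b (k + (M + 1)))"
        using bsum summable_iff_shift[of b "M + 1"] by (intro summable_mult) blast
      ultimately show "summable B" unfolding summable_iff_shift[of B "M + 1", symmetric] by simp
      show "(\<integral>z. cmod (block_proj (N k) (N (k + 1)) f z) \<partial>\<sigma>) \<le> B k" for k
      proof (cases "k \<le> M")
        case False
        have k1: "k \<ge> 1" using False by simp
        have Fi: "integrable \<sigma> (F k)" by (rule csphere_integrable[OF Hc[OF Fs]])
        have "ennreal (\<integral>z. cmod (F k z) \<partial>\<sigma>) = (\<integral>\<^sup>+z. ennreal (cmod (F k z)) \<partial>\<sigma>)"
          using Fi by (intro nn_integral_eq_integral[symmetric]) auto
        also have "\<dots> \<le> ennreal ((sphere_area TYPE('d) + 1) * b k)"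
          unfolding surf_mass[symmetric]
          using False by (intro surf.Lq_le_L1[OF csphere_measurable[OF Hc[OF Fs]] bpos[OF k1] q1] tail) simp
        finally have "(\<integral>z. cmod (F k z) \<partial>\<sigma>) \<le> (sphere_area TYPE('d) + 1) * b k"
          using bpos[OF k1] sphere_area_pos[where 'd = 'd] by (subst (asm) ennreal_le_iff) auto
        then show ?thesis using False by (simp add: B_def F_def)
      qed (simp add: B_def F_def)
    qed
    then have conv: "AE z in \<sigma>. (\<lambda>n. \<Sum>k<n. h (Suc k) z) \<longlonglongrightarrow> f z - y z"
    proof eventually_elim
      case (elim z)
      have "(\<lambda>k. Z k z) sums y z" unfolding y_def by (rule sums_finite) (auto simp: Z_def)
      then have "(\<lambda>k. h k z) sums (f z - y z)" unfolding h_def by (rule sums_diff[OF elim])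
      moreover have "h 0 z = 0" by (simp add: h_def Z_def)
      ultimately have "(\<lambda>k. h (Suc k) z) sums (f z - y z)"
        using sums_Suc_iff[of "\<lambda>k. h k z" "f z - y z"] by simp
      then show ?case by (simp add: sums_def)
    qed
    have Lq: "Lq_le q \<sigma> (\<lambda>z. f z - y z) (\<Sum>k. b (Suc k))"
      by (rule Lq_le_series[where h = "\<lambda>k. h (Suc k)", OF hm _ q1 hb bsum' conv]) (simp add: bpos)
    have "Lp_norm q \<sigma> (\<lambda>z. f z - y z) \<le> (\<Sum>k. b (Suc k))"
    proof (rule Lq_le_Lp(2)[OF _ _ q1 Lq])
      show "(\<lambda>z. f z - y z) \<in> borel_measurable \<sigma>"
        by (intro borel_measurable_diff borel_measurable_integrable[OF fi] csphere_measurable[OF yc])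
      show "0 \<le> (\<Sum>k. b (Suc k))" by (rule suminf_nonneg[OF bsum' less_imp_le[OF bpos]]) simp
    qed
    then show "\<exists>y\<in>cfun.span W. Lp_norm q \<sigma> (\<lambda>z. f z - y z) \<le> (\<Sum>k. b (Suc k))" using ys by blast
  qed
  then show ?thesis unfolding total T_def t_def \<theta>_def s_def s'_def .
qed

lemma rho_eq:
  assumes "t \<ge> 2" "2 \<le> q"
  shows "m > 0 \<Longrightarrow> rho p q t m = ennreal (real t powr enn2real (1 / p) / sqrt (real m) * rho_factor q t)"
    and "m = 0 \<Longrightarrow> rho p q t m = \<infinity>"
proof -
  have P: "rho_factor q t > 0" by (rule rho_factor_pos[OF assms])
  have rho: "rho p q t m = ennreal (real t powr enn2real (1 / p)) / ennreal (sqrt (real m)) * ennreal (rho_factor q t)" for m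
    by (simp add: rho_def rho_factor_def)
  show "rho p q t m = ennreal (real t powr enn2real (1 / p) / sqrt (real m) * rho_factor q t)" if "m > 0"
    using that P unfolding rho by (simp add: divide_ennreal ennreal_mult'[symmetric] del: times_divide_eq_left)
  show "rho p q t m = \<infinity>" if "m = 0"
    using that P assms(1) unfolding rho by (simp add: ennreal_divide_zero ennreal_top_mult)
qed

theorem theorem5p4:
  assumes "CARD('d::finite) \<ge> 2"
  shows "\<exists>C::real. C > 0 \<and>
    (\<forall>(lam::real \<Rightarrow> real) (p::ennreal) (q::ennreal) (N::nat \<Rightarrow> nat) (m::nat \<Rightarrow> nat) (M::nat) (\<beta>::nat).
       (\<forall>x>0. lam x > 0) \<longrightarrow>
       antimono_on {0<..} lam \<longrightarrow>
       lam 0 = 0 \<longrightarrow>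
       1 \<le> p \<longrightarrow> p \<le> 2 \<longrightarrow> 2 \<le> q \<longrightarrow>
       multiplier_bounded TYPE('d) (\<lambda>i j. lam (real (max i j))) 1 2 \<longrightarrow>
       multiplier_bounded TYPE('d) (\<lambda>i j. lam (real (max i j))) p q \<longrightarrow>
       (\<forall>k. N k < N (k + 1)) \<longrightarrow>
       N 0 = 0 \<longrightarrow>
       (\<Sum>k = 0..M. m k) \<le> \<beta> \<longrightarrow>
       theta TYPE('d) (N 0) (N 1) \<le> m 0 \<longrightarrow>
       kolmogorov_width
           (Lp_space q (surface_measure :: (complex^'d) measure)) (Lp_norm q surface_measure) \<beta>
           (multiplier_image (\<lambda>i j. lam (real (max i j))) (Lp_ball p surface_measure) q)
         \<le> ennreal C *
           ((\<Sum>k = 1..M. ennreal (lam (real (N k))) * rho p q (theta TYPE('d) (N k) (N (k + 1))) (m k)) +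
            (\<Sum>k. let l = M + 1 + k in
               ennreal (lam (real (N l)) *
                 real (theta TYPE('d) (N l) (N (l + 1))) powr (enn2real (1 / p) - enn2real (1 / q))))))"
proof (intro exI[of _ "head_const TYPE('d) + tail_const TYPE('d)"] conjI allI impI)
  let ?C = "head_const TYPE('d) + tail_const TYPE('d)"
  have hc: "head_const TYPE('d) > 0" and tc: "tail_const TYPE('d) > 0" by (rule head_const_pos tail_const_pos)+
  then show C: "?C > 0" by simp
  fix lam :: "real \<Rightarrow> real" and p q :: ennreal and N m :: "nat \<Rightarrow> nat" and M \<beta> :: nat
  assume pos: "\<forall>x>0. lam x > 0" and anti: "antimono_on {0<..} lam" and lam0: "lam 0 = 0"
    and p: "1 \<le> p" "p \<le> 2" and q: "2 \<le> q" and N: "\<forall>k. N k < N (k + 1)" and N0: "N 0 = 0"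
    and \<beta>: "(\<Sum>k = 0..M. m k) \<le> \<beta>" and m0: "theta TYPE('d) (N 0) (N 1) \<le> m 0"
  define \<theta> where "\<theta> k = theta TYPE('d) (N k) (N (k + 1))" for k
  define t where "t k = lam (N k) * \<theta> k powr (enn2real (1 / p) - enn2real (1 / q))" for k
  define X where "X = (\<Sum>k = 1..M. ennreal (lam (real (N k))) * rho p q (\<theta> k) (m k))"
  have \<theta>: "\<theta> k \<ge> 2" for k
  proof -
    have Nk: "N k < N (k + 1)" using N by simp
    then show ?thesis using theta_lower[OF assms Nk] by (simp add: \<theta>_def)
  qed
  have mono: "strict_mono N" using N by (simp add: strict_mono_Suc_iff)
  have lN: "lam (N k) > 0" if "k \<ge> 1" for k
  proof -
    have "N k \<ge> k" by (rule strict_mono_imp_increasing[OF mono])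
    then show ?thesis using pos that by simp
  qed
  have t0: "t (M + 1 + k) \<ge> 0" for k unfolding t_def using lN[of "M + 1 + k"] by simp
  have "kolmogorov_width
           (Lp_space q (\<sigma> :: (complex^'d) measure)) (Lp_norm q \<sigma>) \<beta>
           (multiplier_image (\<lambda>i j. lam (real (max i j))) (Lp_ball p \<sigma>) q)
         \<le> ennreal ?C * (X + (\<Sum>k. ennreal (t (M + 1 + k))))"
  \<comment> \<open>If some \<open>m k\<close> with \<open>1 \<le> k \<le> M\<close> is zero, then \<open>rho\<close> is infinite and so is \<open>X\<close>.\<close>
  proof (cases "X = \<infinity> \<or> (\<Sum>k. ennreal (t (M + 1 + k))) = \<infinity>")
    case True
    then have "X + (\<Sum>k. ennreal (t (M + 1 + k))) = \<infinity>" by auto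
    moreover have "ennreal ?C \<noteq> 0" using C by simp
    ultimately have "ennreal ?C * (X + (\<Sum>k. ennreal (t (M + 1 + k)))) = \<infinity>" by (simp only: ennreal_mult_eq_top_iff infinity_ennreal_def) simp
    then show ?thesis by simp
  next
    case False
    have mpos: "m k > 0" if "1 \<le> k" "k \<le> M" for k
    proof (rule ccontr)
      assume "\<not> m k > 0"
      then have "ennreal (lam (real (N k))) * rho p q (\<theta> k) (m k) = \<infinity>"
        using rho_eq(2)[OF \<theta> q] lN[OF that(1)] by (simp add: ennreal_mult_top)
      then have "X = \<infinity>" unfolding X_def using that by (subst sum.remove[of _ k]) auto
      then show False using False by simp
    qed
    have sm: "summable (\<lambda>k. t (M + 1 + k))" using False t0 by (intro summable_suminf_not_top) auto
    define T where "T k = lam (N k) * (\<theta> k powr enn2real (1 / p) / sqrt (m k) * rho_factor q (\<theta> k))" for k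
    have T0: "T k \<ge> 0" if "1 \<le> k" for k
      unfolding T_def using lN[OF that] rho_factor_pos[OF \<theta> q, of k] by (intro mult_nonneg_nonneg) auto
    have X: "X = ennreal (\<Sum>k = 1..M. T k)"
    proof -
      have "X = (\<Sum>k = 1..M. ennreal (T k))" unfolding X_def
      proof (rule sum.cong[OF refl])
        fix k assume k: "k \<in> {1..M}"
        then show "ennreal (lam (real (N k))) * rho p q (\<theta> k) (m k) = ennreal (T k)"
          using rho_eq(1)[OF \<theta> q mpos] lN[of k] by (simp add: T_def ennreal_mult'[symmetric])
      qed
      also have "\<dots> = ennreal (\<Sum>k = 1..M. T k)" using T0 by (intro sum_ennreal) auto
      finally show ?thesis .
    qed
    have S: "(\<Sum>k. ennreal (t (M + 1 + k))) = ennreal (\<Sum>k. t (M + 1 + k))" using t0 sm by (intro suminf_ennreal2) auto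
    have S0: "(\<Sum>k. t (M + 1 + k)) \<ge> 0" using t0 by (intro suminf_nonneg sm) auto
    have X0: "(\<Sum>k = 1..M. T k) \<ge> 0" using T0 by (intro sum_nonneg) auto
    have "kolmogorov_width (Lp_space q (\<sigma> :: (complex^'d) measure)) (Lp_norm q \<sigma>) \<beta>
           (multiplier_image (\<lambda>i j. lam (real (max i j))) (Lp_ball p \<sigma>) q)
        \<le> ennreal (head_const TYPE('d) * (\<Sum>k = 1..M. T k) + tail_const TYPE('d) * (\<Sum>k. t (M + 1 + k)))"
      unfolding T_def t_def \<theta>_def
      by (rule width_of_multiplier_class[OF assms _ anti lam0 p q _ N0 \<beta> m0 mpos])
        (use pos N sm in \<open>auto simp: t_def \<theta>_def\<close>)
    also have "\<dots> \<le> ennreal (?C * ((\<Sum>k = 1..M. T k) + (\<Sum>k. t (M + 1 + k))))"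
      using hc tc S0 X0 by (intro ennreal_leI) (simp add: algebra_simps)
    also have "\<dots> = ennreal ?C * (X + (\<Sum>k. ennreal (t (M + 1 + k))))"
      unfolding X S using C S0 X0 by (simp only: ennreal_mult ennreal_plus add_nonneg_nonneg less_imp_le)
    finally show ?thesis .
  qed
  then show "kolmogorov_width
           (Lp_space q (\<sigma> :: (complex^'d) measure)) (Lp_norm q \<sigma>) \<beta>
           (multiplier_image (\<lambda>i j. lam (real (max i j))) (Lp_ball p \<sigma>) q)
         \<le> ennreal ?C *
           ((\<Sum>k = 1..M. ennreal (lam (real (N k))) * rho p q (theta TYPE('d) (N k) (N (k + 1))) (m k)) +
            (\<Sum>k. let l = M + 1 + k in
               ennreal (lam (real (N l)) *
                 real (theta TYPE('d) (N l) (N (l + 1))) powr (enn2real (1 / p) - enn2real (1 / q)))))"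
    unfolding Let_def X_def t_def \<theta>_def .
qed

end
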